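(* Let $A\subset\mathbb{R}^n$ be a piece of algebraic curve. For every $x_0\in A$ there exist constants $C_1,C_2,\varepsilon_0>0$, depending on $x_0$ and locally bounded above (as functions of $x_0$), such that for all $\varepsilon\in(0,\varepsilon_0)$ and all $p\in\mathbb{R}[x_1,\ldots,x_n]$: 1. if $x_0\in A_{sing}$, then $$|D_vp(x_0)|\le C_1\left(\frac{C_2(\deg p)^2}{\varepsilon}\right)^{k}\|p\|_{A\cap B(x_0,\varepsilon^k)},$$ where $k$ is the complex multiplicity of the singular point $x_0$ in $\tilde A$, and $v$ is any unit vector in the tangent cone $C(A,x_0)$; 2. if $x_0\in A_{reg}\setminus\partial A$, then $$|D_vp(x_0)|\le C_1\left(\frac{C_2\deg p}{\varepsilon}\right)\|p\|_{A\cap B(x_0,\varepsilon)};$$ 3. if $x_0\in\partial A\setminus A_{sing}$, then $$|D_vp(x_0)|\le C_1\left(\frac{C_2\deg p}{\varepsilon}\right)^{2}\|p\|_{A\cap B(x_0,\varepsilon)};$$ where in cases 2 and 3, $v$ is any unit vector of the tangent space $T_{x_0}A_{reg}$.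
   Context: An algebraic curve in $\mathbb{R}^n$ is a set $\{x\in\mathbb{R}^n: p_1(x)=\cdots=p_s(x)=0\}$ with $p_j\in\mathbb{R}[x_1,\ldots,x_n]$, of real dimension $1$. A piece of algebraic curve is a connected irreducible analytic subset of an algebraic curve. $A_{sing}$ and $A_{reg}$ denote the sets of singular and regular points of $A$, and $\partial A$ the boundary of $A$ (its end points). We identify $\mathbb{C}^n=\mathbb{R}^n\oplus i\mathbb{R}^n$; the complexification $\tilde A$ of $A$ is the smallest complex algebraic subset of $\mathbb{C}^n$ containing $A$. For $E\subset\mathbb{C}^n$ and $a\in\overline E$, the tangent cone $C(E,a)$ is the set of $v$ for which there are points $a_j\in E$, $a_j\to a$, and reals $\lambda_j>0$ with $v=\lim_{j\to\infty}\lambda_j(a-a_j)$. The (complex) multiplicity of a point $a$ of a complex algebraic set $\tilde A\subset\mathbb{C}^n$ of pure dimension $p$ is $\mu_a(\tilde A)=\min\{\mu_a(\pi_L|_{\tilde A}): L\in Gr_{\mathbb{C}}(n,n-p)\}$, where $\pi_L:\mathbb{C}^n=L\oplus L^\perp\to L^\perp$ is the orthogonal projection and $\mu_a(\pi_L|_{\tilde A})$ is the multiplicity at $a$ of this map; equivalently it is the Lelong number of the current $[\tilde A]$ at $a$. $D_v$ is the directional derivative in direction $v$, $B(x,r)$ the Euclidean ball of center $x$ and radius $r$, and $\|\cdot\|_K$ the uniform norm on $K$. *)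

theory Defs
  imports "HOL-Analysis.Analysis" "HOL-Library.Poly_Mapping"
begin

text \<open>Polynomials in the variables indexed by \<open>'n\<close> are finitely supported maps from exponent
  vectors to coefficients.\<close>

type_synonym ('a, 'n) mpolynomial = "('n \<Rightarrow>\<^sub>0 nat) \<Rightarrow>\<^sub>0 'a"

definition peval :: "('a::comm_ring_1, 'n::finite) mpolynomial \<Rightarrow> 'a ^ 'n \<Rightarrow> 'a" where
  "peval p x = (\<Sum>m\<in>Poly_Mapping.keys p.
     Poly_Mapping.lookup p m * (\<Prod>i\<in>UNIV. (x $ i) ^ Poly_Mapping.lookup m i))"

text \<open>Total degree; the zero polynomial has degree \<open>0\<close>.\<close>

definition total_deg :: "('a::comm_ring_1, 'n::finite) mpolynomial \<Rightarrow> nat" where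
  "total_deg p = Max (insert 0 ((\<lambda>m. \<Sum>i\<in>UNIV. Poly_Mapping.lookup m i) ` Poly_Mapping.keys p))"

definition dir_deriv :: "('a::real_normed_vector \<Rightarrow> real) \<Rightarrow> 'a \<Rightarrow> 'a \<Rightarrow> real" where
  "dir_deriv f v x = deriv (\<lambda>t. f (x + t *\<^sub>R v)) 0"

definition unif_norm :: "'a set \<Rightarrow> ('a \<Rightarrow> real) \<Rightarrow> real" where
  "unif_norm K f = (SUP x\<in>K. \<bar>f x\<bar>)"

definition locally_bounded_above_on :: "'a::metric_space set \<Rightarrow> ('a \<Rightarrow> real) \<Rightarrow> bool" where
  "locally_bounded_above_on A C \<longleftrightarrow> (\<forall>x\<in>A. \<exists>r>0. \<exists>M. \<forall>y\<in>A \<inter> ball x r. C y \<le> M)"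

definition algebraic_set :: "('a::field ^ 'n::finite) set \<Rightarrow> bool" where
  "algebraic_set Z \<longleftrightarrow>
     (\<exists>P :: ('a, 'n) mpolynomial set. finite P \<and> Z = {x. \<forall>p\<in>P. peval p x = 0})"

definition alg_irreducible :: "('a::field ^ 'n::finite) set \<Rightarrow> bool" where
  "alg_irreducible Z \<longleftrightarrow> algebraic_set Z \<and> Z \<noteq> {} \<and>
     (\<forall>Z1 Z2. algebraic_set Z1 \<and> algebraic_set Z2 \<and> Z = Z1 \<union> Z2 \<longrightarrow> Z1 = Z \<or> Z2 = Z)"

text \<open>Dimension of an algebraic set: supremum of the lengths of strict chains of irreducible
  algebraic subsets. Over the reals this is the usual real dimension. The empty set gets \<open>0\<close>.\<close>

definition alg_dim :: "('a::field ^ 'n::finite) set \<Rightarrow> enat" where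
  "alg_dim Z = (SUP d\<in>{d. \<exists>C :: nat \<Rightarrow> ('a ^ 'n) set.
     (\<forall>i\<le>d. alg_irreducible (C i) \<and> C i \<subseteq> Z) \<and> (\<forall>i<d. C i \<subset> C (Suc i))}. enat d)"

definition algebraic_curve :: "(real ^ 'n::finite) set \<Rightarrow> bool" where
  "algebraic_curve V \<longleftrightarrow> algebraic_set V \<and> alg_dim V = 1"

definition real_analytic_on :: "(real ^ 'n::finite \<Rightarrow> real) \<Rightarrow> (real ^ 'n) set \<Rightarrow> bool" where
  "real_analytic_on f U \<longleftrightarrow> (\<forall>a\<in>U. \<exists>r>0. \<exists>c :: ('n \<Rightarrow> nat) \<Rightarrow> real. \<forall>x\<in>ball a r.
     ((\<lambda>\<alpha>. c \<alpha> * (\<Prod>i\<in>UNIV. (x $ i - a $ i) ^ \<alpha> i)) has_sum f x) UNIV)"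

text \<open>A piece of a curve may contain end points of itself, at which it is not the zero set of
  analytic functions. ``Analytic subset'' is therefore taken in the semianalytic sense, which
  includes the sets defined locally by analytic equations only.\<close>

definition semianalytic :: "(real ^ 'n::finite) set \<Rightarrow> bool" where
  "semianalytic A \<longleftrightarrow> (\<forall>a. \<exists>U S. open U \<and> a \<in> U \<and> finite S \<and>
     (\<forall>(F, G)\<in>S. finite F \<and> finite G \<and> (\<forall>f\<in>F \<union> G. real_analytic_on f U)) \<and>
     A \<inter> U = {x\<in>U. \<exists>(F, G)\<in>S. (\<forall>f\<in>F. f x = 0) \<and> (\<forall>g\<in>G. g x > 0)})"

text \<open>\<open>B\<close> is given inside \<open>A\<close>, near each point of \<open>A\<close>, by analytic equations.\<close>

definition analytic_subset_of :: "(real ^ 'n::finite) set \<Rightarrow> (real ^ 'n) set \<Rightarrow> bool" where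
  "analytic_subset_of B A \<longleftrightarrow> B \<subseteq> A \<and> (\<forall>a\<in>A. \<exists>U F. open U \<and> a \<in> U \<and> finite F \<and>
     (\<forall>f\<in>F. real_analytic_on f U) \<and> B \<inter> U = {x\<in>A \<inter> U. \<forall>f\<in>F. f x = 0})"

definition analytic_irreducible :: "(real ^ 'n::finite) set \<Rightarrow> bool" where
  "analytic_irreducible A \<longleftrightarrow> A \<noteq> {} \<and>
     (\<forall>B1 B2. analytic_subset_of B1 A \<and> analytic_subset_of B2 A \<and> A = B1 \<union> B2
        \<longrightarrow> B1 = A \<or> B2 = A)"

definition piece_of_algebraic_curve :: "(real ^ 'n::finite) set \<Rightarrow> bool" where
  "piece_of_algebraic_curve A \<longleftrightarrow> connected A \<and> analytic_irreducible A \<and> semianalytic A \<and>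
     (\<exists>V. algebraic_curve V \<and> A \<subseteq> V)"

definition analytic_path_on :: "(real \<Rightarrow> real ^ 'n::finite) \<Rightarrow> real set \<Rightarrow> bool" where
  "analytic_path_on \<gamma> T \<longleftrightarrow> (\<forall>t\<in>T. \<exists>r>0. \<exists>c :: nat \<Rightarrow> real ^ 'n. \<forall>s\<in>ball t r.
     (\<lambda>k. (s - t) ^ k *\<^sub>R c k) sums \<gamma> s)"

text \<open>Local parametrisations of \<open>A\<close> at \<open>x\<close> as a one-dimensional analytic submanifold with
  boundary. In the second alternative \<open>x\<close> is a boundary point, and \<open>\<gamma>\<close> is still analytic across
  \<open>0\<close>; so the end point of half of a cusp is not regular.\<close>

definition regular_param ::
  "(real ^ 'n::finite) set \<Rightarrow> real ^ 'n \<Rightarrow> (real \<Rightarrow> real ^ 'n) \<Rightarrow> bool" where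
  "regular_param A x \<gamma> \<longleftrightarrow> \<gamma> 0 = x \<and> (\<exists>\<delta>>0. analytic_path_on \<gamma> {-\<delta><..<\<delta>} \<and>
     (\<forall>t\<in>{-\<delta><..<\<delta>}. vector_derivative \<gamma> (at t) \<noteq> 0) \<and>
     (\<exists>U g. open U \<and>
        (homeomorphism {-\<delta><..<\<delta>} (A \<inter> U) \<gamma> g \<or> homeomorphism {0..<\<delta>} (A \<inter> U) \<gamma> g)))"

definition reg_points :: "(real ^ 'n::finite) set \<Rightarrow> (real ^ 'n) set" where
  "reg_points A = {x\<in>A. \<exists>\<gamma>. regular_param A x \<gamma>}"

definition sing_points :: "(real ^ 'n::finite) set \<Rightarrow> (real ^ 'n) set" where
  "sing_points A = A - reg_points A"

definition end_points :: "(real ^ 'n::finite) set \<Rightarrow> (real ^ 'n) set" where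
  "end_points A = {x\<in>A. \<exists>U \<gamma> g. open U \<and> homeomorphism {0::real..<1} (A \<inter> U) \<gamma> g \<and> \<gamma> 0 = x}"

definition tangent_space :: "(real ^ 'n::finite) set \<Rightarrow> real ^ 'n \<Rightarrow> (real ^ 'n) set" where
  "tangent_space A x =
     {v. \<exists>\<gamma>. regular_param A x \<gamma> \<and> v \<in> span {vector_derivative \<gamma> (at 0)}}"

definition tangent_cone :: "'a::real_normed_vector set \<Rightarrow> 'a \<Rightarrow> 'a set" where
  "tangent_cone E a = {v. \<exists>s l. (\<forall>j::nat. s j \<in> E \<and> l j > (0::real)) \<and> s \<longlonglongrightarrow> a \<and>
     (\<lambda>j. l j *\<^sub>R (a - s j)) \<longlonglongrightarrow> v}"

definition cvec :: "real ^ 'n::finite \<Rightarrow> complex ^ 'n" where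
  "cvec x = (\<chi> i. complex_of_real (x $ i))"

definition complexification :: "(real ^ 'n::finite) set \<Rightarrow> (complex ^ 'n) set" where
  "complexification A = \<Inter>{Z. algebraic_set Z \<and> cvec ` A \<subseteq> Z}"

text \<open>On a complex subspace the real and the Hermitian orthogonal complements agree, so
  the complement of \<open>L\<close> can be taken for the real inner product of \<open>complex ^ 'n\<close>.\<close>

definition proj_along :: "(complex ^ 'n::finite) set \<Rightarrow> complex ^ 'n \<Rightarrow> complex ^ 'n" where
  "proj_along L z = (THE w. w \<in> orthogonal_comp L \<and> z - w \<in> L)"

definition ecard :: "'a set \<Rightarrow> enat" where
  "ecard S = (if finite S then enat (card S) else \<infinity>)"

text \<open>Multiplicity at \<open>a\<close> of the map \<open>f\<close> on \<open>S\<close>: the upper limit, as \<open>w\<close> tends to \<open>f a\<close>, of the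
  number of preimages of \<open>w\<close> near \<open>a\<close> (the number of sheets of the branched covering). The
  filter \<open>nhds (f a)\<close> contains \<open>f a\<close> itself, so the value is \<open>\<infinity>\<close> when \<open>a\<close> is not isolated in
  its fibre.\<close>

definition map_multiplicity :: "('a::topological_space \<Rightarrow> 'b::topological_space) \<Rightarrow> 'a set \<Rightarrow> 'a \<Rightarrow> enat"
  where
  "map_multiplicity f S a = (INF U\<in>{U. open U \<and> a \<in> U}.
     Limsup (nhds (f a)) (\<lambda>w. ecard {z\<in>S \<inter> U. f z = w}))"

text \<open>Complex multiplicity at \<open>a\<close> of a complex algebraic set \<open>Z\<close> of pure dimension \<open>p\<close>. The infimum
  is a minimum, since \<open>enat\<close> is well-ordered.\<close>

definition complex_multiplicity :: "nat \<Rightarrow> (complex ^ 'n::finite) set \<Rightarrow> complex ^ 'n \<Rightarrow> nat" where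
  "complex_multiplicity p Z a = the_enat (INF L\<in>{L. vec.subspace L \<and> vec.dim L + p = CARD('n)}.
     map_multiplicity (proj_along L) Z a)"

end

theory Submission
  imports Defs "HOL-Complex_Analysis.Complex_Analysis" "HOL-Computational_Algebra.Computational_Algebra"
begin

text \<open>
  Take a Puiseux branch \<open>\<gamma>\<close> of \<open>A\<close> at \<open>x0\<close>, with one coordinate equal to \<open>x0 $ i0 \<plusminus> t ^ m\<close>, and put
  \<open>f = p \<circ> \<gamma>\<close>. Eliminating the other coordinates gives \<open>\<Sum>j\<le>J. q j (t ^ m) * f t ^ j = 0\<close>, where \<open>J\<close> depends
  on \<open>A\<close> only and \<open>degree (q j) \<le> J * deg p\<close>. There is a circle on which each \<open>q j\<close> is comparable with a
  constant, up to a factor exponential in \<open>deg p\<close>; hence \<open>f\<close>, if bounded by \<open>M\<close> on \<open>[0, \<epsilon>]\<close>, is bounded by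
  \<open>M * exp (B * deg p)\<close> on the disc of radius \<open>\<epsilon> / 2\<close>. On an arc that continues to both sides of \<open>x0\<close> the
  maximum principle, applied after the substitution \<open>t = r * sin s\<close>, improves this to
  \<open>M * exp (B * deg p * \<bar>s\<bar>)\<close>, and Cauchy's estimate at scale \<open>\<bar>s\<bar> = 1 / (B * deg p)\<close> bounds the first Taylor
  coefficient of \<open>f\<close>. On a half arc one substitutes \<open>t = u\<^sup>2\<close> first, which doubles the order \<open>m\<close> of the
  coefficient and squares the degree.

  Two facts make the bound uniform: the branch belongs to the complexification and a projection takes values on
  it \<open>m\<close> times, so \<open>m\<close> is at most the multiplicity \<open>k\<close>; and the slopes of tangent vectors are roots of
  polynomials, so that there are only finitely many unit tangent vectors.\<close>

subsection \<open>Bernstein--Walsh inequalities for algebraic functions\<close>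

text \<open>The relation satisfied by \<open>f\<close> has coefficients \<open>q j\<close> that
  depend on \<open>p\<close>, and nothing is known about their size; only their number and their
  degrees are controlled. The growth estimates therefore compare values on one circle, where the
  size of a polynomial cancels, and never use norms of coefficients. A real curve is the zero set of
  a single nonnegative \<open>P\<close>, but the complex zero set of \<open>P\<close> is in general
  a hypersurface, so monomials cannot be reduced modulo \<open>P\<close> itself. The perturbed
  critical equations supply a monic relation for each remaining variable instead. Points at
  parameter \<open>t\<close> lie at a distance of order \<open>t ^ m\<close> from \<open>x0\<close>.
  Hence the power \<open>\<epsilon> ^ m\<close> in the coefficient bound is the radius of the ball
  up to a constant, and a larger exponent \<open>k\<close> in place of \<open>m\<close> only weakens
  the estimate. All dependence on \<open>x0\<close> goes into the threshold
  \<open>\<epsilon>0\<close>. The constants are 16 and \<open>32 * B ^ 2\<close> on the whole piece: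
  the length of the derivative of the branch, which is not bounded in \<open>x0\<close>, cancels
  when the derivative is rescaled to a unit vector.\<close>

lemma good_radius:
  fixes A :: "real multiset"
  assumes nonneg: "\<And>a. a \<in># A \<Longrightarrow> 0 \<le> a"
  shows "\<exists>\<rho>\<in>{1/2..1}. (1/24) ^ size A \<le> (\<Prod>a\<in>#A. \<bar>\<rho> - a\<bar> / (\<rho> + a))"
proof -
  \<comment> \<open>With \<open>\<rho> = 3/4 + Re w / 4\<close> and \<open>norm w = 1\<close> one
    has \<open>w ^ 2 + 1 = 2 * w * Re w\<close>, so the first alternative is
    \<open>w * (\<rho> - a) / 3\<close> there. It is nevertheless a polynomial in \<open>w\<close>
    whose value at 0 is 1/24 for every \<open>a\<close>, and the maximum principle finds a point of
    the circle at which the product is no smaller than at 0. The 1/8 is the capacity of the interval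
    [1/2, 1]. The 3 bounds \<open>\<rho> + a\<close> for \<open>a \<le> 2\<close>; for larger
    \<open>a\<close> the quotient is at least 1/3 by itself.\<close>
  define h :: "real \<Rightarrow> complex \<Rightarrow> complex" where
    "h a w = (if a \<le> 2 then (w * of_real (3/4 - a) + (w\<^sup>2 + 1) / 8) / 3 else 1 / 3)" for a w
  define H where "H w = (\<Prod>a\<in>#A. h a w)" for w
  have hol: "H holomorphic_on UNIV"
  proof -
    have "(\<lambda>w. \<Prod>a\<in>#B. h a w) holomorphic_on UNIV" for B
    proof (induction B)
      case (add a B)
      have "h a holomorphic_on UNIV"
        unfolding h_def by (cases "a \<le> 2") (auto intro!: holomorphic_intros)
      with add show ?case by (auto intro!: holomorphic_intros)
    qed auto
    then show ?thesis unfolding H_def by blast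
  qed
  have cont: "continuous_on S H" for S
    using hol holomorphic_on_imp_continuous_on continuous_on_subset by blast
  obtain w where w: "w \<in> sphere 0 1" and wmax: "\<And>z. z \<in> sphere 0 1 \<Longrightarrow> norm (H z) \<le> norm (H w)"
    using continuous_attains_sup[of "sphere (0::complex) 1" "\<lambda>z. norm (H z)"]
      continuous_on_norm[OF cont] by fastforce
  have "norm (H 0) \<le> norm (H w)"
  proof (rule maximum_modulus_frontier[of H "cball 0 1"])
    show "H holomorphic_on interior (cball 0 1)" using hol holomorphic_on_subset by blast
    show "\<And>z. z \<in> frontier (cball 0 1) \<Longrightarrow> norm (H z) \<le> norm (H w)"
      using wmax by simp
  qed (auto intro: cont)
  moreover have "(1/24) ^ size A \<le> norm (H 0)"
  proof -
    have "(1/24::real) ^ size B \<le> norm (\<Prod>a\<in>#B. h a 0)" for B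
    proof (induction B)
      case (add a B)
      have "1/24 \<le> norm (h a 0)" by (simp add: h_def)
      then have "(1/24) * (1/24::real) ^ size B \<le> norm (h a 0) * norm (\<Prod>a\<in>#B. h a 0)"
        using add by (intro mult_mono) auto
      then show ?case by (simp add: norm_mult)
    qed auto
    then show ?thesis unfolding H_def by blast
  qed
  moreover define \<rho> where "\<rho> = 3/4 + Re w / 4"
  have nw: "norm w = 1" using w by simp
  have "\<bar>Re w\<bar> \<le> 1" using abs_Re_le_cmod[of w] nw by simp
  then have rho: "\<rho> \<in> {1/2..1}" unfolding \<rho>_def by auto
  have key: "norm (h a w) \<le> \<bar>\<rho> - a\<bar> / (\<rho> + a)" if "0 \<le> a" for a
  proof (cases "a \<le> 2")
    case True
    have "w * cnj w = 1" using nw by (simp add: complex_norm_square[symmetric])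
    then have "w\<^sup>2 + 1 = w * (w + cnj w)" by (simp add: power2_eq_square algebra_simps)
    also have "w + cnj w = of_real (2 * Re w)" by (rule complex_add_cnj)
    finally have "h a w = w * of_real (\<rho> - a) / 3"
      using True by (simp add: h_def \<rho>_def field_simps)
    then have "norm (h a w) = norm (w * of_real (\<rho> - a) / 3)" by (rule arg_cong)
    also have "\<dots> = \<bar>\<rho> - a\<bar> / 3"
      unfolding norm_mult norm_divide norm_of_real nw by simp
    also have "\<dots> \<le> \<bar>\<rho> - a\<bar> / (\<rho> + a)"
      using rho True that by (intro divide_left_mono) auto
    finally show ?thesis .
  next
    case False
    then have "1/3 \<le> (a - \<rho>) / (\<rho> + a)" using rho by (simp add: field_simps)
    with False rho show ?thesis by (simp add: h_def)
  qed
  have "norm (H w) \<le> (\<Prod>a\<in>#A. \<bar>\<rho> - a\<bar> / (\<rho> + a))"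
  proof -
    have "norm (\<Prod>a\<in>#B. h a w) \<le> (\<Prod>a\<in>#B. \<bar>\<rho> - a\<bar> / (\<rho> + a))" if "\<And>a. a \<in># B \<Longrightarrow> 0 \<le> a" for B
      using that
    proof (induction B)
      case (add a B)
      then have "norm (h a w) * norm (\<Prod>a\<in>#B. h a w)
          \<le> (\<bar>\<rho> - a\<bar> / (\<rho> + a)) * (\<Prod>a\<in>#B. \<bar>\<rho> - a\<bar> / (\<rho> + a))"
        using key[of a] by (intro mult_mono) (auto, smt (verit) key norm_ge_zero)
      then show ?case by (simp add: norm_mult)
    qed auto
    then show ?thesis unfolding H_def using nonneg by blast
  qed
  ultimately show ?thesis using rho by (intro bexI[of _ \<rho>]) auto
qed

lemma prod_mset_nonneg_real:
  fixes f :: "'a \<Rightarrow> real"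
  shows "(\<And>x. x \<in># A \<Longrightarrow> 0 \<le> f x) \<Longrightarrow> 0 \<le> (\<Prod>x\<in>#A. f x)"
  by (induction A) auto

lemma prod_mset_antimono_le_1:
  fixes f :: "'a \<Rightarrow> real"
  assumes "A \<subseteq># B" "\<And>x. x \<in># B \<Longrightarrow> 0 \<le> f x \<and> f x \<le> 1"
  shows "(\<Prod>x\<in>#B. f x) \<le> (\<Prod>x\<in>#A. f x)"
proof -
  obtain C where C: "B = A + C" using assms(1) by (auto simp: mset_subset_eq_exists_conv)
  have nn: "0 \<le> (\<Prod>x\<in>#D. f x)" if "D \<subseteq># B" for D
    using that assms(2) by (intro prod_mset_nonneg_real) (auto dest: mset_subset_eqD)
  have "(\<Prod>x\<in>#C. f x) \<le> 1"
  proof -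
    have "(\<Prod>x\<in>#D. f x) \<le> 1" if "\<And>x. x \<in># D \<Longrightarrow> 0 \<le> f x \<and> f x \<le> 1" for D
      using that
    proof (induction D)
      case (add a D)
      then have "(\<Prod>x\<in>#D. f x) \<le> 1" "0 \<le> f a" "f a \<le> 1" by auto
      then have "f a * (\<Prod>x\<in>#D. f x) \<le> f a * 1" by (intro mult_left_mono) auto
      with \<open>f a \<le> 1\<close> show ?case by simp
    qed auto
    then show ?thesis using assms(2) C by simp
  qed
  with nn[of A] assms(1) C show ?thesis by (simp add: mult_left_le)
qed

text \<open>For each root \<open>z\<close> and each \<open>x\<close> on the circle,
  \<open>norm (x - z)\<close> lies between \<open>\<bar>\<rho> - norm z\<bar>\<close> and
  \<open>\<rho> + norm z\<close>. Multiplying over the roots cancels the leading coefficient, so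
  only the positions of the roots matter.\<close>

lemma poly_comparable_on_circle:
  fixes q :: "complex poly"
  assumes q: "q = smult (lead_coeff q) (\<Prod>z\<in>#A. [:-z, 1:])" and \<rho>: "0 < \<rho>"
    and x: "norm x = \<rho>" "norm x' = \<rho>"
    and le: "inverse L \<le> (\<Prod>z\<in>#A. \<bar>\<rho> - norm z\<bar> / (\<rho> + norm z))" and L: "0 < L"
  shows "norm (poly q x) \<le> L * norm (poly q x')"
proof -
  define c where "c = norm (lead_coeff q)"
  define P where "P = (\<Prod>z\<in>#A. \<rho> + norm z)"
  have ev: "poly q y = lead_coeff q * (\<Prod>z\<in>#A. y - z)" for y
    by (subst q) (simp add: poly_prod_mset image_mset.compositionality o_def)
  have nrm: "norm (poly q y) = c * (\<Prod>z\<in>#A. norm (y - z))" for y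
  proof -
    have "norm (\<Prod>z\<in>#A. y - z) = (\<Prod>z\<in>#A. norm (y - z))" by (induction A) (auto simp: norm_mult)
    then show ?thesis by (simp add: ev norm_mult c_def)
  qed
  have Ppos: "0 < P" unfolding P_def using \<rho> by (induction A) (auto intro!: mult_pos_pos add_pos_nonneg)
  have 1: "(\<Prod>z\<in>#A. norm (x - z)) \<le> P" unfolding P_def
  proof (induction A)
    case (add a A)
    have "norm (x - a) \<le> \<rho> + norm a" using norm_triangle_ineq4[of x a] x by simp
    with add show ?case by (auto intro!: mult_mono prod_mset_nonneg_real add_nonneg_nonneg simp: less_imp_le[OF \<rho>])
  qed auto
  have 2: "(\<Prod>z\<in>#A. \<bar>\<rho> - norm z\<bar> / (\<rho> + norm z)) * P \<le> (\<Prod>z\<in>#A. norm (x' - z))" unfolding P_def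
  proof (induction A)
    case (add a A)
    have pos: "0 < \<rho> + norm a" using \<rho> by (simp add: add_pos_nonneg)
    have "\<bar>\<rho> - norm a\<bar> \<le> norm (x' - a)" using norm_triangle_ineq3[of x' a] x by simp
    then have "\<bar>\<rho> - norm a\<bar> * ((\<Prod>z\<in>#A. \<bar>\<rho> - norm z\<bar> / (\<rho> + norm z)) * (\<Prod>z\<in>#A. \<rho> + norm z))
        \<le> norm (x' - a) * (\<Prod>z\<in>#A. norm (x' - z))"
      using \<rho> add by (intro mult_mono) (auto intro!: mult_nonneg_nonneg prod_mset_nonneg_real divide_nonneg_nonneg)
    moreover have "\<bar>\<rho> - norm a\<bar> / (\<rho> + norm a) * X * ((\<rho> + norm a) * Y) = \<bar>\<rho> - norm a\<bar> * (X * Y)" for X Y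
      using pos by simp
    ultimately show ?case by simp
  qed auto
  have "norm (poly q x) \<le> c * P" using 1 by (simp add: nrm c_def mult_left_mono)
  also have "\<dots> = L * (c * (inverse L * P))" using L by simp
  also have "\<dots> \<le> L * (c * ((\<Prod>z\<in>#A. \<bar>\<rho> - norm z\<bar> / (\<rho> + norm z)) * P))"
    using le L Ppos by (intro mult_left_mono mult_right_mono) (auto simp: c_def)
  also have "\<dots> \<le> L * (c * (\<Prod>z\<in>#A. norm (x' - z)))"
    using 2 L by (intro mult_left_mono) (auto simp: c_def)
  also have "\<dots> = L * norm (poly q x')" by (simp add: nrm)
  finally show ?thesis .
qed

lemma polys_comparable_on_circle:
  fixes q :: "'i \<Rightarrow> complex poly"
  assumes S: "finite S" and nz: "\<And>j. j \<in> S \<Longrightarrow> q j \<noteq> 0" and deg: "\<And>j. j \<in> S \<Longrightarrow> degree (q j) \<le> I"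
    and E: "0 < E"
  obtains \<rho> where "E / 2 \<le> \<rho>" "\<rho> \<le> E"
    "\<And>j x x'. j \<in> S \<Longrightarrow> norm x = \<rho> \<Longrightarrow> norm x' = \<rho> \<Longrightarrow>
       norm (poly (q j) x) \<le> 24 ^ (card S * I) * norm (poly (q j) x')"
proof -
  have "\<exists>A. size A = degree (q j) \<and> q j = smult (lead_coeff (q j)) (\<Prod>z\<in>#A. [:-z, 1:])" if "j \<in> S" for j
    using alg_closed_imp_factorization[OF nz[OF that]] by metis
  then obtain A where A: "\<And>j. j \<in> S \<Longrightarrow> size (A j) = degree (q j)"
    "\<And>j. j \<in> S \<Longrightarrow> q j = smult (lead_coeff (q j)) (\<Prod>z\<in>#A j. [:-z, 1:])" by metis
  define B where "B = (\<Sum>j\<in>S. A j)"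
  have szB: "size B \<le> card S * I"
  proof -
    have "size B = (\<Sum>j\<in>S. size (A j))" unfolding B_def by (rule size_multiset_sum)
    also have "\<dots> \<le> (\<Sum>j\<in>S. I)" using A(1) deg by (intro sum_mono) auto
    finally show ?thesis by simp
  qed
  obtain r where r: "r \<in> {1/2..1}" and rB: "(1/24) ^ size B \<le>
      (\<Prod>z\<in>#B. \<bar>r - norm z / E\<bar> / (r + norm z / E))"
  proof -
    have "0 \<le> a" if "a \<in># image_mset (\<lambda>z. norm z / E) B" for a
      using that E by auto
    from good_radius[of "image_mset (\<lambda>z. norm z / E) B", OF this] that show ?thesis
      by (auto simp: image_mset.compositionality o_def)
  qed
  define \<rho> where "\<rho> = E * r"
  have \<rho>: "0 < \<rho>" using E r by (auto simp: \<rho>_def)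
  have eq: "\<bar>r - norm z / E\<bar> / (r + norm z / E) = \<bar>\<rho> - norm z\<bar> / (\<rho> + norm z)" for z :: complex
  proof -
    have "\<bar>r - norm z / E\<bar> = \<bar>\<rho> - norm z\<bar> / E" "r + norm z / E = (\<rho> + norm z) / E"
      using E by (auto simp: \<rho>_def field_simps abs_mult abs_divide)
    then show ?thesis using E by simp
  qed
  show ?thesis
  proof (rule that[of \<rho>])
    show "E / 2 \<le> \<rho>" "\<rho> \<le> E" using r E by (auto simp: \<rho>_def)
    fix j and x x' :: complex assume j: "j \<in> S" and x: "norm x = \<rho>" "norm x' = \<rho>"
    have "B = A j + (\<Sum>i\<in>S - {j}. A i)" unfolding B_def using S j by (rule sum.remove)
    then have sub: "A j \<subseteq># B" by simp
    have "inverse (24 ^ (card S * I)) = (1/24::real) ^ (card S * I)" by (simp add: power_one_over inverse_eq_divide)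
    also have "\<dots> \<le> (1/24) ^ size B" using szB by (intro power_decreasing) auto
    also have "\<dots> \<le> (\<Prod>z\<in>#B. \<bar>\<rho> - norm z\<bar> / (\<rho> + norm z))" using rB by (simp add: eq)
    also have "\<dots> \<le> (\<Prod>z\<in>#A j. \<bar>\<rho> - norm z\<bar> / (\<rho> + norm z))"
    proof (rule prod_mset_antimono_le_1[OF sub])
      fix z :: complex
      have "0 < \<rho> + norm z" using \<rho> by (simp add: add_pos_nonneg)
      moreover have "\<bar>\<rho> - norm z\<bar> \<le> \<rho> + norm z" using \<rho> by (simp add: abs_le_iff)
      ultimately show "0 \<le> \<bar>\<rho> - norm z\<bar> / (\<rho> + norm z) \<and> \<bar>\<rho> - norm z\<bar> / (\<rho> + norm z) \<le> 1"
        by (simp add: divide_nonneg_pos)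
    qed
    finally show "norm (poly (q j) x) \<le> 24 ^ (card S * I) * norm (poly (q j) x')"
      by (intro poly_comparable_on_circle[OF A(2)[OF j] \<rho> x]) auto
  qed
qed

text \<open>On a suitable circle the vanishing sum must contain two comparable terms of different
  exponents. As the coefficients are nearly constant in modulus there, each pair of exponents
  confines \<open>norm (f z)\<close> to a narrow window. Some value \<open>s i\<close> lies outside
  all windows, and since the circle is connected and meets the interval on which
  \<open>norm f \<le> 1\<close>, the modulus stays below \<open>s i\<close> on the circle and hence
  in the disc.\<close>

lemma bernstein_walsh_algebraic:
  fixes f :: "complex \<Rightarrow> complex" and q :: "nat \<Rightarrow> complex poly" and I J m :: nat
  assumes \<epsilon>: "0 < \<epsilon>" "\<epsilon> < R" and hol: "f holomorphic_on ball 0 R" and m: "0 < m"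
    and rel: "\<And>t. t \<in> ball 0 R \<Longrightarrow> (\<Sum>j\<le>J. poly (q j) (t ^ m) * f t ^ j) = 0"
    and nz: "j0 \<le> J" "q j0 \<noteq> 0" and deg: "\<And>j. j \<le> J \<Longrightarrow> degree (q j) \<le> I"
    and bnd: "\<And>t. 0 \<le> t \<Longrightarrow> t \<le> \<epsilon> \<Longrightarrow> norm (f (of_real t)) \<le> 1"
    and t: "norm t \<le> \<epsilon> / 2"
  shows "norm (f t) \<le> (2 * (real J + 1) * 24 ^ (4 * ((J + 1) * I))) ^ ((J + 1)\<^sup>2 + 1)"
proof -
  define S where "S = {j. j \<le> J \<and> q j \<noteq> 0}"
  have finS: "finite S" and SJ: "S \<subseteq> {..J}" by (auto simp: S_def)
  have cardS: "card S \<le> J + 1" using card_mono[OF _ SJ] by simp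
  obtain \<rho> where \<rho>: "\<epsilon> ^ m / 2 \<le> \<rho>" "\<rho> \<le> \<epsilon> ^ m"
    and cmp0: "\<And>j x x'. j \<in> S \<Longrightarrow> norm x = \<rho> \<Longrightarrow> norm x' = \<rho> \<Longrightarrow>
       norm (poly (q j) x) \<le> 24 ^ (card S * I) * norm (poly (q j) x')"
  proof (rule polys_comparable_on_circle[of S q I "\<epsilon> ^ m"])
    show "q j \<noteq> 0" "degree (q j) \<le> I" if "j \<in> S" for j using that deg by (auto simp: S_def)
  qed (use finS \<epsilon> in auto)
  define L :: real where "L = 24 ^ ((J + 1) * I)"
  have L: "1 \<le> L" unfolding L_def by simp
  have cmp: "norm (poly (q j) x) \<le> L * norm (poly (q j) x')"
    if "j \<in> S" "norm x = \<rho>" "norm x' = \<rho>" for j x x'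
  proof -
    have "card S * I \<le> (J + 1) * I" using cardS by (rule mult_le_mono1)
    then have "(24::real) ^ (card S * I) \<le> L" unfolding L_def by (rule power_increasing) auto
    then show ?thesis using cmp0[OF that] by (meson mult_right_mono norm_ge_zero order_trans)
  qed
  have \<rho>pos: "0 < \<rho>" using \<rho> \<epsilon> by (smt (verit) half_gt_zero zero_less_power)
  define \<tau> where "\<tau> = root m \<rho>"
  have \<tau>m: "\<tau> ^ m = \<rho>" using \<rho>pos m by (simp add: \<tau>_def)
  have \<tau>pos: "0 < \<tau>" using \<rho>pos m by (simp add: \<tau>_def)
  have \<tau>le: "\<tau> \<le> \<epsilon>" using \<rho>(2) \<tau>m \<epsilon> \<tau>pos m by (metis less_imp_le power_mono_iff)
  have \<tau>ge: "\<epsilon> / 2 \<le> \<tau>"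
  proof -
    have "(1/2::real) ^ m \<le> (1/2) ^ 1" using m by (intro power_decreasing) auto
    then have "\<epsilon> ^ m * (1/2) ^ m \<le> \<epsilon> ^ m * (1/2)" using \<epsilon> by (intro mult_left_mono) auto
    moreover have "(\<epsilon> / 2) ^ m = \<epsilon> ^ m * (1/2) ^ m" by (simp add: power_divide)
    ultimately have "(\<epsilon> / 2) ^ m \<le> \<tau> ^ m" using \<rho>(1) by (simp add: \<tau>m)
    then show ?thesis using \<epsilon> \<tau>pos m by (metis less_imp_le power_mono_iff half_gt_zero)
  qed
  \<comment> \<open>The product of the two error factors \<open>L ^ 2\<close> and
    \<open>(J + 1) * L ^ 2\<close> of \<open>dominant\<close>. Consecutive test values
    \<open>s i\<close> differ by \<open>2 * G\<close>, which is more than one window can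
    span.\<close>
  define G where "G = (real J + 1) * L ^ 4"
  have G: "1 \<le> G" unfolding G_def using L
    by (metis add.commute le_add_same_cancel1 mult_mono' mult_1 of_nat_0_le_iff one_le_power zero_le_one)
  define s where "s i = (2 * G) ^ Suc i" for i :: nat
  have s1: "1 < s i" for i unfolding s_def using G by (intro one_less_power) auto
  have s_gap: "2 * G * s i \<le> s i'" if "i < i'" for i i'
  proof -
    have "2 * G * s i = (2 * G) ^ Suc (Suc i)" by (simp add: s_def)
    also have "\<dots> \<le> s i'" unfolding s_def using that G by (intro power_increasing) auto
    finally show ?thesis .
  qed
  define b where "b j = norm (poly (q j) (of_real \<rho>))" for j
  \<comment> \<open>Comparability would spread a zero at \<open>\<rho>\<close> over the whole
    circle, which is infinite.\<close>
  have bpos: "0 < b j" if j: "j \<in> S" for j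
  proof (rule ccontr)
    assume "\<not> 0 < b j"
    then have "b j = 0" by (simp add: b_def)
    then have "norm (poly (q j) x) = 0" if "norm x = \<rho>" for x
      using cmp[OF j that, of "of_real \<rho>"] \<rho>pos by (simp add: b_def)
    then have "sphere 0 \<rho> \<subseteq> {x. poly (q j) x = 0}" by auto
    moreover have "infinite (sphere (0::complex) \<rho>)"
    proof -
      have "complex_of_real \<rho> \<in> sphere 0 \<rho>" "- complex_of_real \<rho> \<in> sphere 0 \<rho>"
        "complex_of_real \<rho> \<noteq> - complex_of_real \<rho>" using \<rho>pos by auto
      moreover have "connected (sphere (0::complex) \<rho>)" by (intro connected_sphere) simp
      ultimately show ?thesis using connected_finite_iff_sing by (metis empty_iff singletonD)
    qed
    moreover have "finite {x. poly (q j) x = 0}" using j by (auto simp: S_def poly_roots_finite)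
    ultimately show False using finite_subset by blast
  qed
  \<comment> \<open>The largest term of a vanishing sum is at most \<open>J + 1\<close> times some
    other term. Passing between \<open>norm (poly (q j) (z ^ m))\<close> and \<open>b j\<close>
    costs a factor \<open>L\<close> each time.\<close>
  have dominant: "\<exists>j\<in>S. \<exists>j'\<in>S. j \<noteq> j' \<and> b j' * \<sigma> ^ j' \<le> L\<^sup>2 * (b j * \<sigma> ^ j) \<and>
      b j * \<sigma> ^ j \<le> (real J + 1) * L\<^sup>2 * (b j' * \<sigma> ^ j')"
    if z: "norm z = \<tau>" and fz: "norm (f z) = \<sigma>" and \<sigma>: "0 < \<sigma>" for z \<sigma>
  proof -
    define c where "c j = norm (poly (q j) (z ^ m)) * \<sigma> ^ j" for j
    have nzm: "norm (z ^ m) = \<rho>" using z \<tau>m by (simp add: norm_power)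
    have zin: "z \<in> ball 0 R" using z \<tau>le \<epsilon> by simp
    have c_b: "c j \<le> L * (b j * \<sigma> ^ j)" "b j * \<sigma> ^ j \<le> L * c j" if "j \<in> S" for j
      using cmp[OF that nzm, of "of_real \<rho>"] cmp[OF that _ nzm, of "of_real \<rho>"] \<rho>pos \<sigma>
      by (auto simp: c_def b_def mult.assoc[symmetric] intro!: mult_right_mono)
    have cpos: "0 < c j" if "j \<in> S" for j
    proof -
      have "0 < L * c j" using c_b(2)[OF that] bpos[OF that] \<sigma> by (smt (verit) mult_pos_pos zero_less_power)
      then show ?thesis using L by (simp add: zero_less_mult_iff)
    qed
    have Sne: "S \<noteq> {}" using nz by (auto simp: S_def)
    obtain j where j: "j \<in> S" and jmax: "\<And>i. i \<in> S \<Longrightarrow> c i \<le> c j"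
    proof -
      have "Max (c ` S) \<in> c ` S" using finS Sne by (intro Max_in) auto
      then obtain j where "j \<in> S" "c j = Max (c ` S)" by auto
      with that[of j] finS show ?thesis by simp
    qed
    have term_eq: "norm (poly (q i) (z ^ m) * f z ^ i) = c i" for i by (simp add: c_def norm_mult norm_power fz)
    have "(\<Sum>i\<in>S. poly (q i) (z ^ m) * f z ^ i) = (\<Sum>i\<le>J. poly (q i) (z ^ m) * f z ^ i)"
      by (rule sum.mono_neutral_left) (auto simp: S_def)
    then have "poly (q j) (z ^ m) * f z ^ j = - (\<Sum>i\<in>S - {j}. poly (q i) (z ^ m) * f z ^ i)"
      using rel[OF zin] finS j by (simp add: sum.remove eq_neg_iff_add_eq_0)
    then have "c j \<le> (\<Sum>i\<in>S - {j}. c i)"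
      using norm_sum[of "\<lambda>i. poly (q i) (z ^ m) * f z ^ i" "S - {j}"] term_eq by (metis (no_types, lifting) norm_minus_cancel sum.cong)
    have "\<exists>j'\<in>S - {j}. c j \<le> (real J + 1) * c j'"
    proof (rule ccontr)
      assume "\<not> ?thesis"
      then have less: "c i < c j / (real J + 1)" if "i \<in> S - {j}" for i using that by (auto simp: field_simps not_le)
      have "(\<Sum>i\<in>S - {j}. c i) \<le> (\<Sum>i\<in>S - {j}. c j / (real J + 1))" using less by (intro sum_mono) (auto simp: less_imp_le)
      also have "\<dots> = (real (card S) - 1) * (c j / (real J + 1))"
        using finS j by (simp add: card_Diff_singleton of_nat_diff Suc_leI card_gt_0_iff Sne)
      also have "\<dots> < (real J + 1) * (c j / (real J + 1))"
        using cpos[OF j] cardS by (intro mult_strict_right_mono) auto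
      finally show False using \<open>c j \<le> _\<close> by simp
    qed
    then obtain j' where j': "j' \<in> S" "j' \<noteq> j" and cj': "c j \<le> (real J + 1) * c j'" by auto
    have "b j' * \<sigma> ^ j' \<le> L * c j" using c_b(2)[OF j'(1)] jmax[OF j'(1)] L by (smt (verit) mult_left_mono)
    also have "\<dots> \<le> L * (L * (b j * \<sigma> ^ j))" using c_b(1)[OF j] L by (intro mult_left_mono) auto
    finally have 1: "b j' * \<sigma> ^ j' \<le> L\<^sup>2 * (b j * \<sigma> ^ j)" by (simp add: power2_eq_square)
    have "b j * \<sigma> ^ j \<le> L * ((real J + 1) * c j')" using c_b(2)[OF j] cj' L by (smt (verit) mult_left_mono)
    also have "\<dots> \<le> L * ((real J + 1) * (L * (b j' * \<sigma> ^ j')))" using c_b(1)[OF j'(1)] L by (intro mult_left_mono) auto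
    finally have 2: "b j * \<sigma> ^ j \<le> (real J + 1) * L\<^sup>2 * (b j' * \<sigma> ^ j')" by (simp add: power2_eq_square mult_ac)
    show ?thesis by (intro bexI[OF _ j] bexI[OF _ j'(1)] conjI 1 2 j'(2)[symmetric])
  qed
  \<comment> \<open>Pigeonhole: there are \<open>(J + 1) ^ 2 + 1\<close> test values but only
    \<open>(J + 1) ^ 2\<close> ordered pairs of exponents. If all values were attained, one pair
    would be balanced at two of them, and dividing the two balances would give a ratio of at most
    \<open>G\<close>.\<close>
  have "\<exists>i\<le>(J + 1)\<^sup>2. \<forall>z. norm z = \<tau> \<longrightarrow> norm (f z) \<noteq> s i"
  proof (rule ccontr)
    assume none: "\<not> ?thesis"
    have "\<exists>jj. fst jj \<in> S \<and> snd jj \<in> S \<and> fst jj \<noteq> snd jj \<and> b (snd jj) * s i ^ snd jj \<le> L\<^sup>2 * (b (fst jj) * s i ^ fst jj) \<and>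
      b (fst jj) * s i ^ fst jj \<le> (real J + 1) * L\<^sup>2 * (b (snd jj) * s i ^ snd jj)" if i: "i \<in> {..(J + 1)\<^sup>2}" for i
    proof -
      obtain z where z: "norm z = \<tau>" "norm (f z) = s i" using none i by auto
      have "0 < s i" using s1[of i] by simp
      obtain j j' where "j \<in> S" "j' \<in> S" "j \<noteq> j'" "b j' * s i ^ j' \<le> L\<^sup>2 * (b j * s i ^ j)"
        "b j * s i ^ j \<le> (real J + 1) * L\<^sup>2 * (b j' * s i ^ j')"
        using dominant[OF z \<open>0 < s i\<close>] by (elim bexE conjE) (rule that)
      then show ?thesis by (intro exI[of _ "(j, j')"]) simp
    qed
    then obtain jj where jj: "\<And>i. i \<in> {..(J + 1)\<^sup>2} \<Longrightarrow> fst (jj i) \<in> S \<and> snd (jj i) \<in> S \<and> fst (jj i) \<noteq> snd (jj i) \<and>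
       b (snd (jj i)) * s i ^ snd (jj i) \<le> L\<^sup>2 * (b (fst (jj i)) * s i ^ fst (jj i)) \<and>
      b (fst (jj i)) * s i ^ fst (jj i) \<le> (real J + 1) * L\<^sup>2 * (b (snd (jj i)) * s i ^ snd (jj i))"
      by metis
    have "fst (jj i) \<in> {..J}" "snd (jj i) \<in> {..J}" if "i \<in> {..(J + 1)\<^sup>2}" for i
      using conjunct1[OF jj[OF that]] conjunct1[OF conjunct2[OF jj[OF that]]] SJ by blast+
    then have "jj ` {..(J + 1)\<^sup>2} \<subseteq> {..J} \<times> {..J}" unfolding image_subset_iff mem_Times_iff by blast
    then have "card (jj ` {..(J + 1)\<^sup>2}) \<le> card ({..J} \<times> {..J})" by (intro card_mono) auto
    also have "\<dots> < card {..(J + 1)\<^sup>2}" by (simp add: power2_eq_square)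
    finally have "\<not> inj_on jj {..(J + 1)\<^sup>2}" using card_image by fastforce
    then obtain i i' where i: "i \<in> {..(J + 1)\<^sup>2}" "i' \<in> {..(J + 1)\<^sup>2}" "i < i'" "jj i = jj i'"
      by (metis inj_onI linorder_cases)
    define j where "j = fst (jj i)"
    define j' where "j' = snd (jj i)"
    have jS: "j \<in> S" "j' \<in> S" "j \<noteq> j'" using jj[OF i(1)] by (auto simp: j_def j'_def)
    have low: "b j' * s k ^ j' \<le> L\<^sup>2 * (b j * s k ^ j)" and high: "b j * s k ^ j \<le> (real J + 1) * L\<^sup>2 * (b j' * s k ^ j')"
      if "k = i \<or> k = i'" for k
      using jj[OF i(1)] jj[OF i(2)] i(4) that by (auto simp: j_def j'_def)
    have spos: "0 < s k" for k using s1[of k] by simp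
    have ratio: "2 * G * s i ^ e \<le> s i' ^ e" if "0 < e" for e :: nat
    proof -
      have "2 * G * s i ^ e \<le> (2 * G) ^ e * s i ^ e"
        using G that spos[of i] by (intro mult_right_mono self_le_power) auto
      also have "\<dots> = (2 * G * s i) ^ e" by (simp add: power_mult_distrib)
      also have "\<dots> \<le> s i' ^ e" using s_gap[OF i(3)] G spos[of i] by (intro power_mono) auto
      finally show ?thesis .
    qed
    have contr: False if "0 < e" "s i' ^ e * X \<le> (real J + 1) * L\<^sup>2 * Y" "Y \<le> L\<^sup>2 * (s i ^ e * X)" "0 < X" for e X Y
    proof -
      have "2 * G * s i ^ e * X \<le> s i' ^ e * X" using ratio[OF that(1)] that(4) by (intro mult_right_mono) auto
      also have "\<dots> \<le> (real J + 1) * L\<^sup>2 * (L\<^sup>2 * (s i ^ e * X))"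
        using that(2,3) L by (smt (verit) mult_left_mono of_nat_0_le_iff zero_le_mult_iff zero_le_power2)
      also have "\<dots> = G * (s i ^ e * X)" by (simp add: G_def power2_eq_square power4_eq_xxxx mult_ac)
      finally have "G * (s i ^ e * X) \<le> 0" by (simp add: mult_ac)
      moreover have "0 < G * (s i ^ e * X)" using G spos[of i] that(4) by simp
      ultimately show False by simp
    qed
    show False
    proof (cases "j' < j")
      case True
      define e where "e = j - j'"
      have e: "0 < e" "j = j' + e" using True by (auto simp: e_def)
      have "s i' ^ j' * (s i' ^ e * b j) \<le> s i' ^ j' * ((real J + 1) * L\<^sup>2 * b j')"
        using high[of i'] e by (simp add: power_add mult_ac)
      then have "s i' ^ e * b j \<le> (real J + 1) * L\<^sup>2 * b j'" using spos[of i'] by simp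
      moreover have "s i ^ j' * b j' \<le> s i ^ j' * (L\<^sup>2 * (s i ^ e * b j))"
        using low[of i] e by (simp add: power_add mult_ac)
      then have "b j' \<le> L\<^sup>2 * (s i ^ e * b j)" using spos[of i] by simp
      ultimately show False using contr[OF e(1)] bpos jS by blast
    next
      case False
      define e where "e = j' - j"
      have e: "0 < e" "j' = j + e" using False jS by (auto simp: e_def)
      have "s i' ^ j * (s i' ^ e * b j') \<le> s i' ^ j * (L\<^sup>2 * b j)"
        using low[of i'] e by (simp add: power_add mult_ac)
      then have 1: "s i' ^ e * b j' \<le> L\<^sup>2 * b j" using spos[of i'] by simp
      have "s i ^ j * b j \<le> s i ^ j * ((real J + 1) * L\<^sup>2 * (s i ^ e * b j'))"
        using high[of i] e by (simp add: power_add mult_ac)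
      then have 2: "b j \<le> (real J + 1) * L\<^sup>2 * (s i ^ e * b j')" using spos[of i] by simp
      have J1: "0 < real J + 1" by linarith
      have "(real J + 1) * L\<^sup>2 * (b j / (real J + 1)) = L\<^sup>2 * b j" using J1 by simp
      moreover have "b j / (real J + 1) \<le> L\<^sup>2 * (s i ^ e * b j')"
        using 2 by (subst pos_divide_le_eq[OF J1]) (simp only: mult_ac)
      ultimately show False
        using contr[OF e(1), of "b j'" "b j / (real J + 1)"] 1 bpos[OF jS(2)] by simp
    qed
  qed
  then obtain i where i: "i \<le> (J + 1)\<^sup>2" and avoid: "\<And>z. norm z = \<tau> \<Longrightarrow> norm (f z) \<noteq> s i" by blast
  have cont: "continuous_on (cball 0 \<tau>) f"
    by (rule continuous_on_subset[OF holomorphic_on_imp_continuous_on[OF hol]]) (use \<tau>le \<epsilon> in auto)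
  \<comment> \<open>The positive real point of the circle lies in \<open>[0, \<epsilon>]\<close>,
    where \<open>f\<close> is at most \<open>1 < s i\<close>; exceeding \<open>s i\<close> elsewhere
    would force the value \<open>s i\<close> in between.\<close>
  have circle: "norm (f z) \<le> s i" if z: "norm z = \<tau>" for z
  proof (rule ccontr)
    assume "\<not> ?thesis"
    have "connected ((\<lambda>z. norm (f z)) ` sphere 0 \<tau>)"
      using cont by (intro connected_continuous_image continuous_on_norm connected_sphere)
        (auto intro: continuous_on_subset)
    moreover have "norm (f (of_real \<tau>)) \<in> (\<lambda>z. norm (f z)) ` sphere 0 \<tau>" using \<tau>pos by auto
    moreover have "norm (f z) \<in> (\<lambda>z. norm (f z)) ` sphere 0 \<tau>" using z by auto
    moreover have "norm (f (of_real \<tau>)) \<le> s i" using bnd[of \<tau>] \<tau>pos \<tau>le s1[of i] by simp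
    ultimately have "s i \<in> (\<lambda>z. norm (f z)) ` sphere 0 \<tau>"
      using \<open>\<not> norm (f z) \<le> s i\<close> connectedD_interval by (metis linorder_le_cases)
    then obtain z' where "z' \<in> sphere 0 \<tau>" "s i = norm (f z')" by (rule imageE)
    with avoid[of z'] show False by simp
  qed
  have "norm (f t) \<le> s i"
  proof (rule maximum_modulus_frontier[of f "cball 0 \<tau>"])
    show "f holomorphic_on interior (cball 0 \<tau>)" using hol \<tau>le \<epsilon> by (auto elim: holomorphic_on_subset)
    show "t \<in> cball 0 \<tau>" using t \<tau>ge by simp
  qed (use cont circle in auto)
  also have "\<dots> \<le> (2 * G) ^ ((J + 1)\<^sup>2 + 1)" unfolding s_def using i G by (intro power_increasing) auto
  also have "2 * G = 2 * (real J + 1) * 24 ^ (4 * ((J + 1) * I))"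
    by (simp add: G_def L_def power_mult[symmetric] mult_ac)
  finally show ?thesis .
qed

text \<open>A three circles argument. With \<open>w = exp (\<i> * s)\<close> the point
  \<open>r * sin s\<close> becomes \<open>u w\<close>, a Joukowski map that carries the unit circle
  onto the real interval. The function \<open>f (u w) * w ^ N\<close> has modulus at most 1 on the
  unit circle by \<open>real\<close>, and on the circle of radius \<open>exp (-1)\<close> because
  \<open>w ^ N\<close> offsets the bound \<open>exp N\<close>.\<close>

lemma annulus_growth:
  fixes f :: "complex \<Rightarrow> complex"
  assumes hol: "f holomorphic_on ball 0 R" and r: "0 < r" "2 * r < R"
    and real: "\<And>x. \<bar>x\<bar> \<le> r \<Longrightarrow> norm (f (of_real x)) \<le> 1"
    and bnd: "\<And>t. norm t \<le> 2 * r \<Longrightarrow> norm (f t) \<le> exp (real N)"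
    and s: "0 \<le> Im s" "Im s \<le> 1"
  shows "norm (f (of_real r * sin s)) \<le> exp (real N * Im s)"
proof -
  define S where "S = cball (0::complex) 1 - ball 0 (exp (-1))"
  define u where "u w = of_real r * ((w - inverse w) / (2 * \<i>))" for w
  define H where "H w = f (u w) * w ^ N" for w
  have nz: "w \<noteq> 0" if "w \<in> S" for w using that by (auto simp: S_def)
  \<comment> \<open>In the annulus \<open>norm w + 1 / norm w\<close> is at most
    \<open>1 + 3\<close>; this is the origin of the radius \<open>2 * r\<close> in the
    hypotheses.\<close>
  have u2: "norm (u w) \<le> 2 * r" if w: "w \<in> S" for w
  proof -
    have "exp (-1) \<le> norm w" "norm w \<le> 1" using w by (auto simp: S_def)
    then have "inverse (norm w) \<le> inverse (exp (-1))" by (intro le_imp_inverse_le) auto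
    also have "\<dots> \<le> 3" using exp_le by (simp add: exp_minus)
    finally have "norm (w - inverse w) \<le> 4"
      using norm_triangle_ineq4[of w "inverse w"] \<open>norm w \<le> 1\<close> by (simp add: norm_inverse)
    then show ?thesis using r by (simp add: u_def norm_mult norm_divide)
  qed
  have uR: "u ` S \<subseteq> ball 0 R" using u2 r by fastforce
  have holu: "u holomorphic_on S" unfolding u_def using nz by (auto intro!: holomorphic_intros)
  have holH: "H holomorphic_on S" unfolding H_def
    by (intro holomorphic_intros holomorphic_on_compose_gen[OF holu hol uR, unfolded o_def])
  have clS: "closed S" unfolding S_def by (intro closed_Diff) auto
  define w where "w = exp (\<i> * s)"
  have nw: "norm w = exp (- Im s)" by (simp add: w_def)
  have "w \<in> S" using nw s by (simp add: S_def)
  have "norm (H w) \<le> 1"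
  proof (rule maximum_modulus_frontier[of H S])
    show "H holomorphic_on interior S" using holH interior_subset by (rule holomorphic_on_subset)
    show "continuous_on (closure S) H" using holH clS by (simp add: holomorphic_on_imp_continuous_on)
    show "bounded S" unfolding S_def by (intro bounded_diff) auto
    show "w \<in> S" by fact
    fix z assume z: "z \<in> frontier S"
    have zS: "z \<in> S" using z clS frontier_subset_closed by blast
    have "ball 0 1 - cball 0 (exp (-1)) \<subseteq> interior S"
      unfolding S_def by (intro interior_maximal open_Diff) auto
    then have "z \<notin> ball 0 1 - cball 0 (exp (-1))" using z by (auto simp: frontier_def)
    with zS consider "norm z = 1" | "norm z = exp (-1)" by (force simp: S_def)
    then show "norm (H z) \<le> 1"
    proof cases
      case 1
      have "z * cnj z = 1" using 1 by (simp add: complex_norm_square[symmetric])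
      then have "inverse z = cnj z" by (rule inverse_unique)
      then have "u z = of_real (r * Im z)"
        by (simp add: u_def complex_eq_iff complex_diff_cnj)
      moreover have "\<bar>r * Im z\<bar> \<le> r" using abs_Im_le_cmod[of z] 1 r by (simp add: abs_mult mult_left_le)
      ultimately show ?thesis using real[of "r * Im z"] 1 by (simp add: H_def norm_mult norm_power)
    next
      case 2
      have "norm (H z) = norm (f (u z)) * exp (-1) ^ N" by (simp add: H_def norm_mult norm_power 2)
      also have "\<dots> \<le> exp (real N) * exp (-1) ^ N" using bnd[OF u2[OF zS]] by (intro mult_right_mono) auto
      also have "\<dots> = 1" by (simp add: exp_of_nat_mult[symmetric] exp_add[symmetric])
      finally show ?thesis .
    qed
  qed
  moreover have "H w = f (of_real r * sin s) * w ^ N"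
    by (simp add: H_def u_def w_def sin_exp_eq exp_minus)
  ultimately have "norm (f (of_real r * sin s)) * exp (- Im s) ^ N \<le> 1"
    by (simp add: norm_mult norm_power nw)
  then have "norm (f (of_real r * sin s)) * exp (- (real N * Im s)) \<le> 1"
    by (simp add: exp_of_nat_mult[symmetric])
  then show ?thesis by (simp add: exp_minus field_simps)
qed

lemma sin_growth:
  fixes f :: "complex \<Rightarrow> complex"
  assumes hol: "f holomorphic_on ball 0 R" and r: "0 < r" "2 * r < R"
    and real: "\<And>x. \<bar>x\<bar> \<le> r \<Longrightarrow> norm (f (of_real x)) \<le> 1"
    and bnd: "\<And>t. norm t \<le> 2 * r \<Longrightarrow> norm (f t) \<le> exp (real N)"
    and s: "norm s \<le> 1"
  shows "norm (f (of_real r * sin s)) \<le> exp (real N * norm s)"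
proof -
  have Im: "\<bar>Im s\<bar> \<le> norm s" by (rule abs_Im_le_cmod)
  have "norm (f (of_real r * sin s)) \<le> exp (real N * \<bar>Im s\<bar>)"
  proof (cases "0 \<le> Im s")
    case True
    then show ?thesis using annulus_growth[OF hol r real bnd, of s] Im s by simp
  next
    case False
    have "(\<lambda>t. f (- t)) holomorphic_on ball 0 R"
      by (rule holomorphic_on_compose_gen[OF _ hol, unfolded o_def]) (auto intro!: holomorphic_intros)
    from annulus_growth[OF this r, of N "- s"] show ?thesis
      using False Im s bnd real by (smt (verit, best) add.inverse_inverse mult_minus_right norm_minus_cancel of_real_minus sin_minus uminus_complex.sel(2))
  qed
  also have "\<dots> \<le> exp (real N * norm s)" using Im by (simp add: mult_left_mono)
  finally show ?thesis .
qed

section \<open>Taylor coefficients after the sine substitution\<close>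

lemma sin_factor:
  obtains h :: "complex \<Rightarrow> complex" where "h holomorphic_on UNIV" "h 0 = 1" "\<And>s. sin s = s * h s"
proof -
  define h where "h = (\<lambda>s::complex. if s = 0 then deriv sin 0 else (sin s - sin 0) / (s - 0))"
  have "h holomorphic_on UNIV" unfolding h_def
    by (rule pole_lemma) (auto intro!: holomorphic_intros)
  moreover have "deriv sin (0::complex) = 1"
    by (rule DERIV_imp_deriv) (auto intro!: derivative_eq_intros)
  ultimately show ?thesis by (intro that[of h]) (auto simp: h_def)
qed

text \<open>Sine is conformal at 0, so the first Taylor coefficient of \<open>f\<close> in
  \<open>t\<close> and that of \<open>f (r * sin s)\<close> in \<open>s\<close> differ exactly by
  the factor \<open>r ^ q\<close>. In the variable \<open>s\<close> the function is bounded on a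
  disc of radius of order \<open>1 / N\<close>, and the maximum principle for the quotient by
  \<open>s ^ q\<close> gives the power \<open>N ^ q\<close>.\<close>

lemma leading_coeff_bound:
  fixes f :: "complex \<Rightarrow> complex"
  assumes hol: "f holomorphic_on ball 0 R" and r: "0 < r" "2 * r < R"
    and real: "\<And>x. \<bar>x\<bar> \<le> r \<Longrightarrow> norm (f (of_real x)) \<le> 1"
    and bnd: "\<And>t. norm t \<le> 2 * r \<Longrightarrow> norm (f t) \<le> exp (real N)"
    and N: "0 < N" and \<phi>: "\<phi> holomorphic_on ball 0 R"
    and f\<phi>: "\<And>t. t \<in> ball 0 R \<Longrightarrow> f t = f 0 + t ^ q * \<phi> t"
  shows "norm (\<phi> 0) \<le> 4 * (2 * real N / r) ^ q"
proof -
  obtain h :: "complex \<Rightarrow> complex" where h: "h holomorphic_on UNIV" "h 0 = 1" "\<And>s. sin s = s * h s"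
    by (rule sin_factor) blast
  define v where "v s = of_real r * sin s" for s :: complex
  \<comment> \<open>On this circle the bound \<open>exp (N * norm s)\<close> is
    \<open>exp (1/2) \<le> 3\<close>. Together with \<open>norm (f 0) \<le> 1\<close> this produces
    the constant 4.\<close>
  define \<rho> where "\<rho> = 1 / (2 * real N)"
  have \<rho>: "0 < \<rho>" "\<rho> < 1" using N by (auto simp: \<rho>_def)
  have vR: "v ` ball 0 1 \<subseteq> ball 0 R"
  proof -
    have "norm (sin s) \<le> 2" if "norm s < 1" for s :: complex
    proof -
      have "norm (sin s) \<le> (norm (exp (\<i> * s)) + norm (exp (- (\<i> * s)))) / 2"
        by (simp add: sin_exp_eq norm_divide norm_mult norm_triangle_ineq4 divide_right_mono del: norm_exp_eq_Re)
      moreover have "norm (exp (\<i> * s)) \<le> exp 1 " "norm (exp (- (\<i> * s))) \<le> exp 1"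
        using abs_Im_le_cmod[of s] that by auto
      moreover have "exp (1::real) \<le> 3" by (rule exp_le)
      moreover have "norm (exp (\<i> * s)) \<le> 1 \<or> norm (exp (- (\<i> * s))) \<le> 1" by auto
      moreover have "x \<le> 2" if "x \<le> (a + b) / 2" "a \<le> e" "b \<le> e" "e \<le> 3" "a \<le> 1 \<or> b \<le> 1" for x a b e :: real
        using that by auto
      ultimately show ?thesis by blast
    qed
    then have "norm (v s) \<le> r * 2" if "norm s < 1" for s
      unfolding v_def norm_mult using that r by simp
    then show ?thesis using r by fastforce
  qed
  define \<psi> where "\<psi> s = of_real (r ^ q) * h s ^ q * \<phi> (v s)" for s
  have holv: "v holomorphic_on ball 0 1" unfolding v_def by (intro holomorphic_intros)
  have hol\<psi>: "\<psi> holomorphic_on ball 0 1" unfolding \<psi>_def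
    by (intro holomorphic_intros holomorphic_on_compose_gen[OF holv \<phi> vR, unfolded o_def]
        holomorphic_on_subset[OF h(1)]) auto
  have eq: "f (v s) - f 0 = s ^ q * \<psi> s" if "s \<in> ball 0 1" for s
  proof -
    have "v s \<in> ball 0 R" using vR that by blast
    from f\<phi>[OF this] have "f (v s) - f 0 = v s ^ q * \<phi> (v s)" by simp
    also have "v s ^ q = s ^ q * (of_real (r ^ q) * h s ^ q)" by (simp add: v_def h(3) power_mult_distrib mult_ac)
    finally show ?thesis by (simp add: \<psi>_def mult_ac)
  qed
  have "norm (\<psi> 0) \<le> 4 * (2 * real N) ^ q"
  proof (rule maximum_modulus_frontier[of \<psi> "cball 0 \<rho>"])
    have sub: "cball 0 \<rho> \<subseteq> ball (0::complex) 1" using \<rho> by auto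
    show "\<psi> holomorphic_on interior (cball 0 \<rho>)"
      using hol\<psi> by (rule holomorphic_on_subset) (use sub in auto)
    show "continuous_on (closure (cball 0 \<rho>)) \<psi>"
      using holomorphic_on_imp_continuous_on[OF hol\<psi>] by (rule continuous_on_subset) (use sub in auto)
    fix z :: complex assume "z \<in> frontier (cball 0 \<rho>)"
    then have z: "norm z = \<rho>" by auto
    have "norm (f (v z)) \<le> exp (real N * norm z)"
      unfolding v_def using sin_growth[OF hol r real bnd] z \<rho> by auto
    also have "real N * norm z = 1 / 2" using N by (simp add: z \<rho>_def)
    also have "exp (1 / 2 :: real) \<le> exp 1" by simp
    also have "\<dots> \<le> 3" by (rule exp_le)
    finally have "norm (f (v z) - f 0) \<le> 4"
      using norm_triangle_ineq4[of "f (v z)" "f 0"] real[of 0] r by simp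
    then have "norm (z ^ q * \<psi> z) \<le> 4" using eq[of z] z \<rho> by simp
    then have "norm (\<psi> z) * \<rho> ^ q \<le> 4" by (simp add: norm_mult norm_power z mult.commute)
    then show "norm (\<psi> z) \<le> 4 * (2 * real N) ^ q"
      using N by (simp add: \<rho>_def power_divide field_simps)
  qed (use \<rho> in auto)
  moreover have "\<psi> 0 = of_real (r ^ q) * \<phi> 0" by (simp add: \<psi>_def h v_def)
  then have "norm (\<psi> 0) = r ^ q * norm (\<phi> 0)" using r by (simp add: norm_mult norm_power)
  ultimately show ?thesis using r by (simp add: power_divide field_simps)
qed

text \<open>Turns the bound of \<open>bernstein_walsh_algebraic\<close> with
  \<open>I = J * d\<close> into a pure exponential in \<open>d\<close>; for \<open>0 < d\<close> the
  additive constant is absorbed. The rate is a natural number because it becomes the exponent of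
  \<open>w\<close> in \<open>annulus_growth\<close>.\<close>

lemma bernstein_walsh_rate:
  obtains \<beta> :: nat where "0 < \<beta>"
    "\<And>d. 0 < d \<Longrightarrow> (2 * (real J + 1) * 24 ^ (4 * ((J + 1) * (J * d)))) ^ ((J + 1)\<^sup>2 + 1) \<le> exp (real (\<beta> * d))"
proof -
  define c where "c = ((J + 1)\<^sup>2 + 1) * (ln (2 * (real J + 1)) + (4 * ((J + 1) * J)) * ln 24)"
  define \<beta> where "\<beta> = nat \<lceil>c\<rceil> + 1"
  have c\<beta>: "c \<le> real \<beta>" unfolding \<beta>_def by linarith
  have "(2 * (real J + 1) * 24 ^ (4 * ((J + 1) * (J * d)))) ^ ((J + 1)\<^sup>2 + 1) \<le> exp (real (\<beta> * d))" if d: "0 < d" for d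
  proof -
    have "0 \<le> ln (2 * (real J + 1))" by simp
    then have 1: "ln (2 * (real J + 1)) \<le> ln (2 * (real J + 1)) * real d" using d by (simp add: mult_left_le)
    have "ln ((2 * (real J + 1) * 24 ^ (4 * ((J + 1) * (J * d)))) ^ ((J + 1)\<^sup>2 + 1))
        = real ((J + 1)\<^sup>2 + 1) * (ln (2 * (real J + 1)) + real (4 * ((J + 1) * (J * d))) * ln 24)"
    proof -
      have "ln (2 * (real J + 1) * 24 ^ e) = ln (2 * (real J + 1)) + real e * ln 24" for e
        by (subst ln_mult) (auto simp: ln_realpow)
      then show ?thesis by (subst ln_realpow) auto
    qed
    also have "\<dots> \<le> real ((J + 1)\<^sup>2 + 1) * (ln (2 * (real J + 1)) * real d + real (4 * ((J + 1) * (J * d))) * ln 24)"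
      using 1 by (intro mult_left_mono) auto
    also have "\<dots> = c * real d" by (simp add: c_def algebra_simps)
    also have "\<dots> \<le> real \<beta> * real d" using c\<beta> by (intro mult_right_mono) auto
    finally have "ln ((2 * (real J + 1) * 24 ^ (4 * ((J + 1) * (J * d)))) ^ ((J + 1)\<^sup>2 + 1)) \<le> real (\<beta> * d)"
      by simp
    moreover have "0 < (2 * (real J + 1) * 24 ^ (4 * ((J + 1) * (J * d)))) ^ ((J + 1)\<^sup>2 + 1)"
      by (intro zero_less_power mult_pos_pos) auto
    ultimately show ?thesis by (metis exp_ln exp_le_cancel_iff)
  qed
  then show ?thesis by (intro that[of \<beta>]) (auto simp: \<beta>_def)
qed

section \<open>Coefficient bounds along half arcs and full arcs\<close>

lemma scaled_relation:
  fixes q :: "nat \<Rightarrow> complex poly" and M :: real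
  assumes "M > 0" "(\<Sum>j\<le>J. poly (q j) x * y ^ j) = 0"
  shows "(\<Sum>j\<le>J. poly (smult (of_real M ^ j) (q j)) x * (y / of_real M) ^ j) = 0"
proof -
  have "poly (smult (of_real M ^ j) (q j)) x * (y / of_real M) ^ j = poly (q j) x * y ^ j" for j
    using assms(1) by (simp add: power_divide)
  then show ?thesis using assms(2) by (simp only:)
qed

text \<open>Lets \<open>f\<close> be divided by some \<open>M' > M\<close> instead of
  \<open>M\<close>, so that \<open>M = 0\<close> causes no division by zero.\<close>

lemma le_of_forall_scaled_le:
  fixes a b M :: real
  assumes "\<And>M'. M < M' \<Longrightarrow> a \<le> b * M'"
  shows "a \<le> b * M"
proof (rule tendsto_lowerbound)
  show "((\<lambda>M'. b * M') \<longlongrightarrow> b * M) (at_right M)" by (intro tendsto_intros)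
  show "\<forall>\<^sub>F M' in at_right M. a \<le> b * M'"
    using assms by (auto simp: eventually_at_filter)
qed auto

text \<open>A bound on \<open>[0, \<epsilon>]\<close> only is turned into a bound on both sides of 0
  by passing to \<open>f (u ^ 2)\<close>. The order of the coefficient becomes \<open>2 * m\<close>,
  which is where the square of the degree comes from.\<close>

lemma half_branch_bound:
  fixes f :: "complex \<Rightarrow> complex" and q :: "nat \<Rightarrow> complex poly" and J d m N :: nat
  assumes \<epsilon>: "0 < \<epsilon>" "\<epsilon> < R" and hol: "f holomorphic_on ball 0 R" and m: "0 < m"
    and rel: "\<And>t. t \<in> ball 0 R \<Longrightarrow> (\<Sum>j\<le>J. poly (q j) (t ^ m) * f t ^ j) = 0"
    and nz: "j0 \<le> J" "q j0 \<noteq> 0" and deg: "\<And>j. j \<le> J \<Longrightarrow> degree (q j) \<le> J * d"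
    and bnd: "\<And>t. 0 \<le> t \<Longrightarrow> t \<le> \<epsilon> \<Longrightarrow> norm (f (of_real t)) \<le> M"
    and N: "0 < N" "(2 * (real J + 1) * 24 ^ (4 * ((J + 1) * (J * d)))) ^ ((J + 1)\<^sup>2 + 1) \<le> exp (real N)"
    and \<phi>: "\<phi> holomorphic_on ball 0 R" and f\<phi>: "\<And>t. t \<in> ball 0 R \<Longrightarrow> f t = f 0 + t ^ m * \<phi> t"
  shows "norm (\<phi> 0) \<le> 4 * (32 * (real N)\<^sup>2 / \<epsilon>) ^ m * M"
proof (rule le_of_forall_scaled_le)
  fix M' assume "M < M'"
  have "0 \<le> M" using bnd[of 0] \<epsilon> norm_ge_zero[of "f 0"] by (simp del: norm_ge_zero)
  then have M': "0 < M'" using \<open>M < M'\<close> by simp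
  define F where "F t = f t / of_real M'" for t
  \<comment> \<open>Chosen so that \<open>(2 * r) ^ 2 = \<epsilon> / 2\<close>, the radius up to
    which \<open>bernstein_walsh_algebraic\<close> controls \<open>f\<close>.\<close>
  define r where "r = sqrt (\<epsilon> / 8)"
  have r: "0 < r" "r\<^sup>2 = \<epsilon> / 8" using \<epsilon> by (auto simp: r_def)
  have small: "norm (F t) \<le> exp (real N)" if "norm t \<le> \<epsilon> / 2" for t
  proof -
    have "norm (F t) \<le> (2 * (real J + 1) * 24 ^ (4 * ((J + 1) * (J * d)))) ^ ((J + 1)\<^sup>2 + 1)"
    proof (rule bernstein_walsh_algebraic[where q = "\<lambda>j. smult (of_real M' ^ j) (q j)" and R = R and \<epsilon> = \<epsilon> and m = m and J = J and f = F and t = t])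
      show "F holomorphic_on ball 0 R" unfolding F_def using M' by (intro holomorphic_intros hol) auto
      show "(\<Sum>j\<le>J. poly (smult (of_real M' ^ j) (q j)) (t ^ m) * F t ^ j) = 0" if "t \<in> ball 0 R" for t
        unfolding F_def by (rule scaled_relation[OF M' rel[OF that]])
      show "smult (of_real M' ^ j0) (q j0) \<noteq> 0" using nz M' by simp
      show "norm (F (of_real t)) \<le> 1" if "0 \<le> t" "t \<le> \<epsilon>" for t
        using bnd[OF that] M' \<open>M < M'\<close> by (simp add: F_def norm_divide)
    qed (use \<epsilon> m nz deg that M' in auto)
    with N show ?thesis by linarith
  qed
  define R' where "R' = sqrt R"
  have R': "R'\<^sup>2 = R" "0 < R'" using \<epsilon> by (auto simp: R'_def)
  have sq_in: "(\<lambda>u :: complex. u\<^sup>2) ` ball 0 R' \<subseteq> ball 0 R"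
  proof (rule image_subsetI)
    fix u :: complex assume "u \<in> ball 0 R'"
    then have "(norm u)\<^sup>2 < R'\<^sup>2" by (intro power_strict_mono) auto
    then show "u\<^sup>2 \<in> ball 0 R" by (simp add: norm_power R')
  qed
  have "norm (\<phi> (0\<^sup>2) / of_real M') \<le> 4 * (2 * real N / r) ^ (2 * m)"
  proof (rule leading_coeff_bound[where f = "\<lambda>u. F (u\<^sup>2)" and R = R' and \<phi> = "\<lambda>u. \<phi> (u\<^sup>2) / of_real M'"])
    show "(\<lambda>u. F (u\<^sup>2)) holomorphic_on ball 0 R'" unfolding F_def using M'
      by (intro holomorphic_intros holomorphic_on_compose_gen[OF _ hol sq_in, unfolded o_def]) auto
    show "(\<lambda>u. \<phi> (u\<^sup>2) / of_real M') holomorphic_on ball 0 R'" using M'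
      by (intro holomorphic_intros holomorphic_on_compose_gen[OF _ \<phi> sq_in, unfolded o_def]) auto
    show "2 * r < R'"
    proof (rule power2_less_imp_less)
      show "(2 * r)\<^sup>2 < R'\<^sup>2" using r R' \<epsilon> by (simp add: power_mult_distrib)
    qed (use R' in auto)
    show "norm (F ((of_real x)\<^sup>2)) \<le> 1" if "\<bar>x\<bar> \<le> r" for x
    proof -
      have "x\<^sup>2 \<le> r\<^sup>2" using that by (metis abs_ge_zero power2_abs power_mono)
      then have "norm (f (of_real (x\<^sup>2))) \<le> M" using r \<epsilon> by (intro bnd) auto
      then show ?thesis using M' \<open>M < M'\<close> by (simp add: F_def norm_divide)
    qed
    show "norm (F (u\<^sup>2)) \<le> exp (real N)" if "norm u \<le> 2 * r" for u
    proof (rule small)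
      have "(norm u)\<^sup>2 \<le> (2 * r)\<^sup>2" using that by (intro power_mono) auto
      then show "norm (u\<^sup>2) \<le> \<epsilon> / 2" using r by (simp add: norm_power power_mult_distrib)
    qed
    show "F (u\<^sup>2) = F (0\<^sup>2) + u ^ (2 * m) * (\<phi> (u\<^sup>2) / of_real M')" if "u \<in> ball 0 R'" for u
    proof -
      have "u\<^sup>2 \<in> ball 0 R" using sq_in that by blast
      from f\<phi>[OF this] show ?thesis by (simp add: F_def power_mult add_divide_distrib)
    qed
  qed (use r N in auto)
  also have "(2 * real N / r) ^ (2 * m) = (32 * (real N)\<^sup>2 / \<epsilon>) ^ m"
  proof -
    have "(2 * real N / r)\<^sup>2 = 32 * (real N)\<^sup>2 / \<epsilon>"
      by (simp add: power_divide power_mult_distrib r)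
    then show ?thesis by (simp only: power_mult)
  qed
  finally show "norm (\<phi> 0) \<le> 4 * (32 * (real N)\<^sup>2 / \<epsilon>) ^ m * M'"
    using M' by (simp add: norm_divide pos_divide_le_eq)
qed

lemma full_branch_bound:
  fixes f :: "complex \<Rightarrow> complex" and q :: "nat \<Rightarrow> complex poly" and J d N :: nat
  assumes \<epsilon>: "0 < \<epsilon>" "\<epsilon> < R" and hol: "f holomorphic_on ball 0 R"
    and rel: "\<And>t. t \<in> ball 0 R \<Longrightarrow> (\<Sum>j\<le>J. poly (q j) t * f t ^ j) = 0"
    and nz: "j0 \<le> J" "q j0 \<noteq> 0" and deg: "\<And>j. j \<le> J \<Longrightarrow> degree (q j) \<le> J * d"
    and bnd: "\<And>t. \<bar>t\<bar> \<le> \<epsilon> \<Longrightarrow> norm (f (of_real t)) \<le> M"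
    and N: "0 < N" "(2 * (real J + 1) * 24 ^ (4 * ((J + 1) * (J * d)))) ^ ((J + 1)\<^sup>2 + 1) \<le> exp (real N)"
    and \<phi>: "\<phi> holomorphic_on ball 0 R" and f\<phi>: "\<And>t. t \<in> ball 0 R \<Longrightarrow> f t = f 0 + t * \<phi> t"
  shows "norm (\<phi> 0) \<le> 32 * real N / \<epsilon> * M"
proof (rule le_of_forall_scaled_le)
  fix M' assume "M < M'"
  have "0 \<le> M" using bnd[of 0] \<epsilon> norm_ge_zero[of "f 0"] by (simp del: norm_ge_zero)
  then have M': "0 < M'" using \<open>M < M'\<close> by simp
  define F where "F t = f t / of_real M'" for t
  have holF: "F holomorphic_on ball 0 R" unfolding F_def using M' by (intro holomorphic_intros hol) auto
  have small: "norm (F t) \<le> exp (real N)" if "norm t \<le> \<epsilon> / 2" for t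
  proof -
    have "norm (F t) \<le> (2 * (real J + 1) * 24 ^ (4 * ((J + 1) * (J * d)))) ^ ((J + 1)\<^sup>2 + 1)"
    proof (rule bernstein_walsh_algebraic[where q = "\<lambda>j. smult (of_real M' ^ j) (q j)" and R = R and \<epsilon> = \<epsilon> and m = 1 and J = J and f = F and t = t])
      show "(\<Sum>j\<le>J. poly (smult (of_real M' ^ j) (q j)) (t ^ 1) * F t ^ j) = 0" if "t \<in> ball 0 R" for t
        unfolding F_def power_one_right by (rule scaled_relation[OF M' rel[OF that]])
      show "smult (of_real M' ^ j0) (q j0) \<noteq> 0" using nz M' by simp
      show "norm (F (of_real t)) \<le> 1" if "0 \<le> t" "t \<le> \<epsilon>" for t
        using bnd[of t] that M' \<open>M < M'\<close> by (simp add: F_def norm_divide)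
    qed (use \<epsilon> holF nz deg that M' in auto)
    with N show ?thesis by linarith
  qed
  have "norm (\<phi> 0 / of_real M') \<le> 4 * (2 * real N / (\<epsilon> / 4)) ^ 1"
  proof (rule leading_coeff_bound[where f = F and R = R and \<phi> = "\<lambda>u. \<phi> u / of_real M'"])
    show "(\<lambda>u. \<phi> u / of_real M') holomorphic_on ball 0 R" using M' by (intro holomorphic_intros \<phi>) auto
    show "norm (F (of_real x)) \<le> 1" if "\<bar>x\<bar> \<le> \<epsilon> / 4" for x
      using bnd[of x] that \<epsilon> M' \<open>M < M'\<close> by (simp add: F_def norm_divide)
    show "F u = F 0 + u ^ 1 * (\<phi> u / of_real M')" if "u \<in> ball 0 R" for u
      using f\<phi>[OF that] by (simp add: F_def add_divide_distrib)
  qed (use \<epsilon> N holF small in auto)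
  then show "norm (\<phi> 0) \<le> 32 * real N / \<epsilon> * M'"
    using M' \<epsilon> by (simp add: norm_divide field_simps)
qed

subsection \<open>Polynomial functions and algebraic sets\<close>

definition monom_val :: "('n::finite \<Rightarrow>\<^sub>0 nat) \<Rightarrow> 'a::comm_ring_1 ^ 'n \<Rightarrow> 'a" where
  "monom_val m x = (\<Prod>i\<in>UNIV. (x $ i) ^ Poly_Mapping.lookup m i)"

lemma monom_val_add: "monom_val (m + n) x = monom_val m x * monom_val n x"
  by (simp add: monom_val_def lookup_add power_add prod.distrib)

lemma monom_val_zero [simp]: "monom_val 0 x = 1"
  by (simp add: monom_val_def)

lemma monom_val_single: "monom_val (Poly_Mapping.single i k) x = (x $ i) ^ k"
proof -
  have "(\<Prod>j\<in>UNIV. (x $ j) ^ Poly_Mapping.lookup (Poly_Mapping.single i k) j)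
      = (\<Prod>j\<in>UNIV. if j = i then (x $ i) ^ k else 1)"
    by (rule prod.cong) (auto simp: lookup_single when_def)
  then show ?thesis by (simp add: monom_val_def)
qed

lemma peval_superset:
  assumes "finite S" "Poly_Mapping.keys p \<subseteq> S"
  shows "peval p x = (\<Sum>m\<in>S. Poly_Mapping.lookup p m * monom_val m x)"
  unfolding peval_def monom_val_def using assms
  by (intro sum.mono_neutral_left) (auto simp: in_keys_iff)

lemma peval_add: "peval (p + q) x = peval p x + peval q x"
proof -
  let ?S = "Poly_Mapping.keys p \<union> Poly_Mapping.keys q"
  have "peval (p + q) x = (\<Sum>m\<in>?S. Poly_Mapping.lookup (p + q) m * monom_val m x)"
    by (rule peval_superset) (use keys_add[of p q] in auto)
  also have "\<dots> = peval p x + peval q x"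
    by (simp add: peval_superset[of ?S] lookup_add distrib_right sum.distrib)
  finally show ?thesis .
qed

lemma peval_single: "peval (Poly_Mapping.single m c) x = c * monom_val m x"
  by (subst peval_superset[of "{m}"]) auto

lemma peval_zero [simp]: "peval 0 x = 0"
  by (simp add: peval_def)

lemma peval_sum: "peval (\<Sum>i\<in>I. f i) x = (\<Sum>i\<in>I. peval (f i) x)"
  by (induction I rule: infinite_finite_induct) (auto simp: peval_add)

lemma mpoly_eq_sum_single:
  "p = (\<Sum>m\<in>Poly_Mapping.keys p. Poly_Mapping.single m (Poly_Mapping.lookup p m))"
proof (rule poly_mapping_eqI)
  fix k
  show "Poly_Mapping.lookup p k = Poly_Mapping.lookup (\<Sum>m\<in>Poly_Mapping.keys p. Poly_Mapping.single m (Poly_Mapping.lookup p m)) k"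
    by (auto simp: lookup_sum lookup_single when_def in_keys_iff)
qed

lemma peval_mult: "peval (p * q) x = peval p x * peval q x"
proof -
  have "p * q = (\<Sum>m\<in>Poly_Mapping.keys p. \<Sum>n\<in>Poly_Mapping.keys q.
      Poly_Mapping.single (m + n) (Poly_Mapping.lookup p m * Poly_Mapping.lookup q n))"
    by (subst mpoly_eq_sum_single[of p], subst mpoly_eq_sum_single[of q])
      (simp add: sum_product mult_single)
  then show ?thesis
    by (simp add: peval_sum peval_single monom_val_add peval_superset[of "Poly_Mapping.keys p" p]
        peval_superset[of "Poly_Mapping.keys q" q] sum_product mult_ac)
qed

lemma peval_uminus: "peval (- p) x = - peval p x"
  using peval_add[of p "- p" x] by (simp add: eq_neg_iff_add_eq_0 add.commute)

lemma total_deg_le_iff: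
  "total_deg p \<le> k \<longleftrightarrow> (\<forall>m\<in>Poly_Mapping.keys p. (\<Sum>i\<in>UNIV. Poly_Mapping.lookup m i) \<le> k)"
  by (auto simp: total_deg_def)

lemma total_deg_mult_le:
  assumes "total_deg p \<le> k" "total_deg q \<le> l"
  shows "total_deg (p * q) \<le> k + l"
  unfolding total_deg_le_iff
proof
  fix m assume "m \<in> Poly_Mapping.keys (p * q)"
  then obtain a b where "m = a + b" "a \<in> Poly_Mapping.keys p" "b \<in> Poly_Mapping.keys q"
    using keys_mult[of p q] by blast
  with assms show "(\<Sum>i\<in>UNIV. Poly_Mapping.lookup m i) \<le> k + l"
    by (auto simp: lookup_add sum.distrib total_deg_le_iff intro: add_mono)
qed

lemma total_deg_power_le:
  assumes "total_deg p \<le> k"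
  shows "total_deg (p ^ j) \<le> j * k"
proof (induction j)
  case 0
  show ?case unfolding total_deg_le_iff by simp
next
  case (Suc j)
  with total_deg_mult_le[OF assms Suc] show ?case by simp
qed

text \<open>Speaking of functions instead of coefficient maps lets algebraic expressions be
  recognised as polynomial by closure rules, without exhibiting their coefficients.\<close>

definition polyfun :: "('a::comm_ring_1 ^ 'n::finite \<Rightarrow> 'a) \<Rightarrow> bool" where
  "polyfun f \<longleftrightarrow> (\<exists>p. f = peval p)"

lemma polyfun_peval [intro, simp]: "polyfun (peval p)" "polyfun (\<lambda>x. peval p x)"
  by (auto simp: polyfun_def)

lemma polyfun_const [intro, simp]: "polyfun (\<lambda>x. c)"
proof -
  have "(\<lambda>x. c) = peval (Poly_Mapping.single 0 c)" by (rule ext) (simp add: peval_single)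
  then show ?thesis by (auto simp: polyfun_def)
qed

lemma polyfun_coord [intro, simp]: "polyfun (\<lambda>x. x $ i)"
proof -
  have "(\<lambda>x. x $ i) = peval (Poly_Mapping.single (Poly_Mapping.single i 1) 1)"
    by (rule ext) (simp add: peval_single monom_val_single)
  then show ?thesis by (auto simp: polyfun_def)
qed

lemma polyfun_add [intro]: "polyfun f \<Longrightarrow> polyfun g \<Longrightarrow> polyfun (\<lambda>x. f x + g x)"
  by (auto simp: polyfun_def fun_eq_iff peval_add[symmetric])

lemma polyfun_mult [intro]: "polyfun f \<Longrightarrow> polyfun g \<Longrightarrow> polyfun (\<lambda>x. f x * g x)"
  by (auto simp: polyfun_def fun_eq_iff peval_mult[symmetric])

lemma polyfun_minus [intro]: "polyfun f \<Longrightarrow> polyfun (\<lambda>x. - f x)"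
  by (auto simp: polyfun_def fun_eq_iff peval_uminus[symmetric])

lemma polyfun_diff [intro]: "polyfun f \<Longrightarrow> polyfun g \<Longrightarrow> polyfun (\<lambda>x. f x - g x)"
  using polyfun_add[OF _ polyfun_minus, of f g] by simp

lemma polyfun_sum [intro]: "(\<And>i. i \<in> I \<Longrightarrow> polyfun (f i)) \<Longrightarrow> polyfun (\<lambda>x. \<Sum>i\<in>I. f i x)"
  by (induction I rule: infinite_finite_induct) auto

lemma polyfun_prod [intro]: "(\<And>i. i \<in> I \<Longrightarrow> polyfun (f i)) \<Longrightarrow> polyfun (\<lambda>x. \<Prod>i\<in>I. f i x)"
  by (induction I rule: infinite_finite_induct) auto

lemma polyfun_power [intro]: "polyfun f \<Longrightarrow> polyfun (\<lambda>x. f x ^ k)"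
  by (induction k) auto

lemma polyfun_poly:
  assumes "polyfun f"
  shows "polyfun (\<lambda>x. poly c (f x))"
  using assms by (induction c) auto

text \<open>The outer variable is \<open>y\<close>, and the coefficients are polynomials in
  \<open>x\<close>. Thus \<open>degree E\<close> is the degree in \<open>y\<close> and
  \<open>lead_coeff E\<close> is a polynomial in \<open>x\<close>.\<close>

definition biv :: "'a::comm_ring_1 poly poly \<Rightarrow> 'a \<Rightarrow> 'a \<Rightarrow> 'a" where
  "biv E x y = poly (poly E [:y:]) x"

lemma biv_simps [simp]:
  "biv 0 x y = 0" "biv (pCons c E) x y = poly c x + y * biv E x y"
  "biv (E + F) x y = biv E x y + biv F x y" "biv (E * F) x y = biv E x y * biv F x y"
  "biv (smult c E) x y = poly c x * biv E x y"
  by (simp_all add: biv_def)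

lemma polyfun_biv:
  assumes "polyfun f" "polyfun g"
  shows "polyfun (\<lambda>x. biv E (f x) (g x))"
  using assms by (induction E) (auto intro: polyfun_poly)

lemma biv_altdef: "biv E x y = poly (map_poly (\<lambda>c. poly c x) E) y"
  by (induction E) (auto simp: map_poly_pCons)

definition zeros :: "('a::comm_ring_1 ^ 'n::finite \<Rightarrow> 'a) \<Rightarrow> ('a ^ 'n) set" where
  "zeros f = {x. f x = 0}"

lemma algebraic_zeros:
  fixes f :: "'a::field ^ 'n::finite \<Rightarrow> 'a"
  assumes "polyfun f"
  shows "algebraic_set (zeros f)"
proof -
  obtain p where "f = peval p" using assms by (auto simp: polyfun_def)
  then show ?thesis unfolding algebraic_set_def zeros_def by (intro exI[of _ "{p}"]) auto
qed

lemma algebraic_Int: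
  assumes "algebraic_set X" "algebraic_set Y"
  shows "algebraic_set (X \<inter> Y)"
proof -
  obtain P Q where "finite P" "X = {x. \<forall>p\<in>P. peval p x = 0}" "finite Q" "Y = {x. \<forall>p\<in>Q. peval p x = 0}"
    using assms unfolding algebraic_set_def by blast
  then show ?thesis unfolding algebraic_set_def by (intro exI[of _ "P \<union> Q"]) auto
qed

lemma algebraic_singleton: "algebraic_set {a :: 'a::field ^ 'n::finite}"
proof -
  have "\<exists>p. peval p = (\<lambda>x. x $ i - a $ i)" for i
    using polyfun_diff[OF polyfun_coord polyfun_const] unfolding polyfun_def by metis
  then obtain p where p: "\<And>i. peval (p i) = (\<lambda>x. x $ i - a $ i)" by metis
  show ?thesis unfolding algebraic_set_def by (intro exI[of _ "range p"]) (auto simp: p vec_eq_iff)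
qed

text \<open>A sum of squares merges the equations. Its nonnegativity makes every zero a minimum,
  which the elimination exploits later.\<close>

lemma real_algebraic_single_equation:
  fixes X :: "(real ^ 'n::finite) set"
  assumes "algebraic_set X"
  obtains p where "X = zeros (peval p)" "\<And>x. 0 \<le> peval p x"
proof -
  obtain P where P: "finite P" "X = {x. \<forall>p\<in>P. peval p x = 0}"
    using assms unfolding algebraic_set_def by blast
  have "polyfun (\<lambda>x. \<Sum>p\<in>P. (peval p x)\<^sup>2)" by (intro polyfun_sum polyfun_power polyfun_peval)
  then obtain q where q: "(\<lambda>x. \<Sum>p\<in>P. (peval p x)\<^sup>2) = peval q" by (auto simp: polyfun_def)
  then have q': "peval q x = (\<Sum>p\<in>P. (peval p x)\<^sup>2)" for x by metis
  show ?thesis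
  proof (rule that[of q])
    show "X = zeros (peval q)" unfolding zeros_def P(2) q' using P(1) by (subst sum_nonneg_eq_0_iff) auto
    show "0 \<le> peval q x" for x unfolding q' by (rule sum_nonneg) auto
  qed
qed

subsection \<open>Hilbert's basis theorem\<close>

text \<open>Rings are subsets of one type, so that variables can be adjoined one after another
  inside the fixed type of polynomials.\<close>

definition subring_of :: "'a::comm_ring_1 set \<Rightarrow> bool" where
  "subring_of R \<longleftrightarrow> 1 \<in> R \<and> (\<forall>x\<in>R. \<forall>y\<in>R. x - y \<in> R \<and> x * y \<in> R)"

lemma subring_ofD:
  assumes "subring_of R"
  shows "1 \<in> R" "0 \<in> R" "x \<in> R \<Longrightarrow> y \<in> R \<Longrightarrow> x + y \<in> R" "x \<in> R \<Longrightarrow> y \<in> R \<Longrightarrow> x - y \<in> R"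
    "x \<in> R \<Longrightarrow> y \<in> R \<Longrightarrow> x * y \<in> R" "x \<in> R \<Longrightarrow> - x \<in> R"
proof -
  show 1: "1 \<in> R" and *: "x \<in> R \<Longrightarrow> y \<in> R \<Longrightarrow> x - y \<in> R" "x \<in> R \<Longrightarrow> y \<in> R \<Longrightarrow> x * y \<in> R" for x y
    using assms by (auto simp: subring_of_def)
  show 0: "0 \<in> R" using *(1)[OF 1 1] by simp
  show neg: "x \<in> R \<Longrightarrow> - x \<in> R" for x using *(1)[OF 0, of x] by simp
  show "x \<in> R \<Longrightarrow> y \<in> R \<Longrightarrow> x + y \<in> R" using *(1)[of x "- y"] neg[of y] by simp
qed

lemma subring_of_sum:
  assumes "subring_of R" "\<And>i. i \<in> I \<Longrightarrow> f i \<in> R"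
  shows "(\<Sum>i\<in>I. f i) \<in> R"
  using assms(2) by (induction I rule: infinite_finite_induct) (auto simp: subring_ofD[OF assms(1)])

text \<open>A form of the ascending chain condition that speaks only of sequences of elements. It is
  used exactly like this: once for leading coefficients and once for the equations of a descending
  chain of algebraic sets.\<close>

definition noetherian_on :: "'a::comm_ring_1 set \<Rightarrow> bool" where
  "noetherian_on R \<longleftrightarrow> subring_of R \<and> (\<forall>a :: nat \<Rightarrow> 'a. range a \<subseteq> R \<longrightarrow>
     (\<exists>N u. (\<forall>i<N. u i \<in> R) \<and> a N = (\<Sum>i<N. u i * a i)))"

text \<open>No transcendence of \<open>x\<close> over \<open>R\<close> is assumed, so an element may
  have several representing polynomials. Degrees in the basis theorem are degrees of chosen
  representatives.\<close>

definition adjoin :: "'a::comm_ring_1 set \<Rightarrow> 'a \<Rightarrow> 'a set" where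
  "adjoin R x = {poly q x |q. \<forall>k. coeff q k \<in> R}"

lemma adjoinI: "(\<And>k. coeff q k \<in> R) \<Longrightarrow> poly q x \<in> adjoin R x"
  by (auto simp: adjoin_def)

lemma subring_adjoin:
  assumes R: "subring_of R"
  shows "subring_of (adjoin R x)" "R \<subseteq> adjoin R x" "x \<in> adjoin R x"
proof -
  note [simp] = subring_ofD[OF R]
  show sub: "R \<subseteq> adjoin R x"
  proof
    fix c assume "c \<in> R"
    then have "poly [:c:] x \<in> adjoin R x" by (intro adjoinI) (auto simp: coeff_pCons split: nat.split)
    then show "c \<in> adjoin R x" by simp
  qed
  have "poly [:0, 1:] x \<in> adjoin R x" by (intro adjoinI) (auto simp: coeff_pCons split: nat.split)
  then show "x \<in> adjoin R x" by simp
  show "subring_of (adjoin R x)" unfolding subring_of_def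
  proof (intro conjI ballI)
    show "1 \<in> adjoin R x" using sub by auto
    fix a b assume "a \<in> adjoin R x" "b \<in> adjoin R x"
    then obtain p q where p: "\<And>k. coeff p k \<in> R" "a = poly p x" and q: "\<And>k. coeff q k \<in> R" "b = poly q x"
      unfolding adjoin_def by auto
    have "poly (p - q) x \<in> adjoin R x" "poly (p * q) x \<in> adjoin R x"
      by (intro adjoinI; auto simp: p q coeff_mult intro!: subring_of_sum[OF R])+
    then show "a - b \<in> adjoin R x" "a * b \<in> adjoin R x" by (auto simp: p q)
  qed
qed

definition idl :: "'a::comm_ring_1 set \<Rightarrow> 'a set \<Rightarrow> 'a set" where
  "idl S G = {\<Sum>g\<in>F. u g * g |F u. finite F \<and> F \<subseteq> G \<and> (\<forall>g\<in>F. u g \<in> S)}"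

lemma idlE:
  assumes "x \<in> idl S G"
  obtains F u where "finite F" "F \<subseteq> G" "\<forall>g\<in>F. u g \<in> S" "x = (\<Sum>g\<in>F. u g * g)"
  using assms unfolding idl_def by blast

lemma idlI:
  "finite F \<Longrightarrow> F \<subseteq> G \<Longrightarrow> \<forall>g\<in>F. u g \<in> S \<Longrightarrow> x = (\<Sum>g\<in>F. u g * g) \<Longrightarrow> x \<in> idl S G"
  unfolding idl_def by blast

lemma idl_mono: "G \<subseteq> G' \<Longrightarrow> idl S G \<subseteq> idl S G'"
  unfolding idl_def by blast

lemma idl_finite:
  assumes S: "subring_of S" and x: "x \<in> idl S G" and G: "finite G"
  obtains u where "\<And>g. g \<in> G \<Longrightarrow> u g \<in> S" "x = (\<Sum>g\<in>G. u g * g)"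
proof -
  obtain F u where F: "F \<subseteq> G" "\<forall>g\<in>F. u g \<in> S" "x = (\<Sum>g\<in>F. u g * g)"
    using x unfolding idl_def by blast
  show ?thesis
  proof (rule that[of "\<lambda>g. if g \<in> F then u g else 0"])
    show "x = (\<Sum>g\<in>G. (if g \<in> F then u g else 0) * g)"
      unfolding F(3) by (rule sum.mono_neutral_cong_left) (use F G in auto)
  qed (use F subring_ofD(2)[OF S] in auto)
qed

lemma idl_ideal:
  assumes S: "subring_of S"
  shows "g \<in> G \<Longrightarrow> g \<in> idl S G" "0 \<in> idl S G"
    "x \<in> idl S G \<Longrightarrow> y \<in> idl S G \<Longrightarrow> x + y \<in> idl S G"
    "s \<in> S \<Longrightarrow> x \<in> idl S G \<Longrightarrow> s * x \<in> idl S G"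
proof -
  show "g \<in> idl S G" if "g \<in> G" unfolding idl_def
    using that subring_ofD(1)[OF S] by (intro CollectI exI[of _ "{g}"] exI[of _ "\<lambda>_. 1"]) auto
  show "0 \<in> idl S G" unfolding idl_def by (intro CollectI exI[of _ "{}"]) auto
  show "s * x \<in> idl S G" if sx: "s \<in> S" "x \<in> idl S G"
  proof -
    obtain F u where F: "finite F" "F \<subseteq> G" "\<forall>g\<in>F. u g \<in> S" "x = (\<Sum>g\<in>F. u g * g)"
      using sx(2) unfolding idl_def by blast
    then show ?thesis unfolding idl_def
      by (intro CollectI exI[of _ F] exI[of _ "\<lambda>g. s * u g"])
        (auto simp: sum_distrib_left mult.assoc subring_ofD[OF S] sx(1))
  qed
  show "x + y \<in> idl S G" if xy: "x \<in> idl S G" "y \<in> idl S G"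
  proof -
    obtain F u where F: "finite F" "F \<subseteq> G" "\<forall>g\<in>F. u g \<in> S" "x = (\<Sum>g\<in>F. u g * g)"
      using xy(1) unfolding idl_def by blast
    obtain F' u' where F': "finite F'" "F' \<subseteq> G" "\<forall>g\<in>F'. u' g \<in> S" "y = (\<Sum>g\<in>F'. u' g * g)"
      using xy(2) unfolding idl_def by blast
    let ?K = "F \<union> F'"
    have xK: "x \<in> idl S ?K" and yK: "y \<in> idl S ?K" unfolding idl_def using F F' by blast+
    obtain v where v: "\<And>g. g \<in> ?K \<Longrightarrow> v g \<in> S" "x = (\<Sum>g\<in>?K. v g * g)"
      by (rule idl_finite[OF S xK finite_UnI[OF F(1) F'(1)]]) (rule that)
    obtain v' where v': "\<And>g. g \<in> ?K \<Longrightarrow> v' g \<in> S" "y = (\<Sum>g\<in>?K. v' g * g)"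
      by (rule idl_finite[OF S yK finite_UnI[OF F(1) F'(1)]]) (rule that)
    have "x + y = (\<Sum>g\<in>?K. (v g + v' g) * g)"
      unfolding v(2) v'(2) by (simp add: distrib_right sum.distrib)
    then show ?thesis unfolding idl_def using F F' v(1) v'(1) subring_ofD(3)[OF S]
      by (intro CollectI exI[of _ ?K] exI[of _ "\<lambda>g. v g + v' g"]) auto
  qed
qed

lemma idl_sum:
  assumes "subring_of S" "\<And>i. i \<in> I \<Longrightarrow> f i \<in> idl S G"
  shows "(\<Sum>i\<in>I. f i) \<in> idl S G"
  using assms(2) by (induction I rule: infinite_finite_induct) (auto simp: idl_ideal[OF assms(1)])

text \<open>Hilbert's argument. From an ideal that is not finitely generated one picks successively
  elements outside the ideal of the earlier ones, each with a representative of least degree. A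
  relation between the leading coefficients over \<open>R\<close> then cancels the leading term of a
  later representative by means of earlier ones, which contradicts minimality.\<close>

lemma noetherian_adjoin:
  assumes noeth: "noetherian_on R"
  shows "noetherian_on (adjoin R x)"
proof -
  have R: "subring_of R" using noeth by (simp add: noetherian_on_def)
  define S where "S = adjoin R x"
  have S: "subring_of S" "R \<subseteq> S" "x \<in> S" unfolding S_def by (rule subring_adjoin[OF R])+
  have "\<exists>N u. (\<forall>i<N. u i \<in> S) \<and> a N = (\<Sum>i<N. u i * a i)" if a: "range a \<subseteq> S" for a :: "nat \<Rightarrow> 'a"
  proof (rule ccontr)
    assume none: "\<not> ?thesis"
    have bad: "a N \<notin> idl S (a ` {..<N})" for N
    proof
      assume "a N \<in> idl S (a ` {..<N})"
      then obtain u where u: "\<And>g. g \<in> a ` {..<N} \<Longrightarrow> u g \<in> S" "a N = (\<Sum>g\<in>a ` {..<N}. u g * g)"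
        by (rule idl_finite[OF S(1)]) auto
      \<comment> \<open>The sequence may repeat values, while ideal membership is phrased with the
        set of values; the coefficient is placed at the first index of each value.\<close>
      define w where "w i = (if \<exists>j<i. a j = a i then 0 else u (a i))" for i
      have "inj_on a {i. i < N \<and> \<not> (\<exists>j<i. a j = a i)}"
        by (rule inj_onI) (metis (mono_tags, lifting) linorder_neqE_nat mem_Collect_eq)
      moreover have "a ` {i. i < N \<and> \<not> (\<exists>j<i. a j = a i)} = a ` {..<N}"
      proof (intro equalityI subsetI)
        fix y assume "y \<in> a ` {..<N}"
        then have ex: "\<exists>i. i < N \<and> a i = y" by auto
        define i where "i = (LEAST i. i < N \<and> a i = y)"
        have "i < N \<and> a i = y" unfolding i_def by (rule LeastI_ex[OF ex])
        moreover have "\<not> (\<exists>j<i. a j = a i)"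
        proof
          assume "\<exists>j<i. a j = a i"
          then obtain j where "j < i" "a j = y" "j < N" using \<open>i < N \<and> a i = y\<close> by auto
          then show False using not_less_Least[of j "\<lambda>i. i < N \<and> a i = y"] by (simp add: i_def)
        qed
        ultimately show "y \<in> a ` {i. i < N \<and> \<not> (\<exists>j<i. a j = a i)}" by blast
      qed auto
      ultimately have "a N = (\<Sum>i\<in>{i. i < N \<and> \<not> (\<exists>j<i. a j = a i)}. u (a i) * a i)"
        unfolding u(2) by (metis (no_types, lifting) sum.reindex_cong)
      also have "\<dots> = (\<Sum>i<N. w i * a i)"
        by (rule sum.mono_neutral_cong_left) (auto simp: w_def)
      finally have "a N = (\<Sum>i<N. w i * a i)" .
      moreover have "\<forall>i<N. w i \<in> S" using u(1) subring_ofD(2)[OF S(1)] by (auto simp: w_def)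
      ultimately show False using none by blast
    qed
    define I where "I = idl S (range a)"
    have fin_in: "\<exists>N. F \<subseteq> idl S (a ` {..<N})" if "finite F" "F \<subseteq> I" for F
      using that
    proof (induction F rule: finite_induct)
      case (insert y F)
      obtain N where N: "F \<subseteq> idl S (a ` {..<N})" using insert by auto
      have "y \<in> idl S (range a)" using insert.prems by (simp add: I_def)
      then obtain K u where K: "finite K" "K \<subseteq> range a" "\<forall>g\<in>K. u g \<in> S" "y = (\<Sum>g\<in>K. u g * g)"
        by (rule idlE)
      obtain B where B: "finite B" "K = a ` B" using K(1,2) by (metis finite_subset_image)
      obtain M where M: "B \<subseteq> {..<M}" using B(1) by (metis finite_nat_iff_bounded)
      have "y \<in> idl S K" by (rule idlI[OF K(1) order_refl K(3,4)])
      moreover have "K \<subseteq> a ` {..<max N M}" using M B(2) by auto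
      ultimately have "y \<in> idl S (a ` {..<max N M})" using idl_mono by blast
      moreover have "idl S (a ` {..<N}) \<subseteq> idl S (a ` {..<max N M})" by (intro idl_mono image_mono) auto
      ultimately show ?case using N by blast
    qed auto
    have idl_idl: "idl S F \<subseteq> idl S G" if "F \<subseteq> idl S G" for F G
    proof
      fix y assume "y \<in> idl S F"
      then obtain K u where "finite K" and K: "K \<subseteq> F" "\<forall>g\<in>K. u g \<in> S" "y = (\<Sum>g\<in>K. u g * g)"
        by (rule idlE)
      show "y \<in> idl S G" unfolding K(3)
        by (intro idl_sum[OF S(1)] idl_ideal(4)[OF S(1)]) (use K that in auto)
    qed
    have proper: "\<exists>y\<in>I. y \<notin> idl S F" if F: "finite F" "F \<subseteq> I" for F
    proof -
      obtain N where "F \<subseteq> idl S (a ` {..<N})" using fin_in[OF F] by blast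
      then have "a N \<notin> idl S F" using idl_idl bad by blast
      moreover have "a N \<in> I" unfolding I_def by (rule idl_ideal(1)[OF S(1)]) auto
      ultimately show ?thesis by blast
    qed
    have "I \<subseteq> S"
    proof
      fix y assume "y \<in> I"
      then have "y \<in> idl S (range a)" by (simp add: I_def)
      then obtain K u where "finite K" and K: "K \<subseteq> range a" "\<forall>g\<in>K. u g \<in> S" "y = (\<Sum>g\<in>K. u g * g)"
        by (rule idlE)
      show "y \<in> S" unfolding K(3) using K a
        by (intro subring_of_sum[OF S(1)] subring_ofD(5)[OF S(1)]) auto
    qed
    \<comment> \<open>Candidates for the next generator: representatives over \<open>R\<close> of
      elements of \<open>I\<close> outside the ideal generated so far. \<open>nxt\<close> takes one
      of least degree.\<close>
    define good where "good F q \<longleftrightarrow> (\<forall>k. coeff q k \<in> R) \<and> poly q x \<in> I \<and> poly q x \<notin> idl S F" for F q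
    define nxt where "nxt F = arg_min degree (good F)" for F
    have nxt: "good F (nxt F)" "\<And>q. good F q \<Longrightarrow> degree (nxt F) \<le> degree q" if F: "finite F" "F \<subseteq> I" for F
    proof -
      obtain y where y: "y \<in> I" "y \<notin> idl S F" using proper[OF F] by blast
      then have "y \<in> adjoin R x" using \<open>I \<subseteq> S\<close> by (auto simp: S_def)
      then obtain q where "good F q" using y by (auto simp: good_def adjoin_def)
      then show "good F (nxt F)" unfolding nxt_def by (rule arg_min_natI)
      show "degree (nxt F) \<le> degree q" if "good F q" for q
        unfolding nxt_def using that by (rule arg_min_nat_le)
    qed
    define Fs where "Fs = rec_nat {} (\<lambda>_ F. insert (poly (nxt F) x) F)"
    have Fs: "Fs 0 = {}" "\<And>n. Fs (Suc n) = insert (poly (nxt (Fs n)) x) (Fs n)" by (auto simp: Fs_def)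
    have FsI: "finite (Fs n) \<and> Fs n \<subseteq> I" for n
      by (induction n) (use nxt in \<open>auto simp: Fs good_def\<close>)
    have Fs_mono: "Fs i \<subseteq> Fs j" if "i \<le> j" for i j using that by (induction j) (auto simp: Fs le_Suc_eq)
    define G where "G n = nxt (Fs n)" for n
    have G: "good (Fs n) (G n)" "\<And>q. good (Fs n) q \<Longrightarrow> degree (G n) \<le> degree q" for n
      unfolding G_def using nxt[of "Fs n"] FsI[of n] by simp_all
    have GF: "poly (G i) x \<in> Fs j" if "i < j" for i j
      using Fs_mono[of "Suc i" j] that by (auto simp: Fs G_def)
    have deg_mono: "degree (G i) \<le> degree (G j)" if "i \<le> j" for i j
      using G(1)[of j] idl_mono[OF Fs_mono[OF that]] by (intro G(2)) (auto simp: good_def)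
    have lcR: "range (\<lambda>n. lead_coeff (G n)) \<subseteq> R" using G(1) by (auto simp: good_def)
    then obtain N u where u: "\<forall>i<N. u i \<in> R" "lead_coeff (G N) = (\<Sum>i<N. u i * lead_coeff (G i))"
      using noeth unfolding noetherian_on_def by blast
    \<comment> \<open>The earlier generator \<open>G i\<close>, shifted to the degree of
      \<open>G N\<close> and weighted so that all leading coefficients add up to that of
      \<open>G N\<close>. The shift is possible since the degrees increase.\<close>
    define T where "T i = monom (u i) (degree (G N) - degree (G i)) * G i" for i
    define h where "h = G N - (\<Sum>i<N. T i)"
    have TR: "coeff (T i) k \<in> R" if "i < N" for i k
      using G(1)[of i] u(1) that subring_ofD[OF R]
      by (auto simp: T_def coeff_monom_mult good_def)
    have cT: "coeff (T i) (degree (G N)) = u i * lead_coeff (G i)" if "i < N" for i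
      using deg_mono[of i N] that by (simp add: T_def coeff_monom_mult)
    have dT: "degree (T i) \<le> degree (G N)" if "i < N" for i
    proof -
      have "degree (T i) \<le> (degree (G N) - degree (G i)) + degree (G i)"
        unfolding T_def by (rule order_trans[OF degree_mult_le add_mono[OF degree_monom_le order_refl]])
      then show ?thesis using deg_mono[of i N] that by simp
    qed
    have hR: "coeff h k \<in> R" for k
      unfolding h_def coeff_diff coeff_sum
      by (intro subring_ofD(4)[OF R] subring_of_sum[OF R]) (use G(1)[of N] TR in \<open>auto simp: good_def\<close>)
    have polyT: "poly (T i) x \<in> idl S (Fs N)" if "i < N" for i
    proof -
      have "poly (monom (u i) (degree (G N) - degree (G i))) x \<in> S" unfolding S_def
        using u(1) that subring_ofD(2)[OF R] by (intro adjoinI) auto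
      then show ?thesis unfolding T_def poly_mult
        by (intro idl_ideal(4)[OF S(1)] idl_ideal(1)[OF S(1)] GF[OF that])
    qed
    have sumT: "(\<Sum>i<N. poly (T i) x) \<in> idl S (Fs N)" using polyT by (intro idl_sum[OF S(1)]) auto
    have polyh: "poly (G N) x = poly h x + (\<Sum>i<N. poly (T i) x)" by (simp add: h_def poly_sum)
    have notin: "poly h x \<notin> idl S (Fs N)"
    proof
      assume "poly h x \<in> idl S (Fs N)"
      then have "poly (G N) x \<in> idl S (Fs N)" unfolding polyh using sumT by (rule idl_ideal(3)[OF S(1)])
      then show False using G(1)[of N] by (simp add: good_def)
    qed
    have "- 1 \<in> S" by (rule subring_ofD(6)[OF S(1) subring_ofD(1)[OF S(1)]])
    have "idl S (Fs N) \<subseteq> I" unfolding I_def by (rule idl_idl) (use FsI in \<open>auto simp: I_def\<close>)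
    moreover have "(- 1) * (\<Sum>i<N. poly (T i) x) \<in> idl S (Fs N)"
      by (rule idl_ideal(4)[OF S(1) \<open>- 1 \<in> S\<close> sumT])
    ultimately have "(- 1) * (\<Sum>i<N. poly (T i) x) \<in> I" ..
    then have "poly (G N) x + (- 1) * (\<Sum>i<N. poly (T i) x) \<in> I"
      using G(1)[of N] unfolding I_def by (intro idl_ideal(3)[OF S(1)]) (auto simp: good_def I_def)
    then have hI: "poly h x \<in> I" using polyh by simp
    have "good (Fs N) h" using hR hI notin by (simp add: good_def)
    then have "degree (G N) \<le> degree h" by (rule G(2))
    moreover have "degree h \<le> degree (G N)" unfolding h_def
      by (intro degree_diff_le degree_sum_le dT) auto
    moreover have "coeff h (degree (G N)) = 0" unfolding h_def by (simp add: coeff_sum cT u(2))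
    \<comment> \<open>The degree of \<open>h\<close> is exactly that of \<open>G N\<close>, and the
      coefficient there vanishes; only the zero polynomial has a vanishing leading coefficient. But
      0 lies in every ideal.\<close>
    ultimately have "h = 0" by (metis leading_coeff_0_iff order_antisym)
    then have "poly h x \<in> idl S (Fs N)" using idl_ideal(2)[OF S(1)] by simp
    then show False using notin by contradiction
  qed
  then show ?thesis unfolding noetherian_on_def using S(1) by (simp add: S_def)
qed

text \<open>The constants form a field, and the finitely many variables are adjoined to them one at
  a time.\<close>

lemma noetherian_mpoly: "noetherian_on (UNIV :: ('a::field, 'n::finite) mpolynomial set)"
proof -
  define X :: "'n \<Rightarrow> ('a, 'n) mpolynomial" where "X i = Poly_Mapping.single (Poly_Mapping.single i 1) 1" for i
  define C :: "('a, 'n) mpolynomial set" where "C = range (Poly_Mapping.single 0)"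
  have subC: "subring_of C" unfolding subring_of_def C_def
  proof (intro conjI ballI)
    show "1 \<in> range (Poly_Mapping.single 0)" by (metis range_eqI single_one)
    fix x y :: "('a, 'n) mpolynomial" assume "x \<in> range (Poly_Mapping.single 0)" "y \<in> range (Poly_Mapping.single 0)"
    then obtain a b where "x = Poly_Mapping.single 0 a" "y = Poly_Mapping.single 0 b" by auto
    then have "x - y = Poly_Mapping.single 0 (a - b)" "x * y = Poly_Mapping.single 0 (a * b)"
      by (auto simp: single_diff mult_single)
    then show "x - y \<in> range (Poly_Mapping.single 0)" "x * y \<in> range (Poly_Mapping.single 0)" by auto
  qed
  have "noetherian_on C" unfolding noetherian_on_def
  proof (intro conjI subC allI impI)
    fix a :: "nat \<Rightarrow> ('a, 'n) mpolynomial" assume "range a \<subseteq> C"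
    then have "\<exists>c. a n = Poly_Mapping.single 0 c" for n by (auto simp: C_def)
    then obtain c where c: "\<And>n. a n = Poly_Mapping.single 0 (c n)" by metis
    show "\<exists>N u. (\<forall>i<N. u i \<in> C) \<and> a N = (\<Sum>i<N. u i * a i)"
    proof (cases "c 0 = 0")
      case True
      then show ?thesis by (intro exI[of _ 0]) (auto simp: c)
    next
      case False
      then show ?thesis
        by (intro exI[of _ 1] exI[of _ "\<lambda>_. Poly_Mapping.single 0 (c 1 / c 0)"])
          (auto simp: c C_def mult_single)
    qed
  qed
  have "\<exists>R. noetherian_on R \<and> C \<subseteq> R \<and> X ` I \<subseteq> R" if "finite I" for I
    using that
  proof (induction I rule: finite_induct)
    case empty
    then show ?case using \<open>noetherian_on C\<close> by auto
  next
    case (insert i I)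
    then obtain R where R: "noetherian_on R" "C \<subseteq> R" "X ` I \<subseteq> R" by auto
    have "subring_of R" using R(1) by (simp add: noetherian_on_def)
    from subring_adjoin[OF this, where x = "X i"] noetherian_adjoin[OF R(1), of "X i"] R(2,3)
    show ?case by (intro exI[of _ "adjoin R (X i)"]) auto
  qed
  then obtain R where R: "noetherian_on R" "C \<subseteq> R" "X ` UNIV \<subseteq> R" using finite[of UNIV] by blast
  have sub: "subring_of R" using R(1) by (simp add: noetherian_on_def)
  \<comment> \<open>Induction on the total degree, splitting off one variable at a time.\<close>
  have mon: "Poly_Mapping.single m 1 \<in> R" for m
  proof (induction "\<Sum>i\<in>UNIV. Poly_Mapping.lookup m i" arbitrary: m)
    case 0
    then have "m = 0" by (intro poly_mapping_eqI) simp
    then show ?case using subring_ofD(1)[OF sub] by simp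
  next
    case (Suc k)
    then obtain i where i: "Poly_Mapping.lookup m i \<noteq> 0" by (metis (no_types, lifting) nat.distinct(1) sum.neutral)
    define m' where "m' = m - Poly_Mapping.single i 1"
    have m: "m = Poly_Mapping.single i 1 + m'"
      using i by (intro poly_mapping_eqI) (auto simp: m'_def lookup_add lookup_minus lookup_single when_def)
    have "(\<Sum>j\<in>UNIV. Poly_Mapping.lookup (Poly_Mapping.single i 1) j) = (1::nat)"
      by (simp add: lookup_single when_def)
    then have "k = (\<Sum>i\<in>UNIV. Poly_Mapping.lookup m' i)"
      using Suc(2) by (subst (asm) m) (simp add: lookup_add sum.distrib)
    then have "Poly_Mapping.single m' 1 \<in> R" by (rule Suc(1))
    moreover have "X i \<in> R" using R(3) by auto
    moreover have "Poly_Mapping.single m 1 = X i * Poly_Mapping.single m' 1"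
      unfolding X_def m mult_single by simp
    ultimately show ?case using subring_ofD(5)[OF sub] by simp
  qed
  have "p \<in> R" for p
  proof (subst mpoly_eq_sum_single, rule subring_of_sum[OF sub])
    fix m
    have "Poly_Mapping.single m (Poly_Mapping.lookup p m) = Poly_Mapping.single 0 (Poly_Mapping.lookup p m) * Poly_Mapping.single m 1"
      by (simp add: mult_single)
    then show "Poly_Mapping.single m (Poly_Mapping.lookup p m) \<in> R"
      using mon[of m] R(2) subring_ofD(5)[OF sub] by (auto simp: C_def)
  qed
  then have "R = UNIV" by auto
  with R(1) show ?thesis by simp
qed

text \<open>In a strictly descending chain choose \<open>p i\<close> vanishing on
  \<open>Z (Suc i)\<close> but not on \<open>Z i\<close>. Some \<open>p N\<close> is a combination
  of its predecessors, all of which vanish on \<open>Z N\<close>, and so it vanishes there as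
  well.\<close>

lemma algebraic_wf:
  "wf {(X, Y :: ('a::field ^ 'n::finite) set). algebraic_set X \<and> algebraic_set Y \<and> X \<subset> Y}"
  unfolding wf_iff_no_infinite_down_chain
proof
  assume "\<exists>Z. \<forall>i. (Z (Suc i), Z i) \<in> {(X, Y :: ('a ^ 'n) set). algebraic_set X \<and> algebraic_set Y \<and> X \<subset> Y}"
  then obtain Z :: "nat \<Rightarrow> ('a ^ 'n) set" where
    Z': "\<forall>i. (Z (Suc i), Z i) \<in> {(X, Y). algebraic_set X \<and> algebraic_set Y \<and> X \<subset> Y}" by blast
  then have Z: "algebraic_set (Z i)" "Z (Suc i) \<subset> Z i" for i by simp_all
  have "\<exists>p. (\<forall>x\<in>Z (Suc i). peval p x = 0) \<and> (\<exists>x\<in>Z i. peval p x \<noteq> 0)" for i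
  proof -
    obtain P where "Z (Suc i) = {x. \<forall>p\<in>P. peval p x = 0}"
      using Z(1)[of "Suc i"] unfolding algebraic_set_def by blast
    then show ?thesis using Z(2)[of i] by blast
  qed
  then obtain p where p: "\<And>i x. x \<in> Z (Suc i) \<Longrightarrow> peval (p i) x = 0" "\<And>i. \<exists>x\<in>Z i. peval (p i) x \<noteq> 0"
    by metis
  obtain N u where "p N = (\<Sum>i<N. u i * p i)"
    using noetherian_mpoly[unfolded noetherian_on_def, THEN conjunct2, rule_format, of p] by auto
  then have pN: "peval (p N) x = (\<Sum>i<N. peval (u i) x * peval (p i) x)" for x
    by (simp add: peval_sum peval_mult)
  have "decseq Z" using Z(2) by (intro decseq_SucI) blast
  then have sub: "Z N \<subseteq> Z (Suc i)" if "i < N" for i using that by (simp add: decseq_def)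
  have "peval (p N) x = 0" if "x \<in> Z N" for x
    unfolding pN
  proof (rule sum.neutral, rule ballI)
    fix i assume "i \<in> {..<N}"
    then have "x \<in> Z (Suc i)" using sub[of i] that by auto
    from p(1)[OF this] show "peval (u i) x * peval (p i) x = 0" by simp
  qed
  then show False using p(2)[of N] by blast
qed

subsection \<open>The Zariski closure of a piece of a curve\<close>

lemma real_analytic_on_polyfun:
  fixes f :: "real ^ 'n::finite \<Rightarrow> real"
  assumes "polyfun f"
  shows "real_analytic_on f U"
  unfolding real_analytic_on_def
proof
  fix a assume "a \<in> U"
  obtain p where p: "f = peval p" using assms by (auto simp: polyfun_def)
  have "polyfun (\<lambda>y. \<Sum>m\<in>Poly_Mapping.keys p. Poly_Mapping.lookup p m * (\<Prod>i\<in>UNIV. (y $ i + a $ i) ^ Poly_Mapping.lookup m i))"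
    by (intro polyfun_sum polyfun_mult polyfun_prod polyfun_power polyfun_add polyfun_const polyfun_coord)
  then have "polyfun (\<lambda>y. f (y + a))" by (simp add: p peval_def)
  then obtain q where "(\<lambda>y. f (y + a)) = peval q" by (auto simp: polyfun_def)
  then have q: "f x = peval q (x - a)" for x by (metis diff_add_cancel)
  \<comment> \<open>Taylor coefficients at \<open>a\<close>. Every exponent function on the finite
    index type has finite support, so \<open>Abs_poly_mapping\<close> is faithful here, and only
    finitely many terms are nonzero.\<close>
  define c where "c \<alpha> = Poly_Mapping.lookup q (Abs_poly_mapping \<alpha>)" for \<alpha> :: "'n \<Rightarrow> nat"
  define S where "S = Poly_Mapping.lookup ` Poly_Mapping.keys q"
  have inj: "inj_on Poly_Mapping.lookup (Poly_Mapping.keys q)"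
    by (auto intro!: inj_onI simp: poly_mapping.lookup_inject)
  have "((\<lambda>\<alpha>. c \<alpha> * (\<Prod>i\<in>UNIV. (x $ i - a $ i) ^ \<alpha> i)) has_sum f x) UNIV" for x
  proof (rule has_sum_finite_neutralI[of S])
    show "finite S" by (simp add: S_def)
    show "c \<alpha> * (\<Prod>i\<in>UNIV. (x $ i - a $ i) ^ \<alpha> i) = 0" if "\<alpha> \<in> UNIV - S" for \<alpha>
    proof -
      have "Poly_Mapping.lookup (Abs_poly_mapping \<alpha>) = \<alpha>" by (rule lookup_Abs_poly_mapping) simp
      then have "Abs_poly_mapping \<alpha> \<notin> Poly_Mapping.keys q" using that unfolding S_def by (metis DiffD2 imageI)
      then show ?thesis by (simp add: c_def in_keys_iff)
    qed
    have "f x = (\<Sum>m\<in>Poly_Mapping.keys q. Poly_Mapping.lookup q m * (\<Prod>i\<in>UNIV. (x $ i - a $ i) ^ Poly_Mapping.lookup m i))"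
      by (simp add: q peval_def)
    then show "f x = (\<Sum>\<alpha>\<in>S. c \<alpha> * (\<Prod>i\<in>UNIV. (x $ i - a $ i) ^ \<alpha> i))"
      unfolding S_def by (subst sum.reindex[OF inj]) (simp add: c_def)
  qed auto
  then show "\<exists>r>0. \<exists>c. \<forall>x\<in>ball a r. ((\<lambda>\<alpha>. c \<alpha> * (\<Prod>i\<in>UNIV. (x $ i - a $ i) ^ \<alpha> i)) has_sum f x) UNIV"
    by (intro exI[of _ 1] conjI exI[of _ c]) auto
qed

text \<open>Transfers the analytic irreducibility of a piece to decompositions of its Zariski
  closure.\<close>

lemma analytic_subset_algebraic:
  assumes "algebraic_set (X :: (real ^ 'n::finite) set)"
  shows "analytic_subset_of (A \<inter> X) A"
proof -
  obtain p where "X = zeros (peval p)" using real_algebraic_single_equation[OF assms] by blast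
  then show ?thesis unfolding analytic_subset_of_def
    by (intro conjI ballI exI[of _ UNIV] exI[of _ "{peval p}"])
      (auto simp: zeros_def intro: real_analytic_on_polyfun)
qed

text \<open>The closure \<open>W\<close> inherits irreducibility from \<open>A\<close>. A proper
  infinite algebraic subset of \<open>W\<close> would put two irreducible sets below
  \<open>W\<close> in a strict chain and give dimension at least 2. Hence a polynomial that does not
  vanish on all of \<open>A\<close> has finitely many zeros on \<open>W\<close>.\<close>

lemma piece_zariski_closure:
  fixes A :: "(real ^ 'n::finite) set"
  assumes A: "piece_of_algebraic_curve A" and inf: "infinite A"
  obtains P where "A \<subseteq> zeros (peval P)" "\<And>x. 0 \<le> peval P x"
    "\<And>f. polyfun f \<Longrightarrow> \<exists>a\<in>A. f a \<noteq> 0 \<Longrightarrow> finite (zeros (peval P) \<inter> zeros f)"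
proof -
  obtain V where V: "algebraic_set V" "alg_dim V = 1" "A \<subseteq> V"
    using A by (auto simp: piece_of_algebraic_curve_def algebraic_curve_def)
  have irr: "B1 = A \<or> B2 = A" if "analytic_subset_of B1 A" "analytic_subset_of B2 A" "A = B1 \<union> B2" for B1 B2
    using A that by (auto simp: piece_of_algebraic_curve_def analytic_irreducible_def)
  obtain W where W: "algebraic_set W" "A \<subseteq> W" "W \<subseteq> V"
    and minW: "\<And>Y. algebraic_set Y \<Longrightarrow> A \<subseteq> Y \<Longrightarrow> Y \<subseteq> W \<Longrightarrow> Y = W"
  proof -
    obtain W where W: "W \<in> {W. algebraic_set W \<and> A \<subseteq> W \<and> W \<subseteq> V}"
      "\<And>Y. (Y, W) \<in> {(X, Y). algebraic_set X \<and> algebraic_set Y \<and> X \<subset> Y} \<Longrightarrow> Y \<notin> {W. algebraic_set W \<and> A \<subseteq> W \<and> W \<subseteq> V}"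
      by (rule wfE_min[OF algebraic_wf, of V "{W. algebraic_set W \<and> A \<subseteq> W \<and> W \<subseteq> V}"]) (use V in auto)
    have "Y = W" if "algebraic_set Y" "A \<subseteq> Y" "Y \<subseteq> W" for Y
      using W(2)[of Y] W(1) that by blast
    then show ?thesis using W(1) by (intro that[of W]) auto
  qed
  have irrW: "alg_irreducible W" unfolding alg_irreducible_def
  proof (intro conjI allI impI)
    show "algebraic_set W" by (fact W(1))
    show "W \<noteq> {}" using W(2) inf by auto
    fix Z1 Z2 assume Z: "algebraic_set Z1 \<and> algebraic_set Z2 \<and> W = Z1 \<union> Z2"
    have "A = (A \<inter> Z1) \<union> (A \<inter> Z2)" using Z W(2) by auto
    then have "A \<inter> Z1 = A \<or> A \<inter> Z2 = A"
      using irr[OF analytic_subset_algebraic analytic_subset_algebraic] Z by blast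
    then show "Z1 = W \<or> Z2 = W" using minW[of Z1] minW[of Z2] Z by blast
  qed
  have fin: "finite X" if X: "algebraic_set X" "X \<subset> W" for X
  proof (rule ccontr)
    assume "infinite X"
    \<comment> \<open>A minimal infinite algebraic subset is irreducible: of two algebraic sets that
      cover it, one is infinite and so is all of it.\<close>
    obtain X' where X': "X' \<in> {Y. algebraic_set Y \<and> infinite Y \<and> Y \<subseteq> X}"
      "\<And>Y. (Y, X') \<in> {(X, Y). algebraic_set X \<and> algebraic_set Y \<and> X \<subset> Y} \<Longrightarrow> Y \<notin> {Y. algebraic_set Y \<and> infinite Y \<and> Y \<subseteq> X}"
      by (rule wfE_min[OF algebraic_wf, of X "{Y. algebraic_set Y \<and> infinite Y \<and> Y \<subseteq> X}"]) (use X \<open>infinite X\<close> in auto)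
    have irrX': "alg_irreducible X'" unfolding alg_irreducible_def
    proof (intro conjI allI impI)
      show "algebraic_set X'" "X' \<noteq> {}" using X' by auto
      fix Z1 Z2 assume Z: "algebraic_set Z1 \<and> algebraic_set Z2 \<and> X' = Z1 \<union> Z2"
      then have "infinite Z1 \<or> infinite Z2" using X'(1) by auto
      then show "Z1 = X' \<or> Z2 = X'" using X' Z by blast
    qed
    obtain a where a: "a \<in> X'" using X' by fastforce
    have irra: "alg_irreducible {a}" unfolding alg_irreducible_def using algebraic_singleton by blast
    have "infinite X'" using X' by simp
    then have sub: "{a} \<subset> X'" using a by (metis finite.emptyI finite_insert insert_subset empty_subsetI psubsetI)
    \<comment> \<open>The chain point, \<open>X'\<close>, \<open>W\<close> has length 2 and lies in
      the curve \<open>V\<close>, whose dimension is 1.\<close>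
    define C where "C i = (if i = 0 then {a} else if i = 1 then X' else W)" for i :: nat
    have "2 \<in> {d. \<exists>C :: nat \<Rightarrow> (real ^ 'n) set.
       (\<forall>i\<le>d. alg_irreducible (C i) \<and> C i \<subseteq> V) \<and> (\<forall>i<d. C i \<subset> C (Suc i))}"
    proof (intro CollectI exI[of _ C] conjI allI impI)
      fix i :: nat
      show "alg_irreducible (C i)" using irra irrX' irrW by (simp add: C_def)
      show "C i \<subseteq> V" using a X'(1) X(2) W(3) by (auto simp: C_def)
      assume "i < 2"
      then consider "i = 0" | "i = 1" by linarith
      then show "C i \<subset> C (Suc i)" using sub X'(1) X(2) by cases (auto simp: C_def)
    qed
    then have "enat 2 \<le> alg_dim V" unfolding alg_dim_def by (rule SUP_upper)
    then show False using V(2) by (simp add: one_enat_def)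
  qed
  obtain P where P: "W = zeros (peval P)" "\<And>x. 0 \<le> peval P x"
    using real_algebraic_single_equation[OF W(1)] by blast
  show ?thesis
  proof (rule that[of P])
    show "A \<subseteq> zeros (peval P)" using W P by simp
    fix f :: "real ^ 'n \<Rightarrow> real" assume f: "polyfun f" "\<exists>a\<in>A. f a \<noteq> 0"
    have "algebraic_set (W \<inter> zeros f)" using W(1) algebraic_zeros[OF f(1)] by (rule algebraic_Int)
    moreover have "W \<inter> zeros f \<subset> W" using f(2) W(2) by (auto simp: zeros_def)
    ultimately show "finite (zeros (peval P) \<inter> zeros f)" using fin P(1) by simp
  qed (fact P(2))
qed

subsection \<open>Elimination by perturbed critical points\<close>

text \<open>More vectors than coordinates are linearly dependent; Gaussian elimination removes one
  coordinate \<open>y\<close> with the pivot \<open>x0\<close>.\<close>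

lemma exists_nontrivial_relation:
  fixes M :: "'x \<Rightarrow> 'y \<Rightarrow> real"
  assumes "finite Y" "finite X" "card Y < card X"
  shows "\<exists>l. (\<exists>x\<in>X. l x \<noteq> 0) \<and> (\<forall>y\<in>Y. (\<Sum>x\<in>X. l x * M x y) = 0)"
  using assms
proof (induction Y arbitrary: X M rule: finite_induct)
  case empty
  then obtain x where "x \<in> X" by (metis card_gt_0_iff ex_in_conv card.empty)
  then show ?case by (intro exI[of _ "\<lambda>_. 1"]) auto
next
  case (insert y Y)
  show ?case
  proof (cases "\<forall>x\<in>X. M x y = 0")
    case True
    have "card Y < card X" using insert by simp
    from insert.IH[OF insert.prems(1) this, of M] True show ?thesis by auto
  next
    case False
    then obtain x0 where x0: "x0 \<in> X" "M x0 y \<noteq> 0" by auto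
    define M' where "M' x z = M x z - M x y / M x0 y * M x0 z" for x z
    have "card Y < card (X - {x0})" using insert x0 by simp
    from insert.IH[OF _ this, of M'] insert.prems(1) obtain l where
      l: "\<exists>x\<in>X - {x0}. l x \<noteq> 0" "\<forall>z\<in>Y. (\<Sum>x\<in>X - {x0}. l x * M' x z) = 0" by auto
    define l' where "l' x = (if x = x0 then - (\<Sum>x\<in>X - {x0}. l x * M x y / M x0 y) else l x)" for x
    have split: "(\<Sum>x\<in>X. l' x * M x z) = l' x0 * M x0 z + (\<Sum>x\<in>X - {x0}. l x * M x z)" for z
      using insert.prems(1) x0(1) by (simp add: sum.remove l'_def)
    have "(\<Sum>x\<in>X. l' x * M x z) = 0" if "z \<in> insert y Y" for z
    proof (cases "z = y")
      case True
      have "l' x0 * M x0 y = - (\<Sum>x\<in>X - {x0}. l x * M x y)"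
        using x0 by (simp add: l'_def sum_divide_distrib[symmetric])
      then show ?thesis using split[of y] True by simp
    next
      case False
      then have "z \<in> Y" using that by simp
      have "(\<Sum>x\<in>X - {x0}. l x * M' x z) = (\<Sum>x\<in>X - {x0}. l x * M x z) - (\<Sum>x\<in>X - {x0}. l x * M x y / M x0 y) * M x0 z"
      proof -
        have "l x * M' x z = l x * M x z - (l x * M x y / M x0 y) * M x0 z" for x
          by (simp add: M'_def algebra_simps)
        then show ?thesis by (simp only: sum_subtractf sum_distrib_right)
      qed
      then show ?thesis using split[of z] l(2) \<open>z \<in> Y\<close> by (simp add: l'_def)
    qed
    moreover have "\<exists>x\<in>X. l' x \<noteq> 0" using l(1) by (auto simp: l'_def)
    ultimately show ?thesis by blast
  qed
qed

text \<open>The partial derivative. Truncated subtraction of exponents does no harm, as the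
  coefficient is 0 whenever variable \<open>i\<close> is absent.\<close>

definition pd :: "'n \<Rightarrow> (real, 'n::finite) mpolynomial \<Rightarrow> (real, 'n) mpolynomial" where
  "pd i p = (\<Sum>m\<in>Poly_Mapping.keys p.
     Poly_Mapping.single (m - Poly_Mapping.single i 1) (Poly_Mapping.lookup p m * real (Poly_Mapping.lookup m i)))"

lemma monom_val_pd:
  fixes x :: "real ^ 'n::finite"
  shows "((\<lambda>t. monom_val m (x + t *\<^sub>R axis i 1)) has_real_derivative
     real (Poly_Mapping.lookup m i) * monom_val (m - Poly_Mapping.single i 1) x) (at 0)"
proof -
  define Q where "Q = (\<Prod>j\<in>UNIV - {i}. (x $ j) ^ Poly_Mapping.lookup m j)"
  have split: "monom_val k y = (y $ i) ^ Poly_Mapping.lookup k i * (\<Prod>j\<in>UNIV - {i}. (y $ j) ^ Poly_Mapping.lookup k j)"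
    for k and y :: "real ^ 'n" by (simp add: monom_val_def prod.remove[of UNIV i])
  have 1: "monom_val m (x + t *\<^sub>R axis i 1) = (x $ i + t) ^ Poly_Mapping.lookup m i * Q" for t
    unfolding split Q_def by (intro arg_cong2[of _ _ _ _ "(*)"] prod.cong) (auto simp: axis_def)
  have 2: "monom_val (m - Poly_Mapping.single i 1) x = (x $ i) ^ (Poly_Mapping.lookup m i - 1) * Q"
    unfolding split Q_def
    by (intro arg_cong2[of _ _ _ _ "(*)"] prod.cong) (auto simp: lookup_minus lookup_single when_def)
  show ?thesis unfolding 1 2 by (auto intro!: derivative_eq_intros)
qed

lemma has_derivative_pd:
  fixes x :: "real ^ 'n::finite"
  shows "((\<lambda>t. peval p (x + t *\<^sub>R axis i 1)) has_real_derivative peval (pd i p) x) (at 0)"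
proof -
  have "((\<lambda>t. \<Sum>m\<in>Poly_Mapping.keys p. Poly_Mapping.lookup p m * monom_val m (x + t *\<^sub>R axis i 1)) has_real_derivative
    (\<Sum>m\<in>Poly_Mapping.keys p. Poly_Mapping.lookup p m * (real (Poly_Mapping.lookup m i) * monom_val (m - Poly_Mapping.single i 1) x))) (at 0)"
    by (intro DERIV_sum DERIV_cmult monom_val_pd)
  then show ?thesis
    by (simp add: pd_def peval_sum peval_single peval_superset[of "Poly_Mapping.keys p" p] mult.assoc)
qed

lemma total_deg_pd:
  assumes "total_deg p \<le> Suc k"
  shows "total_deg (pd i p) \<le> k"
  unfolding total_deg_le_iff
proof
  fix n assume n: "n \<in> Poly_Mapping.keys (pd i p)"
  have "Poly_Mapping.lookup (pd i p) n = (\<Sum>m\<in>Poly_Mapping.keys p.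
      Poly_Mapping.lookup (Poly_Mapping.single (m - Poly_Mapping.single i 1) (Poly_Mapping.lookup p m * real (Poly_Mapping.lookup m i))) n)"
    unfolding pd_def by (rule lookup_sum)
  moreover have "Poly_Mapping.lookup (pd i p) n \<noteq> 0" using n by (simp add: in_keys_iff)
  ultimately obtain m where m: "m \<in> Poly_Mapping.keys p"
    "Poly_Mapping.lookup (Poly_Mapping.single (m - Poly_Mapping.single i 1) (Poly_Mapping.lookup p m * real (Poly_Mapping.lookup m i))) n \<noteq> 0"
    by (metis (no_types, lifting) sum.neutral)
  then have n_eq: "n = m - Poly_Mapping.single i 1" and mi: "Poly_Mapping.lookup m i \<noteq> 0"
    by (auto simp: lookup_single when_def split: if_splits)
  have "m = n + Poly_Mapping.single i 1"
    using mi by (intro poly_mapping_eqI) (auto simp: n_eq lookup_add lookup_minus lookup_single when_def)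
  then have "(\<Sum>j\<in>UNIV. Poly_Mapping.lookup m j) = (\<Sum>j\<in>UNIV. Poly_Mapping.lookup n j) + 1"
    by (simp add: lookup_add sum.distrib lookup_single when_def)
  moreover have "(\<Sum>j\<in>UNIV. Poly_Mapping.lookup m j) \<le> Suc k" using assms m(1) by (auto simp: total_deg_le_iff)
  ultimately show "(\<Sum>j\<in>UNIV. Poly_Mapping.lookup n j) \<le> k" by simp
qed

lemma continuous_on_peval [continuous_intros]:
  fixes f :: "'b::topological_space \<Rightarrow> 'a::real_normed_field ^ 'n::finite"
  assumes "continuous_on S f"
  shows "continuous_on S (\<lambda>x. peval p (f x))"
  unfolding peval_def by (intro continuous_intros assms)

text \<open>The points where \<open>P + S / h\<close>, with \<open>S\<close> a sum of powers of the coordinates other than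
  \<open>i0\<close>, is critical along the slice of constant \<open>i0\<close>-th coordinate. Isolated zeros of a nonnegative \<open>P\<close> in the
  slice are limits of such points as \<open>h\<close> tends to infinity. The equations reduce each power \<open>(x $ i) ^ e\<close>, so
  that polynomials of degree \<open>d\<close> restrict to a space of dimension \<open>O(d\<^sup>2)\<close>; this gives the linear dependence
  behind the elimination.\<close>

definition crit :: "'n \<Rightarrow> nat \<Rightarrow> (real, 'n::finite) mpolynomial \<Rightarrow> ((real ^ 'n) \<times> real) set" where
  "crit i0 e P = {(x, h). \<forall>i. i \<noteq> i0 \<longrightarrow> (x $ i) ^ e = - h * peval (pd i P) x}"

text \<open>Minimise \<open>P + \<delta> * Q\<close> over a small ball in the slice through
  \<open>a\<close>. On the boundary sphere \<open>P\<close> alone exceeds a positive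
  \<open>\<mu>\<close>, while the value at \<open>a\<close> is \<open>\<delta> * Q a\<close>. For
  small \<open>\<delta>\<close> the minimum is therefore interior, and vanishing of the partial
  derivatives within the slice is the equation of \<open>crit\<close> with
  \<open>h = 1 / \<delta>\<close>.\<close>

lemma isolated_zero_near_crit:
  fixes P :: "(real, 'n::finite) mpolynomial"
  assumes nonneg: "\<And>x. 0 \<le> peval P x" and a: "peval P a = 0"
    and fin: "finite {x. peval P x = 0 \<and> x $ i0 = a $ i0}" and e: "odd e" and \<eta>: "0 < \<eta>"
  shows "\<exists>\<delta>0>0. \<forall>\<delta>. 0 < \<delta> \<and> \<delta> < \<delta>0 \<longrightarrow>
    (\<exists>x. norm (x - a) < \<eta> \<and> (x, inverse \<delta>) \<in> crit i0 e P)"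
proof -
  define H where "H = {x :: real ^ 'n. x $ i0 = a $ i0}"
  \<comment> \<open>Differentiation gives exactly the powers \<open>(x $ i) ^ e\<close>. As
    \<open>e\<close> is odd, the exponent \<open>Suc e\<close> is even and \<open>Q\<close> is
    nonnegative.\<close>
  define Q where "Q x = (\<Sum>i\<in>UNIV - {i0}. (x $ i) ^ Suc e / Suc e)" for x :: "real ^ 'n"
  have Q0: "0 \<le> Q x" for x unfolding Q_def using e
    by (intro sum_nonneg divide_nonneg_nonneg zero_le_even_power) auto
  obtain d where d: "d > 0" "\<And>x. peval P x = 0 \<Longrightarrow> x \<in> H \<Longrightarrow> x \<noteq> a \<Longrightarrow> d \<le> dist a x"
    using finite_set_avoid[OF fin, of a] unfolding H_def by blast
  define r where "r = min (d / 2) (\<eta> / 2)"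
  have r: "0 < r" "r < d" "r < \<eta>" using d(1) \<eta> by (auto simp: r_def)
  have clH: "closed H" unfolding H_def by (intro closed_Collect_eq continuous_intros)
  have "\<exists>\<mu>>0. \<forall>x\<in>sphere a r \<inter> H. \<mu> \<le> peval P x"
  proof (cases "sphere a r \<inter> H = {}")
    case False
    have "compact (sphere a r \<inter> H)" using clH by (intro compact_Int_closed) auto
    then obtain x where x: "x \<in> sphere a r \<inter> H" "\<forall>y\<in>sphere a r \<inter> H. peval P x \<le> peval P y"
      using continuous_attains_inf[OF _ False, of "peval P"] continuous_on_peval[OF continuous_on_id] by blast
    have "peval P x \<noteq> 0" using d(2)[of x] x(1) r by auto
    then show ?thesis using nonneg[of x] x(2) by (intro exI[of _ "peval P x"]) auto
  qed (auto intro: exI[of _ 1])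
  then obtain \<mu> where \<mu>: "\<mu> > 0" "\<And>x. x \<in> sphere a r \<inter> H \<Longrightarrow> \<mu> \<le> peval P x" by blast
  \<comment> \<open>Ensures \<open>\<delta> * Q a < \<mu>\<close>; the added 1 covers
    \<open>Q a = 0\<close>.\<close>
  define \<delta>0 where "\<delta>0 = \<mu> / (Q a + 1)"
  have "\<exists>x. norm (x - a) < \<eta> \<and> (x, inverse \<delta>) \<in> crit i0 e P" if \<delta>: "0 < \<delta>" "\<delta> < \<delta>0" for \<delta>
  proof -
    define F where "F x = peval P x + \<delta> * Q x" for x
    have contF: "continuous_on S F" for S unfolding F_def Q_def by (intro continuous_intros) auto
    have "compact (cball a r \<inter> H)" using clH by (intro compact_Int_closed) auto
    moreover have "a \<in> cball a r \<inter> H" using r by (simp add: H_def)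
    ultimately obtain x where x: "x \<in> cball a r \<inter> H" and xmin: "\<And>y. y \<in> cball a r \<inter> H \<Longrightarrow> F x \<le> F y"
      using continuous_attains_inf[OF _ _ contF, of "cball a r \<inter> H"] by blast
    have "\<delta> * (Q a + 1) < \<mu>" using \<delta>(2) Q0[of a] by (simp add: \<delta>0_def pos_less_divide_eq add_nonneg_pos)
    then have "\<delta> * Q a < \<mu>" using \<delta>(1) by (simp add: distrib_left)
    have "x \<notin> sphere a r"
    proof
      assume "x \<in> sphere a r"
      then have "\<mu> \<le> peval P x" using \<mu>(2) x by auto
      also have "\<dots> \<le> F x" using Q0[of x] \<delta>(1) by (simp add: F_def)
      also have "\<dots> \<le> F a" using xmin[of a] r by (simp add: H_def)
      also have "\<dots> = \<delta> * Q a" by (simp add: F_def a)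
      finally show False using \<open>\<delta> * Q a < \<mu>\<close> by simp
    qed
    with x have near: "dist a x < r" by auto
    have "(x $ i) ^ e = - inverse \<delta> * peval (pd i P) x" if i: "i \<noteq> i0" for i
    proof -
      have "((\<lambda>t. Q (x + t *\<^sub>R axis i 1)) has_real_derivative
          (\<Sum>k\<in>UNIV - {i0}. if k = i then (x $ i) ^ e else 0)) (at 0)"
        unfolding Q_def
      proof (rule DERIV_sum)
        fix k
        show "((\<lambda>t. (x + t *\<^sub>R axis i 1) $ k ^ Suc e / Suc e) has_real_derivative (if k = i then (x $ i) ^ e else 0)) (at 0)"
        proof (cases "k = i")
          case True
          have "((\<lambda>t. (x $ i + t) ^ Suc e / Suc e) has_real_derivative (Suc e * (x $ i + 0) ^ e * 1) / Suc e) (at 0)"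
            by (intro derivative_eq_intros) auto
          then show ?thesis using True by (simp add: axis_def del: power_Suc)
        qed (simp add: axis_def)
      qed
      then have dQ: "((\<lambda>t. Q (x + t *\<^sub>R axis i 1)) has_real_derivative (x $ i) ^ e) (at 0)"
        using i by simp
      have dF: "((\<lambda>t. F (x + t *\<^sub>R axis i 1)) has_real_derivative (peval (pd i P) x + \<delta> * (x $ i) ^ e)) (at 0)"
        unfolding F_def by (intro DERIV_add DERIV_cmult has_derivative_pd dQ)
      have "peval (pd i P) x + \<delta> * (x $ i) ^ e = 0"
      proof (rule DERIV_local_min[OF dF, of "r - dist a x"])
        show "0 < r - dist a x" using near by simp
        show "\<forall>t. \<bar>0 - t\<bar> < r - dist a x \<longrightarrow> F (x + 0 *\<^sub>R axis i 1) \<le> F (x + t *\<^sub>R axis i 1)"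
        proof (intro allI impI)
          fix t :: real assume t: "\<bar>0 - t\<bar> < r - dist a x"
          have "dist a (x + t *\<^sub>R axis i 1) \<le> dist a x + dist x (x + t *\<^sub>R axis i 1)" by (rule dist_triangle)
          also have "dist x (x + t *\<^sub>R axis i 1) = \<bar>t\<bar>" by (simp add: dist_norm norm_axis_1)
          finally have "x + t *\<^sub>R axis i 1 \<in> cball a r \<inter> H" using t x i by (simp add: H_def axis_def)
          from xmin[OF this] show "F (x + 0 *\<^sub>R axis i 1) \<le> F (x + t *\<^sub>R axis i 1)" by simp
        qed
      qed
      then show ?thesis using \<delta>(1) by (simp add: field_simps)
    qed
    moreover have "norm (x - a) < \<eta>" using near r by (simp add: dist_norm norm_minus_commute)
    ultimately show ?thesis by (intro exI[of _ x]) (simp add: crit_def)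
  qed
  moreover have "0 < \<delta>0" using \<mu>(1) Q0[of a] by (simp add: \<delta>0_def add_nonneg_pos)
  ultimately show ?thesis by blast
qed

section \<open>Reduction to standard monomials on the critical set\<close>

context
  fixes i0 :: "'n::finite" and e :: nat and P :: "(real, 'n) mpolynomial"
  assumes e: "0 < e" "total_deg P \<le> e"
begin

text \<open>Exponents of the monomials that survive reduction by the rules for
  \<open>(x $ i) ^ e\<close>. The coordinate \<open>i0\<close> is kept apart, because it is treated
  as a coefficient variable, as is \<open>h\<close>.\<close>

definition box :: "('n \<Rightarrow>\<^sub>0 nat) set" where
  "box = {m. Poly_Mapping.lookup m i0 = 0 \<and> (\<forall>i. i \<noteq> i0 \<longrightarrow> Poly_Mapping.lookup m i < e)}"

definition bas :: "nat \<times> nat \<times> ('n \<Rightarrow>\<^sub>0 nat) \<Rightarrow> (real ^ 'n) \<Rightarrow> real \<Rightarrow> real" where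
  "bas k x h = (case k of (i, b, m) \<Rightarrow> (x $ i0) ^ i * h ^ b * monom_val m x)"

definition idx :: "nat \<Rightarrow> (nat \<times> nat \<times> ('n \<Rightarrow>\<^sub>0 nat)) set" where
  "idx d = {..d} \<times> {..d} \<times> box"

text \<open>Membership in the span of the basis of level \<open>d\<close>, as functions on
  \<open>crit\<close>. The single bound \<open>d\<close> limits the powers of both
  \<open>x $ i0\<close> and \<open>h\<close>, so the span has dimension at most
  \<open>(d + 1) ^ 2 * card box\<close>.\<close>

definition red :: "nat \<Rightarrow> ((real ^ 'n) \<Rightarrow> real \<Rightarrow> real) \<Rightarrow> bool" where
  "red d F \<longleftrightarrow> (\<exists>\<kappa>. \<forall>x h. (x, h) \<in> crit i0 e P \<longrightarrow> F x h = (\<Sum>k\<in>idx d. \<kappa> k * bas k x h))"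

lemma finite_box: "finite box"
proof (rule finite_imageD)
  have "Poly_Mapping.lookup ` box \<subseteq> PiE UNIV (\<lambda>_. {..e})"
    using e by (auto simp: box_def) (metis le0 less_imp_le)
  then show "finite (Poly_Mapping.lookup ` box)" by (rule finite_subset) (auto intro: finite_PiE)
  show "inj_on Poly_Mapping.lookup box" by (auto intro!: inj_onI simp: poly_mapping.lookup_inject)
qed

lemma finite_idx: "finite (idx d)"
  unfolding idx_def using finite_box by auto

lemma redI: "(\<And>x h. (x, h) \<in> crit i0 e P \<Longrightarrow> F x h = (\<Sum>k\<in>idx d. \<kappa> k * bas k x h)) \<Longrightarrow> red d F"
  unfolding red_def by blast

lemma redE:
  assumes "red d F"
  obtains \<kappa> where "\<And>x h. (x, h) \<in> crit i0 e P \<Longrightarrow> F x h = (\<Sum>k\<in>idx d. \<kappa> k * bas k x h)"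
  using assms unfolding red_def by blast

lemma red_cong: "red d F \<Longrightarrow> (\<And>x h. (x, h) \<in> crit i0 e P \<Longrightarrow> G x h = F x h) \<Longrightarrow> red d G"
  unfolding red_def by simp

lemma red_mono:
  assumes "red d F" "d \<le> d'"
  shows "red d' F"
proof -
  obtain \<kappa> where \<kappa>: "\<And>x h. (x, h) \<in> crit i0 e P \<Longrightarrow> F x h = (\<Sum>k\<in>idx d. \<kappa> k * bas k x h)"
    by (rule redE[OF assms(1)]) (rule that)
  show ?thesis
  proof (rule redI[where \<kappa> = "\<lambda>k. if k \<in> idx d then \<kappa> k else 0"])
    fix x h assume "(x, h) \<in> crit i0 e P"
    from \<kappa>[OF this] show "F x h = (\<Sum>k\<in>idx d'. (if k \<in> idx d then \<kappa> k else 0) * bas k x h)"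
    proof (simp only:, intro sum.mono_neutral_cong_left finite_idx)
      show "idx d \<subseteq> idx d'" using assms(2) by (auto simp: idx_def)
    qed auto
  qed
qed

lemma red_add:
  assumes "red d F" "red d G"
  shows "red d (\<lambda>x h. F x h + G x h)"
proof -
  obtain \<kappa> where \<kappa>: "\<And>x h. (x, h) \<in> crit i0 e P \<Longrightarrow> F x h = (\<Sum>k\<in>idx d. \<kappa> k * bas k x h)"
    by (rule redE[OF assms(1)]) (rule that)
  obtain \<mu> where \<mu>: "\<And>x h. (x, h) \<in> crit i0 e P \<Longrightarrow> G x h = (\<Sum>k\<in>idx d. \<mu> k * bas k x h)"
    by (rule redE[OF assms(2)]) (rule that)
  show ?thesis
    by (rule redI[where \<kappa> = "\<lambda>k. \<kappa> k + \<mu> k"]) (simp add: \<kappa> \<mu> sum.distrib distrib_right)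
qed

lemma red_scale:
  assumes "red d F"
  shows "red d (\<lambda>x h. c * F x h)"
proof -
  obtain \<kappa> where \<kappa>: "\<And>x h. (x, h) \<in> crit i0 e P \<Longrightarrow> F x h = (\<Sum>k\<in>idx d. \<kappa> k * bas k x h)"
    by (rule redE[OF assms(1)]) (rule that)
  show ?thesis
    by (rule redI[where \<kappa> = "\<lambda>k. c * \<kappa> k"]) (simp add: \<kappa> sum_distrib_left mult.assoc)
qed

lemma red_zero: "red d (\<lambda>x h. 0)"
  by (rule redI[where \<kappa> = "\<lambda>_. 0"]) simp

lemma red_sum: "(\<And>i. i \<in> I \<Longrightarrow> red d (F i)) \<Longrightarrow> red d (\<lambda>x h. \<Sum>i\<in>I. F i x h)"
  by (induction I rule: infinite_finite_induct) (auto intro: red_zero red_add)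

lemma red_bas: "k \<in> idx d \<Longrightarrow> red d (bas k)"
proof (rule redI[where \<kappa> = "\<lambda>l. if l = k then 1 else 0"])
  fix x h assume k: "k \<in> idx d"
  have "(\<Sum>l\<in>idx d. (if l = k then 1 else 0) * bas l x h) = (\<Sum>l\<in>idx d. if l = k then bas l x h else 0)"
    by (rule sum.cong) auto
  then show "bas k x h = (\<Sum>l\<in>idx d. (if l = k then 1 else 0) * bas l x h)"
    using k by (simp add: sum.delta[OF finite_idx])
qed

lemma red_mult_coord:
  assumes "red d F"
  shows "red (Suc d) (\<lambda>x h. (x $ i0) * F x h)" "red (Suc d) (\<lambda>x h. h * F x h)"
proof -
  obtain \<kappa> where \<kappa>: "\<And>x h. (x, h) \<in> crit i0 e P \<Longrightarrow> F x h = (\<Sum>k\<in>idx d. \<kappa> k * bas k x h)"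
    by (rule redE[OF assms(1)]) (rule that)
  have 1: "red (Suc d) (\<lambda>x h. \<Sum>k\<in>idx d. \<kappa> k * bas (Suc (fst k), snd k) x h)"
    by (intro red_sum red_scale red_bas) (auto simp: idx_def)
  have 2: "red (Suc d) (\<lambda>x h. \<Sum>k\<in>idx d. \<kappa> k * bas (fst k, Suc (fst (snd k)), snd (snd k)) x h)"
    by (intro red_sum red_scale red_bas) (auto simp: idx_def)
  have 3: "bas (Suc (fst k), snd k) x h = x $ i0 * bas k x h"
    "bas (fst k, Suc (fst (snd k)), snd (snd k)) x h = h * bas k x h" for k x h
    by (auto simp: bas_def split: prod.splits)
  show "red (Suc d) (\<lambda>x h. (x $ i0) * F x h)"
    by (rule red_cong[OF 1]) (simp add: \<kappa> 3 sum_distrib_left mult.left_commute)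
  show "red (Suc d) (\<lambda>x h. h * F x h)"
    by (rule red_cong[OF 2]) (simp add: \<kappa> 3 sum_distrib_left mult.left_commute)
qed

lemma red_mult_powers:
  assumes "red d F"
  shows "red (d + i + b) (\<lambda>x h. (x $ i0) ^ i * h ^ b * F x h)"
proof -
  have 1: "red (d + b) (\<lambda>x h. h ^ b * F x h)"
  proof (induction b)
    case (Suc b)
    from red_mult_coord(2)[OF Suc] show ?case by (simp add: mult.assoc)
  qed (use assms in simp)
  have "red (d + b + i) (\<lambda>x h. (x $ i0) ^ i * (h ^ b * F x h))"
  proof (induction i)
    case (Suc i)
    from red_mult_coord(1)[OF Suc] show ?case by (simp add: mult.assoc)
  qed (use 1 in simp)
  then show ?thesis by (simp add: mult.assoc add_ac)
qed

text \<open>Replacing \<open>(x $ j) ^ e\<close> by \<open>- h * peval (pd j P) x\<close> lowers the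
  degree in \<open>x\<close> by at least one, since the derivative has degree below
  \<open>e\<close>, and introduces one factor \<open>h\<close>. So the powers of \<open>h\<close>
  never outgrow the degree that has been spent.\<close>

lemma red_monom:
  "(\<Sum>i\<in>UNIV. Poly_Mapping.lookup m i) \<le> d \<Longrightarrow> red d (\<lambda>x h. monom_val m x)"
proof (induction d arbitrary: m rule: less_induct)
  case (less d)
  show ?case
  proof (cases "\<exists>j. j \<noteq> i0 \<and> e \<le> Poly_Mapping.lookup m j")
    case True
    then obtain j where j: "j \<noteq> i0" "e \<le> Poly_Mapping.lookup m j" by blast
    define m' where "m' = m - Poly_Mapping.single j e"
    have m: "m = Poly_Mapping.single j e + m'"
      using j by (intro poly_mapping_eqI) (auto simp: m'_def lookup_add lookup_minus lookup_single when_def)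
    have sm: "(\<Sum>i\<in>UNIV. Poly_Mapping.lookup m i) = e + (\<Sum>i\<in>UNIV. Poly_Mapping.lookup m' i)"
      by (subst m) (simp add: lookup_add sum.distrib lookup_single when_def)
    obtain e' where e': "e = Suc e'" using e by (metis gr0_implies_Suc)
    obtain d' where d': "d = Suc d'" using sm less.prems e by (metis add_is_0 gr0_implies_Suc le_zero_eq neq0_conv)
    have deg: "total_deg (pd j P) \<le> e'" using e(2) unfolding e' by (rule total_deg_pd)
    have "red d' (\<lambda>x h. monom_val (\<gamma> + m') x)" if "\<gamma> \<in> Poly_Mapping.keys (pd j P)" for \<gamma>
    proof (rule less.IH)
      show "d' < d" using d' by simp
      have "(\<Sum>i\<in>UNIV. Poly_Mapping.lookup \<gamma> i) \<le> e'" using deg that by (auto simp: total_deg_le_iff)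
      then show "(\<Sum>i\<in>UNIV. Poly_Mapping.lookup (\<gamma> + m') i) \<le> d'"
        using sm less.prems e' d' by (simp add: lookup_add sum.distrib)
    qed
    then have "red d' (\<lambda>x h. \<Sum>\<gamma>\<in>Poly_Mapping.keys (pd j P). (- Poly_Mapping.lookup (pd j P) \<gamma>) * monom_val (\<gamma> + m') x)"
      by (intro red_sum red_scale)
    from red_mult_coord(2)[OF this] show ?thesis unfolding d'
    proof (rule red_cong)
      fix x h assume "(x, h) \<in> crit i0 e P"
      then have c: "(x $ j) ^ e = - h * peval (pd j P) x" using j by (simp add: crit_def)
      have "monom_val m x = - h * peval (pd j P) x * monom_val m' x"
        by (subst m) (simp add: monom_val_add monom_val_single c)
      also have "\<dots> = h * (\<Sum>\<gamma>\<in>Poly_Mapping.keys (pd j P). (- Poly_Mapping.lookup (pd j P) \<gamma>) * monom_val (\<gamma> + m') x)"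
        by (simp add: peval_superset[of "Poly_Mapping.keys (pd j P)"] monom_val_add sum_distrib_left sum_distrib_right sum_negf mult_ac)
      finally show "monom_val m x = h * (\<Sum>\<gamma>\<in>Poly_Mapping.keys (pd j P). (- Poly_Mapping.lookup (pd j P) \<gamma>) * monom_val (\<gamma> + m') x)" .
    qed
  next
    case False
    define m' where "m' = m - Poly_Mapping.single i0 (Poly_Mapping.lookup m i0)"
    have m: "m = Poly_Mapping.single i0 (Poly_Mapping.lookup m i0) + m'"
      by (intro poly_mapping_eqI) (auto simp: m'_def lookup_add lookup_minus lookup_single when_def)
    have "Poly_Mapping.lookup m i0 \<le> (\<Sum>i\<in>UNIV. Poly_Mapping.lookup m i)" by (rule member_le_sum) auto
    moreover have "m' \<in> box" using False by (auto simp: box_def m'_def lookup_minus lookup_single when_def not_le)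
    ultimately have "red d (bas (Poly_Mapping.lookup m i0, 0, m'))"
      using less.prems by (intro red_bas) (auto simp: idx_def)
    then show ?thesis
    proof (rule red_cong)
      fix x :: "real ^ 'n" and h :: real
      have "monom_val m x = (x $ i0) ^ Poly_Mapping.lookup m i0 * monom_val m' x"
        by (subst m) (simp only: monom_val_add monom_val_single)
      then show "monom_val m x = bas (Poly_Mapping.lookup m i0, 0, m') x h" by (simp add: bas_def)
    qed
  qed
qed

lemma red_peval:
  assumes "total_deg p \<le> d"
  shows "red d (\<lambda>x h. peval p x)"
proof -
  have "red d (\<lambda>x h. \<Sum>m\<in>Poly_Mapping.keys p. Poly_Mapping.lookup p m * monom_val m x)"
    using assms by (intro red_sum red_scale red_monom) (auto simp: total_deg_le_iff)
  then show ?thesis by (simp add: peval_superset[of "Poly_Mapping.keys p" p])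
qed

text \<open>Counting dimensions. The \<open>(J * d + 1) ^ 2 * (J + 1)\<close> products all lie in
  the span of level \<open>3 * (J * d)\<close>, because the exponents \<open>i\<close>,
  \<open>b\<close> and the degree of \<open>p ^ j\<close> each contribute at most
  \<open>J * d\<close>. That span has dimension at most
  \<open>9 * card box * (J * d + 1) ^ 2\<close>, and \<open>J = 9 * card box\<close> makes it too
  small for independence.\<close>

lemma crit_relation:
  assumes p: "total_deg p \<le> d"
  defines "J \<equiv> 9 * card box"
  shows "\<exists>l :: nat \<times> nat \<times> nat \<Rightarrow> real. (\<exists>k\<in>{..J * d} \<times> {..J * d} \<times> {..J}. l k \<noteq> 0) \<and>
    (\<forall>x h. (x, h) \<in> crit i0 e P \<longrightarrow>
       (\<Sum>(i, b, j)\<in>{..J * d} \<times> {..J * d} \<times> {..J}. l (i, b, j) * ((x $ i0) ^ i * h ^ b * peval p x ^ j)) = 0)"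
proof -
  define X where "X = {..J * d} \<times> {..J * d} \<times> {..J}"
  have "red (3 * (J * d)) (\<lambda>x h. (x $ i0) ^ i * h ^ b * peval p x ^ j)" if "(i, b, j) \<in> X" for i b j
  proof -
    have ppow: "peval (p ^ j) x = peval p x ^ j" for x
    proof (induction j)
      case 0
      have "peval (1 :: (real, 'n) mpolynomial) x = 1" using peval_single[of 0 "1::real" x] by simp
      then show ?case by simp
    qed (simp add: peval_mult)
    have "red (j * d + i + b) (\<lambda>x h. (x $ i0) ^ i * h ^ b * peval (p ^ j) x)"
      by (intro red_mult_powers red_peval total_deg_power_le p)
    moreover have "j \<le> J" "i \<le> J * d" "b \<le> J * d" using that by (auto simp: X_def)
    then have "j * d + i + b \<le> 3 * (J * d)" using mult_le_mono1[of j J d] by linarith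
    ultimately show ?thesis unfolding ppow by (rule red_mono)
  qed
  then have "\<forall>k\<in>X. \<exists>\<kappa>. \<forall>x h. (x, h) \<in> crit i0 e P \<longrightarrow>
      (case k of (i, b, j) \<Rightarrow> (x $ i0) ^ i * h ^ b * peval p x ^ j) = (\<Sum>y\<in>idx (3 * (J * d)). \<kappa> y * bas y x h)"
    unfolding red_def by auto
  then obtain \<kappa> where \<kappa>0: "\<forall>k\<in>X. \<forall>x h. (x, h) \<in> crit i0 e P \<longrightarrow>
      (case k of (i, b, j) \<Rightarrow> (x $ i0) ^ i * h ^ b * peval p x ^ j) = (\<Sum>y\<in>idx (3 * (J * d)). \<kappa> k y * bas y x h)"
    by (rule bchoice[THEN exE])
  note \<kappa> = \<kappa>0[rule_format]
  have "0 \<in> box" using e by (simp add: box_def)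
  then have cb: "0 < card box" using finite_box by (auto simp: card_gt_0_iff)
  have "card (idx (3 * (J * d))) = (3 * (J * d) + 1)\<^sup>2 * card box"
    unfolding idx_def card_cartesian_product card_atMost power2_eq_square
    by (simp only: Suc_eq_plus1 mult.assoc)
  also have "\<dots> \<le> (3 * (J * d + 1))\<^sup>2 * card box" by (intro mult_right_mono power_mono) auto
  also have "\<dots> = (J * d + 1)\<^sup>2 * (9 * card box)" unfolding power_mult_distrib by simp
  also have "9 * card box = J" by (simp add: J_def)
  also have "(J * d + 1)\<^sup>2 * J < (J * d + 1)\<^sup>2 * (J + 1)"
    by (intro mult_strict_left_mono) auto
  also have "\<dots> = card X"
    unfolding X_def card_cartesian_product card_atMost power2_eq_square
    by (simp only: Suc_eq_plus1 mult.assoc)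
  finally have "card (idx (3 * (J * d))) < card X" .
  then obtain l where l: "\<exists>k\<in>X. l k \<noteq> 0" "\<forall>y\<in>idx (3 * (J * d)). (\<Sum>k\<in>X. l k * \<kappa> k y) = 0"
    using exists_nontrivial_relation[OF finite_idx, of X "3 * (J * d)" \<kappa>] by (auto simp: X_def)
  have "(\<Sum>(i, b, j)\<in>X. l (i, b, j) * ((x $ i0) ^ i * h ^ b * peval p x ^ j)) = 0" if xh: "(x, h) \<in> crit i0 e P" for x h
  proof -
    have "(\<Sum>(i, b, j)\<in>X. l (i, b, j) * ((x $ i0) ^ i * h ^ b * peval p x ^ j))
        = (\<Sum>k\<in>X. l k * (\<Sum>y\<in>idx (3 * (J * d)). \<kappa> k y * bas y x h))"
    proof (rule sum.cong[OF refl])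
      fix k assume "k \<in> X"
      from \<kappa>[OF this xh] show "(case k of (i, b, j) \<Rightarrow> l (i, b, j) * ((x $ i0) ^ i * h ^ b * peval p x ^ j)) =
          l k * (\<Sum>y\<in>idx (3 * (J * d)). \<kappa> k y * bas y x h)" by (cases k) auto
    qed
    also have "\<dots> = (\<Sum>k\<in>X. \<Sum>y\<in>idx (3 * (J * d)). l k * \<kappa> k y * bas y x h)"
      by (simp add: sum_distrib_left mult.assoc)
    also have "\<dots> = (\<Sum>y\<in>idx (3 * (J * d)). \<Sum>k\<in>X. l k * \<kappa> k y * bas y x h)" by (rule sum.swap)
    also have "\<dots> = (\<Sum>y\<in>idx (3 * (J * d)). (\<Sum>k\<in>X. l k * \<kappa> k y) * bas y x h)"
      by (simp add: sum_distrib_right)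
    also have "\<dots> = 0" using l(2) by simp
    finally show ?thesis .
  qed
  then show ?thesis unfolding X_def[symmetric] by (intro exI[of _ l] conjI l(1) allI impI)
qed

end

text \<open>The relation on \<open>crit\<close> is divided by the highest power of \<open>h\<close>
  that occurs in it. Each zero of \<open>P\<close> is a limit of critical points with
  \<open>h\<close> tending to infinity, so in the limit only the coefficient of that power remains;
  it is a relation in \<open>x $ i0\<close> and \<open>p\<close> alone, and it is not
  trivial.\<close>

lemma elimination:
  fixes P :: "(real, 'n::finite) mpolynomial"
  assumes nonneg: "\<And>x. 0 \<le> peval P x" and fin: "\<And>c. finite {x. peval P x = 0 \<and> x $ i0 = c}"
  obtains J where "\<And>p d. total_deg p \<le> d \<Longrightarrow> \<exists>q :: nat \<Rightarrow> real poly. (\<exists>j\<le>J. q j \<noteq> 0) \<and>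
      (\<forall>j\<le>J. degree (q j) \<le> J * d) \<and>
      (\<forall>a. peval P a = 0 \<longrightarrow> (\<Sum>j\<le>J. poly (q j) (a $ i0) * peval p a ^ j) = 0)"
proof -
  \<comment> \<open>Odd, positive and at least the degree of \<open>P\<close>, as the minimisation
    and the reduction require.\<close>
  define e where "e = 2 * total_deg P + 1"
  have e: "0 < e" "total_deg P \<le> e" "odd e" by (auto simp: e_def)
  define J where "J = 9 * card (box i0 e)"
  have "\<exists>q :: nat \<Rightarrow> real poly. (\<exists>j\<le>J. q j \<noteq> 0) \<and> (\<forall>j\<le>J. degree (q j) \<le> J * d) \<and>
      (\<forall>a. peval P a = 0 \<longrightarrow> (\<Sum>j\<le>J. poly (q j) (a $ i0) * peval p a ^ j) = 0)"
    if p: "total_deg p \<le> d" for p d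
  proof -
    define D where "D = J * d"
    obtain l :: "nat \<times> nat \<times> nat \<Rightarrow> real" where l: "\<exists>k\<in>{..D} \<times> {..D} \<times> {..J}. l k \<noteq> 0"
      and rel0: "\<forall>x h. (x, h) \<in> crit i0 e P \<longrightarrow>
       (\<Sum>(i, b, j)\<in>{..D} \<times> {..D} \<times> {..J}. l (i, b, j) * ((x $ i0) ^ i * h ^ b * peval p x ^ j)) = 0"
      using crit_relation[OF e(1,2) p, of i0] unfolding D_def J_def by (elim exE conjE)
    note rel = rel0[rule_format]
    define Q where "Q b x = (\<Sum>i\<le>D. \<Sum>j\<le>J. l (i, b, j) * ((x $ i0) ^ i * peval p x ^ j))" for b x
    \<comment> \<open>The powers of \<open>h\<close> whose coefficient is not formally zero;
      \<open>B\<close> is the greatest of them, and \<open>Q b\<close> is the coefficient of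
      \<open>h ^ b\<close>.\<close>
    define Bs where "Bs = {b. b \<le> D \<and> (\<exists>i\<le>D. \<exists>j\<le>J. l (i, b, j) \<noteq> 0)}"
    have Bs: "finite Bs" "Bs \<noteq> {}" using l by (auto simp: Bs_def)
    define B where "B = Max Bs"
    have "B \<in> Bs" unfolding B_def by (rule Max_in[OF Bs])
    have above: "l (i, b, j) = 0" if "B < b" "b \<le> D" "i \<le> D" "j \<le> J" for i b j
    proof (rule ccontr)
      assume "l (i, b, j) \<noteq> 0"
      then have "b \<in> Bs" using that by (auto simp: Bs_def)
      then show False using that(1) Bs(1) by (simp add: B_def) (metis Max_ge not_le)
    qed
    have BD: "B \<le> D" using \<open>B \<in> Bs\<close> by (simp add: Bs_def)
    have rel': "(\<Sum>b\<le>B. \<delta> ^ (B - b) * Q b x) = 0" if xh: "(x, inverse \<delta>) \<in> crit i0 e P" and \<delta>: "0 < \<delta>" for x \<delta>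
    proof -
      have "0 = (\<Sum>i\<le>D. \<Sum>b\<le>D. \<Sum>j\<le>J. l (i, b, j) * ((x $ i0) ^ i * inverse \<delta> ^ b * peval p x ^ j))"
        using rel[OF xh] by (simp add: sum.cartesian_product)
      also have "\<dots> = (\<Sum>b\<le>D. \<Sum>i\<le>D. \<Sum>j\<le>J. l (i, b, j) * ((x $ i0) ^ i * inverse \<delta> ^ b * peval p x ^ j))"
        by (rule sum.swap)
      also have "\<dots> = (\<Sum>b\<le>D. inverse \<delta> ^ b * Q b x)"
        by (simp add: Q_def sum_distrib_left mult_ac)
      also have "\<dots> = (\<Sum>b\<le>B. inverse \<delta> ^ b * Q b x)"
      proof (rule sum.mono_neutral_right)
        show "\<forall>b\<in>{..D} - {..B}. inverse \<delta> ^ b * Q b x = 0" using above by (auto simp: Q_def)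
      qed (use BD in auto)
      finally have "0 = \<delta> ^ B * (\<Sum>b\<le>B. inverse \<delta> ^ b * Q b x)" by simp
      also have "\<dots> = (\<Sum>b\<le>B. \<delta> ^ (B - b) * Q b x)"
        unfolding sum_distrib_left
      proof (rule sum.cong[OF refl])
        fix b assume "b \<in> {..B}"
        then have "\<delta> ^ B = \<delta> ^ (B - b) * \<delta> ^ b" by (simp add: power_add[symmetric])
        then show "\<delta> ^ B * (inverse \<delta> ^ b * Q b x) = \<delta> ^ (B - b) * Q b x"
          using \<delta> by (simp add: power_inverse)
      qed
      finally show ?thesis by simp
    qed
    have QB: "Q B a = 0" if a: "peval P a = 0" for a
    proof -
      have "\<exists>x \<delta>. norm (x - a) < inverse (Suc n) \<and> 0 < \<delta> \<and> \<delta> < inverse (Suc n) \<and> (x, inverse \<delta>) \<in> crit i0 e P" for n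
      proof -
        obtain \<delta>0 where \<delta>0: "\<delta>0 > 0" "\<forall>\<delta>. 0 < \<delta> \<and> \<delta> < \<delta>0 \<longrightarrow>
            (\<exists>x. norm (x - a) < inverse (Suc n) \<and> (x, inverse \<delta>) \<in> crit i0 e P)"
          using isolated_zero_near_crit[OF nonneg a fin e(3), of "inverse (Suc n)"] by auto
        define \<delta> where "\<delta> = min \<delta>0 (inverse (Suc n)) / 2"
        have "0 < \<delta>" "\<delta> < \<delta>0" "\<delta> < inverse (Suc n)" using \<delta>0(1) by (auto simp: \<delta>_def min_def field_simps)
        then show ?thesis using \<delta>0(2) by blast
      qed
      then obtain x \<delta> where x: "\<And>n. norm (x n - a) < inverse (Suc n)" and \<delta>: "\<And>n. 0 < \<delta> n" "\<And>n. \<delta> n < inverse (Suc n)"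
        and cr: "\<And>n. (x n, inverse (\<delta> n)) \<in> crit i0 e P" by metis
      have "(\<lambda>n. x n - a) \<longlonglongrightarrow> 0"
        by (rule Lim_null_comparison[OF _ LIMSEQ_inverse_real_of_nat])
          (use x in \<open>auto intro!: always_eventually less_imp_le\<close>)
      then have xl: "x \<longlonglongrightarrow> a" by (simp add: LIM_zero_iff)
      have "norm (\<delta> n) \<le> inverse (real (Suc n))" for n using \<delta>(1)[of n] \<delta>(2)[of n] by simp
      then have "\<delta> \<longlonglongrightarrow> 0"
        by (intro Lim_null_comparison[OF _ LIMSEQ_inverse_real_of_nat] always_eventually allI)
      have "isCont (Q b) a" for b
        unfolding Q_def using continuous_on_peval[OF continuous_on_id, of UNIV p]
        by (intro continuous_intros) (auto simp: continuous_on_eq_continuous_at)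
      then have "(\<lambda>n. Q b (x n)) \<longlonglongrightarrow> Q b a" for b using xl by (rule isCont_tendsto_compose)
      \<comment> \<open>With \<open>\<delta> = 1 / h\<close> tending to 0, each term with
        \<open>b < B\<close> carries a positive power of \<open>\<delta>\<close>; the limit of the
        term \<open>b = B\<close> is \<open>Q B a\<close> because \<open>0 ^ 0 = 1\<close>.\<close>
      then have "(\<lambda>n. \<Sum>b\<le>B. \<delta> n ^ (B - b) * Q b (x n)) \<longlonglongrightarrow> (\<Sum>b\<le>B. 0 ^ (B - b) * Q b a)"
        using \<open>\<delta> \<longlonglongrightarrow> 0\<close> by (intro tendsto_intros)
      moreover have "(\<Sum>b\<le>B. \<delta> n ^ (B - b) * Q b (x n)) = 0" for n by (rule rel'[OF cr \<delta>(1)])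
      ultimately have "(\<Sum>b\<le>B. 0 ^ (B - b) * Q b a) = 0" by (simp add: LIMSEQ_const_iff)
      moreover have "(\<Sum>b\<le>B. 0 ^ (B - b) * Q b a) = (\<Sum>b\<le>B. if b = B then Q b a else 0)"
        by (rule sum.cong) auto
      ultimately show ?thesis by simp
    qed
    define q where "q j = (\<Sum>i\<le>D. monom (l (i, B, j)) i)" for j
    have cq: "coeff (q j) i = l (i, B, j)" if "i \<le> D" for i j
      using that by (simp add: q_def coeff_sum coeff_monom)
    show ?thesis
    proof (intro exI[of _ q] conjI allI impI)
      obtain i j where ij: "i \<le> D" "j \<le> J" "l (i, B, j) \<noteq> 0" using \<open>B \<in> Bs\<close> by (auto simp: Bs_def)
      then have "q j \<noteq> 0" using cq[of i j] by auto
      with ij show "\<exists>j\<le>J. q j \<noteq> 0" by blast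
      show "degree (q j) \<le> J * d" for j
        unfolding q_def D_def[symmetric] by (intro degree_sum_le) (auto intro: order_trans[OF degree_monom_le])
      fix a assume a: "peval P a = 0"
      have "(\<Sum>j\<le>J. poly (q j) (a $ i0) * peval p a ^ j) = (\<Sum>j\<le>J. \<Sum>i\<le>D. l (i, B, j) * ((a $ i0) ^ i * peval p a ^ j))"
        by (simp add: q_def poly_sum poly_monom sum_distrib_right mult.assoc)
      also have "\<dots> = Q B a" unfolding Q_def by (rule sum.swap)
      finally show "(\<Sum>j\<le>J. poly (q j) (a $ i0) * peval p a ^ j) = 0" using QB[OF a] by simp
    qed
  qed
  then show ?thesis by (rule that)
qed

subsection \<open>Equations in two coordinates\<close>

lemma cvec_nth [simp]: "cvec x $ i = complex_of_real (x $ i)"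
  by (simp add: cvec_def)

lemma monom_val_cvec: "monom_val m (cvec x) = complex_of_real (monom_val m x)"
  by (simp add: monom_val_def)

text \<open>Zeros on \<open>A\<close> of complex polynomials reduce to zeros of two real ones, to
  which the real Zariski closure applies.\<close>

lemma polyfun_Re_Im_cvec:
  fixes f :: "complex ^ 'n::finite \<Rightarrow> complex"
  assumes "polyfun f"
  shows "polyfun (\<lambda>a. Re (f (cvec a)))" "polyfun (\<lambda>a. Im (f (cvec a)))"
proof -
  obtain p where p: "f = peval p" using assms by (auto simp: polyfun_def)
  have mono: "polyfun (\<lambda>a. monom_val m a)" for m :: "'n \<Rightarrow>\<^sub>0 nat"
    unfolding monom_val_def by (intro polyfun_prod polyfun_power polyfun_coord)
  have "f (cvec a) = (\<Sum>m\<in>Poly_Mapping.keys p. Poly_Mapping.lookup p m * of_real (monom_val m a))" for a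
    by (simp add: p peval_superset[of "Poly_Mapping.keys p" p] monom_val_cvec)
  then have "Re (f (cvec a)) = (\<Sum>m\<in>Poly_Mapping.keys p. Re (Poly_Mapping.lookup p m) * monom_val m a)"
    "Im (f (cvec a)) = (\<Sum>m\<in>Poly_Mapping.keys p. Im (Poly_Mapping.lookup p m) * monom_val m a)" for a
    by simp_all
  then show "polyfun (\<lambda>a. Re (f (cvec a)))" "polyfun (\<lambda>a. Im (f (cvec a)))"
    by (simp_all add: polyfun_sum polyfun_mult mono)
qed

text \<open>\<open>P\<close> is an equation of the Zariski closure of \<open>A\<close>; \<open>zar\<close> says that this closure is irreducible of
  dimension one.\<close>

locale curve_coord =
  fixes A :: "(real ^ 'n::finite) set" and i0 :: 'n and P :: "(real, 'n) mpolynomial" and a1 a2 :: "real ^ 'n"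
  assumes conn: "connected A" and AP: "A \<subseteq> zeros (peval P)" and nonneg: "0 \<le> peval P x"
    and zar: "polyfun f \<Longrightarrow> \<exists>a\<in>A. f a \<noteq> 0 \<Longrightarrow> finite (zeros (peval P) \<inter> zeros f)"
    and a12: "a1 \<in> A" "a2 \<in> A" "a1 $ i0 \<noteq> a2 $ i0"
begin

lemma infinite_coord: "infinite ((\<lambda>a. a $ i0) ` A)"
proof
  assume fin: "finite ((\<lambda>a. a $ i0) ` A)"
  have "connected ((\<lambda>a. a $ i0) ` A)"
    using conn by (intro connected_continuous_image continuous_intros)
  then have "(\<lambda>a. a $ i0) ` A = {} \<or> (\<exists>x. (\<lambda>a. a $ i0) ` A = {x})"
    using fin connected_finite_iff_sing by blast
  then show False using a12 by (metis empty_iff imageI singletonD)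
qed

lemma infinite_A: "infinite A"
  using infinite_coord by blast

lemma finite_fibre: "finite {x. peval P x = 0 \<and> x $ i0 = c}"
proof -
  have "\<exists>a\<in>A. a $ i0 - c \<noteq> 0" using a12 by (metis eq_iff_diff_eq_0)
  from zar[OF polyfun_diff[OF polyfun_coord polyfun_const] this]
  have "finite (zeros (peval P) \<inter> zeros (\<lambda>a. a $ i0 - c))" .
  then show ?thesis by (rule rev_finite_subset) (auto simp: zeros_def)
qed

lemma vanish_on_A:
  assumes "polyfun f" "infinite {a \<in> A. f a = 0}" "a \<in> A"
  shows "f a = 0"
proof (rule ccontr)
  assume "f a \<noteq> 0"
  then have "finite (zeros (peval P) \<inter> zeros f)" using zar assms by blast
  then have "finite {a \<in> A. f a = 0}" by (rule rev_finite_subset) (use AP in \<open>auto simp: zeros_def\<close>)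
  then show False using assms by blast
qed

lemma cvanish_on_A:
  fixes f :: "complex ^ 'n \<Rightarrow> complex"
  assumes f: "polyfun f" "infinite {a \<in> A. f (cvec a) = 0}" "a \<in> A"
  shows "f (cvec a) = 0"
proof -
  have "infinite {a \<in> A. Re (f (cvec a)) = 0}" "infinite {a \<in> A. Im (f (cvec a)) = 0}"
    using f(2) by (auto elim!: infinite_super[rotated])
  then show ?thesis using vanish_on_A[OF polyfun_Re_Im_cvec(1)[OF f(1)] _ f(3)]
      vanish_on_A[OF polyfun_Re_Im_cvec(2)[OF f(1)] _ f(3)] by (simp add: complex_eq_iff)
qed

text \<open>Complex coefficients are allowed from the outset, because the equation serves both for
  the real curve and for its complexification.\<close>

definition vanishing :: "'n \<Rightarrow> complex poly poly \<Rightarrow> bool" where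
  "vanishing j E \<longleftrightarrow> E \<noteq> 0 \<and> (\<forall>a\<in>A. biv E (of_real (a $ i0)) (of_real (a $ j)) = 0)"

lemma vanishingI:
  assumes "E \<noteq> 0" "infinite {a \<in> A. biv E (of_real (a $ i0)) (of_real (a $ j)) = 0}"
  shows "vanishing j E"
proof -
  have "polyfun (\<lambda>z :: complex ^ 'n. biv E (z $ i0) (z $ j))" by (intro polyfun_biv polyfun_coord)
  from cvanish_on_A[OF this] assms show ?thesis by (simp add: vanishing_def)
qed

lemma elimination_A:
  obtains J where "\<And>p d. total_deg p \<le> d \<Longrightarrow> \<exists>q :: nat \<Rightarrow> real poly. (\<exists>j\<le>J. q j \<noteq> 0) \<and>
      (\<forall>j\<le>J. degree (q j) \<le> J * d) \<and> (\<forall>a\<in>A. (\<Sum>j\<le>J. poly (q j) (a $ i0) * peval p a ^ j) = 0)"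
proof -
  obtain J where J: "\<And>p d. total_deg p \<le> d \<Longrightarrow> \<exists>q :: nat \<Rightarrow> real poly. (\<exists>j\<le>J. q j \<noteq> 0) \<and>
      (\<forall>j\<le>J. degree (q j) \<le> J * d) \<and> (\<forall>a. peval P a = 0 \<longrightarrow> (\<Sum>j\<le>J. poly (q j) (a $ i0) * peval p a ^ j) = 0)"
    by (rule elimination[OF nonneg finite_fibre]) (rule that)
  show ?thesis
  proof (rule that[of J])
    fix p :: "(real, 'n) mpolynomial" and d assume "total_deg p \<le> d"
    from J[OF this] AP show "\<exists>q :: nat \<Rightarrow> real poly. (\<exists>j\<le>J. q j \<noteq> 0) \<and>
      (\<forall>j\<le>J. degree (q j) \<le> J * d) \<and> (\<forall>a\<in>A. (\<Sum>j\<le>J. poly (q j) (a $ i0) * peval p a ^ j) = 0)"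
      by (auto simp: zeros_def subset_iff)
  qed
qed

text \<open>The elimination applied to the polynomial \<open>x $ j\<close>.\<close>

lemma vanishing_exists: "\<exists>E. vanishing j E"
proof -
  obtain p where p: "peval p = (\<lambda>x :: real ^ 'n. x $ j)" using polyfun_coord unfolding polyfun_def by metis
  obtain J :: nat and q :: "nat \<Rightarrow> real poly" where q: "\<exists>k\<le>J. q k \<noteq> 0" "\<forall>a\<in>A. (\<Sum>k\<le>J. poly (q k) (a $ i0) * peval p a ^ k) = 0"
    using elimination_A by (metis order_refl)
  define E where "E = (\<Sum>k\<le>J. monom (map_poly complex_of_real (q k)) k)"
  have cE: "coeff E k = map_poly of_real (q k)" if "k \<le> J" for k
    using that by (simp add: E_def coeff_sum)
  obtain k where "k \<le> J" "q k \<noteq> 0" using q by blast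
  then have "coeff E k \<noteq> 0" by (simp add: cE map_poly_eq_0_iff)
  then have "E \<noteq> 0" by auto
  have bm: "biv (monom c k) x y = poly c x * y ^ k" for c :: "complex poly" and k x y
    by (simp add: biv_altdef map_poly_monom poly_monom)
  have bs: "biv (\<Sum>k\<in>I. F k) x y = (\<Sum>k\<in>I. biv (F k) x y)" for I and F :: "nat \<Rightarrow> complex poly poly" and x y
    by (induction I rule: infinite_finite_induct) auto
  have pr: "poly (map_poly complex_of_real c) (of_real x) = of_real (poly c x)" for c x
    by (induction c) (auto simp: map_poly_pCons)
  have "biv E (of_real (a $ i0)) (of_real (a $ j)) = of_real (\<Sum>k\<le>J. poly (q k) (a $ i0) * peval p a ^ k)" for a
    by (simp add: E_def bs bm pr p)
  then have "vanishing j E" unfolding vanishing_def using \<open>E \<noteq> 0\<close> q(2) by (metis of_real_0)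
  then show ?thesis by blast
qed

text \<open>Two minimality conditions are imposed: first on the degree of \<open>E\<close> in
  \<open>y\<close>, then on the degree of its leading coefficient. The first makes \<open>E\<close>
  and its derivative coprime over the field of rational functions, and a Bezout identity yields a
  polynomial \<open>g\<close> in \<open>x\<close> outside whose zeros all roots are simple. The
  second excludes factors that depend on \<open>x\<close> only, so every fibre is finite.\<close>

lemma minimal_equation:
  obtains E D where "vanishing j E" "D \<noteq> 0" "0 < degree E"
    "\<And>x. poly D x \<noteq> 0 \<Longrightarrow> poly (lead_coeff E) x \<noteq> 0"
    "\<And>x y. poly D x \<noteq> 0 \<Longrightarrow> biv E x y = 0 \<Longrightarrow> biv (pderiv E) x y \<noteq> 0"
    "\<And>x. finite {y. biv E x y = 0} \<and> card {y. biv E x y = 0} \<le> degree E"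
proof -
  define K where "K = {E. vanishing j E}"
  obtain k where k: "\<exists>E\<in>K. degree E = k" "\<And>E. E \<in> K \<Longrightarrow> k \<le> degree E"
  proof -
    define k where "k = (LEAST k. \<exists>E\<in>K. degree E = k)"
    have "\<exists>k. \<exists>E\<in>K. degree E = k" using vanishing_exists[of j] by (auto simp: K_def)
    from LeastI_ex[OF this] have "\<exists>E\<in>K. degree E = k" unfolding k_def .
    moreover have "k \<le> degree E" if "E \<in> K" for E unfolding k_def by (rule Least_le) (use that in blast)
    ultimately show ?thesis by (rule that)
  qed
  obtain E where E: "E \<in> K" "degree E = k" and minE: "\<And>F. F \<in> K \<Longrightarrow> degree F = k \<Longrightarrow> degree (lead_coeff E) \<le> degree (lead_coeff F)"
    using ex_has_least_nat[of "\<lambda>E. E \<in> K \<and> degree E = k" _ "\<lambda>E. degree (lead_coeff E)"] k(1) by blast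
  have V: "vanishing j E" and E0: "E \<noteq> 0" using E(1) by (auto simp: K_def vanishing_def)
  have notV: "\<not> vanishing j F" if "degree F < k" for F
    using k(2)[of F] that by (auto simp: K_def)
  have prod: "vanishing j F \<or> vanishing j G" if FG: "F \<noteq> 0" "G \<noteq> 0" "\<forall>a\<in>A. biv (F * G) (of_real (a $ i0)) (of_real (a $ j)) = 0" for F G
  proof (rule ccontr)
    assume "\<not> ?thesis"
    then have "finite {a \<in> A. biv F (of_real (a $ i0)) (of_real (a $ j)) = 0}"
      "finite {a \<in> A. biv G (of_real (a $ i0)) (of_real (a $ j)) = 0}" using vanishingI FG by blast+
    then have "finite ({a \<in> A. biv F (of_real (a $ i0)) (of_real (a $ j)) = 0} \<union> {a \<in> A. biv G (of_real (a $ i0)) (of_real (a $ j)) = 0})"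
      by (rule finite_UnI)
    moreover have "A \<subseteq> {a \<in> A. biv F (of_real (a $ i0)) (of_real (a $ j)) = 0} \<union> {a \<in> A. biv G (of_real (a $ i0)) (of_real (a $ j)) = 0}"
      using FG(3) by auto
    ultimately show False using infinite_A finite_subset by blast
  qed
  have k1: "0 < k"
  proof (rule ccontr)
    assume "\<not> 0 < k"
    then obtain c where c: "E = [:c:]" using E(2) by (metis degree_eq_zeroE neq0_conv)
    have "poly c (of_real x) = 0" if "x \<in> (\<lambda>a. a $ i0) ` A" for x
      using V that by (auto simp: vanishing_def c)
    then have "complex_of_real ` (\<lambda>a. a $ i0) ` A \<subseteq> {x. poly c x = 0}" by auto
    moreover have "infinite (complex_of_real ` (\<lambda>a. a $ i0) ` A)"
      using infinite_coord by (subst finite_image_iff) (auto intro: injI inj_onI)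
    moreover have "c \<noteq> 0" using E0 c by auto
    ultimately show False using poly_roots_finite[of c] finite_subset by blast
  qed
  \<comment> \<open>If \<open>E\<close> vanished identically above some \<open>x\<close>, the factor
    belonging to \<open>x\<close> could be cancelled without losing the equation on
    \<open>A\<close>. The degree in \<open>y\<close> would stay the same, but the leading
    coefficient would have smaller degree.\<close>
  have nz: "map_poly (\<lambda>c. poly c x) E \<noteq> 0" for x
  proof
    assume z: "map_poly (\<lambda>c. poly c x) E = 0"
    have "poly (coeff E n) x = 0" for n
      using arg_cong[OF z, of "\<lambda>p. coeff p n"] by (simp add: coeff_map_poly)
    then have "[:[:- x, 1:]:] dvd E" by (simp add: const_poly_dvd_iff poly_eq_0_iff_dvd)
    then obtain F where F: "E = smult [:- x, 1:] F" by (auto elim!: dvdE simp: mult.commute)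
    have F0: "F \<noteq> 0" using F E0 by auto
    have "{a \<in> A. a $ i0 \<noteq> Re x} \<subseteq> {a \<in> A. biv F (of_real (a $ i0)) (of_real (a $ j)) = 0}"
    proof clarify
      fix a assume "a \<in> A" "a $ i0 \<noteq> Re x"
      then have "(of_real (a $ i0) - x) * biv F (of_real (a $ i0)) (of_real (a $ j)) = 0"
        using V by (simp add: vanishing_def F)
      moreover have "complex_of_real (a $ i0) \<noteq> x" using \<open>a $ i0 \<noteq> Re x\<close> by auto
      ultimately show "biv F (of_real (a $ i0)) (of_real (a $ j)) = 0" by simp
    qed
    moreover have "infinite {a \<in> A. a $ i0 \<noteq> Re x}"
    proof
      assume "finite {a \<in> A. a $ i0 \<noteq> Re x}"
      then have "finite (insert (Re x) ((\<lambda>a. a $ i0) ` {a \<in> A. a $ i0 \<noteq> Re x}))" by simp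
      then have "finite ((\<lambda>a. a $ i0) ` A)" by (rule rev_finite_subset) auto
      then show False using infinite_coord by blast
    qed
    ultimately have "vanishing j F" using F0 by (intro vanishingI) (auto dest: infinite_super)
    moreover have "degree F = k" using F E(2) by (simp add: F0)
    ultimately have "degree (lead_coeff E) \<le> degree (lead_coeff F)" by (intro minE) (auto simp: K_def)
    moreover have "lead_coeff E = [:- x, 1:] * lead_coeff F" unfolding F by (simp add: lead_coeff_smult)
    moreover have "degree ([:- x, 1:] * lead_coeff F) = degree [:- x, 1:] + degree (lead_coeff F)"
      using F0 by (intro degree_mult_eq) auto
    ultimately show False by simp
  qed
  have roots: "finite {y. biv E x y = 0} \<and> card {y. biv E x y = 0} \<le> degree E" for x
  proof -
    have "card {y. biv E x y = 0} \<le> degree (map_poly (\<lambda>c. poly c x) E)"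
      unfolding biv_altdef by (rule card_poly_roots_bound[OF nz])
    also have "\<dots> \<le> degree E" by (rule degree_le) (auto simp: coeff_map_poly coeff_eq_0)
    finally show ?thesis unfolding biv_altdef using poly_roots_finite[OF nz] by blast
  qed
  \<comment> \<open>The nonzero elements of the ideal generated by \<open>E\<close> and its
    derivative. One of least degree in \<open>y\<close> plays the part of a greatest common
    divisor.\<close>
  define I where "I = {G. G \<noteq> 0 \<and> (\<exists>u v. G = u * E + v * pderiv E)}"
  have "E = 1 * E + 0 * pderiv E" "pderiv E = 0 * E + 1 * pderiv E" by simp_all
  moreover have "pderiv E \<noteq> 0" using E(2) k1 by (auto simp: pderiv_eq_0_iff)
  ultimately have EI: "E \<in> I" "pderiv E \<in> I" unfolding I_def using E0 by blast+
  obtain G where G: "G \<in> I" and minG: "\<And>F. F \<in> I \<Longrightarrow> degree G \<le> degree F"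
    using ex_has_least_nat[of "\<lambda>G. G \<in> I" E degree] EI by blast
  have G0: "G \<noteq> 0" using G by (simp add: I_def)
  obtain u v where uv: "G = u * E + v * pderiv E" using G by (auto simp: I_def)
  have dG: "degree G < k" using minG[OF EI(2)] k1 E(2) by (simp add: degree_pderiv)
  \<comment> \<open>Pseudo-division of \<open>E\<close> by \<open>G\<close> leaves no remainder, as
    a remainder would be in \<open>I\<close> with smaller degree. So a multiple of \<open>E\<close>
    is the product of \<open>G\<close> and \<open>q\<close>; if \<open>G\<close> had positive
    degree, both would have smaller degree than \<open>E\<close>, and one of them would vanish on
    \<open>A\<close>.\<close>
  have "degree G = 0"
  proof (rule ccontr)
    assume dG0: "degree G \<noteq> 0"
    obtain q r where qr: "pseudo_divmod E G = (q, r)" by (cases "pseudo_divmod E G")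
    define c where "c = lead_coeff G ^ (Suc (degree E) - degree G)"
    have pd: "smult c E = G * q + r" "r = 0 \<or> degree r < degree G"
      using pseudo_divmod[OF G0 qr] by (auto simp: c_def)
    have "r = smult c E - G * q" using pd(1) by simp
    also have "\<dots> = (smult c 1 - u * q) * E + (- v * q) * pderiv E" by (simp add: uv algebra_simps)
    finally have "r \<noteq> 0 \<Longrightarrow> r \<in> I" unfolding I_def by blast
    then have r0: "r = 0" using pd(2) minG[of r] by (meson not_le)
    have c0: "c \<noteq> 0" using G0 by (simp add: c_def)
    have q0: "q \<noteq> 0" using pd(1) r0 c0 E0 by auto
    have "degree E = degree G + degree q" using pd(1) r0 c0 degree_mult_eq[OF G0 q0] by (metis add.right_neutral degree_smult_eq)
    then have "degree q < k" using dG0 E(2) by simp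
    moreover have "vanishing j G \<or> vanishing j q"
    proof (rule prod[OF G0 q0], rule ballI)
      fix a assume "a \<in> A"
      have "G * q = smult c E" using pd(1) r0 by simp
      then show "biv (G * q) (of_real (a $ i0)) (of_real (a $ j)) = 0"
        using V \<open>a \<in> A\<close> by (simp add: vanishing_def del: biv_simps(4))
    qed
    ultimately show False using notV dG by blast
  qed
  then obtain g where g: "G = [:g:]" by (metis degree_eq_zeroE)
  have g0: "g \<noteq> 0" using G0 g by auto
  have bez: "poly g x = biv u x y * biv E x y + biv v x y * biv (pderiv E) x y" for x y
  proof -
    have "biv G x y = biv (u * E + v * pderiv E) x y" using uv by simp
    then show ?thesis by (simp add: g)
  qed
  show ?thesis
  proof (rule that[of E "g * lead_coeff E"])
    show "g * lead_coeff E \<noteq> 0" using g0 E0 by simp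
    show "biv (pderiv E) x y \<noteq> 0" if "poly (g * lead_coeff E) x \<noteq> 0" "biv E x y = 0" for x y
      using bez[of x y] that by auto
  qed (use V roots k1 E(2) in auto)
qed

end

subsection \<open>Root functions over simply connected domains\<close>

text \<open>Divides the difference of two values by \<open>y - y'\<close> polynomially. As the
  quotient is continuous and equals the derivative on the diagonal, it takes the place of an
  implicit function theorem, both for separating roots and for differentiating them.\<close>

lemma poly_difference_quotient:
  fixes E :: "complex poly poly"
  obtains B where "continuous_on UNIV (\<lambda>(x, y, y'). B x y y')"
    "\<And>x y y'. biv E x y - biv E x y' = (y - y') * B x y y'" "\<And>x y. B x y y = biv (pderiv E) x y"
proof -
  have "\<exists>B. continuous_on UNIV (\<lambda>(x, y, y'). B x y y') \<and>
    (\<forall>x y y'. biv E x y - biv E x y' = (y - y') * B x y y') \<and> (\<forall>x y. B x y y = biv (pderiv E) x y)"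
  proof (induction E)
    case 0
    show ?case by (intro exI[of _ "\<lambda>x y y'. 0"]) (auto simp: case_prod_unfold)
  next
    case (pCons c E)
    then obtain B where B: "continuous_on UNIV (\<lambda>(x, y, y'). B x y y')"
      "\<And>x y y'. biv E x y - biv E x y' = (y - y') * B x y y'" "\<And>x y. B x y y = biv (pderiv E) x y" by blast
    have cont: "continuous_on UNIV (\<lambda>(x, y, y' :: complex). biv E x y)"
    proof (induction E)
      case (pCons c E)
      then show ?case by (auto simp: case_prod_unfold intro!: continuous_intros)
    qed (simp add: case_prod_unfold)
    show ?case
    proof (intro exI[of _ "\<lambda>x y y'. biv E x y + y' * B x y y'"] conjI allI)
      show "continuous_on UNIV (\<lambda>(x, y, y'). biv E x y + y' * B x y y')"
        using B(1) cont by (auto simp: case_prod_unfold intro!: continuous_intros)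
      show "biv (pCons c E) x y - biv (pCons c E) x y' = (y - y') * (biv E x y + y' * B x y y')" for x y y'
      proof -
        have "biv (pCons c E) x y - biv (pCons c E) x y' = (y - y') * biv E x y + y' * (biv E x y - biv E x y')"
          by (simp add: algebra_simps)
        then show ?thesis unfolding B(2) by (simp add: algebra_simps)
      qed
      show "biv E x y + y * B x y y = biv (pderiv (pCons c E)) x y" for x y
        by (simp add: pderiv_pCons B(3))
    qed
  qed
  then show ?thesis using that by blast
qed

lemma isCont_biv:
  fixes E :: "complex poly poly"
  shows "isCont (\<lambda>x. biv E x y) x0"
  unfolding biv_def by (intro continuous_intros)

lemma holomorphic_on_poly [holomorphic_intros]:
  "f holomorphic_on S \<Longrightarrow> (\<lambda>z. poly p (f z)) holomorphic_on S"
  by (induction p) (auto intro!: holomorphic_intros)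

text \<open>The map \<open>e\<close> pulls the equation back to the convex set \<open>H\<close>,
  where roots become single valued functions. In the application it is the exponential map from a
  half plane onto a punctured disc.\<close>

locale separated_roots =
  fixes E :: "complex poly poly" and D :: "complex poly" and H :: "complex set" and e :: "complex \<Rightarrow> complex"
  assumes H: "open H" "convex H" "H \<noteq> {}" and hole: "e holomorphic_on H"
    and De: "\<And>w. w \<in> H \<Longrightarrow> poly D (e w) \<noteq> 0"
    and lead: "\<And>x. poly D x \<noteq> 0 \<Longrightarrow> poly (lead_coeff E) x \<noteq> 0"
    and simple: "\<And>x y. poly D x \<noteq> 0 \<Longrightarrow> biv E x y = 0 \<Longrightarrow> biv (pderiv E) x y \<noteq> 0"
    and deg: "0 < degree E"
    and fin_roots: "\<And>x. finite {y. biv E x y = 0} \<and> card {y. biv E x y = 0} \<le> degree E"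
begin

section \<open>Roots in a fixed fibre and their stability\<close>

lemma degree_fibre:
  assumes "poly D x \<noteq> 0"
  shows "degree (map_poly (\<lambda>c. poly c x) E) = degree E"
    "lead_coeff (map_poly (\<lambda>c. poly c x) E) = poly (lead_coeff E) x"
proof -
  have "coeff (map_poly (\<lambda>c. poly c x) E) (degree E) \<noteq> 0" using lead[OF assms] by (simp add: coeff_map_poly)
  then have "degree E \<le> degree (map_poly (\<lambda>c. poly c x) E)" by (rule le_degree)
  moreover have "degree (map_poly (\<lambda>c. poly c x) E) \<le> degree E"
    by (rule degree_le) (auto simp: coeff_map_poly coeff_eq_0)
  ultimately show "degree (map_poly (\<lambda>c. poly c x) E) = degree E" by simp
  then show "lead_coeff (map_poly (\<lambda>c. poly c x) E) = poly (lead_coeff E) x" by (simp add: coeff_map_poly)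
qed

lemma pderiv_fibre: "poly (pderiv (map_poly (\<lambda>c. poly c x) E)) y = biv (pderiv E) x y"
proof -
  have "pderiv (map_poly (\<lambda>c. poly c x) E) = map_poly (\<lambda>c. poly c x) (pderiv E)"
    by (rule poly_eqI) (simp add: coeff_pderiv coeff_map_poly)
  then show ?thesis by (simp add: biv_altdef)
qed

lemma card_roots:
  assumes D: "poly D x \<noteq> 0"
  shows "card {y. biv E x y = 0} = degree E"
proof -
  let ?p = "map_poly (\<lambda>c. poly c x) E"
  have p0: "?p \<noteq> 0" using lead[OF D] degree_fibre[OF D] by auto
  have "rsquarefree ?p" unfolding rsquarefree_roots
    using simple[OF D] by (auto simp: pderiv_fibre biv_altdef[symmetric])
  then have dec: "?p = smult (lead_coeff ?p) (\<Prod>z|poly ?p z = 0. [:- z, 1:])"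
    by (rule complex_poly_decompose_rsquarefree[symmetric])
  have "degree ?p = degree (\<Prod>z|poly ?p z = 0. [:- z, 1:])" by (subst dec) (use p0 in simp)
  also have "\<dots> = card {y. poly ?p y = 0}" by (subst degree_prod_sum_eq) auto
  finally have "card {y. poly ?p y = 0} = degree ?p" by simp
  then show ?thesis by (simp add: biv_altdef degree_fibre[OF D])
qed

text \<open>If all roots above \<open>x\<close> had distance at least \<open>\<eta>\<close> from
  \<open>y0\<close>, the factorisation would give a lower bound for
  \<open>norm (biv E x y0)\<close>. This fails near \<open>x0\<close>, where the value at
  \<open>y0\<close> is 0 and the leading coefficient is not.\<close>

lemma root_near:
  assumes D: "poly D x0 \<noteq> 0" and y0: "biv E x0 y0 = 0" and \<eta>: "0 < \<eta>"
  shows "\<forall>\<^sub>F x in nhds x0. poly D x \<noteq> 0 \<and> (\<exists>y\<in>ball y0 \<eta>. biv E x y = 0)"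
proof -
  define k where "k = degree E"
  define F where "F x = norm (poly (lead_coeff E) x) * \<eta> ^ k - norm (biv E x y0)" for x
  have "0 < F x0" using lead[OF D] \<eta> by (simp add: F_def y0)
  moreover have "isCont F x0" unfolding F_def by (intro continuous_intros isCont_biv)
  ultimately have "\<forall>\<^sub>F x in nhds x0. 0 < F x"
    unfolding isCont_def by (intro order_tendstoD) (simp_all add: tendsto_nhds_iff)
  moreover have "isCont (poly D) x0" by (intro continuous_intros)
  then have "\<forall>\<^sub>F x in nhds x0. poly D x \<noteq> 0"
    using D unfolding isCont_def by (intro tendsto_imp_eventually_ne) (simp_all add: tendsto_nhds_iff)
  ultimately show ?thesis
  proof eventually_elim
    case (elim x)
    let ?p = "map_poly (\<lambda>c. poly c x) E"
    have "?p \<noteq> 0" using lead[OF elim(2)] degree_fibre[OF elim(2)] by auto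
    then obtain A where A: "size A = degree ?p" "?p = smult (lead_coeff ?p) (\<Prod>z\<in>#A. [:- z, 1:])"
      using alg_closed_imp_factorization by blast
    have ev: "poly ?p y = lead_coeff ?p * (\<Prod>z\<in>#A. y - z)" for y
      by (subst A(2)) (simp add: poly_prod_mset image_mset.compositionality o_def)
    have "\<exists>z\<in>#A. norm (y0 - z) < \<eta>"
    proof (rule ccontr)
      assume none: "\<not> ?thesis"
      have gen: "\<eta> ^ size B \<le> norm (\<Prod>z\<in>#B. y0 - z)" if "\<And>z. z \<in># B \<Longrightarrow> \<eta> \<le> norm (y0 - z)" for B
        using that
      proof (induction B)
        case (add z B)
        then have "\<eta> * \<eta> ^ size B \<le> norm (y0 - z) * norm (\<Prod>z\<in>#B. y0 - z)"
          using \<eta> by (intro mult_mono) auto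
        then show ?case by (simp add: norm_mult)
      qed auto
      have "\<eta> ^ size A \<le> norm (\<Prod>z\<in>#A. y0 - z)" by (rule gen) (use none in \<open>auto simp: not_less\<close>)
      moreover have "size A = k" using A(1) degree_fibre(1)[OF elim(2)] by (simp add: k_def)
      ultimately have "\<eta> ^ k \<le> norm (\<Prod>z\<in>#A. y0 - z)" by simp
      then have "norm (poly (lead_coeff E) x) * \<eta> ^ k \<le> norm (biv E x y0)"
        unfolding biv_altdef ev norm_mult degree_fibre(2)[OF elim(2)] by (intro mult_left_mono) auto
      then show False using elim(1) by (simp add: F_def)
    qed
    then obtain z where z: "z \<in># A" "norm (y0 - z) < \<eta>" by blast
    have "(\<Prod>u\<in>#A. z - u) = 0" using z(1) by (auto simp: prod_mset_zero_iff image_iff)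
    then have "biv E x z = 0" unfolding biv_altdef ev by simp
    then show ?case using z elim by (intro conjI bexI[of _ z]) (auto simp: dist_norm)
  qed
qed

text \<open>The difference quotient is nonzero at \<open>(x0, y0, y0)\<close> because the root is
  simple, hence also nearby; two distinct nearby roots would make it vanish.\<close>

lemma root_unique:
  assumes D: "poly D x0 \<noteq> 0" and y0: "biv E x0 y0 = 0"
  obtains \<eta> where "0 < \<eta>" "\<And>x y y'. x \<in> ball x0 \<eta> \<Longrightarrow> y \<in> ball y0 \<eta> \<Longrightarrow> y' \<in> ball y0 \<eta> \<Longrightarrow>
    biv E x y = 0 \<Longrightarrow> biv E x y' = 0 \<Longrightarrow> y = y'"
proof -
  obtain B where B: "continuous_on UNIV (\<lambda>(x, y, y'). B x y y')"
    "\<And>x y y'. biv E x y - biv E x y' = (y - y') * B x y y'" "\<And>x y. B x y y = biv (pderiv E) x y"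
    by (rule poly_difference_quotient[of E]) (rule that)
  have "open {p. (case p of (x, y, y') \<Rightarrow> B x y y') \<noteq> 0}"
    using B(1) by (intro open_Collect_neq continuous_intros)
  moreover have "(x0, y0, y0) \<in> {p. (case p of (x, y, y') \<Rightarrow> B x y y') \<noteq> 0}"
    using simple[OF D y0] by (simp add: B(3))
  ultimately obtain \<epsilon> where \<epsilon>: "0 < \<epsilon>" "ball (x0, y0, y0) \<epsilon> \<subseteq> {p. (case p of (x, y, y') \<Rightarrow> B x y y') \<noteq> 0}"
    using open_contains_ball by blast
  show ?thesis
  proof (rule that[of "\<epsilon> / 3"])
    fix x y y' assume "x \<in> ball x0 (\<epsilon> / 3)" "y \<in> ball y0 (\<epsilon> / 3)" "y' \<in> ball y0 (\<epsilon> / 3)"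
      and roots: "biv E x y = 0" "biv E x y' = 0"
    then have 1: "dist x0 x < \<epsilon> / 3" "dist y0 y < \<epsilon> / 3" "dist y0 y' < \<epsilon> / 3" by auto
    have pair: "dist (p, q) (p', q') \<le> dist p p' + dist q q'" for p p' :: complex and q q' :: "complex \<times> complex"
      by (simp add: dist_Pair_Pair sqrt_sum_squares_le_sum)
    have pair': "dist (p, q) (p', q') \<le> dist p p' + dist q q'" for p p' q q' :: complex
      by (simp add: dist_Pair_Pair sqrt_sum_squares_le_sum)
    have "dist (x0, y0, y0) (x, y, y') < \<epsilon>"
      using pair[of x0 "(y0, y0)" x "(y, y')"] pair'[of y0 y0 y y'] 1 by linarith
    then have "(x, y, y') \<in> ball (x0, y0, y0) \<epsilon>" by simp
    then have "B x y y' \<noteq> 0" using \<epsilon>(2) by auto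
    then show "y = y'" using B(2)[of x y y'] roots by simp
  qed (use \<epsilon> in simp)
qed

section \<open>Root functions and the covering formed by the roots\<close>

definition root_fun :: "(complex \<Rightarrow> complex) \<Rightarrow> bool" where
  "root_fun g \<longleftrightarrow> continuous_on H g \<and> (\<forall>w\<in>H. biv E (e w) (g w) = 0)"

lemma isCont_e: "w \<in> H \<Longrightarrow> isCont e w"
  using holomorphic_on_imp_continuous_on[OF hole] by (simp add: continuous_on_eq_continuous_at[OF H(1)])

lemma eventually_e:
  assumes "w \<in> H" "\<forall>\<^sub>F x in nhds (e w). Q x"
  shows "\<forall>\<^sub>F v in nhds w. Q (e v)"
proof -
  have "(e \<longlongrightarrow> e w) (nhds w)" using isCont_e[OF assms(1)] by (simp add: isCont_def tendsto_at_iff_tendsto_nhds)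
  then show ?thesis using assms(2) by (simp add: filterlim_iff)
qed

lemma root_fun_unique:
  assumes "root_fun g" "root_fun g'" "w0 \<in> H" "g w0 = g' w0" "w \<in> H"
  shows "g w = g' w"
proof -
  have cont: "continuous_on H g" "continuous_on H g'" using assms by (auto simp: root_fun_def)
  let ?S = "{v \<in> H. g v = g' v}"
  have "closedin (top_of_set H) ?S"
    using continuous_closedin_preimage_constant[OF continuous_on_diff[OF cont], of 0] by simp
  moreover have "open ?S"
  proof (subst open_subopen, rule ballI)
    fix v assume "v \<in> ?S"
    then have v: "v \<in> H" "g v = g' v" by auto
    have "biv E (e v) (g v) = 0" using assms v by (auto simp: root_fun_def)
    then obtain \<eta> where \<eta>: "0 < \<eta>" "\<And>x y y'. x \<in> ball (e v) \<eta> \<Longrightarrow> y \<in> ball (g v) \<eta> \<Longrightarrow> y' \<in> ball (g v) \<eta> \<Longrightarrow>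
        biv E x y = 0 \<Longrightarrow> biv E x y' = 0 \<Longrightarrow> y = y'"
      by (rule root_unique[OF De[OF v(1)]]) (rule that)
    have ev: "\<forall>\<^sub>F u in nhds v. f u \<in> ball (f v) \<eta>" if "isCont f v" for f :: "complex \<Rightarrow> complex"
      using that \<eta>(1) unfolding isCont_def
      by (intro topological_tendstoD) (auto simp: tendsto_nhds_iff)
    have "isCont g v" "isCont g' v" using cont H(1) v(1) by (auto simp: continuous_on_eq_continuous_at)
    then have "\<forall>\<^sub>F u in nhds v. e u \<in> ball (e v) \<eta> \<and> g u \<in> ball (g v) \<eta> \<and> g' u \<in> ball (g v) \<eta> \<and> u \<in> H"
      using ev[OF isCont_e[OF v(1)]] ev[of g] ev[of g'] v(2) eventually_nhds_in_open[OF H(1) v(1)]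
      by (auto intro!: eventually_conj)
    then have "\<forall>\<^sub>F u in nhds v. u \<in> ?S"
      by eventually_elim (use \<eta>(2) assms in \<open>auto simp: root_fun_def\<close>)
    then show "\<exists>T. open T \<and> v \<in> T \<and> T \<subseteq> ?S" by (auto simp: eventually_nhds)
  qed
  then have "openin (top_of_set H) ?S" by (intro open_openin_trans) (auto simp: H)
  moreover have "connected H" using H(2) by (rule convex_connected)
  ultimately have "?S = {} \<or> ?S = H" using connected_clopen by blast
  then show ?thesis using assms by blast
qed

text \<open>Subtracting the equations at \<open>w\<close> and \<open>w0\<close> expresses the
  increment of \<open>g\<close> by that of the explicit holomorphic function \<open>q\<close>,
  divided by a continuous factor that is nonzero at \<open>w0\<close>.\<close>

lemma root_fun_holomorphic:
  assumes "root_fun g"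
  shows "g holomorphic_on H"
  unfolding holomorphic_on_open[OF H(1)]
proof
  fix w0 assume w0: "w0 \<in> H"
  have rt: "\<And>w. w \<in> H \<Longrightarrow> biv E (e w) (g w) = 0" and contg: "isCont g w0"
    using assms w0 H(1) by (auto simp: root_fun_def continuous_on_eq_continuous_at)
  obtain B where B: "continuous_on UNIV (\<lambda>(x, y, y'). B x y y')"
    "\<And>x y y'. biv E x y - biv E x y' = (y - y') * B x y y'" "\<And>x y. B x y y = biv (pderiv E) x y"
    by (rule poly_difference_quotient[of E]) (rule that)
  define \<beta> where "\<beta> w = B (e w) (g w) (g w0)" for w
  have "isCont (\<lambda>w. (e w, g w, g w0)) w0" using isCont_e[OF w0] contg by (intro continuous_intros)
  moreover have "isCont (\<lambda>(x, y, y'). B x y y') (e w0, g w0, g w0)" using B(1) by (simp add: continuous_on_eq_continuous_at)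
  ultimately have "isCont (\<lambda>w. (\<lambda>(x, y, y'). B x y y') (e w, g w, g w0)) w0" by (rule isCont_o2)
  then have cont\<beta>: "isCont \<beta> w0" unfolding \<beta>_def by simp
  have \<beta>0: "\<beta> w0 \<noteq> 0" using simple[OF De[OF w0] rt[OF w0]] by (simp add: \<beta>_def B(3))
  define q where "q w = poly (poly E [:g w0:]) (e w)" for w
  have "e field_differentiable at w0" using hole H(1) w0 holomorphic_on_imp_differentiable_at by blast
  then obtain e' where e': "(e has_field_derivative e') (at w0)" by (auto simp: field_differentiable_def)
  have dq: "(q has_field_derivative (poly (pderiv (poly E [:g w0:])) (e w0) * e')) (at w0)"
    unfolding q_def by (intro DERIV_chain2[OF poly_DERIV e'])
  have eq: "(g w - g w0) * \<beta> w = - (q w - q w0)" if "w \<in> H" for w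
    using B(2)[of "e w" "g w" "g w0"] rt[OF that] rt[OF w0] by (simp add: \<beta>_def q_def biv_def[symmetric])
  have "((\<lambda>w. - ((q w - q w0) / (w - w0)) / \<beta> w) \<longlongrightarrow> - (poly (pderiv (poly E [:g w0:])) (e w0) * e') / \<beta> w0) (at w0)"
    using dq cont\<beta> \<beta>0 by (intro tendsto_intros) (auto simp: has_field_derivative_iff isCont_def)
  moreover have "\<forall>\<^sub>F w in at w0. - ((q w - q w0) / (w - w0)) / \<beta> w = (g w - g w0) / (w - w0)"
  proof -
    have "\<forall>\<^sub>F w in at w0. \<beta> w \<noteq> 0" using cont\<beta> \<beta>0 by (intro tendsto_imp_eventually_ne) (auto simp: isCont_def)
    moreover have "\<forall>\<^sub>F w in at w0. w \<in> H" using H(1) w0 by (rule eventually_at_in_open')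
    ultimately show ?thesis
    proof eventually_elim
      case (elim w)
      have "- ((q w - q w0) / (w - w0)) / \<beta> w = (- (q w - q w0)) / \<beta> w / (w - w0)"
        by (simp only: minus_divide_left divide_divide_eq_left mult.commute)
      also have "\<dots> = (g w - g w0) * \<beta> w / \<beta> w / (w - w0)" by (simp only: eq[OF elim(2)])
      finally show ?case using elim(1) by simp
    qed
  qed
  ultimately have "((\<lambda>w. (g w - g w0) / (w - w0)) \<longlongrightarrow> - (poly (pderiv (poly E [:g w0:])) (e w0) * e') / \<beta> w0) (at w0)"
    by (rule Lim_transform_eventually)
  then show "\<exists>f'. (g has_field_derivative f') (at w0)" by (auto simp: has_field_derivative_iff)
qed

definition total :: "(complex \<times> complex) set" where
  "total = {(w, y). w \<in> H \<and> biv E (e w) y = 0}"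

text \<open>Every fibre has exactly \<open>degree E\<close> points. Near \<open>w0\<close> each of
  the \<open>degree E\<close> disjoint discs around the old roots contains at least one new root, so
  each contains exactly one and none lies outside.\<close>

lemma local_sections:
  assumes w0: "w0 \<in> H"
  obtains N \<eta> where "open N" "w0 \<in> N" "N \<subseteq> H" "0 < \<eta>"
    "\<And>y y'. biv E (e w0) y = 0 \<Longrightarrow> biv E (e w0) y' = 0 \<Longrightarrow> y \<noteq> y' \<Longrightarrow> ball y \<eta> \<inter> ball y' \<eta> = {}"
    "\<And>w y. w \<in> N \<Longrightarrow> biv E (e w0) y = 0 \<Longrightarrow> \<exists>!z. z \<in> ball y \<eta> \<and> biv E (e w) z = 0"
    "\<And>w z. w \<in> N \<Longrightarrow> biv E (e w) z = 0 \<Longrightarrow> \<exists>y. biv E (e w0) y = 0 \<and> z \<in> ball y \<eta>"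
proof -
  define Y where "Y = {y. biv E (e w0) y = 0}"
  have finY: "finite Y" and cardY: "card Y = degree E"
    using fin_roots card_roots[OF De[OF w0]] by (auto simp: Y_def)
  have "\<exists>\<eta>>0. \<forall>y\<in>Y. \<forall>y'\<in>Y. y \<noteq> y' \<longrightarrow> 2 * \<eta> \<le> dist y y'"
  proof -
    define S where "S = (\<lambda>(y, y'). dist y y') ` {(y, y') \<in> Y \<times> Y. y \<noteq> y'}"
    have finS: "finite S" unfolding S_def using finY by (intro finite_imageI) (auto intro: finite_subset[of _ "Y \<times> Y"])
    have pos: "0 < s" if "s \<in> insert 1 S" for s using that by (auto simp: S_def)
    define \<eta> where "\<eta> = Min (insert 1 S) / 2"
    have "0 < Min (insert 1 S)" using pos finS by (subst Min_gr_iff) auto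
    moreover have "2 * \<eta> \<le> dist y y'" if "y \<in> Y" "y' \<in> Y" "y \<noteq> y'" for y y'
    proof -
      have "dist y y' \<in> S" unfolding S_def using that by (intro image_eqI[of _ _ "(y, y')"]) auto
      then show ?thesis unfolding \<eta>_def using finS by simp
    qed
    ultimately show ?thesis by (intro exI[of _ \<eta>]) (auto simp: \<eta>_def)
  qed
  then obtain \<eta> where \<eta>: "0 < \<eta>" "\<And>y y'. y \<in> Y \<Longrightarrow> y' \<in> Y \<Longrightarrow> y \<noteq> y' \<Longrightarrow> 2 * \<eta> \<le> dist y y'" by blast
  have disj: "ball y \<eta> \<inter> ball y' \<eta> = {}" if "y \<in> Y" "y' \<in> Y" "y \<noteq> y'" for y y'
  proof (rule ccontr)
    assume "ball y \<eta> \<inter> ball y' \<eta> \<noteq> {}"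
    then obtain z where "dist y z < \<eta>" "dist y' z < \<eta>" by auto
    then show False using \<eta>(2)[OF that] dist_triangle2[of y y' z] by linarith
  qed
  have "\<forall>\<^sub>F w in nhds w0. \<forall>y\<in>Y. poly D (e w) \<noteq> 0 \<and> (\<exists>z\<in>ball y \<eta>. biv E (e w) z = 0)"
    using eventually_e[OF w0 root_near[OF De[OF w0] _ \<eta>(1)]] finY
    by (intro eventually_ball_finite) (auto simp: Y_def)
  moreover have "\<forall>\<^sub>F w in nhds w0. w \<in> H" using H(1) w0 by (rule eventually_nhds_in_open)
  ultimately have "\<forall>\<^sub>F w in nhds w0. w \<in> H \<and> (\<forall>y\<in>Y. \<exists>z\<in>ball y \<eta>. biv E (e w) z = 0)"
    by eventually_elim auto
  then obtain N where N: "open N" "w0 \<in> N" "\<And>w. w \<in> N \<Longrightarrow> w \<in> H"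
    "\<And>w y. w \<in> N \<Longrightarrow> y \<in> Y \<Longrightarrow> \<exists>z\<in>ball y \<eta>. biv E (e w) z = 0"
    unfolding eventually_nhds by blast
  have only: "\<exists>y\<in>Y. z \<in> ball y \<eta> \<and> (\<forall>z'\<in>ball y \<eta>. biv E (e w) z' = 0 \<longrightarrow> z' = z)"
    if w: "w \<in> N" and z: "biv E (e w) z = 0" for w z
  proof -
    obtain f where f: "\<And>y. y \<in> Y \<Longrightarrow> f y \<in> ball y \<eta> \<and> biv E (e w) (f y) = 0"
      using N(4)[OF w] by metis
    have "inj_on f Y"
    proof (rule inj_onI, rule ccontr)
      fix y y' assume y: "y \<in> Y" "y' \<in> Y" "f y = f y'" "y \<noteq> y'"
      have "f y \<in> ball y \<eta> \<inter> ball y' \<eta>" using f[OF y(1)] f[OF y(2)] y(3) by simp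
      then show False using disj[OF y(1,2,4)] by simp
    qed
    then have "card (f ` Y) = degree E" by (simp add: card_image cardY)
    moreover have "card {z. biv E (e w) z = 0} = degree E" using card_roots De N(3) w by blast
    moreover have "f ` Y \<subseteq> {z. biv E (e w) z = 0}" using f by auto
    ultimately have eq: "f ` Y = {z. biv E (e w) z = 0}" using fin_roots by (intro card_subset_eq) auto
    then obtain y where y: "y \<in> Y" "z = f y" using z by auto
    have "z' = z" if z': "z' \<in> ball y \<eta>" "biv E (e w) z' = 0" for z'
    proof -
      obtain y' where y': "y' \<in> Y" "z' = f y'" using eq z' by auto
      then have "z' \<in> ball y' \<eta>" using f by blast
      then have "y' = y" using disj[OF y'(1) y(1)] z'(1) by blast
      then show ?thesis using y y' by simp
    qed
    then show ?thesis using y f by (intro bexI[of _ y]) auto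
  qed
  show ?thesis
  proof (rule that[OF N(1,2) _ \<eta>(1)])
    show "N \<subseteq> H" using N(3) by blast
    show "ball y \<eta> \<inter> ball y' \<eta> = {}" if "biv E (e w0) y = 0" "biv E (e w0) y' = 0" "y \<noteq> y'" for y y'
      using disj that by (simp add: Y_def)
    show "\<exists>!z. z \<in> ball y \<eta> \<and> biv E (e w) z = 0" if w: "w \<in> N" and y: "biv E (e w0) y = 0" for w y
    proof -
      obtain z where z: "z \<in> ball y \<eta>" "biv E (e w) z = 0" using N(4)[OF w, of y] y by (auto simp: Y_def)
      obtain y' where y': "y' \<in> Y" "z \<in> ball y' \<eta>" "\<forall>z'\<in>ball y' \<eta>. biv E (e w) z' = 0 \<longrightarrow> z' = z"
        using only[OF w z(2)] by blast
      have "y \<in> Y" using y by (simp add: Y_def)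
      then have "y' = y" using disj[OF y'(1), of y] z(1) y'(2) by blast
      with y'(3) have "\<forall>z'\<in>ball y \<eta>. biv E (e w) z' = 0 \<longrightarrow> z' = z" by simp
      then show ?thesis using z by blast
    qed
    show "\<exists>y. biv E (e w0) y = 0 \<and> z \<in> ball y \<eta>" if "w \<in> N" "biv E (e w) z = 0" for w z
      using only[OF that] by (auto simp: Y_def)
  qed
qed

lemma covering_total: "covering_space total fst H"
  unfolding covering_space_def
proof (intro conjI ballI)
  show "continuous_on total fst" by (intro continuous_intros)
  show "fst ` total = H"
  proof (intro equalityI subsetI)
    fix w assume w: "w \<in> H"
    have "{y. biv E (e w) y = 0} \<noteq> {}" using card_roots[OF De[OF w]] deg by (metis card.empty less_numeral_extra(3))
    then show "w \<in> fst ` total" using w by (force simp: total_def)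
  qed (auto simp: total_def)
  fix w0 assume w0: "w0 \<in> H"
  obtain N \<eta> where N: "open N" "w0 \<in> N" "N \<subseteq> H" and \<eta>: "0 < \<eta>"
    and disj: "\<And>y y'. biv E (e w0) y = 0 \<Longrightarrow> biv E (e w0) y' = 0 \<Longrightarrow> y \<noteq> y' \<Longrightarrow> ball y \<eta> \<inter> ball y' \<eta> = {}"
    and ex1: "\<And>w y. w \<in> N \<Longrightarrow> biv E (e w0) y = 0 \<Longrightarrow> \<exists>!z. z \<in> ball y \<eta> \<and> biv E (e w) z = 0"
    and cover: "\<And>w z. w \<in> N \<Longrightarrow> biv E (e w) z = 0 \<Longrightarrow> \<exists>y. biv E (e w0) y = 0 \<and> z \<in> ball y \<eta>"
    by (rule local_sections[OF w0]) (rule that)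
  define V where "V y = total \<inter> (N \<times> ball y \<eta>)" for y
  show "\<exists>T. w0 \<in> T \<and> openin (top_of_set H) T \<and> (\<exists>v. \<Union> v = total \<inter> fst -` T \<and>
      (\<forall>u\<in>v. openin (top_of_set total) u) \<and> pairwise disjnt v \<and> (\<forall>u\<in>v. \<exists>q. homeomorphism u T fst q))"
  proof (intro exI[of _ N] conjI exI[of _ "V ` {y. biv E (e w0) y = 0}"] ballI)
    show "w0 \<in> N" by fact
    show "openin (top_of_set H) N" using N by (simp add: open_subset)
    show "\<Union> (V ` {y. biv E (e w0) y = 0}) = total \<inter> fst -` N"
      using cover by (fastforce simp: V_def total_def)
    show "pairwise disjnt (V ` {y. biv E (e w0) y = 0})"
      using disj by (fastforce simp: pairwise_def disjnt_def V_def)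
    fix u assume "u \<in> V ` {y. biv E (e w0) y = 0}"
    then obtain y where y: "biv E (e w0) y = 0" "u = V y" by auto
    show "openin (top_of_set total) u" unfolding y(2) V_def
      using N(1) by (intro openin_open_Int open_Times) auto
    define z where "z w = (THE z. z \<in> ball y \<eta> \<and> biv E (e w) z = 0)" for w
    have z: "z w \<in> ball y \<eta> \<and> biv E (e w) (z w) = 0" if "w \<in> N" for w
      unfolding z_def by (rule theI'[OF ex1[OF that y(1)]])
    have zu: "z' = z w" if "w \<in> N" "z' \<in> ball y \<eta>" "biv E (e w) z' = 0" for w z'
      using ex1[OF that(1) y(1)] z[OF that(1)] that by blast
    have contz: "continuous_on N z" unfolding continuous_on_eq_continuous_at[OF N(1)]
    proof
      fix w1 assume w1: "w1 \<in> N"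
      then have w1H: "w1 \<in> H" using N(3) by blast
      show "isCont z w1" unfolding isCont_def
      proof (rule topological_tendstoI)
        fix S assume S: "open S" "z w1 \<in> S"
        then have "open (S \<inter> ball y \<eta>)" "z w1 \<in> S \<inter> ball y \<eta>" using z[OF w1] by auto
        then obtain \<epsilon> where \<epsilon>: "0 < \<epsilon>" "ball (z w1) \<epsilon> \<subseteq> S \<inter> ball y \<eta>" using open_contains_ball by blast
        have "\<forall>\<^sub>F w in nhds w1. poly D (e w) \<noteq> 0 \<and> (\<exists>z'\<in>ball (z w1) \<epsilon>. biv E (e w) z' = 0)"
          by (rule eventually_e[OF w1H root_near[OF De[OF w1H] _ \<epsilon>(1)]]) (use z[OF w1] in simp)
        moreover have "\<forall>\<^sub>F w in nhds w1. w \<in> N" using N(1) w1 by (rule eventually_nhds_in_open)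
        ultimately have "\<forall>\<^sub>F w in nhds w1. z w \<in> S"
        proof eventually_elim
          case (elim w)
          then obtain z' where z': "z' \<in> ball (z w1) \<epsilon>" "biv E (e w) z' = 0" by blast
          then have "z' = z w" using \<epsilon>(2) elim by (intro zu) auto
          then show ?case using z' \<epsilon>(2) by auto
        qed
        then show "\<forall>\<^sub>F w in at w1. z w \<in> S" by (auto simp: eventually_nhds_conv_at)
      qed
    qed
    show "\<exists>q. homeomorphism u N fst q"
    proof (intro exI[of _ "\<lambda>w. (w, z w)"] homeomorphismI)
      show "continuous_on N (\<lambda>w. (w, z w))" by (intro continuous_intros contz)
      show "(\<lambda>w. (w, z w)) ` N \<subseteq> u" using z N(3) by (auto simp: y(2) V_def total_def)
      show "(fst p, z (fst p)) = p" if "p \<in> u" for p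
        using that zu[of "fst p" "snd p"] by (auto simp: y(2) V_def total_def)
    qed (auto simp: y(2) V_def intro!: continuous_intros)
  qed
qed

end

context separated_roots
begin

text \<open>The identity of the simply connected set \<open>H\<close> is lifted through the
  covering; the second component of the lift is the root function.\<close>

lemma root_fun_exists:
  assumes "w0 \<in> H" "biv E (e w0) y0 = 0"
  obtains g where "root_fun g" "g w0 = y0"
proof -
  have "simply_connected H" using H(2) by (rule convex_imp_simply_connected)
  moreover have "locally path_connected H" using H(2) by (rule convex_imp_locally_path_connected)
  moreover have "(w0, y0) \<in> total" using assms by (simp add: total_def)
  moreover have "(\<lambda>w. w) \<in> H \<rightarrow> H" by simp
  ultimately obtain f where f: "continuous_on H f" "f \<in> H \<rightarrow> total" "f w0 = (w0, y0)" "\<And>w. w \<in> H \<Longrightarrow> fst (f w) = w"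
    using covering_space_lift_strong[OF covering_total, of "(w0, y0)" w0 H "\<lambda>w. w"] assms(1) continuous_on_id
    by (metis fst_conv)
  show ?thesis
  proof (rule that[of "\<lambda>w. snd (f w)"])
    show "root_fun (\<lambda>w. snd (f w))" unfolding root_fun_def
    proof (intro conjI ballI)
      show "continuous_on H (\<lambda>w. snd (f w))" using f(1) by (intro continuous_intros)
      fix w assume w: "w \<in> H"
      then have "f w \<in> total" using f(2) by blast
      then show "biv E (e w) (snd (f w)) = 0" using f(4)[OF w] by (auto simp: total_def)
    qed
  qed (simp add: f(3))
qed

text \<open>All translates of \<open>g\<close> by multiples of \<open>T\<close> are root functions,
  but they take only finitely many values at one point. Two translates agree there, hence
  everywhere.\<close>

lemma root_fun_period:
  assumes g: "root_fun g" and T: "\<And>w. w \<in> H \<longleftrightarrow> w + T \<in> H" "\<And>w. e (w + T) = e w"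
  obtains M :: nat where "0 < M" "\<And>w. w \<in> H \<Longrightarrow> g (w + of_nat M * T) = g w"
proof -
  have TH: "w + of_nat n * T \<in> H \<longleftrightarrow> w \<in> H" for n w
  proof (induction n)
    case (Suc n)
    have "w + of_nat (Suc n) * T = (w + of_nat n * T) + T" by (simp add: algebra_simps)
    then show ?case using Suc T(1)[of "w + of_nat n * T"] by (simp only:)
  qed simp
  have Te: "e (w + of_nat n * T) = e w" for n w
  proof (induction n)
    case (Suc n)
    have "w + of_nat (Suc n) * T = (w + of_nat n * T) + T" by (simp add: algebra_simps)
    then show ?case using Suc T(2)[of "w + of_nat n * T"] by (simp only:)
  qed simp
  have shift: "root_fun (\<lambda>w. g (w + of_nat n * T))" for n
    unfolding root_fun_def
  proof (intro conjI ballI)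
    show "continuous_on H (\<lambda>w. g (w + of_nat n * T))"
    proof (rule continuous_on_compose2[of H g])
      show "(\<lambda>w. w + of_nat n * T) ` H \<subseteq> H" using TH by auto
    qed (use g in \<open>auto simp: root_fun_def intro!: continuous_intros\<close>)
    fix w assume w: "w \<in> H"
    then have "biv E (e (w + of_nat n * T)) (g (w + of_nat n * T)) = 0"
      using g TH by (auto simp: root_fun_def)
    then show "biv E (e w) (g (w + of_nat n * T)) = 0" by (simp add: Te)
  qed
  obtain w0 where w0: "w0 \<in> H" using H(3) by blast
  have "range (\<lambda>n. g (w0 + of_nat n * T)) \<subseteq> {y. biv E (e w0) y = 0}"
    using shift w0 by (auto simp: root_fun_def)
  then have "finite (range (\<lambda>n. g (w0 + of_nat n * T)))" using fin_roots finite_subset by blast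
  then have "\<not> inj (\<lambda>n::nat. g (w0 + of_nat n * T))" using finite_imageD infinite_UNIV_nat by blast
  then obtain n n' :: nat where n: "n < n'" "g (w0 + of_nat n * T) = g (w0 + of_nat n' * T)"
    by (metis (mono_tags, lifting) injI linorder_neqE_nat)
  have eq: "g (w + of_nat n * T) = g (w + of_nat n' * T)" if "w \<in> H" for w
    using root_fun_unique[OF shift shift w0 n(2) that] .
  show ?thesis
  proof (rule that[of "n' - n"])
    fix w assume w: "w \<in> H"
    define v where "v = w - of_nat n * T"
    have "v \<in> H" using TH[of v n] w by (simp add: v_def)
    from eq[OF this] have "g w = g (v + of_nat n' * T)" by (simp add: v_def)
    also have "v + of_nat n' * T = w + of_nat (n' - n) * T"
      using n(1) by (simp add: v_def of_nat_diff algebra_simps)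
    finally show "g (w + of_nat (n' - n) * T) = g w" by simp
  qed (use n in simp)
qed

end

subsection \<open>Holomorphic functions tested along a sequence\<close>

lemma factor_at_zero:
  fixes f :: "complex \<Rightarrow> complex"
  assumes "f holomorphic_on ball 0 \<rho>" "f 0 = 0" "0 < \<rho>"
  obtains g where "g holomorphic_on ball 0 \<rho>" "\<And>t. f t = t * g t"
proof -
  define g where "g = (\<lambda>z. if z = 0 then deriv f 0 else (f z - f 0) / (z - 0))"
  have "g holomorphic_on ball 0 \<rho>" unfolding g_def using assms by (intro pole_lemma) auto
  then show ?thesis by (rule that) (auto simp: g_def assms)
qed

lemma tendsto_along:
  fixes f :: "complex \<Rightarrow> complex"
  assumes "f holomorphic_on ball 0 \<rho>" "0 < \<rho>" "t \<longlonglongrightarrow> 0"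
  shows "(\<lambda>l::nat. f (t l)) \<longlonglongrightarrow> f 0"
proof -
  have "isCont f 0" using holomorphic_on_imp_continuous_on[OF assms(1)] assms(2)
    by (simp add: continuous_on_eq_continuous_at)
  then show ?thesis using assms(3) by (rule isCont_tendsto_compose)
qed

text \<open>The growth bound permits at most a pole at 0, and a finite limit along one sequence
  excludes it. The induction lowers the admissible order of the pole: the extension of
  \<open>t ^ Suc N * f t\<close> vanishes at 0, so one factor \<open>t\<close> can be
  removed.\<close>

lemma extend_by_sequence:
  fixes f :: "complex \<Rightarrow> complex"
  assumes hol: "f holomorphic_on (ball 0 \<rho> - {0})" and \<rho>: "0 < \<rho>"
    and bnd: "\<forall>\<^sub>F t in at 0. norm (t ^ N * f t) \<le> B"
    and t: "t \<longlonglongrightarrow> 0" "\<And>l::nat. t l \<noteq> 0" and lim: "(\<lambda>l. f (t l)) \<longlonglongrightarrow> y"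
  obtains g where "g holomorphic_on ball 0 \<rho>" "\<And>z. z \<in> ball 0 \<rho> - {0} \<Longrightarrow> g z = f z" "g 0 = y"
proof -
  have "\<exists>g. g holomorphic_on ball 0 \<rho> \<and> (\<forall>z\<in>ball 0 \<rho> - {0}. g z = f z)"
    using bnd
  proof (induction N arbitrary: B)
    case 0
    then show ?case using holomorphic_on_extend_bounded[OF hol] \<rho> by auto
  next
    case (Suc N)
    have "(\<lambda>t. t ^ Suc N * f t) holomorphic_on (ball 0 \<rho> - {0})" by (intro holomorphic_intros hol)
    then obtain G where G: "G holomorphic_on ball 0 \<rho>" "\<And>z. z \<in> ball 0 \<rho> - {0} \<Longrightarrow> G z = z ^ Suc N * f z"
      using holomorphic_on_extend_bounded[of "\<lambda>t. t ^ Suc N * f t" "ball 0 \<rho>" 0] \<rho> Suc.prems by auto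
    have "(\<lambda>l. t l ^ Suc N * f (t l)) \<longlonglongrightarrow> 0 ^ Suc N * y" by (intro tendsto_intros t lim)
    moreover have "\<forall>\<^sub>F l in sequentially. t l \<in> ball 0 \<rho>"
      using t(1) \<rho> by (intro topological_tendstoD) auto
    then have "\<forall>\<^sub>F l in sequentially. t l ^ Suc N * f (t l) = G (t l)"
      by eventually_elim (use G(2) t(2) in auto)
    ultimately have "(\<lambda>l. G (t l)) \<longlonglongrightarrow> 0" by (auto dest: Lim_transform_eventually)
    then have "G 0 = 0" using tendsto_along[OF G(1) \<rho> t(1)] LIMSEQ_unique by blast
    then obtain G1 where G1: "G1 holomorphic_on ball 0 \<rho>" "\<And>t. G t = t * G1 t"
      using factor_at_zero[OF G(1) _ \<rho>] by blast
    have "isCont G1 0" using holomorphic_on_imp_continuous_on[OF G1(1)] \<rho>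
      by (simp add: continuous_on_eq_continuous_at)
    then have "(G1 \<longlongrightarrow> G1 0) (at 0)" by (simp add: isCont_def)
    then have "\<forall>\<^sub>F z in at 0. dist (G1 z) (G1 0) < 1" by (rule tendstoD) simp
    moreover have "\<forall>\<^sub>F z in at 0. z \<in> ball 0 \<rho> - {0}"
      using \<rho> by (intro eventually_at_in_open) auto
    ultimately have "\<forall>\<^sub>F z in at 0. norm (z ^ N * f z) \<le> norm (G1 0) + 1"
    proof eventually_elim
      case (elim z)
      have "z * G1 z = z * (z ^ N * f z)" using G(2)[OF elim(2)] G1(2)[of z] by (simp add: mult.assoc)
      then have "G1 z = z ^ N * f z" using elim(2) by simp
      moreover have "norm (G1 z) \<le> norm (G1 0) + 1"
        using elim(1) norm_triangle_sub[of "G1 z" "G1 0"] by (simp add: dist_norm)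
      ultimately show ?case by simp
    qed
    then show ?case by (rule Suc.IH)
  qed
  then obtain g where g: "g holomorphic_on ball 0 \<rho>" "\<And>z. z \<in> ball 0 \<rho> - {0} \<Longrightarrow> g z = f z" by blast
  have "\<forall>\<^sub>F l in sequentially. t l \<in> ball 0 \<rho>"
    using t(1) \<rho> by (intro topological_tendstoD) auto
  then have "\<forall>\<^sub>F l in sequentially. f (t l) = g (t l)"
    by eventually_elim (use g(2) t(2) in auto)
  then have "(\<lambda>l. g (t l)) \<longlonglongrightarrow> y" using lim by (auto dest: Lim_transform_eventually)
  then have "g 0 = y" using tendsto_along[OF g(1) \<rho> t(1)] LIMSEQ_unique by blast
  with g show ?thesis by (rule that)
qed

text \<open>Convergence of the quotient along one sequence already forces all Taylor coefficients
  below order \<open>m\<close> to vanish; they are removed one at a time.\<close>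

lemma order_by_sequence:
  fixes f :: "complex \<Rightarrow> complex"
  assumes hol: "f holomorphic_on ball 0 \<rho>" and \<rho>: "0 < \<rho>"
    and t: "t \<longlonglongrightarrow> 0" "\<And>l::nat. t l \<noteq> 0" and lim: "(\<lambda>l. (f (t l) - f 0) / t l ^ m) \<longlonglongrightarrow> a"
  obtains \<phi> where "\<phi> holomorphic_on ball 0 \<rho>" "\<And>z. f z = f 0 + z ^ m * \<phi> z" "\<phi> 0 = a"
proof -
  have step: "\<exists>\<phi>. \<phi> holomorphic_on ball 0 \<rho> \<and> (\<forall>z. f z = f 0 + z ^ k * \<phi> z)" if "k \<le> m" for k
    using that
  proof (induction k)
    case 0
    show ?case using hol by (intro exI[of _ "\<lambda>z. f z - f 0"]) (auto intro!: holomorphic_intros)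
  next
    case (Suc k)
    then obtain \<phi> where \<phi>: "\<phi> holomorphic_on ball 0 \<rho>" "\<And>z. f z = f 0 + z ^ k * \<phi> z" by auto
    have "(\<lambda>l. t l ^ (m - k) * ((f (t l) - f 0) / t l ^ m)) \<longlonglongrightarrow> 0 ^ (m - k) * a"
      by (intro tendsto_intros t lim)
    moreover have "t l ^ (m - k) * ((f (t l) - f 0) / t l ^ m) = \<phi> (t l)" for l
    proof -
      have "t l ^ m = t l ^ (m - k) * t l ^ k" using Suc.prems by (simp add: power_add[symmetric])
      moreover have "f (t l) - f 0 = t l ^ k * \<phi> (t l)" using \<phi>(2)[of "t l"] by simp
      ultimately show ?thesis using t(2) by simp
    qed
    ultimately have "(\<lambda>l. \<phi> (t l)) \<longlonglongrightarrow> 0" using Suc.prems by (simp add: power_0_left)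
    then have "\<phi> 0 = 0" using tendsto_along[OF \<phi>(1) \<rho> t(1)] LIMSEQ_unique by blast
    then obtain \<psi> where \<psi>: "\<psi> holomorphic_on ball 0 \<rho>" "\<And>t. \<phi> t = t * \<psi> t"
      using factor_at_zero[OF \<phi>(1) _ \<rho>] by blast
    have "f z = f 0 + z ^ Suc k * \<psi> z" for z using \<phi>(2)[of z] \<psi>(2)[of z] by (simp add: mult_ac)
    with \<psi>(1) show ?case by blast
  qed
  from step[of m] obtain \<phi> where \<phi>: "\<phi> holomorphic_on ball 0 \<rho>" "\<And>z. f z = f 0 + z ^ m * \<phi> z" by auto
  have "(f (t l) - f 0) / t l ^ m = \<phi> (t l)" for l using \<phi>(2)[of "t l"] t(2) by simp
  then have "(\<lambda>l. \<phi> (t l)) \<longlonglongrightarrow> a" using lim by simp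
  then have "\<phi> 0 = a" using tendsto_along[OF \<phi>(1) \<rho> t(1)] LIMSEQ_unique by blast
  with \<phi> show ?thesis by (rule that)
qed

lemma identity_by_sequence:
  fixes f :: "complex \<Rightarrow> complex"
  assumes hol: "f holomorphic_on ball 0 \<rho>" and t: "t \<longlonglongrightarrow> 0" "\<And>l::nat. t l \<noteq> 0"
    and zero: "\<forall>\<^sub>F l in sequentially. f (t l) = 0" and z: "z \<in> ball 0 \<rho>"
  shows "f z = 0"
proof -
  have \<rho>: "0 < \<rho>" using z by (auto intro: le_less_trans[OF norm_ge_zero])
  obtain N where N: "\<And>l. N \<le> l \<Longrightarrow> f (t l) = 0 \<and> t l \<in> ball 0 \<rho>"
  proof -
    have "\<forall>\<^sub>F l in sequentially. t l \<in> ball 0 \<rho>" using t(1) \<rho> by (intro topological_tendstoD) auto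
    then have "\<forall>\<^sub>F l in sequentially. f (t l) = 0 \<and> t l \<in> ball 0 \<rho>" using zero by eventually_elim auto
    then show ?thesis using that by (auto simp: eventually_sequentially)
  qed
  show ?thesis
  proof (rule analytic_continuation[OF hol, of "t ` {N..}" 0])
    show "0 islimpt t ` {N..}" unfolding islimpt_sequential
    proof (intro exI[of _ "\<lambda>l. t (l + N)"] conjI allI)
      show "(\<lambda>l. t (l + N)) \<longlonglongrightarrow> 0" using t(1) by (rule LIMSEQ_ignore_initial_segment)
    qed (use t(2) in auto)
  qed (use N z \<rho> in auto)
qed

subsection \<open>Branches of the curve\<close>

text \<open>\<open>E j\<close> is a polynomial of least degree satisfied by the \<open>j\<close>-th coordinate over the \<open>i0\<close>-th one, and
  \<open>D j\<close> stands for its discriminant times its leading coefficient.\<close>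

locale curve_eqs = curve_coord +
  fixes E :: "'a \<Rightarrow> complex poly poly" and D :: "'a \<Rightarrow> complex poly"
  assumes van: "vanishing j (E j)" and D0: "D j \<noteq> 0" and deg: "0 < degree (E j)"
    and lead: "poly (D j) x \<noteq> 0 \<Longrightarrow> poly (lead_coeff (E j)) x \<noteq> 0"
    and simple: "poly (D j) x \<noteq> 0 \<Longrightarrow> biv (E j) x y = 0 \<Longrightarrow> biv (pderiv (E j)) x y \<noteq> 0"
    and finr: "finite {y. biv (E j) x y = 0} \<and> card {y. biv (E j) x y = 0} \<le> degree (E j)"

lemma (in curve_coord) curve_eqs_exists: "\<exists>E D. curve_eqs A i0 P a1 a2 E D"
proof -
  have "\<exists>E D. vanishing j E \<and> D \<noteq> 0 \<and> 0 < degree E \<and>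
    (\<forall>x. poly D x \<noteq> 0 \<longrightarrow> poly (lead_coeff E) x \<noteq> 0) \<and>
    (\<forall>x y. poly D x \<noteq> 0 \<longrightarrow> biv E x y = 0 \<longrightarrow> biv (pderiv E) x y \<noteq> 0) \<and>
    (\<forall>x. finite {y. biv E x y = 0} \<and> card {y. biv E x y = 0} \<le> degree E)" for j
    by (rule minimal_equation[of j]) blast
  then obtain E D where "\<And>j. vanishing j (E j) \<and> D j \<noteq> 0 \<and> 0 < degree (E j) \<and>
    (\<forall>x. poly (D j) x \<noteq> 0 \<longrightarrow> poly (lead_coeff (E j)) x \<noteq> 0) \<and>
    (\<forall>x y. poly (D j) x \<noteq> 0 \<longrightarrow> biv (E j) x y = 0 \<longrightarrow> biv (pderiv (E j)) x y \<noteq> 0) \<and>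
    (\<forall>x. finite {y. biv (E j) x y = 0} \<and> card {y. biv (E j) x y = 0} \<le> degree (E j))" by metis
  then have "curve_eqs A i0 P a1 a2 E D" by unfold_locales auto
  then show ?thesis by blast
qed

context curve_eqs
begin

lemma good_radius_exists:
  obtains r where "0 < r" "\<And>j x. 0 < norm (x - c) \<Longrightarrow> norm (x - c) < r \<Longrightarrow> poly (D j) x \<noteq> 0"
proof -
  have "finite (\<Union>j. {x. poly (D j) x = 0})" using D0 by (auto intro: poly_roots_finite)
  from finite_set_avoid[OF this, of c] obtain r where r: "0 < r"
    "\<And>x. x \<in> (\<Union>j. {x. poly (D j) x = 0}) \<Longrightarrow> x \<noteq> c \<Longrightarrow> r \<le> dist c x" by blast
  show ?thesis
  proof (rule that[OF r(1)])
    fix j x assume x: "0 < norm (x - c)" "norm (x - c) < r"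
    show "poly (D j) x \<noteq> 0"
    proof
      assume "poly (D j) x = 0"
      then have "r \<le> dist c x" using r(2)[of x] x by auto
      then show False using x by (simp add: dist_norm norm_minus_commute)
    qed
  qed
qed

text \<open>The exponential map makes the punctured disc of radius \<open>exp L\<close> around
  \<open>c\<close> accessible from a convex domain; \<open>\<sigma>\<close> turns the disc so that
  real \<open>w\<close> correspond to the chosen side of \<open>c\<close>.\<close>

lemma separated_half_plane:
  assumes "\<And>j x. 0 < norm (x - c) \<Longrightarrow> norm (x - c) < exp L \<Longrightarrow> poly (D j) x \<noteq> 0" and \<sigma>: "norm \<sigma> = 1"
  shows "separated_roots (E j) (D j) {w. Re w < L} (\<lambda>w. c + \<sigma> * exp w)"
proof
  show "open {w. Re w < L}" by (rule open_halfspace_Re_lt)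
  show "convex {w. Re w < L}" by (rule convex_halfspace_Re_lt)
  have "of_real (L - 1) \<in> {w. Re w < L}" by simp
  then show "{w. Re w < L} \<noteq> {}" by blast
  show "(\<lambda>w. c + \<sigma> * exp w) holomorphic_on {w. Re w < L}" by (intro holomorphic_intros)
  show "poly (D j) (c + \<sigma> * exp w) \<noteq> 0" if "w \<in> {w. Re w < L}" for w
    using that \<sigma> by (intro assms(1)) (auto simp: norm_mult)
qed (use lead simple deg finr in auto)

text \<open>Through each point of the sequence passes a tuple of root functions, one for each
  coordinate. There are only finitely many such tuples, so infinitely many points of the sequence
  lie on a single one.\<close>

lemma branch_log:
  assumes x0: "x0 \<in> A" and s: "\<And>l. s l \<in> A" "s \<longlonglongrightarrow> x0" and \<sigma>: "\<sigma> = 1 \<or> \<sigma> = - 1"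
    and pos: "\<And>l::nat. 0 < \<sigma> * (s l $ i0 - x0 $ i0)"
  obtains L g \<phi> m where "strict_mono (\<phi> :: nat \<Rightarrow> nat)" "(0::nat) < m"
    "\<And>j x. 0 < norm (x - of_real (x0 $ i0)) \<Longrightarrow> norm (x - of_real (x0 $ i0)) < exp L \<Longrightarrow> poly (D j) x \<noteq> 0"
    "\<And>j. g j holomorphic_on {w. Re w < L}"
    "\<And>j w. Re w < L \<Longrightarrow> biv (E j) (of_real (x0 $ i0) + of_real \<sigma> * exp w) (g j w) = 0"
    "\<And>j w. Re w < L \<Longrightarrow> g j (w + of_nat m * (2 * of_real pi * \<i>)) = g j w"
    "\<And>i. 0 < i \<Longrightarrow> i < m \<Longrightarrow> \<exists>j w. Re w < L \<and> g j (w + of_nat i * (2 * of_real pi * \<i>)) \<noteq> g j w"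
    "\<And>l. ln (\<sigma> * (s (\<phi> l) $ i0 - x0 $ i0)) < L"
    "\<And>l j. g j (of_real (ln (\<sigma> * (s (\<phi> l) $ i0 - x0 $ i0)))) = of_real (s (\<phi> l) $ j)"
proof -
  define c where "c = x0 $ i0"
  define T where "T = 2 * complex_of_real pi * \<i>"
  obtain r where r: "0 < r" "\<And>j x. 0 < norm (x - complex_of_real c) \<Longrightarrow> norm (x - of_real c) < r \<Longrightarrow> poly (D j) x \<noteq> 0"
    by (rule good_radius_exists[of "complex_of_real c"]) (rule that)
  define L where "L = ln r"
  have eL: "exp L = r" using r(1) by (simp add: L_def)
  define H where "H = {w. Re w < L}"
  define e where "e w = complex_of_real c + of_real \<sigma> * exp w" for w
  have sep: "separated_roots (E j) (D j) H e" for j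
    unfolding H_def e_def using \<sigma> r(2) by (intro separated_half_plane) (auto simp: eL)
  have "(\<lambda>l. s l $ i0) \<longlonglongrightarrow> c" unfolding c_def by (intro tendsto_intros s(2))
  then have "\<forall>\<^sub>F l in sequentially. dist (s l $ i0) c < r" by (rule tendstoD[OF _ r(1)])
  then obtain N where N: "\<And>l. N \<le> l \<Longrightarrow> dist (s l $ i0) c < r" by (auto simp: eventually_sequentially)
  define w where "w l = complex_of_real (ln (\<sigma> * (s l $ i0 - c)))" for l
  have wH: "w l \<in> H" if "N \<le> l" for l
  proof -
    have "\<sigma> * (s l $ i0 - c) < r" using N[OF that] \<sigma> by (auto simp: dist_real_def)
    moreover have "0 < \<sigma> * (s l $ i0 - c)" using pos[of l] by (simp add: c_def)
    ultimately show ?thesis by (simp add: w_def H_def L_def)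
  qed
  have ew: "e (w l) = of_real (s l $ i0)" for l
  proof -
    have "exp (w l) = of_real (\<sigma> * (s l $ i0 - c))"
      unfolding w_def using pos[of l] by (simp add: exp_of_real c_def del: of_real_mult of_real_diff)
    then show ?thesis using \<sigma> by (auto simp: e_def)
  qed
  have "\<exists>g. separated_roots.root_fun (E j) H e g \<and> g (w l) = of_real (s l $ j)" if "N \<le> l" for j l
  proof -
    have "biv (E j) (e (w l)) (of_real (s l $ j)) = 0"
      using van[of j] s(1)[of l] by (simp add: vanishing_def ew)
    then show ?thesis by (rule separated_roots.root_fun_exists[OF sep wH[OF that]]) blast
  qed
  note ex_root = this
  define G where "G j l = (SOME g. separated_roots.root_fun (E j) H e g \<and> g (w l) = of_real (s l $ j))" for j l
  have G: "separated_roots.root_fun (E j) H e (G j l)" "G j l (w l) = of_real (s l $ j)" if "N \<le> l" for j l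
    using someI_ex[OF ex_root[OF that, of j]] by (simp_all add: G_def)
  \<comment> \<open>A root function is determined by its value at one point, so the tuples are
    counted by their values at this base point.\<close>
  define w0 where "w0 = complex_of_real (L - 1)"
  have w0: "w0 \<in> H" by (simp add: w0_def H_def)
  have "(\<lambda>l. \<lambda>j. G j l w0) ` {N..} \<subseteq> PiE UNIV (\<lambda>j. {y. biv (E j) (e w0) y = 0})"
    using G(1) w0 separated_roots.root_fun_def[OF sep] by auto
  then have "finite ((\<lambda>l. \<lambda>j. G j l w0) ` {N..})"
    by (rule finite_subset) (use finr in \<open>auto intro!: finite_PiE\<close>)
  then obtain l0 where l0: "l0 \<in> {N..}" "infinite {l \<in> {N..}. (\<lambda>j. G j l w0) = (\<lambda>j. G j l0 w0)}"
    using pigeonhole_infinite[OF infinite_Ici[of N]] by blast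
  obtain \<phi> :: "nat \<Rightarrow> nat" where \<phi>: "strict_mono \<phi>" "\<And>n. \<phi> n \<in> {l \<in> {N..}. (\<lambda>j. G j l w0) = (\<lambda>j. G j l0 w0)}"
    using infinite_enumerate[OF l0(2)] by blast
  define g where "g j = G j l0" for j
  have rg: "separated_roots.root_fun (E j) H e (g j)" for j unfolding g_def using l0 G(1) by auto
  have gs: "g j (w (\<phi> l)) = of_real (s (\<phi> l) $ j)" for j l
  proof -
    have l: "N \<le> \<phi> l" "G j (\<phi> l) w0 = g j w0" using \<phi>(2)[of l] by (auto simp: g_def dest: fun_cong)
    have "G j (\<phi> l) (w (\<phi> l)) = g j (w (\<phi> l))"
      by (rule separated_roots.root_fun_unique[OF sep G(1)[OF l(1)] rg w0 l(2) wH[OF l(1)]])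
    then show ?thesis using G(2)[OF l(1)] by simp
  qed
  have TH: "v \<in> H \<longleftrightarrow> v + of_nat n * T \<in> H" for v n by (simp add: H_def T_def)
  have Te: "e (v + T) = e v" for v by (simp add: e_def T_def exp_add)
  have "\<exists>M>0. \<forall>v\<in>H. g j (v + of_nat M * T) = g j v" for j
    by (rule separated_roots.root_fun_period[OF sep rg, of T]) (use TH[of _ 1] Te in auto)
  then obtain M :: "'a \<Rightarrow> nat" where M: "\<And>j. 0 < M j" "\<And>j v. v \<in> H \<Longrightarrow> g j (v + of_nat (M j) * T) = g j v" by metis
  have Mmult: "g j (v + of_nat (n * M j) * T) = g j v" if "v \<in> H" for j v n
    using that
  proof (induction n)
    case (Suc n)
    have "v + of_nat (Suc n * M j) * T = (v + of_nat (n * M j) * T) + of_nat (M j) * T" by (simp add: algebra_simps)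
    then have "g j (v + of_nat (Suc n * M j) * T) = g j ((v + of_nat (n * M j) * T) + of_nat (M j) * T)" by (rule arg_cong)
    also have "\<dots> = g j (v + of_nat (n * M j) * T)" by (rule M(2)) (use TH Suc.prems in blast)
    finally show ?case using Suc by simp
  qed simp
  \<comment> \<open>The period must be common to all coordinates. Its minimality says that no
    smaller number of turns fixes the whole tuple, which later makes the branch injective.\<close>
  define Q where "Q m \<longleftrightarrow> 0 < m \<and> (\<forall>j. \<forall>v\<in>H. g j (v + of_nat m * T) = g j v)" for m :: nat
  have "Q (\<Prod>j\<in>UNIV. M j)" unfolding Q_def
  proof (intro conjI allI ballI)
    show "0 < (\<Prod>j\<in>UNIV. M j)" using M(1) by (intro prod_pos) auto
    fix j v assume "v \<in> H"
    have "(\<Prod>j\<in>UNIV. M j) = (\<Prod>j\<in>UNIV - {j}. M j) * M j" by (simp add: prod.remove mult.commute)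
    then show "g j (v + of_nat (\<Prod>j\<in>UNIV. M j) * T) = g j v" using Mmult[OF \<open>v \<in> H\<close>] by metis
  qed
  define m where "m = (LEAST m. Q m)"
  have Qm: "Q m" unfolding m_def by (rule LeastI) fact
  have notQ: "\<not> Q i" if "i < m" for i using that not_less_Least unfolding m_def by blast
  show ?thesis
  proof (rule that[of \<phi> m L g])
    show "strict_mono \<phi>" by fact
    show "0 < m" using Qm by (simp add: Q_def)
    show "poly (D j) x \<noteq> 0" if "0 < norm (x - of_real (x0 $ i0))" "norm (x - of_real (x0 $ i0)) < exp L" for j x
      using r(2) that by (simp add: eL c_def)
    show "g j holomorphic_on {w. Re w < L}" for j
      using separated_roots.root_fun_holomorphic[OF sep rg] by (simp add: H_def)
    show "biv (E j) (of_real (x0 $ i0) + of_real \<sigma> * exp w) (g j w) = 0" if "Re w < L" for j w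
      using rg[of j] that separated_roots.root_fun_def[OF sep] by (simp add: H_def e_def c_def)
    show "g j (w + of_nat m * (2 * of_real pi * \<i>)) = g j w" if "Re w < L" for j w
      using Qm that by (simp add: Q_def H_def T_def)
    show "\<exists>j w. Re w < L \<and> g j (w + of_nat i * (2 * of_real pi * \<i>)) \<noteq> g j w" if "0 < i" "i < m" for i
      using notQ[OF that(2)] that(1) by (auto simp: Q_def H_def T_def)
    show "ln (\<sigma> * (s (\<phi> l) $ i0 - x0 $ i0)) < L" for l
      using wH[of "\<phi> l"] \<phi>(2)[of l] by (simp add: w_def H_def c_def)
    show "g j (of_real (ln (\<sigma> * (s (\<phi> l) $ i0 - x0 $ i0)))) = of_real (s (\<phi> l) $ j)" for l j
      using gs by (simp add: w_def c_def)
  qed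
qed

end

text \<open>For \<open>norm y > 1\<close> the equation is divided by a power of \<open>y\<close>.
  Thus a root can become large only where the leading coefficient is small, which limits the
  singularity of a branch at its centre to a pole.\<close>

lemma root_bound:
  fixes E :: "complex poly poly"
  assumes "biv E x y = 0" "0 < degree E"
  shows "norm (poly (lead_coeff E) x * y) \<le> (\<Sum>i\<le>degree E. norm (poly (coeff E i) x))"
proof (cases "norm y \<le> 1")
  case True
  have "norm (poly (lead_coeff E) x * y) \<le> norm (poly (lead_coeff E) x)"
    using True by (simp add: norm_mult mult_left_le)
  also have "\<dots> \<le> (\<Sum>i\<le>degree E. norm (poly (coeff E i) x))"
    by (rule member_le_sum) auto
  finally show ?thesis .
next
  case False
  then have y: "1 < norm y" by simp
  obtain k where k: "degree E = Suc k" using assms(2) by (metis gr0_implies_Suc)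
  have "biv E x y = (\<Sum>i\<le>degree E. poly (coeff E i) x * y ^ i)"
  proof -
    have deg: "degree (map_poly (\<lambda>c. poly c x) E) \<le> degree E"
      by (rule degree_le) (auto simp: coeff_map_poly coeff_eq_0)
    show ?thesis unfolding biv_altdef poly_altdef[of "map_poly (\<lambda>c. poly c x) E"]
    proof (rule sum.mono_neutral_cong_left)
      show "\<forall>i\<in>{..degree E} - {..degree (map_poly (\<lambda>c. poly c x) E)}. poly (coeff E i) x * y ^ i = 0"
      proof
        fix i assume "i \<in> {..degree E} - {..degree (map_poly (\<lambda>c. poly c x) E)}"
        then have "coeff (map_poly (\<lambda>c. poly c x) E) i = 0" by (intro coeff_eq_0) auto
        then show "poly (coeff E i) x * y ^ i = 0" by (simp add: coeff_map_poly)
      qed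
    qed (use deg in \<open>auto simp: coeff_map_poly\<close>)
  qed
  then have "poly (lead_coeff E) x * y ^ Suc k = - (\<Sum>i\<le>k. poly (coeff E i) x * y ^ i)"
    using assms(1) by (simp add: k eq_neg_iff_add_eq_0 add.commute del: power_Suc)
  then have "norm (poly (lead_coeff E) x * y) * norm y ^ k = norm (\<Sum>i\<le>k. poly (coeff E i) x * y ^ i)"
    by (simp add: norm_mult norm_power mult_ac) (metis norm_minus_cancel norm_mult norm_power)
  also have "\<dots> \<le> (\<Sum>i\<le>k. norm (poly (coeff E i) x) * norm y ^ k)"
    by (rule order_trans[OF norm_sum sum_mono])
      (use y in \<open>auto simp: norm_mult norm_power intro!: mult_left_mono power_increasing\<close>)
  also have "\<dots> = (\<Sum>i\<le>k. norm (poly (coeff E i) x)) * norm y ^ k" by (simp add: sum_distrib_right)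
  finally have "norm (poly (lead_coeff E) x * y) \<le> (\<Sum>i\<le>k. norm (poly (coeff E i) x))"
    using y by (smt (verit) mult_le_cancel_right_pos zero_less_power)
  also have "\<dots> \<le> (\<Sum>i\<le>degree E. norm (poly (coeff E i) x))" by (rule sum_mono2) (auto simp: k)
  finally show ?thesis .
qed

lemma isolated_zero_at_centre:
  fixes f :: "complex \<Rightarrow> complex"
  assumes hol: "f holomorphic_on ball 0 \<rho>" and z: "z \<in> ball 0 \<rho>" "f z \<noteq> 0"
  obtains \<delta> where "0 < \<delta>" "\<And>t. 0 < norm t \<Longrightarrow> norm t < \<delta> \<Longrightarrow> f t \<noteq> 0"
proof (rule ccontr)
  assume none: "\<not> thesis"
  have "\<exists>t. 0 < norm t \<and> norm t < inverse (real (Suc n)) \<and> f t = 0" for n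
  proof (rule ccontr)
    assume "\<not> ?thesis"
    then show False using none that[of "inverse (real (Suc n))"] by auto
  qed
  then obtain t where t: "\<And>n. 0 < norm (t n)" "\<And>n. norm (t n) < inverse (real (Suc n))" "\<And>n. f (t n) = 0"
    by metis
  have "t \<longlonglongrightarrow> 0"
    by (rule Lim_null_comparison[OF _ LIMSEQ_inverse_real_of_nat])
      (use t(2) in \<open>auto intro!: always_eventually less_imp_le\<close>)
  then have "f z = 0"
    by (rule identity_by_sequence[OF hol]) (use t z in auto)
  with z show False by simp
qed

lemma root_of_unity_multiple:
  fixes t t' :: complex
  assumes "t ^ m = t' ^ m" "0 < m" "t \<noteq> 0"
  obtains i where "i < m" "t' = exp (2 * of_real pi * \<i> * of_nat i / of_nat m) * t"
proof -
  have "(t' / t) ^ m = 1" by (simp add: power_divide assms(1)[symmetric] assms(3))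
  then have "t' / t \<in> {z. z ^ m = 1}" by simp
  also have "{z. z ^ m = 1} = {exp (2 * of_real pi * \<i> * of_nat j / of_nat m) |j. j < m}"
    using assms(2) by (intro complex_roots_unity) auto
  finally obtain i where "i < m" "t' / t = exp (2 * of_real pi * \<i> * of_nat i / of_nat m)" by blast
  then show ?thesis using assms(3) by (intro that[of i]) (auto simp: field_simps)
qed

context curve_eqs
begin

lemma periodic_multiple:
  fixes g :: "complex \<Rightarrow> complex"
  assumes per: "\<And>w. Re w < L \<Longrightarrow> g (w + T) = g w" and T: "Re T = 0" and w: "Re w < L"
  shows "g (w + of_int n * T) = g w"
proof -
  have nat: "g (v + of_nat k * T) = g v" if "Re v < L" for v k
    using that
  proof (induction k)
    case (Suc k)
    have "v + of_nat (Suc k) * T = (v + of_nat k * T) + T" by (simp add: algebra_simps)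
    then have "g (v + of_nat (Suc k) * T) = g ((v + of_nat k * T) + T)" by (rule arg_cong)
    also have "\<dots> = g (v + of_nat k * T)" by (rule per) (use Suc.prems T in simp)
    finally show ?case using Suc by simp
  qed simp
  show ?thesis
  proof (cases n rule: int_cases2)
    case (nonneg k)
    then show ?thesis using nat[OF w] by simp
  next
    case (nonpos k)
    have "Re (w - of_nat k * T) < L" using w T by simp
    from nat[OF this, of k] show ?thesis using nonpos by simp
  qed
qed

text \<open>A root function \<open>g\<close> of period \<open>2\<pi>im\<close> on the half plane becomes a function of \<open>t = e\<^sup>w\<^sup>/\<^sup>m\<close> on
  a disc; along a bounded sequence its singularity at \<open>0\<close> is removable.\<close>

lemma branch_disc:
  assumes m: "0 < m" and \<sigma>: "\<sigma> = 1 \<or> \<sigma> = - 1"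
    and good: "\<And>x. 0 < norm (x - of_real c) \<Longrightarrow> norm (x - of_real c) < exp L \<Longrightarrow> poly (D j) x \<noteq> 0"
    and g: "g holomorphic_on {w. Re w < L}"
    and root: "\<And>w. Re w < L \<Longrightarrow> biv (E j) (of_real c + of_real \<sigma> * exp w) (g w) = 0"
    and per: "\<And>w. Re w < L \<Longrightarrow> g (w + of_nat m * (2 * of_real pi * \<i>)) = g w"
    and w: "\<And>l::nat. w l < L" "w0 \<longlonglongrightarrow> 0" "\<And>l. w0 l = exp (w l / m)"
    and lim: "(\<lambda>l. g (of_real (w l))) \<longlonglongrightarrow> y"
  obtains \<gamma> where "\<gamma> holomorphic_on ball 0 (exp (L / m))" "\<gamma> 0 = y"
    "\<And>v. Re v < L / m \<Longrightarrow> \<gamma> (exp v) = g (of_nat m * v)"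
proof -
  define \<rho> where "\<rho> = exp (L / m)"
  have \<rho>: "0 < \<rho>" by (simp add: \<rho>_def)
  \<comment> \<open>The jump of \<open>Ln\<close> across its cut is \<open>2 * pi * \<i>\<close>,
    and \<open>m\<close> times this is a period of \<open>g\<close>; so \<open>f\<close> is
    independent of the choice of logarithm, as \<open>key\<close> states.\<close>
  define f where "f t = g (of_nat m * Ln t)" for t
  have Lm: "Re (of_nat m * v) < L \<longleftrightarrow> Re v < L / m" for v using m by (simp add: field_simps)
  have key: "f (exp v) = g (of_nat m * v)" if v: "Re v < L / m" for v
  proof -
    have "exp (Ln (exp v)) = exp v" by simp
    then obtain n :: int where n: "Ln (exp v) = v + (of_int (2 * n) * pi) * \<i>" using exp_eq by blast
    have "of_nat m * Ln (exp v) = of_nat m * v + of_int n * (of_nat m * (2 * of_real pi * \<i>))"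
      unfolding n by (simp add: algebra_simps)
    then show ?thesis unfolding f_def
      using periodic_multiple[where g = g and L = L and T = "of_nat m * (2 * of_real pi * \<i>)", OF per, of "of_nat m * v" n] v Lm by simp
  qed
  have Re_Ln_lt: "Re (Ln t) < L / m" if "t \<in> ball 0 \<rho> - {0}" for t :: complex
  proof -
    have "ln (norm t) < ln \<rho>" using that \<rho> by (subst ln_less_cancel_iff) auto
    then show ?thesis using that by (simp add: \<rho>_def)
  qed
  have opn: "open (ball 0 \<rho> - {0 :: complex})" by auto
  have holf: "f holomorphic_on (ball 0 \<rho> - {0})"
    unfolding holomorphic_on_def
  proof
    fix t0 :: complex assume t0: "t0 \<in> ball 0 \<rho> - {0}"
    define S where "S = ball t0 (norm t0) \<inter> (ball 0 \<rho> - {0})"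
    have S: "open S" "t0 \<in> S" using t0 by (auto simp: S_def)
    \<comment> \<open>A logarithm that is holomorphic near \<open>t0\<close> even if
      \<open>t0\<close> lies on the cut of \<open>Ln\<close>.\<close>
    define l where "l t = Ln (t / t0) + Ln t0" for t
    have el: "exp (l t) = t" if "t \<in> S" for t using that t0 by (auto simp: l_def exp_add S_def)
    have notneg: "t / t0 \<notin> \<real>\<^sub>\<le>\<^sub>0" if "t \<in> S" for t
    proof
      assume "t / t0 \<in> \<real>\<^sub>\<le>\<^sub>0"
      then have "Re (t / t0) \<le> 0" by (auto simp: complex_nonpos_Reals_iff)
      then have "1 \<le> Re (1 - t / t0)" by simp
      also have "\<dots> \<le> norm (1 - t / t0)" by (rule complex_Re_le_cmod)
      also have "1 - t / t0 = (t0 - t) / t0" using t0 by (simp add: field_simps)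
      also have "norm \<dots> < 1" using that t0 by (simp add: S_def dist_norm norm_divide)
      finally show False by simp
    qed
    have hl: "(\<lambda>t. of_nat m * l t) holomorphic_on S" unfolding l_def
      using notneg t0 by (intro holomorphic_intros) auto
    have rl: "Re (l t) < L / m" if "t \<in> S" for t
    proof -
      have "exp (Re (l t)) = norm t" using el[OF that] norm_exp_eq_Re[of "l t"] by simp
      also have "\<dots> < exp (L / m)" using that by (simp add: S_def \<rho>_def)
      finally show ?thesis by simp
    qed
    have "(\<lambda>t. g (of_nat m * l t)) holomorphic_on S"
      by (rule holomorphic_on_compose_gen[OF hl g, unfolded o_def]) (use rl Lm in auto)
    moreover have "g (of_nat m * l t) = f t" if "t \<in> S" for t
      using key[OF rl[OF that]] el[OF that] by simp
    ultimately have "f holomorphic_on S" by (rule holomorphic_transform)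
    then have "f field_differentiable at t0" using S holomorphic_on_imp_differentiable_at by blast
    then show "f field_differentiable at t0 within ball 0 \<rho> - {0}" by (rule field_differentiable_at_within)
  qed
  define X where "X t = of_real c + of_real \<sigma> * t ^ m" for t :: complex
  have nX: "norm (X t - of_real c) = norm t ^ m" for t
    using \<sigma> by (auto simp: X_def norm_mult norm_power)
  have \<rho>m: "\<rho> ^ m = exp L" using m by (simp add: \<rho>_def exp_of_nat_mult[symmetric])
  have rootf: "biv (E j) (X t) (f t) = 0" if t: "t \<in> ball 0 \<rho> - {0}" for t
  proof -
    have "exp (of_nat m * Ln t) = t ^ m" using t by (simp add: exp_of_nat_mult)
    then show ?thesis using root[of "of_nat m * Ln t"] Re_Ln_lt[OF t] Lm by (simp add: X_def f_def)
  qed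
  \<comment> \<open>The leading coefficient vanishes at \<open>c\<close> to the order
    \<open>q\<close>, so along \<open>X t\<close> it behaves like \<open>t ^ (m * q)\<close>. By
    \<open>root_bound\<close> this power of \<open>t\<close> makes \<open>f\<close> bounded near
    0.\<close>
  have "\<exists>N B. \<forall>\<^sub>F t in at 0. norm (t ^ N * f t) \<le> B"
  proof -
    define a where "a = lead_coeff (E j)"
    have "a \<noteq> 0" using deg[of j] by (auto simp: a_def)
    then obtain a1 where a1: "a = [:- of_real c, 1:] ^ order (of_real c) a * a1" "\<not> [:- of_real c, 1:] dvd a1"
      using order_decomp by blast
    define q where "q = order (complex_of_real c) a"
    have a1c: "poly a1 (of_real c) \<noteq> 0" using a1(2) by (simp add: poly_eq_0_iff_dvd)
    have aX: "poly a (X t) = (of_real \<sigma> * t ^ m) ^ q * poly a1 (X t)" for t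
      by (subst a1(1)) (simp add: q_def X_def)
    have "compact ((\<lambda>x. \<Sum>i\<le>degree (E j). norm (poly (coeff (E j) i) x)) ` cball (of_real c) (exp L))"
      by (intro compact_continuous_image continuous_intros) auto
    then obtain C where C0: "\<forall>z\<in>(\<lambda>x. \<Sum>i\<le>degree (E j). norm (poly (coeff (E j) i) x)) ` cball (of_real c) (exp L). norm z \<le> C"
      by (auto dest!: compact_imp_bounded simp only: bounded_iff)
    have C: "(\<Sum>i\<le>degree (E j). norm (poly (coeff (E j) i) x)) \<le> C" if "x \<in> cball (of_real c) (exp L)" for x
      using bspec[OF C0 imageI[OF that]] unfolding real_norm_def by (rule abs_le_D1)
    have "isCont X 0" unfolding X_def by (intro continuous_intros)
    then have "((\<lambda>t. poly a1 (X t)) \<longlongrightarrow> poly a1 (X 0)) (at 0)"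
      by (intro tendsto_intros) (simp add: isCont_def)
    then have "((\<lambda>t. norm (poly a1 (X t))) \<longlongrightarrow> norm (poly a1 (X 0))) (at 0)" by (rule tendsto_norm)
    moreover have "X 0 = of_real c" using m by (simp add: X_def)
    ultimately have "\<forall>\<^sub>F t in at 0. norm (poly a1 (of_real c)) / 2 < norm (poly a1 (X t))"
      using a1c by (intro order_tendstoD) auto
    moreover have "\<forall>\<^sub>F t in at 0. t \<in> ball 0 \<rho> - {0 :: complex}"
      using \<rho> by (intro eventually_at_in_open) auto
    ultimately have "\<forall>\<^sub>F t in at 0. norm (t ^ (m * q) * f t) \<le> 2 * C / norm (poly a1 (of_real c))"
    proof eventually_elim
      case (elim t)
      have "norm (X t - of_real c) < \<rho> ^ m" unfolding nX using elim m by (intro power_strict_mono) auto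
      then have "X t \<in> cball (of_real c) (exp L)" by (simp add: \<rho>m dist_norm norm_minus_commute)
      then have "norm (poly a (X t) * f t) \<le> C"
        using root_bound[OF rootf[OF elim(2)] deg] C[of "X t"] by (simp add: a_def)
      then have "norm (t ^ (m * q) * f t) * norm (poly a1 (X t)) \<le> C"
        unfolding aX using \<sigma> by (auto simp: norm_mult norm_power power_mult_distrib power_mult mult_ac)
      moreover have "norm (t ^ (m * q) * f t) * (norm (poly a1 (of_real c)) / 2) \<le> norm (t ^ (m * q) * f t) * norm (poly a1 (X t))"
        using elim(1) by (intro mult_left_mono) auto
      ultimately have "norm (t ^ (m * q) * f t) * (norm (poly a1 (of_real c)) / 2) \<le> C" by linarith
      then show ?case using a1c by (simp add: field_simps)
    qed
    then show ?thesis by blast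
  qed
  then obtain N B where NB: "\<forall>\<^sub>F t in at 0. norm (t ^ N * f t) \<le> B" by blast
  define tl where "tl l = complex_of_real (w0 l)" for l
  have tl: "tl \<longlonglongrightarrow> 0" "\<And>l. tl l \<noteq> 0" using w(2,3) tendsto_of_real[OF w(2)] by (auto simp: tl_def[abs_def])
  have "f (tl l) = g (of_real (w l))" for l
  proof -
    have "tl l = exp (of_real (w l / m))" by (simp only: tl_def w(3) exp_of_real)
    then have "f (tl l) = g (of_nat m * of_real (w l / m))" using key[of "of_real (w l / m)"] w(1)[of l] m
      by (simp add: divide_strict_right_mono)
    then show ?thesis using m by simp
  qed
  then have limf: "(\<lambda>l. f (tl l)) \<longlonglongrightarrow> y" using lim by simp
  obtain \<gamma> where \<gamma>: "\<gamma> holomorphic_on ball 0 \<rho>" "\<And>z. z \<in> ball 0 \<rho> - {0} \<Longrightarrow> \<gamma> z = f z" "\<gamma> 0 = y"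
    by (rule extend_by_sequence[OF holf \<rho> NB tl limf]) (rule that)
  show ?thesis
  proof (rule that[of \<gamma>])
    show "\<gamma> holomorphic_on ball 0 (exp (L / m))" using \<gamma>(1) by (simp add: \<rho>_def)
    show "\<gamma> 0 = y" by fact
    fix v :: complex assume v: "Re v < L / m"
    then have "exp v \<in> ball 0 \<rho> - {0}" by (simp add: \<rho>_def)
    then show "\<gamma> (exp v) = g (of_nat m * v)" using \<gamma>(2) key[OF v] by simp
  qed
qed

end

text \<open>Schwarz reflection: \<open>f\<close> and its conjugate reflection agree along the
  sequence, hence on the whole disc.\<close>

lemma holomorphic_real_along_sequence:
  fixes f :: "complex \<Rightarrow> complex"
  assumes hol: "f holomorphic_on ball 0 \<rho>" and t: "t \<longlonglongrightarrow> 0" "\<And>l::nat. t l \<noteq> (0::real)"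
    and real: "\<And>l. f (of_real (t l)) \<in> \<real>" and x: "\<bar>x\<bar> < \<rho>"
  shows "f (of_real x) \<in> \<real>"
proof -
  have "(cnj \<circ> f \<circ> cnj) holomorphic_on ball 0 \<rho>"
  proof (rule holomorphic_on_compose_cnj_cnj)
    have "cnj ` ball 0 \<rho> \<subseteq> ball 0 \<rho>" by auto
    then show "f holomorphic_on cnj ` ball 0 \<rho>" using hol holomorphic_on_subset by blast
  qed simp
  then have h: "(\<lambda>z. cnj (f (cnj z)) - f z) holomorphic_on ball 0 \<rho>"
    unfolding o_def by (intro holomorphic_intros hol)
  have "cnj (f (cnj (of_real x))) - f (of_real x) = 0"
  proof (rule identity_by_sequence[OF h, of "\<lambda>l. of_real (t l)"])
    show "(\<lambda>l. complex_of_real (t l)) \<longlonglongrightarrow> 0" using tendsto_of_real[OF t(1)] by simp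
    show "\<forall>\<^sub>F l in sequentially. cnj (f (cnj (of_real (t l)))) - f (of_real (t l)) = 0"
      using real by (intro always_eventually) (auto simp: Reals_cnj_iff)
  qed (use t x in auto)
  then show ?thesis by (simp add: Reals_cnj_iff)
qed

section \<open>Puiseux branches with a real arc inside the curve\<close>

context curve_eqs
begin

text \<open>The part of \<open>A\<close> on the arc between \<open>ta\<close> and \<open>tc\<close>
  is closed in \<open>A\<close>. It is also open in \<open>A\<close>: its end points are not in
  \<open>A\<close>, and near an interior point of the arc the separated roots leave \<open>A\<close>
  no room beside the arc. Being nonempty and without \<open>x0\<close>, it would disconnect
  \<open>A\<close>.\<close>

lemma arc_connected_in_A:
  fixes \<beta> :: "real \<Rightarrow> real ^ 'a"
  assumes x0: "x0 \<in> A" and m: "0 < m" and \<sigma>: "\<sigma> = 1 \<or> \<sigma> = - 1"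
    and cont: "continuous_on {0<..<\<rho>} \<beta>"
    and i0: "\<And>t. t \<in> {0<..<\<rho>} \<Longrightarrow> \<beta> t $ i0 = x0 $ i0 + \<sigma> * t ^ m"
    and good: "\<And>j t. t \<in> {0<..<\<rho>} \<Longrightarrow> poly (D j) (of_real (\<beta> t $ i0)) \<noteq> 0"
    and root: "\<And>j t. t \<in> {0<..<\<rho>} \<Longrightarrow> biv (E j) (of_real (\<beta> t $ i0)) (of_real (\<beta> t $ j)) = 0"
    and t: "0 < ta" "ta < tb" "tb < tc" "tc < \<rho>" and A: "\<beta> ta \<notin> A" "\<beta> tb \<in> A" "\<beta> tc \<notin> A"
  shows False
proof -
  define K where "K = A \<inter> \<beta> ` {ta..tc}"
  have "compact (\<beta> ` {ta..tc})"
    using t by (intro compact_continuous_image continuous_on_subset[OF cont]) auto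
  then have cl: "closedin (top_of_set A) K" unfolding K_def
    by (intro closedin_closed_Int compact_imp_closed)
  have "\<exists>U. open U \<and> a \<in> U \<and> A \<inter> U \<subseteq> K" if a: "a \<in> K" for a
  proof -
    obtain t where t1: "t \<in> {ta..tc}" "a = \<beta> t" "a \<in> A" using a by (auto simp: K_def)
    then have t2: "ta < t" "t < tc" using A by (auto simp: less_eq_real_def)
    have tin: "t \<in> {0<..<\<rho>}" using t t2 by auto
    \<comment> \<open>Recovers the parameter of a point from its \<open>i0\<close>-th
      coordinate.\<close>
    define \<tau> where "\<tau> b = root m (\<sigma> * (b $ i0 - x0 $ i0))" for b :: "real ^ 'a"
    have \<sigma>\<sigma>: "\<sigma> * (\<sigma> * u) = u" for u using \<sigma> by auto
    have \<tau>a: "\<tau> a = t" using i0[OF tin] t2 t(1) m by (simp add: \<tau>_def t1(2) \<sigma>\<sigma> real_root_power_cancel)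
    have cont\<tau>: "isCont \<tau> a" unfolding \<tau>_def by (intro continuous_intros)
    have "isCont \<beta> (\<tau> a)" using cont tin \<tau>a by (simp add: continuous_on_eq_continuous_at)
    then have cont\<beta>\<tau>: "isCont (\<lambda>b. \<beta> (\<tau> b)) a" using cont\<tau> by (rule isCont_o2[rotated])
    have "\<exists>\<eta>>0. \<forall>x y y'. x \<in> ball (of_real (a $ i0)) \<eta> \<longrightarrow> y \<in> ball (of_real (a $ j)) \<eta> \<longrightarrow> y' \<in> ball (of_real (a $ j)) \<eta> \<longrightarrow>
        biv (E j) x y = 0 \<longrightarrow> biv (E j) x y' = 0 \<longrightarrow> y = y'" for j
    proof -
      \<comment> \<open>Uniqueness of nearby roots does not involve the half plane or the map, so
        any instance of the locale gives access to it.\<close>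
      obtain r where r: "0 < r" "\<And>j x. 0 < norm (x - 0) \<Longrightarrow> norm (x - 0) < r \<Longrightarrow> poly (D j) x \<noteq> 0"
        by (rule good_radius_exists[of 0]) (rule that)
      have sep: "separated_roots (E j) (D j) {w. Re w < ln r} (\<lambda>w. 0 + 1 * exp w)"
        by (rule separated_half_plane) (use r in auto)
      show ?thesis
        by (rule separated_roots.root_unique[OF sep good[OF tin] root[OF tin]]) (unfold t1(2), blast)
    qed
    then obtain \<eta> where \<eta>: "\<And>j. 0 < \<eta> j" "\<And>j x y y'. x \<in> ball (of_real (a $ i0)) (\<eta> j) \<Longrightarrow> y \<in> ball (of_real (a $ j)) (\<eta> j) \<Longrightarrow>
        y' \<in> ball (of_real (a $ j)) (\<eta> j) \<Longrightarrow> biv (E j) x y = 0 \<Longrightarrow> biv (E j) x y' = 0 \<Longrightarrow> y = y'" by metis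
    have ev: "\<forall>\<^sub>F b in nhds a. \<bar>f b - f a\<bar> < \<epsilon>" if "isCont f a" "0 < \<epsilon>" for f :: "real ^ 'a \<Rightarrow> real" and \<epsilon>
    proof -
      have "(f \<longlongrightarrow> f a) (nhds a)" using that(1) by (simp add: isCont_def tendsto_at_iff_tendsto_nhds)
      from tendstoD[OF this that(2)] show ?thesis by (simp add: dist_real_def)
    qed
    have ci: "isCont (\<lambda>b :: real ^ 'a. b $ i) a" for i by (intro continuous_intros)
    have cb: "isCont (\<lambda>b. \<beta> (\<tau> b) $ i) a" for i by (intro continuous_intros cont\<beta>\<tau>)
    define \<epsilon> where "\<epsilon> = min (t - ta) (tc - t)"
    have \<epsilon>: "0 < \<epsilon>" using t2 by (simp add: \<epsilon>_def)
    have "a $ i0 - x0 $ i0 \<noteq> 0" using i0[OF tin] tin \<sigma> by (auto simp: t1(2))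
    then have "\<forall>\<^sub>F b in nhds a. \<bar>\<tau> b - \<tau> a\<bar> < \<epsilon> \<and> \<bar>b $ i0 - a $ i0\<bar> < \<bar>a $ i0 - x0 $ i0\<bar> \<and>
        (\<forall>j. \<bar>b $ i0 - a $ i0\<bar> < \<eta> j \<and> \<bar>b $ j - a $ j\<bar> < \<eta> j \<and> \<bar>\<beta> (\<tau> b) $ j - \<beta> (\<tau> a) $ j\<bar> < \<eta> j)"
      by (intro eventually_conj eventually_all_finite ev cont\<tau> ci cb \<epsilon> \<eta>(1)) auto
    then obtain U where U: "open U" "a \<in> U" and Ub: "\<And>b. b \<in> U \<Longrightarrow> \<bar>\<tau> b - \<tau> a\<bar> < \<epsilon> \<and> \<bar>b $ i0 - a $ i0\<bar> < \<bar>a $ i0 - x0 $ i0\<bar> \<and>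
        (\<forall>j. \<bar>b $ i0 - a $ i0\<bar> < \<eta> j \<and> \<bar>b $ j - a $ j\<bar> < \<eta> j \<and> \<bar>\<beta> (\<tau> b) $ j - \<beta> (\<tau> a) $ j\<bar> < \<eta> j)"
      unfolding eventually_nhds by blast
    have "b \<in> K" if b: "b \<in> A" "b \<in> U" for b
    proof -
      have tb: "\<tau> b \<in> {ta..tc}" using Ub[OF b(2)] \<tau>a by (auto simp: \<epsilon>_def)
      then have tb': "\<tau> b \<in> {0<..<\<rho>}" using t by auto
      have "0 < \<sigma> * (a $ i0 - x0 $ i0)" using i0[OF tin] tin by (simp add: t1(2) \<sigma>\<sigma>)
      then have "0 < \<sigma> * (b $ i0 - x0 $ i0)" using Ub[OF b(2)] \<sigma> by auto
      then have "\<tau> b ^ m = \<sigma> * (b $ i0 - x0 $ i0)" using m by (simp add: \<tau>_def)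
      then have bi0: "\<beta> (\<tau> b) $ i0 = b $ i0" using i0[OF tb'] by (simp add: \<sigma>\<sigma>)
      have "\<beta> (\<tau> b) $ j = b $ j" for j
      proof -
        have r1: "biv (E j) (of_real (b $ i0)) (of_real (b $ j)) = 0" using van[of j] b(1) by (simp add: vanishing_def)
        have r2: "biv (E j) (of_real (b $ i0)) (of_real (\<beta> (\<tau> b) $ j)) = 0" using root[OF tb', of j] bi0 by simp
        have d: "dist u v = \<bar>v - u\<bar>" for u v :: real
          by (simp add: dist_real_def abs_minus_commute)
        have "complex_of_real (\<beta> (\<tau> b) $ j) = of_real (b $ j)"
          by (rule \<eta>(2)[OF _ _ _ r2 r1]) (use Ub[OF b(2)] \<tau>a in \<open>auto simp: d t1(2)\<close>)
        then show ?thesis by simp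
      qed
      then have "b = \<beta> (\<tau> b)" by (simp add: vec_eq_iff)
      then show "b \<in> K" unfolding K_def using b(1) tb by blast
    qed
    then show ?thesis using U by blast
  qed
  note nbhd = this
  have "openin (top_of_set A) K"
  proof (subst openin_subopen, rule ballI)
    fix a assume a: "a \<in> K"
    then obtain U where U: "open U" "a \<in> U" "A \<inter> U \<subseteq> K" using nbhd by blast
    have "a \<in> A" using a by (simp add: K_def)
    then show "\<exists>T. openin (top_of_set A) T \<and> a \<in> T \<and> T \<subseteq> K"
      using U by (intro exI[of _ "A \<inter> U"]) (auto intro: openin_open_Int)
  qed
  then have "K = {} \<or> K = A" using cl conn connected_clopen by blast
  moreover have "\<beta> tb \<in> K" using A t by (auto simp: K_def)
  moreover have "x0 \<notin> K"
  proof
    assume "x0 \<in> K"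
    then obtain s where "s \<in> {ta..tc}" "x0 = \<beta> s" by (auto simp: K_def)
    then show False using i0[of s] t \<sigma> by auto
  qed
  ultimately show False using x0 by blast
qed

text \<open>The disc parametrisation agrees with points of \<open>A\<close> along a sequence of
  parameters tending to 0. The Taylor data, the form of the \<open>i0\<close>-th coordinate and the
  reality on the real axis all follow from this sequence, and connectedness of \<open>A\<close>
  turns the sequence into a whole arc in \<open>A\<close>.\<close>

lemma branch:
  assumes x0: "x0 \<in> A" and s: "\<And>l. s l \<in> A" "s \<longlonglongrightarrow> x0" and \<sigma>: "\<sigma> = 1 \<or> \<sigma> = - 1"
    and pos: "\<And>l::nat. 0 < \<sigma> * (s l $ i0 - x0 $ i0)"
    and W: "\<And>j. (\<lambda>l. (s l $ j - x0 $ j) / (\<sigma> * (s l $ i0 - x0 $ i0))) \<longlonglongrightarrow> W j"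
  obtains m :: nat and \<rho> t1 :: real and \<gamma> :: "complex \<Rightarrow> complex ^ 'a" where
    "0 < m" "0 < t1" "t1 < \<rho>" "\<And>j. (\<lambda>t. \<gamma> t $ j) holomorphic_on ball 0 \<rho>" "\<gamma> 0 = cvec x0"
    "\<And>t. t \<in> ball 0 \<rho> \<Longrightarrow> \<gamma> t $ i0 = of_real (x0 $ i0) + of_real \<sigma> * t ^ m"
    "\<And>j. \<exists>\<psi>. \<psi> holomorphic_on ball 0 \<rho> \<and> (\<forall>t\<in>ball 0 \<rho>. \<gamma> t $ j = of_real (x0 $ j) + t ^ m * \<psi> t) \<and> \<psi> 0 = of_real (W j)"
    "\<And>t. 0 \<le> t \<Longrightarrow> t \<le> t1 \<Longrightarrow> \<exists>a\<in>A. \<gamma> (of_real t) = cvec a" "inj_on \<gamma> (ball 0 \<rho>)"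
proof -
  define c where "c = x0 $ i0"
  define T where "T = 2 * complex_of_real pi * \<i>"
  obtain L g \<phi> m where \<phi>: "strict_mono (\<phi> :: nat \<Rightarrow> nat)" and m: "(0::nat) < m"
    and good: "\<And>j x. 0 < norm (x - of_real c) \<Longrightarrow> norm (x - of_real c) < exp L \<Longrightarrow> poly (D j) x \<noteq> 0"
    and g: "\<And>j. g j holomorphic_on {w. Re w < L}"
    and root: "\<And>j w. Re w < L \<Longrightarrow> biv (E j) (of_real c + of_real \<sigma> * exp w) (g j w) = 0"
    and per: "\<And>j w. Re w < L \<Longrightarrow> g j (w + of_nat m * (2 * of_real pi * \<i>)) = g j w"
    and prim: "\<And>i. 0 < i \<Longrightarrow> i < m \<Longrightarrow> \<exists>j w. Re w < L \<and> g j (w + of_nat i * (2 * of_real pi * \<i>)) \<noteq> g j w"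
    and wL: "\<And>l. ln (\<sigma> * (s (\<phi> l) $ i0 - c)) < L"
    and gs: "\<And>l j. g j (of_real (ln (\<sigma> * (s (\<phi> l) $ i0 - c)))) = of_real (s (\<phi> l) $ j)"
    by (rule branch_log[OF x0 s \<sigma> pos]) (rule that[unfolded c_def])
  define w where "w l = ln (\<sigma> * (s (\<phi> l) $ i0 - c))" for l
  \<comment> \<open>The parameter of the \<open>l\<close>-th point, that is, the positive
    \<open>m\<close>-th root of its signed \<open>i0\<close>-distance from
    \<open>x0\<close>.\<close>
  define tl where "tl l = exp (w l / m)" for l
  define \<rho> where "\<rho> = exp (L / m)"
  have \<rho>: "0 < \<rho>" by (simp add: \<rho>_def)
  have tlm: "tl l ^ m = \<sigma> * (s (\<phi> l) $ i0 - c)" for l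
    using pos[of "\<phi> l"] m by (simp add: tl_def w_def c_def exp_of_nat_mult[symmetric])
  have s\<phi>: "(\<lambda>l. s (\<phi> l)) \<longlonglongrightarrow> x0" using LIMSEQ_subseq_LIMSEQ[OF s(2) \<phi>] by (simp add: o_def)
  have tlpos: "0 < tl l" for l by (simp add: tl_def)
  have tl0: "tl \<longlonglongrightarrow> 0"
  proof -
    have "(\<lambda>l. \<sigma> * (s (\<phi> l) $ i0 - c)) \<longlonglongrightarrow> \<sigma> * (x0 $ i0 - c)" by (intro tendsto_intros s\<phi>)
    then have "(\<lambda>l. tl l ^ m) \<longlonglongrightarrow> 0" by (simp add: tlm c_def)
    then have "(\<lambda>l. root m (tl l ^ m)) \<longlonglongrightarrow> root m 0" by (rule tendsto_real_root)
    then show ?thesis using tlpos m by (simp add: real_root_power_cancel less_imp_le)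
  qed
  have "\<exists>\<gamma>. \<gamma> holomorphic_on ball 0 \<rho> \<and> \<gamma> 0 = of_real (x0 $ j) \<and>
      (\<forall>v. Re v < L / m \<longrightarrow> \<gamma> (exp v) = g j (of_nat m * v))" for j
  proof -
    have "(\<lambda>l. complex_of_real (s (\<phi> l) $ j)) \<longlonglongrightarrow> of_real (x0 $ j)" by (intro tendsto_intros s\<phi>)
    then have lim: "(\<lambda>l. g j (of_real (w l))) \<longlonglongrightarrow> of_real (x0 $ j)" by (simp add: w_def gs)
    show ?thesis unfolding \<rho>_def
      by (rule branch_disc[where j = j and g = "g j" and w = w and ?w0.0 = tl, OF m \<sigma> good g root per]) (use wL tl0 tl_def lim in \<open>auto simp: w_def\<close>)
  qed
  then obtain \<Gamma> where \<Gamma>: "\<And>j. \<Gamma> j holomorphic_on ball 0 \<rho>" "\<And>j. \<Gamma> j 0 = of_real (x0 $ j)"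
    "\<And>j v. Re v < L / m \<Longrightarrow> \<Gamma> j (exp v) = g j (of_nat m * v)" by metis
  have \<Gamma>s: "\<Gamma> j (of_real (tl l)) = of_real (s (\<phi> l) $ j)" for j l
  proof -
    have "\<Gamma> j (exp (of_real (w l / m))) = g j (of_nat m * of_real (w l / m))"
      using wL[of l] m by (intro \<Gamma>(3)) (simp add: w_def divide_strict_right_mono)
    moreover have "exp (of_real (w l / m)) = complex_of_real (tl l)" by (simp only: tl_def exp_of_real)
    ultimately show ?thesis using m gs[of j l] by (simp add: w_def)
  qed
  have tlc: "(\<lambda>l. complex_of_real (tl l)) \<longlonglongrightarrow> 0" "\<And>l. complex_of_real (tl l) \<noteq> 0"
    using tendsto_of_real[OF tl0] tlpos by (auto simp: less_imp_neq[symmetric])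
  have \<Gamma>i0: "\<Gamma> i0 t = of_real c + of_real \<sigma> * t ^ m" if t: "t \<in> ball 0 \<rho>" for t
  proof -
    have "(\<lambda>t. \<Gamma> i0 t - (of_real c + of_real \<sigma> * t ^ m)) holomorphic_on ball 0 \<rho>" by (intro holomorphic_intros \<Gamma>)
    moreover have "\<Gamma> i0 (of_real (tl l)) - (of_real c + of_real \<sigma> * of_real (tl l) ^ m) = 0" for l
    proof -
      have "complex_of_real (tl l) ^ m = of_real (\<sigma> * (s (\<phi> l) $ i0 - c))" by (simp add: tlm[symmetric])
      then show ?thesis using \<sigma> by (auto simp: \<Gamma>s)
    qed
    ultimately have "\<Gamma> i0 t - (of_real c + of_real \<sigma> * t ^ m) = 0"
      by (intro identity_by_sequence[OF _ tlc _ t]) auto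
    then show ?thesis by simp
  qed
  have ord: "\<exists>\<psi>. \<psi> holomorphic_on ball 0 \<rho> \<and> (\<forall>t. \<Gamma> j t = of_real (x0 $ j) + t ^ m * \<psi> t) \<and> \<psi> 0 = of_real (W j)" for j
  proof -
    have "(\<lambda>l. (s (\<phi> l) $ j - x0 $ j) / (\<sigma> * (s (\<phi> l) $ i0 - c))) \<longlonglongrightarrow> W j"
      using LIMSEQ_subseq_LIMSEQ[OF W[of j] \<phi>] by (simp add: o_def c_def)
    then have "(\<lambda>l. complex_of_real ((s (\<phi> l) $ j - x0 $ j) / tl l ^ m)) \<longlonglongrightarrow> of_real (W j)"
      unfolding tlm by (rule tendsto_of_real)
    then have "(\<lambda>l. (\<Gamma> j (of_real (tl l)) - \<Gamma> j 0) / of_real (tl l) ^ m) \<longlonglongrightarrow> of_real (W j)"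
      by (simp add: \<Gamma>s \<Gamma>(2))
    from order_by_sequence[OF \<Gamma>(1) \<rho> tlc this] show ?thesis unfolding \<Gamma>(2) by metis
  qed
  have \<Gamma>root: "biv (E j) (of_real c + of_real \<sigma> * t ^ m) (\<Gamma> j t) = 0" if t: "t \<in> ball 0 \<rho>" "t \<noteq> 0" for j t
  proof -
    have "ln (norm t) < ln \<rho>" using t \<rho> by (subst ln_less_cancel_iff) auto
    then have r: "Re (Ln t) < L / m" using t by (simp add: \<rho>_def)
    then have "\<Gamma> j t = g j (of_nat m * Ln t)" using \<Gamma>(3)[OF r, of j] t by simp
    moreover have "exp (of_nat m * Ln t) = t ^ m" using t by (simp add: exp_of_nat_mult)
    moreover have "Re (of_nat m * Ln t) < L" using r m by (simp add: field_simps)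
    ultimately show ?thesis using root[of "of_nat m * Ln t" j] by simp
  qed
  have \<Gamma>real: "\<Gamma> j (of_real t) \<in> \<real>" if "\<bar>t\<bar> < \<rho>" for j t
    by (rule holomorphic_real_along_sequence[OF \<Gamma>(1) tl0 _ _ that]) (use tlpos \<Gamma>s in \<open>auto simp: less_imp_neq[symmetric]\<close>)
  define \<gamma> where "\<gamma> t = (\<chi> j. \<Gamma> j t)" for t
  define \<beta> where "\<beta> t = (\<chi> j. Re (\<Gamma> j (of_real t)))" for t :: real
  have \<gamma>\<beta>: "\<gamma> (of_real t) = cvec (\<beta> t)" if "\<bar>t\<bar> < \<rho>" for t
    using \<Gamma>real[OF that] by (simp add: vec_eq_iff \<gamma>_def \<beta>_def)
  have \<beta>c: "complex_of_real (\<beta> t $ j) = \<Gamma> j (of_real t)" if "\<bar>t\<bar> < \<rho>" for t j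
    using \<Gamma>real[OF that, of j] by (simp add: \<beta>_def)
  have \<beta>s: "\<beta> (tl l) = s (\<phi> l)" for l by (simp add: vec_eq_iff \<beta>_def \<Gamma>s)
  have \<beta>i0: "\<beta> t $ i0 = x0 $ i0 + \<sigma> * t ^ m" if "\<bar>t\<bar> < \<rho>" for t
    using \<Gamma>i0[of "of_real t"] that by (simp add: \<beta>_def c_def flip: of_real_power)
  have cont\<beta>: "continuous_on {0<..<\<rho>} \<beta>"
  proof -
    have "continuous_on {0<..<\<rho>} (\<lambda>t. \<Gamma> j (of_real t))" for j
      by (rule continuous_on_compose2[OF holomorphic_on_imp_continuous_on[OF \<Gamma>(1)]]) (auto intro!: continuous_intros)
    then show ?thesis unfolding \<beta>_def by (intro continuous_intros)
  qed
  have nobetween: False if "0 < ta" "ta < tb" "tb < tc" "tc < \<rho>" "\<beta> ta \<notin> A" "\<beta> tb \<in> A" "\<beta> tc \<notin> A" for ta tb tc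
  proof (rule arc_connected_in_A[OF x0 m \<sigma> cont\<beta> _ _ _ that])
    show "\<beta> t $ i0 = x0 $ i0 + \<sigma> * t ^ m" if "t \<in> {0<..<\<rho>}" for t using \<beta>i0 that by auto
    fix j t assume t: "t \<in> {0<..<\<rho>}"
    have e: "complex_of_real (\<beta> t $ i0) = of_real c + of_real \<sigma> * of_real t ^ m"
      using \<beta>i0[of t] t by (simp add: c_def)
    show "biv (E j) (of_real (\<beta> t $ i0)) (of_real (\<beta> t $ j)) = 0"
      using \<Gamma>root[of "of_real t" j] \<beta>c[of t j] t unfolding e by simp
    have "\<rho> ^ m = exp L" using m by (simp add: \<rho>_def exp_of_nat_mult[symmetric])
    moreover have "t ^ m < \<rho> ^ m" using t m by (intro power_strict_mono) auto
    ultimately show "poly (D j) (of_real (\<beta> t $ i0)) \<noteq> 0"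
      unfolding e using t \<sigma> by (intro good) (auto simp: norm_mult norm_power)
  qed
  \<comment> \<open>Otherwise the arc leaves \<open>A\<close> at arbitrarily small parameters. Since
    the points at parameters \<open>tl l\<close> belong to \<open>A\<close> and accumulate at 0, one
    of them lies between two parameters outside \<open>A\<close>, contrary to
    \<open>nobetween\<close>.\<close>
  have "\<exists>t1. 0 < t1 \<and> t1 < \<rho> \<and> (\<forall>t\<in>{0<..t1}. \<beta> t \<in> A)"
  proof (rule ccontr)
    assume none: "\<not> ?thesis"
    obtain tc where tc: "0 < tc" "tc < \<rho>" "\<beta> tc \<notin> A" using none \<rho>
      by (metis field_lbound_gt_zero greaterThanAtMost_iff le_less_trans)
    obtain l where l: "tl l < tc"
      using order_tendstoD(2)[OF tl0 tc(1)] by (auto simp: eventually_sequentially)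
    have "tl l < \<rho>" using l tc by simp
    then have "\<exists>t\<in>{0<..tl l}. \<beta> t \<notin> A" using none tlpos[of l] by blast
    then obtain ta where ta: "0 < ta" "ta \<le> tl l" "\<beta> ta \<notin> A" by auto
    have "\<beta> (tl l) \<in> A" using \<beta>s s(1) by simp
    then have "ta < tl l" using ta by (metis order_le_less)
    then show False using nobetween[OF ta(1) _ l tc(2) ta(3) \<open>\<beta> (tl l) \<in> A\<close> tc(3)] by simp
  qed
  then obtain t1 where t1: "0 < t1" "t1 < \<rho>" "\<And>t. t \<in> {0<..t1} \<Longrightarrow> \<beta> t \<in> A" by blast
  define \<zeta> where "\<zeta> i = exp (2 * of_real pi * \<i> * of_nat i / of_nat m)" for i :: nat
  have n\<zeta>: "norm (\<zeta> i) = 1" for i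
    by (simp add: \<zeta>_def)
  \<comment> \<open>Equality of \<open>\<gamma> (\<zeta> i * t)\<close> and
    \<open>\<gamma> t\<close> in all coordinates and for all \<open>t\<close> would mean that
    \<open>i < m\<close> turns are a period. So some coordinate difference is not identically zero,
    and its zeros are isolated from 0 outside 0 itself.\<close>
  have "\<exists>\<delta>>0. \<forall>t. 0 < norm t \<longrightarrow> norm t < \<delta> \<longrightarrow> \<gamma> (\<zeta> i * t) \<noteq> \<gamma> t" if i: "i \<in> {0<..<m}" for i
  proof -
    obtain j v where v: "Re v < L" "g j (v + of_nat i * (2 * of_real pi * \<i>)) \<noteq> g j v" using prim[of i] i by auto
    define d where "d t = \<Gamma> j (\<zeta> i * t) - \<Gamma> j t" for t
    have "(\<lambda>t. \<Gamma> j (\<zeta> i * t)) holomorphic_on ball 0 \<rho>"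
      by (rule holomorphic_on_compose_gen[OF _ \<Gamma>(1), unfolded o_def])
        (auto intro!: holomorphic_intros simp: norm_mult n\<zeta>)
    then have hd: "d holomorphic_on ball 0 \<rho>" unfolding d_def by (intro holomorphic_intros \<Gamma>(1))
    define z where "z = exp (v / of_nat m)"
    have rv: "Re (v / of_nat m) < L / m" using v(1) m by (simp add: divide_strict_right_mono)
    then have "z \<in> ball 0 \<rho>" by (simp add: z_def \<rho>_def)
    have "\<zeta> i * z = exp (v / of_nat m + 2 * of_real pi * \<i> * of_nat i / of_nat m)"
      by (simp add: \<zeta>_def z_def exp_add)
    moreover have "Re (v / of_nat m + 2 * of_real pi * \<i> * of_nat i / of_nat m) < L / m" using rv by simp
    ultimately have "\<Gamma> j (\<zeta> i * z) = g j (of_nat m * (v / of_nat m + 2 * of_real pi * \<i> * of_nat i / of_nat m))"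
      using \<Gamma>(3) by simp
    also have "of_nat m * (v / of_nat m + 2 * of_real pi * \<i> * of_nat i / of_nat m) = v + of_nat i * (2 * of_real pi * \<i>)"
      using m by (simp add: field_simps)
    finally have "d z \<noteq> 0" using v(2) \<Gamma>(3)[OF rv, of j] m by (simp add: d_def z_def)
    from isolated_zero_at_centre[OF hd \<open>z \<in> ball 0 \<rho>\<close> this] obtain \<delta> where
      "0 < \<delta>" "\<And>t. 0 < norm t \<Longrightarrow> norm t < \<delta> \<Longrightarrow> d t \<noteq> 0" by blast
    then show ?thesis by (intro exI[of _ \<delta>]) (auto simp: d_def \<gamma>_def vec_eq_iff)
  qed
  then obtain \<delta> where \<delta>: "\<And>i. i \<in> {0<..<m} \<Longrightarrow> 0 < \<delta> i"
    "\<And>i t. i \<in> {0<..<m} \<Longrightarrow> 0 < norm t \<Longrightarrow> norm t < \<delta> i \<Longrightarrow> \<gamma> (\<zeta> i * t) \<noteq> \<gamma> t" by metis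
  define \<rho>' where "\<rho>' = Min (insert \<rho> (\<delta> ` {0<..<m}))"
  have \<rho>': "0 < \<rho>'" "\<rho>' \<le> \<rho>" "\<And>i. i \<in> {0<..<m} \<Longrightarrow> \<rho>' \<le> \<delta> i"
    unfolding \<rho>'_def using \<delta>(1) \<rho> by (auto simp: Min_gr_iff)
  have sub: "ball 0 \<rho>' \<subseteq> ball (0::complex) \<rho>" using \<rho>'(2) by auto
  show ?thesis
  proof (rule that[of m "min t1 (\<rho>' / 2)" \<rho>' \<gamma>])
    show "0 < m" by fact
    show "0 < min t1 (\<rho>' / 2)" "min t1 (\<rho>' / 2) < \<rho>'" using t1 \<rho>' by auto
    show "(\<lambda>t. \<gamma> t $ j) holomorphic_on ball 0 \<rho>'" for j
      using \<Gamma>(1)[of j] sub by (auto simp: \<gamma>_def intro: holomorphic_on_subset)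
    show "\<gamma> 0 = cvec x0" by (simp add: \<gamma>_def \<Gamma>(2) vec_eq_iff)
    show "\<gamma> t $ i0 = of_real (x0 $ i0) + of_real \<sigma> * t ^ m" if "t \<in> ball 0 \<rho>'" for t
      using \<Gamma>i0[of t] that sub by (auto simp: \<gamma>_def c_def)
    show "\<exists>\<psi>. \<psi> holomorphic_on ball 0 \<rho>' \<and> (\<forall>t\<in>ball 0 \<rho>'. \<gamma> t $ j = of_real (x0 $ j) + t ^ m * \<psi> t) \<and> \<psi> 0 = of_real (W j)" for j
      using ord[of j] sub by (auto simp: \<gamma>_def intro: holomorphic_on_subset)
    show "\<exists>a\<in>A. \<gamma> (of_real t) = cvec a" if t: "0 \<le> t" "t \<le> min t1 (\<rho>' / 2)" for t
    proof (cases "t = 0")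
      case True
      then show ?thesis using x0 by (auto simp: \<gamma>_def \<Gamma>(2) vec_eq_iff)
    next
      case False
      then have "\<beta> t \<in> A" using t t1(3)[of t] by simp
      then show ?thesis using \<gamma>\<beta>[of t] t t1(2) by auto
    qed
    show "inj_on \<gamma> (ball 0 \<rho>')"
    proof (rule inj_onI)
      fix t t' assume t: "t \<in> ball 0 \<rho>'" "t' \<in> ball 0 \<rho>'" "\<gamma> t = \<gamma> t'"
      have "\<Gamma> i0 t = \<Gamma> i0 t'" using t(3) by (simp add: \<gamma>_def vec_eq_iff)
      moreover have "t \<in> ball 0 \<rho>" "t' \<in> ball 0 \<rho>" using t(1,2) sub by blast+
      ultimately have pw: "t ^ m = t' ^ m" using \<Gamma>i0[of t] \<Gamma>i0[of t'] \<sigma> by auto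
      show "t = t'"
      proof (cases "t = 0")
        case True
        then show ?thesis using pw m by (simp add: power_0_left)
      next
        case False
        obtain i where i: "i < m" "t' = \<zeta> i * t"
          by (rule root_of_unity_multiple[OF pw m False]) (rule that[unfolded \<zeta>_def])
        show ?thesis
        proof (cases "i = 0")
          case True
          then show ?thesis using i by (simp add: \<zeta>_def)
        next
          case False
          then have "i \<in> {0<..<m}" using i by simp
          then have "\<gamma> (\<zeta> i * t) \<noteq> \<gamma> t" using \<delta>(2)[of i t] \<rho>'(3)[of i] t(1) \<open>t \<noteq> 0\<close> by auto
          then show ?thesis using t(3) i by simp
        qed
      qed
    qed
  qed
qed

end

subsection \<open>The complex multiplicity\<close>

lemma holomorphic_on_peval:
  fixes \<gamma> :: "complex \<Rightarrow> complex ^ 'n::finite"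
  assumes "\<And>j. (\<lambda>t. \<gamma> t $ j) holomorphic_on S"
  shows "(\<lambda>t. peval p (\<gamma> t)) holomorphic_on S"
  unfolding peval_def by (intro holomorphic_intros assms)

text \<open>With \<open>u\<close> outside \<open>L\<close>, each basis vector is congruent modulo
  \<open>L\<close> to a multiple \<open>\<kappa> j\<close> of \<open>u\<close>; the functional
  measures the component along \<open>u\<close>.\<close>

lemma hyperplane_functional:
  fixes L :: "(complex ^ 'n::finite) set"
  assumes L: "vec.subspace L" "vec.dim L + 1 = CARD('n)"
  obtains \<kappa> where "\<And>z. (\<Sum>j\<in>UNIV. \<kappa> j * z $ j) = 0 \<Longrightarrow> z \<in> L"
proof -
  have "L \<noteq> UNIV" using L(2) vec_dim_card[where 'a = complex and 'n = 'n] by (metis Suc_eq_plus1 n_not_Suc_n)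
  then obtain u where u: "u \<notin> L" by blast
  have "vec.dim (insert u L) = CARD('n)" using L u by (simp add: vec.dim_insert vec.span_eq_iff[THEN iffD2, OF L(1)])
  then have "vec.span (insert u L) = UNIV" using vec.dim_eq_full by (metis vec_dim_card vec.span_UNIV)
  then have "\<exists>k. axis j 1 - k *s u \<in> L" for j
    using vec.span_breakdown_eq[of "axis j 1" u L] L(1) by (metis UNIV_I vec.span_eq_iff)
  then obtain \<kappa> where \<kappa>: "\<And>j. axis j 1 - \<kappa> j *s u \<in> L" by metis
  show ?thesis
  proof (rule that[of \<kappa>])
    fix z :: "complex ^ 'n" assume z: "(\<Sum>j\<in>UNIV. \<kappa> j * z $ j) = 0"
    have "(\<Sum>j\<in>UNIV. z $ j *s (axis j 1 - \<kappa> j *s u)) \<in> L"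
      by (intro vec.subspace_sum vec.subspace_scale L \<kappa>)
    moreover have "(\<Sum>j\<in>UNIV. z $ j *s (axis j 1 - \<kappa> j *s u)) = z"
    proof -
      have "(\<Sum>j\<in>UNIV. z $ j *s (axis j 1 - \<kappa> j *s u)) $ i = z $ i" for i
      proof -
        have "(\<Sum>j\<in>UNIV. z $ j *s (axis j 1 - \<kappa> j *s u)) $ i
            = (\<Sum>j\<in>UNIV. z $ j * axis j 1 $ i) - (\<Sum>j\<in>UNIV. \<kappa> j * z $ j) * u $ i"
        proof -
          have "z $ j * (axis j 1 $ i - \<kappa> j * u $ i) = z $ j * axis j 1 $ i - (\<kappa> j * z $ j) * u $ i" for j
            by (simp add: right_diff_distrib)
          then show ?thesis
            by (simp only: sum_component vector_smult_component vector_minus_component sum_subtractf sum_distrib_right)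
        qed
        also have "(\<Sum>j\<in>UNIV. z $ j * axis j 1 $ i) = (\<Sum>j\<in>UNIV. if j = i then z $ i else 0)"
          by (rule sum.cong) (auto simp: axis_def)
        finally show ?thesis using z by simp
      qed
      then show ?thesis by (simp add: vec_eq_iff)
    qed
    ultimately show "z \<in> L" by simp
  qed
qed

section \<open>Projections along complex hyperplanes\<close>

lemma real_subspace_of_complex:
  assumes "vec.subspace (L :: (complex ^ 'n::finite) set)"
  shows "subspace L"
proof (rule subspaceI)
  show "0 \<in> L" using assms by (auto simp: vec.subspace_def)
  show "x + y \<in> L" if "x \<in> L" "y \<in> L" for x y
    using assms that by (auto simp: vec.subspace_def)
  fix c x assume "x \<in> L"
  then have "of_real c *s x \<in> L" using assms by (auto simp: vec.subspace_def)
  moreover have "of_real c *s x = c *\<^sub>R x"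
    unfolding vec_eq_iff by (auto simp: scaleR_conv_of_real[where 'a = complex])
  ultimately show "c *\<^sub>R x \<in> L" by simp
qed

text \<open>The orthogonal decomposition exists and is unique, which gives the definite description
  in \<open>proj_along\<close> its meaning.\<close>

lemma proj_along_props:
  assumes "vec.subspace (L :: (complex ^ 'n::finite) set)"
  shows "proj_along L z \<in> orthogonal_comp L \<and> z - proj_along L z \<in> L"
proof -
  have L: "subspace L" by (rule real_subspace_of_complex[OF assms])
  obtain y w where yw: "y \<in> span L" "\<And>v. v \<in> span L \<Longrightarrow> orthogonal w v" "z = y + w"
    by (rule orthogonal_subspace_decomp_exists[of L z]) (rule that)
  have "w \<in> orthogonal_comp L \<and> z - w \<in> L"
    using yw by (auto simp: orthogonal_comp_def orthogonal_commute span_base span_eq_iff[THEN iffD2, OF L])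
  moreover have "w' = w" if "w' \<in> orthogonal_comp L \<and> z - w' \<in> L" for w'
  proof -
    have "w' - w \<in> orthogonal_comp L" using that calculation subspace_orthogonal_comp by (blast intro: subspace_diff)
    moreover have "(z - w) - (z - w') \<in> L" using that \<open>w \<in> _ \<and> _\<close> L by (blast intro: subspace_diff)
    ultimately have "orthogonal (w' - w) (w' - w)" by (simp add: orthogonal_comp_def)
    then show ?thesis by (simp add: orthogonal_self)
  qed
  ultimately show ?thesis unfolding proj_along_def by (rule theI)
qed

lemma proj_along_eq_iff:
  assumes "vec.subspace (L :: (complex ^ 'n::finite) set)"
  shows "proj_along L z = proj_along L z' \<longleftrightarrow> z - z' \<in> L"
proof
  have L: "subspace L" by (rule real_subspace_of_complex[OF assms])
  note p = proj_along_props[OF assms]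
  show "z - z' \<in> L" if eq: "proj_along L z = proj_along L z'"
  proof -
    have "(z - proj_along L z) - (z' - proj_along L z') \<in> L" using p L by (blast intro: subspace_diff)
    then show ?thesis by (simp add: eq)
  qed
  show "proj_along L z = proj_along L z'" if zz: "z - z' \<in> L"
  proof -
    have "z' - w \<in> L \<longleftrightarrow> z - w \<in> L" for w
    proof -
      have "(z' - w) + (z - z') \<in> L \<longleftrightarrow> z' - w \<in> L" using zz L
        by (metis add_diff_cancel_right' subspace_add subspace_diff)
      then show ?thesis by simp
    qed
    then show ?thesis by (simp add: proj_along_def)
  qed
qed

lemma norm_proj_along_diff_le:
  assumes "vec.subspace (L :: (complex ^ 'n::finite) set)"
  shows "norm (proj_along L z - proj_along L z') \<le> norm (z - z')"
proof -
  have L: "subspace L" by (rule real_subspace_of_complex[OF assms])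
  note p = proj_along_props[OF assms]
  define v where "v = proj_along L z - proj_along L z'"
  define w where "w = (z - proj_along L z) - (z' - proj_along L z')"
  have "v \<in> orthogonal_comp L" unfolding v_def using p subspace_orthogonal_comp by (blast intro: subspace_diff)
  moreover have "w \<in> L" unfolding w_def using p L by (blast intro: subspace_diff)
  ultimately have "orthogonal w v" by (simp add: orthogonal_comp_def)
  then have "(norm (w + v))\<^sup>2 = (norm w)\<^sup>2 + (norm v)\<^sup>2" by (rule norm_add_Pythagorean)
  then have "(norm v)\<^sup>2 \<le> (norm (w + v))\<^sup>2" by simp
  moreover have "w + v = z - z'" by (simp add: v_def w_def)
  ultimately show ?thesis by (metis v_def norm_ge_zero power2_le_imp_le)
qed

text \<open>Near a zero of order \<open>n\<close> a holomorphic function is the \<open>n\<close>-th power of an open map, so it takes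
  each small nonzero value in \<open>n\<close> distinct points.\<close>

lemma many_equal_values:
  fixes h :: "complex \<Rightarrow> complex"
  assumes hol: "h holomorphic_on ball 0 \<rho>" and k0: "k0 holomorphic_on ball 0 \<rho>"
    and hk0: "\<And>t. t \<in> ball 0 \<rho> \<Longrightarrow> h t = t ^ m * k0 t" and m: "0 < m"
    and nonconst: "z \<in> ball 0 \<rho>" "h z \<noteq> 0" and r: "0 < r" "r \<le> \<rho>"
  shows "\<exists>S t. S \<subseteq> ball 0 r \<and> m \<le> card S \<and> finite S \<and> t \<in> S \<and> (\<forall>u\<in>S. h u = h t)"
proof -
  have \<rho>: "0 < \<rho>" using r by simp
  have h0: "h 0 = 0" using hk0[of 0] \<rho> m by simp
  have c0: "(0::complex) \<in> ball 0 \<rho>" using \<rho> by simp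
  have nc: "\<not> h constant_on ball 0 \<rho>" using h0 nonconst \<rho> by (force simp: constant_on_def)
  obtain g r1 n where g: "0 < n" "0 < r1" "ball (0::complex) r1 \<subseteq> ball 0 \<rho>" "g holomorphic_on ball 0 r1"
    "\<And>w. w \<in> ball 0 r1 \<Longrightarrow> h w = (w - 0) ^ n * g w" "\<And>w. w \<in> ball 0 r1 \<Longrightarrow> g w \<noteq> 0"
    by (rule holomorphic_factor_zero_nonconstant[OF hol open_ball connected_ball c0 h0 nc]) (rule that)
  \<comment> \<open>The true order \<open>n\<close> is at least \<open>m\<close> because
    \<open>t ^ m\<close> divides \<open>h\<close>; otherwise the nonvanishing factor
    \<open>g\<close> would tend to 0.\<close>
  have nm: "m \<le> n"
  proof (rule ccontr)
    assume "\<not> m \<le> n"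
    then have nlm: "n < m" by simp
    have "g t = t ^ (m - n) * k0 t" if "t \<in> ball 0 r1 - {0}" for t
    proof -
      have "t ^ n * g t = t ^ m * k0 t" using g(3,5) hk0[of t] that by auto
      also have "t ^ m = t ^ n * t ^ (m - n)" using nlm by (simp add: power_add[symmetric])
      finally show ?thesis using that by simp
    qed
    then have "\<forall>\<^sub>F t in at 0. t ^ (m - n) * k0 t = g t"
      using g(2) by (auto simp: eventually_at dist_norm intro!: exI[of _ r1])
    moreover have "((\<lambda>t. t ^ (m - n) * k0 t) \<longlongrightarrow> 0 ^ (m - n) * k0 0) (at 0)"
      using holomorphic_on_imp_continuous_on[OF k0] \<rho>
      by (intro tendsto_intros) (simp add: continuous_on_eq_continuous_at isCont_def)
    ultimately have "(g \<longlongrightarrow> 0) (at 0)" using nlm by (auto simp: power_0_left dest: Lim_transform_eventually)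
    moreover have "(g \<longlongrightarrow> g 0) (at 0)"
      using holomorphic_on_imp_continuous_on[OF g(4)] g(2) by (simp add: continuous_on_eq_continuous_at isCont_def)
    ultimately have "g 0 = 0" using tendsto_unique[OF at_neq_bot] by blast
    then show False using g(6)[of 0] g(2) by simp
  qed
  \<comment> \<open>A holomorphic logarithm of the nonvanishing factor supplies its
    \<open>n\<close>-th root.\<close>
  obtain k where k: "k holomorphic_on ball 0 r1" "\<And>x. x \<in> ball 0 r1 \<Longrightarrow> exp (k x) = g x"
    by (rule holomorphic_logarithm_exists[OF convex_ball open_ball g(4,6), of 0]) (use g(2) in auto)
  define p where "p t = t * exp (k t / of_nat n)" for t
  have hp: "h t = p t ^ n" if "t \<in> ball 0 r1" for t
  proof -
    have "exp (k t / of_nat n) ^ n = exp (k t)" using g(1) by (simp add: exp_of_nat_mult[symmetric])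
    then show ?thesis using g(5)[OF that] k(2)[OF that] by (simp add: p_def power_mult_distrib)
  qed
  have holp: "p holomorphic_on ball 0 r1" unfolding p_def by (intro holomorphic_intros k(1)) (use g in auto)
  have "\<not> p constant_on ball 0 r1"
  proof
    assume "p constant_on ball 0 r1"
    moreover have "complex_of_real (r1 / 2) \<in> ball 0 r1" "(0::complex) \<in> ball 0 r1" using g(2) by auto
    ultimately have "p (of_real (r1 / 2)) = p 0" by (metis constant_on_def)
    then show False using g(2) by (simp add: p_def)
  qed
  then have "open (p ` ball 0 (min r r1))"
    by (intro open_mapping_thm[OF holp]) auto
  moreover have "0 \<in> p ` ball 0 (min r r1)" using r(1) g(2) by (intro image_eqI[of _ _ 0]) (auto simp: p_def)
  ultimately obtain \<epsilon> where \<epsilon>: "0 < \<epsilon>" "ball 0 \<epsilon> \<subseteq> p ` ball 0 (min r r1)" using open_contains_ball by blast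
  define R where "R = {z::complex. z ^ n = 1}"
  have cR: "card R = n" unfolding R_def using g(1) by (intro card_complex_roots_unity) simp
  then have finR: "finite R" using g(1) by (intro card_ge_0_finite) simp
  \<comment> \<open>A nonzero target value of the open map \<open>p\<close>. Its products with the
    \<open>n\<close>-th roots of unity are all attained, at distinct points, and have the same
    \<open>n\<close>-th power.\<close>
  define \<tau> where "\<tau> = complex_of_real (\<epsilon> / 2)"
  have "\<exists>t\<in>ball 0 (min r r1). p t = z * \<tau>" if "z \<in> R" for z
  proof -
    have "norm z ^ n = 1" using that by (simp add: R_def norm_power[symmetric])
    then have "norm z = 1" using g(1) power_eq_1_iff by (metis norm_ge_zero abs_of_nonneg real_norm_def less_not_refl)
    then have "z * \<tau> \<in> ball 0 \<epsilon>" using \<epsilon>(1) by (simp add: norm_mult \<tau>_def)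
    then have "z * \<tau> \<in> p ` ball 0 (min r r1)" using \<epsilon>(2) by blast
    then show ?thesis by force
  qed
  then obtain t where t: "\<And>z. z \<in> R \<Longrightarrow> t z \<in> ball 0 (min r r1)" "\<And>z. z \<in> R \<Longrightarrow> p (t z) = z * \<tau>" by metis
  have inj: "inj_on t R"
  proof (rule inj_onI)
    fix z z' assume z: "z \<in> R" "z' \<in> R" "t z = t z'"
    then have "z * \<tau> = z' * \<tau>" using t(2) by metis
    then show "z = z'" using \<epsilon>(1) by (simp add: \<tau>_def)
  qed
  have val: "h (t z) = \<tau> ^ n" if "z \<in> R" for z
    using hp[of "t z"] t[OF that] that by (simp add: power_mult_distrib R_def)
  have "1 \<in> R" by (simp add: R_def)
  show ?thesis
  proof (intro exI[of _ "t ` R"] exI[of _ "t 1"] conjI)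
    show "t ` R \<subseteq> ball 0 r" using t(1) by auto
    show "m \<le> card (t ` R)" using nm cR by (simp add: card_image[OF inj])
  qed (use finR val \<open>1 \<in> R\<close> in auto)
qed

context curve_eqs
begin

lemma complexification_equation:
  assumes "z \<in> complexification A"
  shows "biv (E j) (z $ i0) (z $ j) = 0"
proof -
  have "polyfun (\<lambda>z :: complex ^ 'a. biv (E j) (z $ i0) (z $ j))" by (intro polyfun_biv polyfun_coord)
  from algebraic_zeros[OF this] have "algebraic_set (zeros (\<lambda>z :: complex ^ 'a. biv (E j) (z $ i0) (z $ j)))" .
  moreover have "cvec ` A \<subseteq> zeros (\<lambda>z. biv (E j) (z $ i0) (z $ j))"
    using van[of j] by (auto simp: vanishing_def zeros_def)
  ultimately show ?thesis using assms by (auto simp: complexification_def zeros_def)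
qed

text \<open>Each equation of a complex algebraic set containing \<open>A\<close> becomes a
  holomorphic function on the disc that vanishes along a real arc.\<close>

lemma branch_in_complexification:
  fixes \<gamma> :: "complex \<Rightarrow> complex ^ 'a"
  assumes hol: "\<And>j. (\<lambda>t. \<gamma> t $ j) holomorphic_on ball 0 \<rho>" and t1: "0 < t1"
    and A: "\<And>t. 0 \<le> t \<Longrightarrow> t \<le> t1 \<Longrightarrow> \<exists>a\<in>A. \<gamma> (of_real t) = cvec a" and t: "t \<in> ball 0 \<rho>"
  shows "\<gamma> t \<in> complexification A"
  unfolding complexification_def
proof clarify
  fix X :: "(complex ^ 'a) set" assume X: "algebraic_set X" "cvec ` A \<subseteq> X"
  obtain Q where Q: "X = {x. \<forall>p\<in>Q. peval p x = 0}" using X(1) unfolding algebraic_set_def by blast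
  have "peval p (\<gamma> t) = 0" if p: "p \<in> Q" for p
  proof (rule identity_by_sequence[OF holomorphic_on_peval[OF hol], of "\<lambda>l. of_real (t1 * inverse (real (Suc l)))"])
    have "(\<lambda>l. t1 * inverse (real (Suc l))) \<longlonglongrightarrow> t1 * 0" by (intro tendsto_intros LIMSEQ_inverse_real_of_nat)
    from tendsto_of_real[OF this, where 'a = complex] show "(\<lambda>l. complex_of_real (t1 * inverse (real (Suc l)))) \<longlonglongrightarrow> 0"
      by (simp only: mult_zero_right of_real_0)
    show "complex_of_real (t1 * inverse (real (Suc l))) \<noteq> 0" for l using t1 by (simp del: of_nat_Suc)
    show "\<forall>\<^sub>F l in sequentially. peval p (\<gamma> (complex_of_real (t1 * inverse (real (Suc l))))) = 0"
    proof (intro always_eventually allI)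
      fix l
      have "inverse (real (Suc l)) \<le> 1" by (simp add: inverse_le_1_iff)
      then have "t1 * inverse (real (Suc l)) \<le> t1" using t1 by (simp add: mult_left_le)
      then obtain a where "a \<in> A" "\<gamma> (of_real (t1 * inverse (real (Suc l)))) = cvec a"
        using A[of "t1 * inverse (real (Suc l))"] t1 by auto
      then show "peval p (\<gamma> (complex_of_real (t1 * inverse (real (Suc l))))) = 0" using X(2) Q p by auto
    qed
  qed (fact t)
  then show "\<gamma> t \<in> X" by (simp add: Q)
qed

text \<open>One projection with uniformly bounded fibres is enough. Finiteness is essential, because
  \<open>the_enat\<close> would not preserve a lower bound if the infimum were infinite.\<close>

lemma multiplicity_finite:
  "(INF L\<in>{L. vec.subspace L \<and> vec.dim L + 1 = CARD('a)}. map_multiplicity (proj_along L) (complexification A) a) < \<infinity>"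
proof -
  \<comment> \<open>The hyperplane on which the \<open>i0\<close>-th coordinate vanishes: points in
    one fibre share that coordinate, and the others are roots of the equations
    \<open>E j\<close>.\<close>
  define L where "L = {z :: complex ^ 'a. \<forall>i. i \<notin> UNIV - {i0} \<longrightarrow> z $ i = 0}"
  have "vec.dim L = card (UNIV - {i0})" unfolding L_def by (rule dim_substandard_cart)
  then have dimL: "vec.dim L + 1 = CARD('a)" by (simp add: card_Diff_singleton Suc_leI)
  have subL: "vec.subspace L" by (auto simp: L_def vec.subspace_def)
  define B where "B = (\<Prod>j\<in>UNIV. degree (E j))"
  have card_le: "ecard {z \<in> complexification A \<inter> UNIV. proj_along L z = w} \<le> enat B" for w
  proof -
    define F where "F = {z \<in> complexification A. z $ i0 = w $ i0}"
    have sub: "{z \<in> complexification A \<inter> UNIV. proj_along L z = w} \<subseteq> F"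
    proof clarify
      fix z assume "z \<in> complexification A"
      moreover have "z - proj_along L z \<in> L" using proj_along_props[OF subL] by blast
      ultimately show "z \<in> F" if "w = proj_along L z" using that by (simp add: F_def L_def)
    qed
    have img: "(\<lambda>z j. z $ j) ` F \<subseteq> PiE UNIV (\<lambda>j. {y. biv (E j) (w $ i0) y = 0})"
      using complexification_equation by (fastforce simp: F_def)
    have inj: "inj_on (\<lambda>z j. z $ j) F" by (auto intro!: inj_onI simp: vec_eq_iff dest: fun_cong)
    have finP: "finite (PiE UNIV (\<lambda>j. {y. biv (E j) (w $ i0) y = 0}))" using finr by (intro finite_PiE) auto
    have finF: "finite F" using finite_imageD[OF finite_subset[OF img finP] inj] .
    have "card F = card ((\<lambda>z j. z $ j) ` F)" by (rule card_image[OF inj, symmetric])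
    also have "\<dots> \<le> card (PiE UNIV (\<lambda>j. {y. biv (E j) (w $ i0) y = 0}))" by (rule card_mono[OF finP img])
    also have "\<dots> = (\<Prod>j\<in>UNIV. card {y. biv (E j) (w $ i0) y = 0})" by (simp add: card_PiE)
    also have "\<dots> \<le> B" unfolding B_def using finr by (intro prod_mono) auto
    finally have "card F \<le> B" .
    moreover have "card {z \<in> complexification A \<inter> UNIV. proj_along L z = w} \<le> card F" by (rule card_mono[OF finF sub])
    ultimately show ?thesis using finite_subset[OF sub finF] by (simp add: ecard_def)
  qed
  have "(INF L\<in>{L. vec.subspace L \<and> vec.dim L + 1 = CARD('a)}. map_multiplicity (proj_along L) (complexification A) a)
      \<le> map_multiplicity (proj_along L) (complexification A) a"
    by (rule INF_lower) (use subL dimL in simp)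
  also have "\<dots> \<le> Limsup (nhds (proj_along L a)) (\<lambda>w. ecard {z \<in> complexification A \<inter> UNIV. proj_along L z = w})"
    unfolding map_multiplicity_def by (rule INF_lower) simp
  also have "\<dots> \<le> enat B" by (intro Limsup_bounded always_eventually allI card_le)
  also have "\<dots> < \<infinity>" by simp
  finally show ?thesis .
qed

text \<open>For each hyperplane the linear functional that vanishes along it has order at least
  \<open>m\<close> on the branch. It therefore takes some value near 0 in at least \<open>m\<close>
  points of the disc, and injectivity of \<open>\<gamma>\<close> makes these distinct points of one
  fibre, arbitrarily close to \<open>x0\<close>.\<close>

lemma branch_multiplicity_le:
  fixes \<gamma> :: "complex \<Rightarrow> complex ^ 'a"
  assumes m: "0 < m" and \<rho>: "0 < \<rho>" and hol: "\<And>j. (\<lambda>t. \<gamma> t $ j) holomorphic_on ball 0 \<rho>" and \<gamma>0: "\<gamma> 0 = cvec x0"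
    and ord: "\<And>j. \<exists>\<psi>. \<psi> holomorphic_on ball 0 \<rho> \<and> (\<forall>t\<in>ball 0 \<rho>. \<gamma> t $ j = of_real (x0 $ j) + t ^ m * \<psi> t)"
    and inj: "inj_on \<gamma> (ball 0 \<rho>)" and Z: "\<And>t. t \<in> ball 0 \<rho> \<Longrightarrow> \<gamma> t \<in> complexification A"
  shows "m \<le> complex_multiplicity 1 (complexification A) (cvec x0)"
proof -
  define a where "a = cvec x0"
  define Y where "Y = complexification A"
  have key: "enat m \<le> map_multiplicity (proj_along L) Y a" if L: "vec.subspace L" "vec.dim L + 1 = CARD('a)" for L
    unfolding map_multiplicity_def
  proof (rule INF_greatest)
    fix U assume "U \<in> {U. open U \<and> a \<in> U}"
    then have U: "open U" "a \<in> U" by auto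
    define N where "N w = ecard {z \<in> Y \<inter> U. proj_along L z = w}" for w
    obtain \<kappa> where \<kappa>: "\<And>z. (\<Sum>j\<in>UNIV. \<kappa> j * z $ j) = 0 \<Longrightarrow> z \<in> L"
      by (rule hyperplane_functional[OF L]) (rule that)
    obtain \<psi> where \<psi>: "\<And>j. \<psi> j holomorphic_on ball 0 \<rho>"
      "\<And>j t. t \<in> ball 0 \<rho> \<Longrightarrow> \<gamma> t $ j = of_real (x0 $ j) + t ^ m * \<psi> j t" using ord by metis
    define h where "h t = (\<Sum>j\<in>UNIV. \<kappa> j * (\<gamma> t - a) $ j)" for t
    define k0 where "k0 t = (\<Sum>j\<in>UNIV. \<kappa> j * \<psi> j t)" for t
    have holk0: "k0 holomorphic_on ball 0 \<rho>" unfolding k0_def by (intro holomorphic_intros \<psi>)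
    have holh: "h holomorphic_on ball 0 \<rho>" unfolding h_def vector_minus_component by (intro holomorphic_intros hol)
    have hk0: "h t = t ^ m * k0 t" if "t \<in> ball 0 \<rho>" for t
      unfolding h_def k0_def sum_distrib_left by (rule sum.cong) (use \<psi>(2)[OF that] in \<open>auto simp: a_def\<close>)
    have same: "proj_along L (\<gamma> t) = proj_along L (\<gamma> t')" if "h t = h t'" for t t'
      unfolding proj_along_eq_iff[OF L(1)]
      by (rule \<kappa>) (use that in \<open>simp add: h_def sum_subtractf right_diff_distrib\<close>)
    have cont: "continuous_on (ball 0 \<rho>) \<gamma>"
    proof -
      have "continuous_on (ball 0 \<rho>) (\<lambda>t. \<chi> j. \<gamma> t $ j)"
        by (intro continuous_on_vec_lambda holomorphic_on_imp_continuous_on hol)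
      then show ?thesis by simp
    qed
    then have "isCont \<gamma> 0" using \<rho> by (simp add: continuous_on_eq_continuous_at)
    then have "(\<gamma> \<longlongrightarrow> \<gamma> 0) (nhds 0)" by (simp only: isCont_def tendsto_at_iff_tendsto_nhds)
    then have lim: "(\<gamma> \<longlongrightarrow> a) (nhds 0)" by (simp only: \<gamma>0 a_def)
    have "\<exists>w\<in>Q. enat m \<le> N w" if Q: "open Q" "proj_along L a \<in> Q" for Q
    proof -
      obtain \<epsilon> where \<epsilon>: "0 < \<epsilon>" "ball (proj_along L a) \<epsilon> \<subseteq> Q" using Q open_contains_ball by blast
      have "\<forall>\<^sub>F t in nhds 0. \<gamma> t \<in> U" using topological_tendstoD[OF lim U] .
      moreover have "\<forall>\<^sub>F t in nhds 0. dist (\<gamma> t) a < \<epsilon>" using tendstoD[OF lim \<epsilon>(1)] .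
      ultimately have "\<forall>\<^sub>F t in nhds 0. \<gamma> t \<in> U \<and> dist (\<gamma> t) a < \<epsilon>" by eventually_elim simp
      then obtain r0 where r0: "0 < r0" "\<And>t. dist t 0 < r0 \<Longrightarrow> \<gamma> t \<in> U \<and> dist (\<gamma> t) a < \<epsilon>"
        by (auto simp: eventually_nhds_metric)
      define r where "r = min r0 \<rho>"
      have r: "0 < r" "r \<le> \<rho>" "r \<le> r0" using r0 \<rho> by (auto simp: r_def)
      have inQ: "proj_along L (\<gamma> t) \<in> Q" if "t \<in> ball 0 r" for t
      proof -
        have "norm (proj_along L (\<gamma> t) - proj_along L a) \<le> norm (\<gamma> t - a)" by (rule norm_proj_along_diff_le[OF L(1)])
        also have "\<dots> < \<epsilon>" using r0(2)[of t] that r(3) by (simp add: dist_norm)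
        finally show ?thesis using \<epsilon>(2) by (auto simp: dist_norm norm_minus_commute)
      qed
      have fib: "\<gamma> ` S \<subseteq> {z \<in> Y \<inter> U. proj_along L z = proj_along L (\<gamma> t)}"
        if "S \<subseteq> ball 0 r" "\<And>u. u \<in> S \<Longrightarrow> h u = h t" for S t
      proof clarify
        fix u assume u: "u \<in> S"
        then have u': "norm u < r" using that(1) by auto
        then have "\<gamma> u \<in> Y" "\<gamma> u \<in> U" using Z[of u] r0(2)[of u] r by (auto simp: Y_def)
        then show "\<gamma> u \<in> Y \<inter> U \<and> proj_along L (\<gamma> u) = proj_along L (\<gamma> t)" using same that(2)[OF u] by blast
      qed
      have injS: "inj_on \<gamma> S" if "S \<subseteq> ball 0 r" for S
        using inj by (rule inj_on_subset) (use that r in auto)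
      show ?thesis
      proof (cases "\<exists>z\<in>ball 0 \<rho>. h z \<noteq> 0")
        case True
        then obtain z where z: "z \<in> ball 0 \<rho>" "h z \<noteq> 0" by blast
        obtain S t where S: "S \<subseteq> ball 0 r" "m \<le> card S" "finite S" "t \<in> S" "\<forall>u\<in>S. h u = h t"
          using many_equal_values[OF holh holk0 hk0 m z r(1,2)] by blast
        let ?F = "{z \<in> Y \<inter> U. proj_along L z = proj_along L (\<gamma> t)}"
        have "enat m \<le> ecard ?F"
        proof (cases "finite ?F")
          case True
          have "card S = card (\<gamma> ` S)" by (rule card_image[OF injS[OF S(1)], symmetric])
          also have "\<dots> \<le> card ?F" using S(5) by (intro card_mono True fib[OF S(1)]) blast
          finally show ?thesis using S(2) True by (simp add: ecard_def)
        qed (simp add: ecard_def)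
        then show ?thesis using inQ S(1,4) by (intro bexI[of _ "proj_along L (\<gamma> t)"]) (auto simp: N_def)
      next
        \<comment> \<open>The functional vanishes on the whole branch, which then lies in one fibre;
          the fibre is infinite near \<open>x0\<close>.\<close>
        case False
        let ?F = "{z \<in> Y \<inter> U. proj_along L z = proj_along L (\<gamma> 0)}"
        have "\<gamma> ` ball 0 r \<subseteq> ?F" using False r \<rho> by (intro fib) auto
        moreover have "infinite (ball (0::complex) r)" using r(1) uncountable_infinite[OF uncountable_ball] by blast
        then have "infinite (\<gamma> ` ball 0 r)" using finite_imageD[OF _ injS[OF order_refl]] by blast
        ultimately have "infinite ?F" using finite_subset by blast
        then have "enat m \<le> N (proj_along L (\<gamma> 0))" by (simp add: N_def ecard_def)
        then show ?thesis using inQ[of 0] r(1) by auto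
      qed
    qed
    note freq = this
    show "enat m \<le> Limsup (nhds (proj_along L a)) (\<lambda>w. ecard {z \<in> Y \<inter> U. proj_along L z = w})"
    proof (rule ccontr)
      assume "\<not> ?thesis"
      then have "Limsup (nhds (proj_along L a)) N < enat m" by (simp add: N_def[abs_def] not_le)
      then have "\<forall>\<^sub>F w in nhds (proj_along L a). N w < enat m" by (rule Limsup_lessD)
      then obtain Q where "open Q" "proj_along L a \<in> Q" "\<And>w. w \<in> Q \<Longrightarrow> N w < enat m" by (auto simp: eventually_nhds)
      then show False using freq[of Q] by (meson not_le)
    qed
  qed
  define I where "I = (INF L\<in>{L. vec.subspace L \<and> vec.dim L + 1 = CARD('a)}. map_multiplicity (proj_along L) Y a)"
  have "enat m \<le> I" unfolding I_def by (rule INF_greatest) (use key in auto)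
  moreover have "I < \<infinity>" unfolding I_def Y_def by (rule multiplicity_finite)
  ultimately have "m \<le> the_enat I" by (cases I) auto
  then show ?thesis by (simp add: complex_multiplicity_def I_def Y_def a_def)
qed

end

subsection \<open>Derivatives of polynomials along branches\<close>

lemma peval_differentiable: "(peval (p :: (real, 'n::finite) mpolynomial)) differentiable (at x)"
proof -
  have coord: "(\<lambda>y :: real ^ 'n. y $ i) differentiable (at x)" for i
    by (rule bounded_linear_imp_differentiable) (rule bounded_linear_vec_nth)
  have pow: "(\<lambda>y :: real ^ 'n. (y $ i) ^ k) differentiable (at x)" for i k
    by (induction k) (auto intro!: differentiable_mult coord)
  have pr: "(\<lambda>y :: real ^ 'n. \<Prod>i\<in>I. (y $ i) ^ k i) differentiable (at x)" if "finite I" for I k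
    using that by (induction I rule: finite_induct) (auto intro!: differentiable_mult pow)
  have "(\<lambda>y. \<Sum>m\<in>S. c m * (\<Prod>i\<in>UNIV. (y $ i) ^ Poly_Mapping.lookup m i)) differentiable (at x)"
    if "finite S" for S and c :: "('n \<Rightarrow>\<^sub>0 nat) \<Rightarrow> real"
    using that by (induction S rule: finite_induct) (auto intro!: differentiable_mult differentiable_add pr)
  then show ?thesis unfolding peval_def[abs_def] by simp
qed

lemma dir_deriv_eq:
  assumes D: "(f has_derivative D) (at x)"
  shows "dir_deriv f v x = D v"
proof -
  have lin: "linear D" using D by (rule has_derivative_linear)
  have "((\<lambda>t. x + t *\<^sub>R v) has_derivative (\<lambda>t. t *\<^sub>R v)) (at 0)"
    by (auto intro!: derivative_eq_intros)
  moreover have "(f has_derivative D) (at (x + 0 *\<^sub>R v))" using D by simp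
  ultimately have "((\<lambda>t. f (x + t *\<^sub>R v)) has_derivative (\<lambda>t. D (t *\<^sub>R v))) (at 0)"
    by (rule has_derivative_compose)
  moreover have "(\<lambda>t. D (t *\<^sub>R v)) = (\<lambda>t. D v * t)" using linear_scale[OF lin] by (simp add: mult.commute)
  ultimately have "((\<lambda>t. f (x + t *\<^sub>R v)) has_field_derivative D v) (at 0)"
    by (simp add: has_field_derivative_def)
  then show ?thesis unfolding dir_deriv_def by (rule DERIV_imp_deriv)
qed

text \<open>The increments need only be asymptotic to multiples of \<open>w\<close>. This suits a
  branch of order \<open>m\<close>, where \<open>h\<close> is \<open>t ^ m\<close> and not the
  parameter.\<close>

lemma has_derivative_along_sequence:
  fixes f :: "'a::real_normed_vector \<Rightarrow> real"
  assumes D: "(f has_derivative D) (at x)" and y: "y \<longlonglongrightarrow> x" and h: "\<And>l::nat. h l > (0::real)"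
    and lim: "(\<lambda>l. (1 / h l) *\<^sub>R (y l - x)) \<longlonglongrightarrow> w"
  shows "(\<lambda>l. (f (y l) - f x) / h l) \<longlonglongrightarrow> D w"
proof -
  have bl: "bounded_linear D" using D by (rule has_derivative_bounded_linear)
  have lin: "linear D" using D by (rule has_derivative_linear)
  have 1: "(\<lambda>l. D ((1 / h l) *\<^sub>R (y l - x))) \<longlonglongrightarrow> D w" using bl lim by (rule bounded_linear.tendsto)
  have "(\<lambda>l. norm ((1 / h l) *\<^sub>R (y l - x))) \<longlonglongrightarrow> norm w" using lim by (rule tendsto_norm)
  then have bnd: "\<forall>\<^sub>F l in sequentially. norm ((1 / h l) *\<^sub>R (y l - x)) < norm w + 1" by (rule order_tendstoD) simp
  have "(\<lambda>l. (f (y l) - f x) / h l - D ((1 / h l) *\<^sub>R (y l - x))) \<longlonglongrightarrow> 0"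
  proof (rule LIMSEQ_I[unfolded eventually_sequentially[symmetric]], goal_cases)
    case (1 r)
    define e where "e = r / (norm w + 1) / 2"
    have w1: "0 < norm w + 1" by (simp add: add_nonneg_pos)
    have e: "0 < e" using 1 w1 by (simp add: e_def)
    obtain d where d: "0 < d" "\<And>z. norm (z - x) < d \<Longrightarrow> norm (f z - f x - D (z - x)) \<le> e * norm (z - x)"
      using D e unfolding has_derivative_at_alt by blast
    have "\<forall>\<^sub>F l in sequentially. dist (y l) x < d" using y d(1) by (rule tendstoD)
    with bnd show ?case
    proof eventually_elim
      case (elim l)
      have "(f (y l) - f x) / h l - D ((1 / h l) *\<^sub>R (y l - x)) = (f (y l) - f x - D (y l - x)) / h l"
        by (simp add: linear_scale[OF lin] diff_divide_distrib)
      then have "norm ((f (y l) - f x) / h l - D ((1 / h l) *\<^sub>R (y l - x))) = norm (f (y l) - f x - D (y l - x)) / h l"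
        using h[of l] by (simp add: abs_divide)
      also have "\<dots> \<le> e * norm (y l - x) / h l"
        using d(2)[of "y l"] elim(2) h[of l] by (intro divide_right_mono) (auto simp: dist_norm)
      also have "\<dots> = e * norm ((1 / h l) *\<^sub>R (y l - x))" using h[of l] by simp
      also have "\<dots> \<le> e * (norm w + 1)" using elim(1) e by (intro mult_left_mono) auto
      also have "e * (norm w + 1) = r / 2" using w1 unfolding e_def by (simp del: divide_divide_eq_left)
      also have "\<dots> < r" using 1 by simp
      finally show ?case by simp
    qed
  qed
  from tendsto_add[OF this 1] show ?thesis by simp
qed

lemma peval_of_real:
  fixes p :: "(real, 'n::finite) mpolynomial"
  shows "peval (Poly_Mapping.map complex_of_real p) (cvec a) = of_real (peval p a)"
proof -
  have lm: "Poly_Mapping.lookup (Poly_Mapping.map complex_of_real p) k = of_real (Poly_Mapping.lookup p k)" for k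
    by (simp add: map.rep_eq when_def)
  have "Poly_Mapping.keys (Poly_Mapping.map complex_of_real p) \<subseteq> Poly_Mapping.keys p"
    by (auto simp: in_keys_iff lm)
  then show ?thesis
    by (simp add: peval_superset[of "Poly_Mapping.keys p"] lm monom_val_cvec)
qed

text \<open>A Puiseux parametrisation of a branch at \<open>x0\<close> by the \<open>m\<close>-th root of the \<open>i0\<close>-th coordinate.\<close>

definition holo_branch :: "real ^ 'n::finite \<Rightarrow> 'n \<Rightarrow> real \<Rightarrow> nat \<Rightarrow> real \<Rightarrow> (complex \<Rightarrow> complex ^ 'n) \<Rightarrow> real ^ 'n \<Rightarrow> bool" where
  "holo_branch x0 i0 \<sigma> m \<rho> \<gamma> W \<longleftrightarrow> 0 < m \<and> 0 < \<rho> \<and> (\<sigma> = 1 \<or> \<sigma> = - 1) \<and>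
     (\<forall>j. (\<lambda>t. \<gamma> t $ j) holomorphic_on ball 0 \<rho>) \<and> \<gamma> 0 = cvec x0 \<and>
     (\<forall>t\<in>ball 0 \<rho>. \<gamma> t $ i0 = of_real (x0 $ i0) + of_real \<sigma> * t ^ m) \<and>
     (\<forall>j. \<exists>\<psi>. \<psi> holomorphic_on ball 0 \<rho> \<and> (\<forall>t\<in>ball 0 \<rho>. \<gamma> t $ j = of_real (x0 $ j) + t ^ m * \<psi> t) \<and>
        \<psi> 0 = of_real (W $ j))"

lemma poly_map_of_real: "poly (map_poly complex_of_real c) (of_real x) = of_real (poly c x)"
  by (induction c) (auto simp: map_poly_pCons)

lemma holo_branch_limit:
  assumes br: "holo_branch x0 i0 \<sigma> m \<rho> \<gamma> W" and \<beta>: "\<And>l. \<gamma> (of_real (t l)) = cvec (\<beta> l)"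
    and t: "t \<longlonglongrightarrow> 0" "\<And>l::nat. 0 < t l"
  shows "\<beta> \<longlonglongrightarrow> x0" "(\<lambda>l. (1 / t l ^ m) *\<^sub>R (\<beta> l - x0)) \<longlonglongrightarrow> W"
proof -
  have tc: "(\<lambda>l. complex_of_real (t l)) \<longlonglongrightarrow> 0" using tendsto_of_real[OF t(1)] by simp
  have \<rho>: "0 < \<rho>" using br by (simp add: holo_branch_def)
  have ev: "\<forall>\<^sub>F l in sequentially. complex_of_real (t l) \<in> ball 0 \<rho>" using tc \<rho> by (intro topological_tendstoD) auto
  have "(\<lambda>l. \<beta> l $ j) \<longlonglongrightarrow> x0 $ j \<and> (\<lambda>l. (\<beta> l $ j - x0 $ j) / t l ^ m) \<longlonglongrightarrow> W $ j" for j
  proof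
    obtain \<psi> where \<psi>: "\<psi> holomorphic_on ball 0 \<rho>" "\<And>t. t \<in> ball 0 \<rho> \<Longrightarrow> \<gamma> t $ j = of_real (x0 $ j) + t ^ m * \<psi> t"
      "\<psi> 0 = of_real (W $ j)" using br unfolding holo_branch_def by blast
    have hol: "(\<lambda>t. \<gamma> t $ j) holomorphic_on ball 0 \<rho>" and \<gamma>0: "\<gamma> 0 = cvec x0"
      using br by (auto simp: holo_branch_def)
    have "(\<lambda>l. \<gamma> (of_real (t l)) $ j) \<longlonglongrightarrow> \<gamma> 0 $ j" by (rule tendsto_along[OF hol \<rho> tc])
    then show "(\<lambda>l. \<beta> l $ j) \<longlonglongrightarrow> x0 $ j" by (simp add: \<beta> \<gamma>0 tendsto_of_real_iff)
    have "(\<lambda>l. \<psi> (of_real (t l))) \<longlonglongrightarrow> of_real (W $ j)" using tendsto_along[OF \<psi>(1) \<rho> tc] \<psi>(3) by simp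
    moreover have "\<forall>\<^sub>F l in sequentially. \<psi> (of_real (t l)) = of_real ((\<beta> l $ j - x0 $ j) / t l ^ m)"
      using ev
    proof eventually_elim
      case (elim l)
      from \<psi>(2)[OF this] have "complex_of_real (\<beta> l $ j) - of_real (x0 $ j) = of_real (t l) ^ m * \<psi> (of_real (t l))"
        by (simp add: \<beta>)
      then show ?case using t(2)[of l] by (simp add: field_simps)
    qed
    ultimately have "(\<lambda>l. complex_of_real ((\<beta> l $ j - x0 $ j) / t l ^ m)) \<longlonglongrightarrow> of_real (W $ j)"
      by (rule Lim_transform_eventually)
    then show "(\<lambda>l. (\<beta> l $ j - x0 $ j) / t l ^ m) \<longlonglongrightarrow> W $ j" by (simp only: tendsto_of_real_iff)
  qed
  then show "\<beta> \<longlonglongrightarrow> x0" "(\<lambda>l. (1 / t l ^ m) *\<^sub>R (\<beta> l - x0)) \<longlonglongrightarrow> W"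
    by (auto intro!: vec_tendstoI)
qed

context curve_coord
begin

text \<open>Along the branch the derivative of \<open>p\<close> in direction \<open>W\<close> is the
  Taylor coefficient of order \<open>m\<close>, and the lower ones vanish except for the constant.
  The elimination relation, known on the real arc, extends to the disc by the identity
  theorem.\<close>

lemma branch_function:
  assumes br: "holo_branch x0 i0 \<sigma> m \<rho> \<gamma> W" and t1: "0 < t1"
    and A: "\<And>t. 0 \<le> t \<Longrightarrow> t \<le> t1 \<Longrightarrow> \<exists>a\<in>A. \<gamma> (of_real t) = cvec a"
    and q: "q j0 \<noteq> 0" "j0 \<le> J" "\<And>j. j \<le> J \<Longrightarrow> degree (q j) \<le> J * d"
      "\<And>a. a \<in> A \<Longrightarrow> (\<Sum>j\<le>J. poly (q j) (a $ i0) * peval p a ^ j) = 0"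
    and D: "(peval p has_derivative D) (at x0)"
  obtains f q' \<phi> where "f holomorphic_on ball 0 \<rho>" "\<phi> holomorphic_on ball 0 \<rho>"
    "\<And>t. t \<in> ball 0 \<rho> \<Longrightarrow> (\<Sum>j\<le>J. poly (q' j) (t ^ m) * f t ^ j) = 0"
    "q' j0 \<noteq> 0" "\<And>j. j \<le> J \<Longrightarrow> degree (q' j) \<le> J * d"
    "\<And>t. t \<in> ball 0 \<rho> \<Longrightarrow> f t = f 0 + t ^ m * \<phi> t" "\<phi> 0 = of_real (D W)"
    "\<And>t a. \<gamma> (of_real t) = cvec a \<Longrightarrow> f (of_real t) = of_real (peval p a)"
proof -
  have m: "0 < m" and \<rho>: "0 < \<rho>" and \<sigma>: "\<sigma> = 1 \<or> \<sigma> = - 1" and hol: "\<And>j. (\<lambda>t. \<gamma> t $ j) holomorphic_on ball 0 \<rho>"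
    and \<gamma>0: "\<gamma> 0 = cvec x0" and \<gamma>i0: "\<And>t. t \<in> ball 0 \<rho> \<Longrightarrow> \<gamma> t $ i0 = of_real (x0 $ i0) + of_real \<sigma> * t ^ m"
    using br by (auto simp: holo_branch_def)
  define f where "f t = peval (Poly_Mapping.map complex_of_real p) (\<gamma> t)" for t
  have holf: "f holomorphic_on ball 0 \<rho>" unfolding f_def by (rule holomorphic_on_peval[OF hol])
  have freal: "f (of_real t) = of_real (peval p a)" if "\<gamma> (of_real t) = cvec a" for t a
    using that by (simp add: f_def peval_of_real)
  define t where "t l = t1 * inverse (real (Suc l))" for l
  have t: "t \<longlonglongrightarrow> 0" "\<And>l. 0 < t l" "\<And>l. t l \<le> t1"
  proof -
    have "t \<longlonglongrightarrow> t1 * 0" unfolding t_def by (intro tendsto_intros LIMSEQ_inverse_real_of_nat)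
    then show "t \<longlonglongrightarrow> 0" by simp
    show "0 < t l" for l using t1 by (simp add: t_def)
    have "inverse (real (Suc l)) \<le> 1" for l by (simp add: inverse_le_1_iff)
    then show "t l \<le> t1" for l using t1 by (simp add: t_def mult_left_le)
  qed
  have "\<exists>a\<in>A. \<gamma> (of_real (t l)) = cvec a" for l using A t(2,3)[of l] by simp
  then obtain \<beta> where \<beta>: "\<And>l. \<beta> l \<in> A" "\<And>l. \<gamma> (of_real (t l)) = cvec (\<beta> l)" by metis
  have tc: "(\<lambda>l. complex_of_real (t l)) \<longlonglongrightarrow> 0" "\<And>l. complex_of_real (t l) \<noteq> 0"
    using tendsto_of_real[OF t(1)] t(2) by (auto simp: less_imp_neq[symmetric])
  \<comment> \<open>The \<open>i0\<close>-th coordinate is affine in \<open>t ^ m\<close>; composing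
    with this affine map preserves degrees and, since \<open>\<sigma>\<close> is not 0,
    nontriviality.\<close>
  define q' where "q' j = pcompose (map_poly complex_of_real (q j)) [:of_real (x0 $ i0), of_real \<sigma>:]" for j
  have pq': "poly (q' j) (z ^ m) = poly (map_poly complex_of_real (q j)) (\<gamma> z $ i0)" if "z \<in> ball 0 \<rho>" for z j
    by (simp add: q'_def poly_pcompose \<gamma>i0[OF that] mult.commute)
  have rel: "(\<Sum>j\<le>J. poly (q' j) (z ^ m) * f z ^ j) = 0" if z: "z \<in> ball 0 \<rho>" for z
  proof (rule identity_by_sequence[OF _ tc _ z])
    show "(\<lambda>z. \<Sum>j\<le>J. poly (q' j) (z ^ m) * f z ^ j) holomorphic_on ball 0 \<rho>"
      by (intro holomorphic_intros holf)
    have "\<forall>\<^sub>F l in sequentially. complex_of_real (t l) \<in> ball 0 \<rho>" using tc \<rho> by (intro topological_tendstoD) auto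
    then show "\<forall>\<^sub>F l in sequentially. (\<Sum>j\<le>J. poly (q' j) (of_real (t l) ^ m) * f (of_real (t l)) ^ j) = 0"
    proof eventually_elim
      case (elim l)
      have "(\<Sum>j\<le>J. poly (q' j) (of_real (t l) ^ m) * f (of_real (t l)) ^ j)
          = of_real (\<Sum>j\<le>J. poly (q j) (\<beta> l $ i0) * peval p (\<beta> l) ^ j)"
        by (simp add: pq'[OF elim] freal[OF \<beta>(2)] \<beta>(2) poly_map_of_real)
      also have "\<dots> = 0" using q(4)[OF \<beta>(1)] by simp
      finally show ?case .
    qed
  qed
  have f0: "f 0 = of_real (peval p x0)" using freal[of 0 x0] \<gamma>0 by simp
  have "(\<lambda>l. (peval p (\<beta> l) - peval p x0) / t l ^ m) \<longlonglongrightarrow> D W"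
    by (rule has_derivative_along_sequence[OF D]) (use holo_branch_limit[OF br \<beta>(2) t(1,2)] t(2) in auto)
  then have "(\<lambda>l. complex_of_real ((peval p (\<beta> l) - peval p x0) / t l ^ m)) \<longlonglongrightarrow> of_real (D W)"
    by (rule tendsto_of_real)
  then have "(\<lambda>l. (f (of_real (t l)) - f 0) / of_real (t l) ^ m) \<longlonglongrightarrow> of_real (D W)"
    by (simp add: freal[OF \<beta>(2)] f0)
  then obtain \<phi> where \<phi>: "\<phi> holomorphic_on ball 0 \<rho>" "\<And>z. f z = f 0 + z ^ m * \<phi> z" "\<phi> 0 = of_real (D W)"
    by (rule order_by_sequence[OF holf \<rho> tc]) (rule that)
  show ?thesis
  proof (rule that[OF holf \<phi>(1) rel])
    show "q' j0 \<noteq> 0" using q(1) \<sigma> by (auto simp: q'_def pcompose_eq_0_iff map_poly_eq_0_iff)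
    show "degree (q' j) \<le> J * d" if "j \<le> J" for j
    proof -
      have "degree (q' j) \<le> degree (map_poly complex_of_real (q j)) * degree [:complex_of_real (x0 $ i0), of_real \<sigma>:]"
        unfolding q'_def by (rule degree_pcompose_le)
      also have "\<dots> \<le> degree (q j) * 1"
        by (intro mult_mono) (auto intro: degree_le simp: coeff_map_poly coeff_eq_0)
      finally show ?thesis using q(3)[OF that] by simp
    qed
    show "f t = f 0 + t ^ m * \<phi> t" for t by (rule \<phi>(2))
    show "\<phi> 0 = of_real (D W)" by (rule \<phi>(3))
    show "f (of_real t) = of_real (peval p a)" if "\<gamma> (of_real t) = cvec a" for t a by (rule freal[OF that])
  qed
qed

text \<open>\<open>B\<close> is obtained from the elimination for \<open>A\<close> and
  \<open>i0\<close> before any point or branch is chosen. This order of quantifiers is the source of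
  the uniformity in \<open>x0\<close>.\<close>

lemma branch_estimates:
  obtains B :: nat where "0 < B"
    "\<And>x0 \<sigma> m \<rho> \<gamma> W \<epsilon> p D M. holo_branch x0 i0 \<sigma> m \<rho> \<gamma> W \<Longrightarrow> 0 < \<epsilon> \<Longrightarrow> \<epsilon> < \<rho> \<Longrightarrow>
       (\<And>t. 0 \<le> t \<Longrightarrow> t \<le> \<epsilon> \<Longrightarrow> \<exists>a\<in>A. \<gamma> (of_real t) = cvec a \<and> \<bar>peval p a\<bar> \<le> M) \<Longrightarrow>
       (peval p has_derivative D) (at x0) \<Longrightarrow> 0 < total_deg p \<Longrightarrow>
       \<bar>D W\<bar> \<le> 4 * (32 * (real (B * total_deg p))\<^sup>2 / \<epsilon>) ^ m * M"
    "\<And>x0 \<sigma> \<rho> \<gamma> W \<epsilon> p D M. holo_branch x0 i0 \<sigma> 1 \<rho> \<gamma> W \<Longrightarrow> 0 < \<epsilon> \<Longrightarrow> \<epsilon> < \<rho> \<Longrightarrow>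
       (\<And>t. \<bar>t\<bar> \<le> \<epsilon> \<Longrightarrow> \<exists>a\<in>A. \<gamma> (of_real t) = cvec a \<and> \<bar>peval p a\<bar> \<le> M) \<Longrightarrow>
       (peval p has_derivative D) (at x0) \<Longrightarrow> 0 < total_deg p \<Longrightarrow>
       \<bar>D W\<bar> \<le> 32 * real (B * total_deg p) / \<epsilon> * M"
proof -
  obtain J where J: "\<And>p d. total_deg p \<le> d \<Longrightarrow> \<exists>q :: nat \<Rightarrow> real poly. (\<exists>j\<le>J. q j \<noteq> 0) \<and>
      (\<forall>j\<le>J. degree (q j) \<le> J * d) \<and> (\<forall>a\<in>A. (\<Sum>j\<le>J. poly (q j) (a $ i0) * peval p a ^ j) = 0)"
    by (rule elimination_A) (rule that)
  obtain B where B: "0 < B"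
    "\<And>d. 0 < d \<Longrightarrow> (2 * (real J + 1) * 24 ^ (4 * ((J + 1) * (J * d)))) ^ ((J + 1)\<^sup>2 + 1) \<le> exp (real (B * d))"
    by (rule bernstein_walsh_rate[of J]) (rule that)
  show ?thesis
  proof (rule that[OF B(1)])
    fix x0 \<sigma> m \<rho> \<gamma> W \<epsilon> D M and p :: "(real, 'n) mpolynomial"
    assume br: "holo_branch x0 i0 \<sigma> m \<rho> \<gamma> W" and \<epsilon>: "0 < \<epsilon>" "\<epsilon> < \<rho>"
      and A: "\<And>t. 0 \<le> t \<Longrightarrow> t \<le> \<epsilon> \<Longrightarrow> \<exists>a\<in>A. \<gamma> (of_real t) = cvec a \<and> \<bar>peval p a\<bar> \<le> M"
      and D: "(peval p has_derivative D) (at x0)" and d: "0 < total_deg p"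
    obtain q j0 where q: "q j0 \<noteq> 0" "j0 \<le> J" "\<And>j. j \<le> J \<Longrightarrow> degree (q j) \<le> J * total_deg p"
      "\<And>a. a \<in> A \<Longrightarrow> (\<Sum>j\<le>J. poly (q j) (a $ i0) * peval p a ^ j) = 0"
      using J[OF order_refl, of p] by blast
    have A': "\<exists>a\<in>A. \<gamma> (of_real t) = cvec a" if "0 \<le> t" "t \<le> \<epsilon>" for t using A[OF that] by blast
    obtain f q' \<phi> where f: "f holomorphic_on ball 0 \<rho>" "\<phi> holomorphic_on ball 0 \<rho>"
      "\<And>t. t \<in> ball 0 \<rho> \<Longrightarrow> (\<Sum>j\<le>J. poly (q' j) (t ^ m) * f t ^ j) = 0"
      "q' j0 \<noteq> 0" "\<And>j. j \<le> J \<Longrightarrow> degree (q' j) \<le> J * total_deg p"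
      "\<And>t. t \<in> ball 0 \<rho> \<Longrightarrow> f t = f 0 + t ^ m * \<phi> t" "\<phi> 0 = of_real (D W)"
      "\<And>t a. \<gamma> (of_real t) = cvec a \<Longrightarrow> f (of_real t) = of_real (peval p a)"
      by (rule branch_function[OF br \<epsilon>(1) A' q D]) (assumption+, rule that)
    have m: "0 < m" using br by (simp add: holo_branch_def)
    have bnd: "norm (f (of_real t)) \<le> M" if t: "0 \<le> t" "t \<le> \<epsilon>" for t
    proof -
      obtain a where "\<gamma> (of_real t) = cvec a" "\<bar>peval p a\<bar> \<le> M" using A[OF t] by blast
      then show ?thesis using f(8) by simp
    qed
    have "norm (\<phi> 0) \<le> 4 * (32 * (real (B * total_deg p))\<^sup>2 / \<epsilon>) ^ m * M"
      by (rule half_branch_bound[OF \<epsilon> f(1) m f(3) q(2) f(4,5) bnd _ B(2)[OF d] f(2,6)]) (use B(1) d in auto)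
    then show "\<bar>D W\<bar> \<le> 4 * (32 * (real (B * total_deg p))\<^sup>2 / \<epsilon>) ^ m * M" using f(7) by simp
  next
    fix x0 \<sigma> \<rho> \<gamma> W \<epsilon> D M and p :: "(real, 'n) mpolynomial"
    assume br: "holo_branch x0 i0 \<sigma> 1 \<rho> \<gamma> W" and \<epsilon>: "0 < \<epsilon>" "\<epsilon> < \<rho>"
      and A: "\<And>t. \<bar>t\<bar> \<le> \<epsilon> \<Longrightarrow> \<exists>a\<in>A. \<gamma> (of_real t) = cvec a \<and> \<bar>peval p a\<bar> \<le> M"
      and D: "(peval p has_derivative D) (at x0)" and d: "0 < total_deg p"
    obtain q j0 where q: "q j0 \<noteq> 0" "j0 \<le> J" "\<And>j. j \<le> J \<Longrightarrow> degree (q j) \<le> J * total_deg p"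
      "\<And>a. a \<in> A \<Longrightarrow> (\<Sum>j\<le>J. poly (q j) (a $ i0) * peval p a ^ j) = 0"
      using J[OF order_refl, of p] by blast
    have A': "\<exists>a\<in>A. \<gamma> (of_real t) = cvec a" if "0 \<le> t" "t \<le> \<epsilon>" for t using A[of t] that by auto
    obtain f q' \<phi> where f: "f holomorphic_on ball 0 \<rho>" "\<phi> holomorphic_on ball 0 \<rho>"
      "\<And>t. t \<in> ball 0 \<rho> \<Longrightarrow> (\<Sum>j\<le>J. poly (q' j) (t ^ 1) * f t ^ j) = 0"
      "q' j0 \<noteq> 0" "\<And>j. j \<le> J \<Longrightarrow> degree (q' j) \<le> J * total_deg p"
      "\<And>t. t \<in> ball 0 \<rho> \<Longrightarrow> f t = f 0 + t ^ 1 * \<phi> t" "\<phi> 0 = of_real (D W)"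
      "\<And>t a. \<gamma> (of_real t) = cvec a \<Longrightarrow> f (of_real t) = of_real (peval p a)"
      by (rule branch_function[OF br \<epsilon>(1) A' q D]) (assumption+, rule that)
    have bnd: "norm (f (of_real t)) \<le> M" if t: "\<bar>t\<bar> \<le> \<epsilon>" for t
    proof -
      obtain a where "\<gamma> (of_real t) = cvec a" "\<bar>peval p a\<bar> \<le> M" using A[OF t] by blast
      then show ?thesis using f(8) by simp
    qed
    have "norm (\<phi> 0) \<le> 32 * real (B * total_deg p) / \<epsilon> * M"
      by (rule full_branch_bound[OF \<epsilon> f(1) f(3)[unfolded power_one_right] q(2) f(4,5) bnd _ B(2)[OF d] f(2) f(6)[unfolded power_one_right]])
        (use B(1) d in auto)
    then show "\<bar>D W\<bar> \<le> 32 * real (B * total_deg p) / \<epsilon> * M" using f(7) by simp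
  qed
qed

end

subsection \<open>Tangent directions\<close>

lemma tendsto_biv:
  fixes E :: "complex poly poly"
  assumes "(f \<longlongrightarrow> x) F" "(g \<longlongrightarrow> y) F"
  shows "((\<lambda>l. biv E (f l) (g l)) \<longlongrightarrow> biv E x y) F"
  by (induction E) (auto intro!: tendsto_intros assms tendsto_poly)

lemma slope_polynomial_aux:
  fixes E :: "complex poly poly"
  shows "\<exists>F. \<forall>\<tau> \<xi>. biv F \<tau> \<xi> = biv E (c + \<xi>) (y + \<tau> * \<xi>)"
proof (induction E)
  case 0
  show ?case by (rule exI[of _ 0]) simp
next
  case (pCons e E)
  then obtain F where F: "\<And>\<tau> \<xi>. biv F \<tau> \<xi> = biv E (c + \<xi>) (y + \<tau> * \<xi>)" by blast
  have *: "biv (map_poly (\<lambda>a. [:a:]) p) \<tau> \<xi> = poly p \<xi>" for p and \<tau> \<xi> :: complex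
    by (induction p) (auto simp: map_poly_pCons)
  have "biv (map_poly (\<lambda>a. [:a:]) (pcompose e [:c, 1:]) + [:[:y:], [:0, 1:]:] * F) \<tau> \<xi>
      = biv (pCons e E) (c + \<xi>) (y + \<tau> * \<xi>)" for \<tau> \<xi>
    by (simp add: * F poly_pcompose algebra_simps)
  then show ?case by blast
qed

text \<open>A blow-up at \<open>(c, y)\<close>: the equation in the slope \<open>\<tau>\<close> and
  the displacement \<open>\<xi>\<close> is divided by the highest power of \<open>\<xi>\<close>.
  What remains at \<open>\<xi> = 0\<close> is a nonzero polynomial in the slope, and limits of
  secant slopes are among its roots.\<close>

lemma slope_polynomial:
  fixes E :: "complex poly poly"
  assumes E: "E \<noteq> 0"
  obtains Q :: "complex poly" where "Q \<noteq> 0"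
    "\<And>\<xi> \<tau> \<tau>0. \<xi> \<longlonglongrightarrow> 0 \<Longrightarrow> (\<And>l::nat. \<xi> l \<noteq> 0) \<Longrightarrow> \<tau> \<longlonglongrightarrow> \<tau>0 \<Longrightarrow>
       (\<And>l. biv E (c + \<xi> l) (y + \<tau> l * \<xi> l) = 0) \<Longrightarrow> poly Q \<tau>0 = 0"
proof -
  obtain F where F: "\<And>\<tau> \<xi>. biv F \<tau> \<xi> = biv E (c + \<xi>) (y + \<tau> * \<xi>)" using slope_polynomial_aux by metis
  have "F \<noteq> 0"
  proof
    \<comment> \<open>The substitution is invertible away from \<open>x = c\<close>, so a trivial
      \<open>F\<close> would make \<open>E\<close> vanish there identically.\<close>
    assume F0: "F = 0"
    have "finite (insert c {x. poly (lead_coeff E) x = 0})" using E by (simp add: poly_roots_finite)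
    then obtain x where x: "x \<noteq> c" "poly (lead_coeff E) x \<noteq> 0"
      using ex_new_if_finite[OF infinite_UNIV_char_0] by blast
    have "coeff (map_poly (\<lambda>a. poly a x) E) (degree E) \<noteq> 0" using x(2) by (simp add: coeff_map_poly)
    then have "map_poly (\<lambda>a. poly a x) E \<noteq> 0" by auto
    then obtain z where "poly (map_poly (\<lambda>a. poly a x) E) z \<noteq> 0" using poly_all_0_iff_0 by blast
    then have "biv E x z \<noteq> 0" by (simp add: biv_altdef)
    moreover have "biv F ((z - y) / (x - c)) (x - c) = biv E x z" using x(1) by (simp add: F)
    ultimately show False using F0 by simp
  qed
  then obtain F1 where F1: "F = [:- 0, 1:] ^ order 0 F * F1" "\<not> [:- 0, 1:] dvd F1" using order_decomp by blast
  have nz: "poly F1 0 \<noteq> 0" using F1(2) by (simp add: poly_eq_0_iff_dvd)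
  have FF: "biv F \<tau> \<xi> = \<xi> ^ order 0 F * biv F1 \<tau> \<xi>" for \<tau> \<xi>
    by (subst F1(1)) (simp add: biv_def)
  show ?thesis
  proof (rule that[OF nz])
    fix \<xi> \<tau> :: "nat \<Rightarrow> complex" and \<tau>0
    assume \<xi>: "\<xi> \<longlonglongrightarrow> 0" "\<And>l. \<xi> l \<noteq> 0" and \<tau>: "\<tau> \<longlonglongrightarrow> \<tau>0" and z: "\<And>l. biv E (c + \<xi> l) (y + \<tau> l * \<xi> l) = 0"
    have "biv F1 (\<tau> l) (\<xi> l) = 0" for l using z[of l] \<xi>(2)[of l] FF[of "\<tau> l" "\<xi> l"] F by simp
    then have "(\<lambda>l::nat. 0) \<longlonglongrightarrow> biv F1 \<tau>0 0" using tendsto_biv[OF \<tau> \<xi>(1), of F1] by simp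
    then have "biv F1 \<tau>0 0 = 0" by (simp add: LIMSEQ_const_iff)
    then show "poly (poly F1 0) \<tau>0 = 0" by (simp add: biv_def)
  qed
qed

text \<open>The cone is formed with \<open>a - s j\<close>, so the points approach \<open>x0\<close>
  from the side opposite to \<open>v\<close>; hence the sign \<open>- sgn (v $ i0)\<close>. The
  quotients of coordinates eliminate the unknown scaling factors.\<close>

lemma tangent_cone_sequence:
  fixes A :: "(real ^ 'n::finite) set" and v :: "real ^ 'n"
  assumes v: "v \<in> tangent_cone A x0" and i0: "v $ i0 \<noteq> 0"
  obtains s :: "nat \<Rightarrow> real ^ 'n" where "\<And>l::nat. s l \<in> A" "s \<longlonglongrightarrow> x0" "\<And>l. 0 < - sgn (v $ i0) * (s l $ i0 - x0 $ i0)"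
    "\<And>j. (\<lambda>l. (s l $ j - x0 $ j) / (s l $ i0 - x0 $ i0)) \<longlonglongrightarrow> v $ j / v $ i0"
proof -
  obtain s \<mu> where s: "\<And>l::nat. s l \<in> A" "\<And>l. 0 < (\<mu> l :: real)" "s \<longlonglongrightarrow> x0" "(\<lambda>l. \<mu> l *\<^sub>R (x0 - s l)) \<longlonglongrightarrow> v"
    using v by (auto simp: tangent_cone_def)
  have c: "(\<lambda>l. \<mu> l * (x0 $ j - s l $ j)) \<longlonglongrightarrow> v $ j" for j
    using tendsto_vec_nth[OF s(4), of j] by simp
  have "(\<lambda>l. sgn (v $ i0) * (\<mu> l * (x0 $ i0 - s l $ i0))) \<longlonglongrightarrow> sgn (v $ i0) * v $ i0"
    by (intro tendsto_intros c)
  moreover have "0 < sgn (v $ i0) * v $ i0" using i0 by (simp add: sgn_mult_self_eq abs_sgn[symmetric] mult.commute)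
  ultimately have "\<forall>\<^sub>F l in sequentially. 0 < sgn (v $ i0) * (\<mu> l * (x0 $ i0 - s l $ i0))" by (rule order_tendstoD(1))
  then obtain N where N: "\<And>l. N \<le> l \<Longrightarrow> 0 < \<mu> l * (sgn (v $ i0) * (x0 $ i0 - s l $ i0))"
    by (auto simp: eventually_sequentially mult_ac)
  have pos: "0 < - sgn (v $ i0) * (s (l + N) $ i0 - x0 $ i0)" for l
  proof -
    have "0 < sgn (v $ i0) * (x0 $ i0 - s (l + N) $ i0)" by (rule zero_less_mult_pos[OF N s(2)]) simp
    then show ?thesis by (simp add: right_diff_distrib)
  qed
  show ?thesis
  proof (rule that[of "\<lambda>l. s (l + N)"])
    show "(\<lambda>l. s (l + N)) \<longlonglongrightarrow> x0" by (rule LIMSEQ_ignore_initial_segment[OF s(3)])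
    fix j
    have "(\<lambda>l. (\<mu> (l + N) * (x0 $ j - s (l + N) $ j)) / (\<mu> (l + N) * (x0 $ i0 - s (l + N) $ i0))) \<longlonglongrightarrow> v $ j / v $ i0"
      by (intro tendsto_divide LIMSEQ_ignore_initial_segment[OF c] i0)
    moreover have "(\<mu> (l + N) * (x0 $ j - s (l + N) $ j)) / (\<mu> (l + N) * (x0 $ i0 - s (l + N) $ i0))
        = (s (l + N) $ j - x0 $ j) / (s (l + N) $ i0 - x0 $ i0)" for l
      using s(2)[of "l + N"] minus_divide_divide[of "s (l + N) $ j - x0 $ j" "s (l + N) $ i0 - x0 $ i0"] by simp
    ultimately show "(\<lambda>l. (s (l + N) $ j - x0 $ j) / (s (l + N) $ i0 - x0 $ i0)) \<longlonglongrightarrow> v $ j / v $ i0" by simp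
  qed (use s(1) pos in auto)
qed

text \<open>A unit vector with \<open>v $ i0\<close> nonzero is determined up to sign by the slopes
  \<open>v $ j / v $ i0\<close>, and each of these is a root of a fixed polynomial.\<close>

lemma (in curve_coord) finite_tangent_directions:
  "finite {v \<in> tangent_cone A x0. norm v = 1 \<and> v $ i0 \<noteq> 0}"
proof -
  obtain E D where "curve_eqs A i0 P a1 a2 E D" using curve_eqs_exists by blast
  then interpret curve_eqs A i0 P a1 a2 E D .
  have "\<exists>Q :: complex poly. Q \<noteq> 0 \<and> (\<forall>\<xi> \<tau> \<tau>0. \<xi> \<longlonglongrightarrow> 0 \<longrightarrow> (\<forall>l::nat. \<xi> l \<noteq> 0) \<longrightarrow> \<tau> \<longlonglongrightarrow> \<tau>0 \<longrightarrow>
       (\<forall>l. biv (E j) (of_real (x0 $ i0) + \<xi> l) (of_real (x0 $ j) + \<tau> l * \<xi> l) = 0) \<longrightarrow> poly Q \<tau>0 = 0)" for j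
  proof -
    have "E j \<noteq> 0" using deg[of j] by auto
    then show ?thesis by (rule slope_polynomial[of "E j" "of_real (x0 $ i0)" "of_real (x0 $ j)"]) blast
  qed
  then obtain Q :: "_ \<Rightarrow> complex poly" where Q: "\<And>j. Q j \<noteq> 0"
    "\<And>j \<xi> \<tau> \<tau>0. \<xi> \<longlonglongrightarrow> 0 \<Longrightarrow> (\<And>l::nat. \<xi> l \<noteq> 0) \<Longrightarrow> \<tau> \<longlonglongrightarrow> \<tau>0 \<Longrightarrow>
       (\<And>l. biv (E j) (of_real (x0 $ i0) + \<xi> l) (of_real (x0 $ j) + \<tau> l * \<xi> l) = 0) \<Longrightarrow> poly (Q j) \<tau>0 = 0"
    by metis
  define S where "S j = {\<tau>. poly (Q j) (complex_of_real \<tau>) = 0}" for j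
  have fS: "finite (S j)" for j
    unfolding S_def by (rule finite_vimageI[OF poly_roots_finite[OF Q(1)], unfolded vimage_def, simplified]) (simp add: inj_of_real)
  have root: "v $ j / v $ i0 \<in> S j" if v: "v \<in> tangent_cone A x0" "v $ i0 \<noteq> 0" for v :: "real ^ 'n" and j
  proof -
    obtain s :: "nat \<Rightarrow> real ^ 'n" where s: "\<And>l::nat. s l \<in> A" "s \<longlonglongrightarrow> x0" "\<And>l. 0 < - sgn (v $ i0) * (s l $ i0 - x0 $ i0)"
      "\<And>j. (\<lambda>l. (s l $ j - x0 $ j) / (s l $ i0 - x0 $ i0)) \<longlonglongrightarrow> v $ j / v $ i0"
      by (rule tangent_cone_sequence[OF v]) (rule that)
    have ne: "s l $ i0 - x0 $ i0 \<noteq> 0" for l using s(3)[of l] by auto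
    have "(\<lambda>l. s l $ i0 - x0 $ i0) \<longlonglongrightarrow> x0 $ i0 - x0 $ i0" by (intro tendsto_intros s(2))
    then have 1: "(\<lambda>l. complex_of_real (s l $ i0 - x0 $ i0)) \<longlonglongrightarrow> 0" using tendsto_of_real by force
    have "poly (Q j) (of_real (v $ j / v $ i0)) = 0"
    proof (rule Q(2)[OF 1 _ tendsto_of_real[OF s(4)]])
      fix l
      have "biv (E j) (of_real (s l $ i0)) (of_real (s l $ j)) = 0" using van[of j] s(1)[of l] by (auto simp: vanishing_def)
      then show "biv (E j) (of_real (x0 $ i0) + of_real (s l $ i0 - x0 $ i0))
         (of_real (x0 $ j) + of_real ((s l $ j - x0 $ j) / (s l $ i0 - x0 $ i0)) * of_real (s l $ i0 - x0 $ i0)) = 0"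
        using ne[of l] by (simp flip: of_real_mult of_real_add)
    qed (use ne in \<open>simp del: of_real_diff\<close>)
    then show ?thesis by (simp add: S_def)
  qed
  define T where "T = (\<lambda>f. \<chi> j. f j) ` (PiE UNIV S)"
  have fT: "finite T" unfolding T_def by (intro finite_imageI finite_PiE fS) simp
  have "{v \<in> tangent_cone A x0. norm v = 1 \<and> v $ i0 \<noteq> 0} \<subseteq> (\<lambda>u. u /\<^sub>R norm u) ` T \<union> (\<lambda>u. - u /\<^sub>R norm u) ` T"
  proof safe
    fix v :: "real ^ 'n" assume v: "v \<in> tangent_cone A x0" "norm v = 1" "v $ i0 \<noteq> 0" "v \<notin> (\<lambda>u. - u /\<^sub>R norm u) ` T"
    define u where "u = v /\<^sub>R (v $ i0)"
    have uT: "u \<in> T" unfolding T_def u_def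
      by (rule image_eqI[of _ _ "\<lambda>j. v $ j / v $ i0"]) (use root[OF v(1,3)] in \<open>auto simp: vec_eq_iff divide_inverse mult.commute\<close>)
    have nu: "norm u = 1 / \<bar>v $ i0\<bar>" using v by (simp add: u_def divide_inverse)
    have "u /\<^sub>R norm u = (\<bar>v $ i0\<bar> / v $ i0) *\<^sub>R v" unfolding nu by (simp add: u_def divide_inverse)
    then have "v = u /\<^sub>R norm u \<or> v = - u /\<^sub>R norm u" using v(3) by (cases "v $ i0 > 0") auto
    then show "v \<in> (\<lambda>u. u /\<^sub>R norm u) ` T" using v(4) uT by blast
  qed
  then show ?thesis using fT by (meson finite_UnI finite_imageI finite_subset)
qed

subsection \<open>Regular points\<close>

text \<open>The same power series converge in a complex disc.\<close>

lemma analytic_path_complexify: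
  fixes g :: "real \<Rightarrow> real ^ 'n::finite"
  assumes an: "analytic_path_on g T" and T: "0 \<in> T"
  obtains r and \<Gamma> :: "'n \<Rightarrow> complex \<Rightarrow> complex" where "0 < r" "\<And>j. \<Gamma> j holomorphic_on ball 0 r"
    "\<And>j s. \<bar>s\<bar> < r \<Longrightarrow> \<Gamma> j (of_real s) = of_real (g s $ j)"
proof -
  obtain r and c :: "nat \<Rightarrow> real ^ 'n" where r: "0 < r" and c: "\<And>s. s \<in> ball 0 r \<Longrightarrow> (\<lambda>k. (s - 0) ^ k *\<^sub>R c k) sums g s"
    using an T unfolding analytic_path_on_def by blast
  have cj: "(\<lambda>k. c k $ j * s ^ k) sums (g s $ j)" if "\<bar>s\<bar> < r" for s j
    using bounded_linear.sums[OF bounded_linear_vec_nth c[of s]] that by (simp add: mult.commute)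
  define \<Gamma> where "\<Gamma> j z = suminf (\<lambda>k. complex_of_real (c k $ j) * z ^ k)" for j z
  have \<Gamma>s: "(\<lambda>k. complex_of_real (c k $ j) * z ^ k) sums \<Gamma> j z" if z: "norm z < r" for j z
  proof -
    obtain s where s: "norm z < s" "s < r" using dense[OF z] by blast
    have s0: "0 \<le> s" using s(1) norm_ge_zero[of z] by linarith
    have "summable (\<lambda>k. c k $ j * s ^ k)" using cj[of s j] s s0 by (auto simp: sums_iff)
    then have "summable (\<lambda>k. complex_of_real (c k $ j * s ^ k))" by (rule summable_of_real)
    then have "summable (\<lambda>k. complex_of_real (c k $ j) * of_real s ^ k)" by simp
    then have "summable (\<lambda>k. complex_of_real (c k $ j) * z ^ k)"
      by (rule powser_inside) (use s s0 in simp)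
    then show ?thesis unfolding \<Gamma>_def by (rule summable_sums)
  qed
  show ?thesis
  proof (rule that[OF r])
    show "\<Gamma> j holomorphic_on ball 0 r" for j
      by (rule power_series_holomorphic[of 0 r "\<lambda>k. of_real (c k $ j)"]) (use \<Gamma>s in simp)
    fix j and s :: real assume s: "\<bar>s\<bar> < r"
    have "(\<lambda>k. complex_of_real (c k $ j * s ^ k)) sums of_real (g s $ j)" by (rule sums_of_real[OF cj[OF s]])
    then have "(\<lambda>k. complex_of_real (c k $ j) * of_real s ^ k) sums of_real (g s $ j)" by simp
    with \<Gamma>s[of "of_real s" j] s show "\<Gamma> j (of_real s) = of_real (g s $ j)" by (simp add: sums_iff)
  qed
qed

text \<open>The complexification yields differentiability of the path; only then is
  \<open>vector_derivative\<close> known to be the actual derivative.\<close>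

lemma complexify_derivative:
  fixes g :: "real \<Rightarrow> real ^ 'n::finite"
  assumes r: "0 < r" and hol: "\<And>j. \<Gamma> j holomorphic_on ball (0::complex) r"
    and \<Gamma>: "\<And>j s. \<bar>s\<bar> < r \<Longrightarrow> \<Gamma> j (of_real s) = of_real (g s $ j)"
  shows "(\<Gamma> j has_field_derivative of_real (vector_derivative g (at 0) $ j)) (at 0)"
    and "(g has_vector_derivative vector_derivative g (at 0)) (at 0)"
proof -
  have D: "(\<Gamma> j has_field_derivative deriv (\<Gamma> j) 0) (at (of_real 0))" for j
    using holomorphic_derivI[OF hol[of j]] r by simp
  have vd: "((\<lambda>s. complex_of_real (g s $ j)) has_vector_derivative deriv (\<Gamma> j) 0) (at 0)" for j
    by (rule has_vector_derivative_transform_within_open[OF has_vector_derivative_real_field[OF D], of "ball 0 r"])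
      (use r \<Gamma> in auto)
  have Re: "((\<lambda>s. g s $ j) has_vector_derivative Re (deriv (\<Gamma> j) 0)) (at 0)" for j
    using bounded_linear.has_vector_derivative[OF bounded_linear_Re vd[of j]] by simp
  have "((\<lambda>s. (0::real)) has_vector_derivative Im (deriv (\<Gamma> j) 0)) (at 0)" for j
    using bounded_linear.has_vector_derivative[OF bounded_linear_Im vd[of j]] by simp
  then have Im: "Im (deriv (\<Gamma> j) 0) = 0" for j
    using vector_derivative_unique_at[OF _ has_vector_derivative_const] by blast
  define d :: "real ^ 'n" where "d = (\<chi> j. Re (deriv (\<Gamma> j) 0))"
  have gd: "(g has_vector_derivative d) (at 0)"
    unfolding has_vector_derivative_def has_derivative_componentwise_within[of g]
    using Re by (auto simp: Basis_vec_def inner_axis d_def has_vector_derivative_def)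
  then have d: "vector_derivative g (at 0) = d" by (rule vector_derivative_at)
  show "(g has_vector_derivative vector_derivative g (at 0)) (at 0)" using gd d by simp
  have "deriv (\<Gamma> j) 0 = of_real (d $ j)" using Im by (simp add: d_def complex_eq_iff)
  then show "(\<Gamma> j has_field_derivative of_real (vector_derivative g (at 0) $ j)) (at 0)" using D[of j] d by simp
qed

text \<open>The holomorphic inverse function theorem with one addition: the inverse is real on the
  real axis, since it is real along a sequence of real values of \<open>f\<close>.\<close>

lemma local_inverse:
  fixes f :: "complex \<Rightarrow> complex"
  assumes hol: "f holomorphic_on ball 0 r" and r: "0 < r" and f0: "f 0 = 0"
    and D: "(f has_field_derivative of_real \<omega>) (at 0)" and \<omega>: "\<omega> \<noteq> 0"
    and real: "\<And>s. \<bar>s\<bar> < r \<Longrightarrow> f (of_real s) \<in> \<real>"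
  obtains \<rho> h \<eta> where "0 < \<rho>" "h holomorphic_on ball 0 \<rho>" "h 0 = 0" "\<And>z. z \<in> ball 0 \<rho> \<Longrightarrow> f (h z) = z"
    "\<And>z. z \<in> ball 0 \<rho> \<Longrightarrow> norm (h z) < r" "(h has_field_derivative of_real (1 / \<omega>)) (at 0)"
    "\<And>x. \<bar>x\<bar> < \<rho> \<Longrightarrow> h (of_real x) = of_real (\<eta> x)"
proof -
  have d: "deriv f 0 = of_real \<omega>" using D by (rule DERIV_imp_deriv)
  obtain r1 where r1: "0 < r1" "ball (0::complex) r1 \<subseteq> ball 0 r" "inj_on f (ball 0 r1)"
    by (rule has_complex_derivative_locally_injective[OF hol _ open_ball, of 0]) (use r d \<omega> in simp, use d \<omega> in simp, rule that)
  have hol1: "f holomorphic_on ball 0 r1" using hol r1(2) by (rule holomorphic_on_subset)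
  obtain h where h: "h holomorphic_on f ` ball 0 r1" "\<And>z. z \<in> ball 0 r1 \<Longrightarrow> deriv f z * deriv h (f z) = 1"
    "\<And>z. z \<in> ball 0 r1 \<Longrightarrow> h (f z) = z"
    by (rule holomorphic_has_inverse[OF hol1 open_ball r1(3)]) (rule that)
  have "open (f ` ball 0 r1)" by (rule open_mapping_thm3[OF hol1 open_ball r1(3)])
  moreover have "0 \<in> f ` ball 0 r1" using f0 r1(1) by (intro image_eqI[of _ _ 0]) auto
  ultimately obtain \<rho> where \<rho>: "0 < \<rho>" "ball 0 \<rho> \<subseteq> f ` ball 0 r1" by (meson open_contains_ball)
  have holh: "h holomorphic_on ball 0 \<rho>" using h(1) \<rho>(2) by (rule holomorphic_on_subset)
  have h0: "h 0 = 0" using h(3)[of 0] f0 r1(1) by simp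
  have inv: "f (h z) = z \<and> norm (h z) < r" if z: "z \<in> ball 0 \<rho>" for z
  proof -
    obtain y where "y \<in> ball 0 r1" "z = f y" using \<rho>(2) z by blast
    then show ?thesis using h(3)[of y] r1(2) by auto
  qed
  have "of_real \<omega> * deriv h 0 = 1" using h(2)[of 0] r1(1) f0 d by simp
  then have "deriv h 0 = of_real (1 / \<omega>)" using \<omega> by (simp add: field_simps)
  then have Dh: "(h has_field_derivative of_real (1 / \<omega>)) (at 0)"
    using holomorphic_derivI[OF holh open_ball, of 0] \<rho>(1) by simp
  define r2 where "r2 = r1 / 2"
  define s where "s l = r2 * inverse (real (Suc l))" for l :: nat
  have s: "\<bar>s l\<bar> < r1" "s l \<noteq> 0" for l
  proof -
    have "inverse (real (Suc l)) \<le> 1" by (simp add: inverse_le_1_iff)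
    then have "s l \<le> r2 * 1" unfolding s_def r2_def using r1(1) by (intro mult_left_mono) auto
    moreover have "0 < s l" using r1(1) by (simp add: s_def r2_def)
    ultimately show "\<bar>s l\<bar> < r1" "s l \<noteq> 0" using r1(1) by (auto simp: r2_def)
  qed
  have "s \<longlonglongrightarrow> r2 * 0" unfolding s_def by (intro tendsto_intros LIMSEQ_inverse_real_of_nat)
  then have s0: "(\<lambda>l. complex_of_real (s l)) \<longlonglongrightarrow> 0" using tendsto_of_real by force
  have sr: "\<bar>s l\<bar> < r" for l
  proof -
    have "complex_of_real (s l) \<in> ball 0 r1" using s(1)[of l] by simp
    then have "complex_of_real (s l) \<in> ball 0 r" using r1(2) by blast
    then show ?thesis by simp
  qed
  define x where "x l = Re (f (of_real (s l)))" for l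
  have fx: "f (of_real (s l)) = of_real (x l)" for l using real[OF sr[of l]] by (simp add: x_def of_real_Re)
  have xne: "x l \<noteq> 0" for l
  proof
    assume "x l = 0"
    then have "f (of_real (s l)) = f 0" using fx f0 by simp
    moreover have "complex_of_real (s l) \<in> ball 0 r1" "0 \<in> ball (0::complex) r1" using s(1)[of l] r1(1) by auto
    ultimately have "complex_of_real (s l) = 0" using r1(3) by (meson inj_onD)
    then show False using s(2)[of l] by simp
  qed
  have "(\<lambda>l. complex_of_real (x l)) \<longlonglongrightarrow> of_real 0" using tendsto_along[OF hol r s0] f0 by (simp add: fx)
  then have x0: "x \<longlonglongrightarrow> 0" by (simp only: tendsto_of_real_iff)
  have "h (of_real (x l)) \<in> \<real>" for l
    using h(3)[of "of_real (s l)"] s(1)[of l] by (simp add: fx)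
  then have hr: "h (of_real y) \<in> \<real>" if "\<bar>y\<bar> < \<rho>" for y
    by (rule holomorphic_real_along_sequence[OF holh x0 xne _ that])
  show ?thesis
    by (rule that[OF \<rho>(1) holh h0 _ _ Dh, of "\<lambda>y. Re (h (of_real y))"]) (use inv hr of_real_Re in auto)
qed

lemma sgn_real_cases: "x \<noteq> 0 \<Longrightarrow> sgn x = 1 \<or> sgn x = (- 1 :: real)"
  by (auto simp: sgn_if)

text \<open>At a regular point the \<open>i0\<close>-th coordinate is itself a local parameter,
  which gives a branch with \<open>m = 1\<close>. The sign \<open>\<sigma>\<close> makes positive
  \<open>t\<close> correspond to positive parameters of \<open>g\<close>, so one half arc lies in
  \<open>A\<close> in both alternatives of \<open>regular_param\<close>.\<close>

lemma regular_branch: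
  fixes A :: "(real ^ 'n::finite) set" and g :: "real \<Rightarrow> real ^ 'n"
  assumes reg: "regular_param A x0 g" and nz: "vector_derivative g (at 0) $ i0 \<noteq> 0"
  obtains \<rho> \<gamma> where "holo_branch x0 i0 (sgn (vector_derivative g (at 0) $ i0)) 1 \<rho> \<gamma>
      (vector_derivative g (at 0) /\<^sub>R \<bar>vector_derivative g (at 0) $ i0\<bar>)"
    "\<And>t. 0 \<le> t \<Longrightarrow> t < \<rho> \<Longrightarrow> \<exists>a\<in>A. \<gamma> (of_real t) = cvec a"
    "x0 \<notin> end_points A \<Longrightarrow> (\<And>t. \<bar>t\<bar> < \<rho> \<Longrightarrow> \<exists>a\<in>A. \<gamma> (of_real t) = cvec a)"
proof -
  define w where "w = vector_derivative g (at 0)"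
  define \<omega> where "\<omega> = w $ i0"
  define \<sigma> where "\<sigma> = sgn \<omega>"
  have \<omega>: "\<omega> \<noteq> 0" using nz by (simp add: \<omega>_def w_def)
  then have \<sigma>: "\<sigma> = 1 \<or> \<sigma> = - 1" unfolding \<sigma>_def by (rule sgn_real_cases)
  obtain \<delta> U k where \<delta>: "0 < \<delta>" and an: "analytic_path_on g {-\<delta><..<\<delta>}" and g0: "g 0 = x0" and U: "open U"
    and hom: "homeomorphism {-\<delta><..<\<delta>} (A \<inter> U) g k \<or> homeomorphism {0..<\<delta>} (A \<inter> U) g k"
    using reg unfolding regular_param_def by blast
  obtain r1 and \<Gamma> :: "'n \<Rightarrow> complex \<Rightarrow> complex" where r1: "0 < r1" "\<And>j. \<Gamma> j holomorphic_on ball 0 r1"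
    "\<And>j s. \<bar>s\<bar> < r1 \<Longrightarrow> \<Gamma> j (of_real s) = of_real (g s $ j)"
    by (rule analytic_path_complexify[OF an]) (use \<delta> that in auto)
  have D: "(\<Gamma> j has_field_derivative of_real (w $ j)) (at 0)" for j
    unfolding w_def by (rule complexify_derivative(1)[OF r1]) auto
  define r where "r = min r1 \<delta>"
  have r: "0 < r" "r \<le> r1" "r \<le> \<delta>" using r1(1) \<delta> by (auto simp: r_def)
  have hol: "\<Gamma> j holomorphic_on ball 0 r" for j by (rule holomorphic_on_subset[OF r1(2)]) (use r in auto)
  have \<Gamma>0: "\<Gamma> j 0 = of_real (x0 $ j)" for j using r1(3)[of 0 j] r1(1) g0 by simp
  obtain \<rho>0 h \<eta> where \<rho>0: "0 < \<rho>0" and h: "h holomorphic_on ball 0 \<rho>0" "h 0 = 0"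
    "\<And>z. z \<in> ball 0 \<rho>0 \<Longrightarrow> \<Gamma> i0 (h z) - of_real (x0 $ i0) = z"
    "\<And>z. z \<in> ball 0 \<rho>0 \<Longrightarrow> norm (h z) < r" "(h has_field_derivative of_real (1 / \<omega>)) (at 0)"
    and \<eta>: "\<And>x. \<bar>x\<bar> < \<rho>0 \<Longrightarrow> h (of_real x) = of_real (\<eta> x)"
  proof (rule local_inverse[of "\<lambda>z. \<Gamma> i0 z - of_real (x0 $ i0)" r \<omega>])
    show "((\<lambda>z. \<Gamma> i0 z - of_real (x0 $ i0)) has_field_derivative of_real \<omega>) (at 0)"
      using D[of i0] unfolding \<omega>_def by (auto intro!: derivative_eq_intros)
    show "(\<lambda>z. \<Gamma> i0 z - of_real (x0 $ i0)) holomorphic_on ball 0 r" by (intro holomorphic_intros hol)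
    show "\<Gamma> i0 (of_real s) - of_real (x0 $ i0) \<in> \<real>" if "\<bar>s\<bar> < r" for s
      using r1(3)[of s i0] that r(2) by simp
  qed (use r \<Gamma>0 \<omega> that in auto)
  have \<eta>r: "\<bar>\<eta> x\<bar> < r" if "\<bar>x\<bar> < \<rho>0" for x using h(4)[of "of_real x"] \<eta>[OF that] that by simp
  \<comment> \<open>The derivative \<open>\<sigma> / \<omega>\<close> is positive, so small positive
    \<open>t\<close> have positive parameters.\<close>
  have D\<eta>: "((\<lambda>t. \<eta> (\<sigma> * t)) has_real_derivative \<sigma> * (1 / \<omega>)) (at 0)"
  proof -
    have "((\<lambda>z. h (of_real \<sigma> * z)) has_field_derivative of_real (1 / \<omega>) * of_real \<sigma>) (at (of_real 0))"
      by (rule DERIV_chain2[where f = h]) (use h(5) in \<open>auto intro!: derivative_eq_intros\<close>)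
    from bounded_linear.has_vector_derivative[OF bounded_linear_Re has_vector_derivative_real_field[OF this]]
    have "((\<lambda>t::real. Re (h (of_real \<sigma> * of_real t))) has_vector_derivative \<sigma> * (1 / \<omega>)) (at 0)"
      by (simp add: mult.commute flip: of_real_mult of_real_divide)
    then have "((\<lambda>t. \<eta> (\<sigma> * t)) has_vector_derivative \<sigma> * (1 / \<omega>)) (at 0)"
    proof (rule has_vector_derivative_transform_within_open[of _ _ _ "ball 0 \<rho>0"])
      fix t :: real assume "t \<in> ball 0 \<rho>0"
      then have "\<bar>\<sigma> * t\<bar> < \<rho>0" using \<sigma> by auto
      then show "Re (h (of_real \<sigma> * of_real t)) = \<eta> (\<sigma> * t)" using \<eta>[of "\<sigma> * t"] by simp
    qed (use \<rho>0 in auto)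
    then show ?thesis by (simp add: has_real_derivative_iff_has_vector_derivative)
  qed
  have pos: "0 < \<sigma> * (1 / \<omega>)" using \<omega> by (simp add: \<sigma>_def sgn_if)
  have \<eta>0: "\<eta> 0 = 0" using \<eta>[of 0] h(2) \<rho>0 by simp
  obtain d where d: "0 < d" "\<And>t. 0 < t \<Longrightarrow> t < d \<Longrightarrow> 0 < \<eta> (\<sigma> * t)"
    using DERIV_pos_inc_right[OF D\<eta> pos] \<eta>0 by auto
  define \<rho> where "\<rho> = min d \<rho>0"
  have \<rho>: "0 < \<rho>" "\<rho> \<le> d" "\<rho> \<le> \<rho>0" using d \<rho>0 by (auto simp: \<rho>_def)
  define \<gamma> :: "complex \<Rightarrow> complex ^ 'n" where "\<gamma> t = (\<chi> j. \<Gamma> j (h (of_real \<sigma> * t)))" for t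
  have \<gamma>: "\<gamma> (of_real t) = cvec (g (\<eta> (\<sigma> * t)))" if "\<bar>t\<bar> < \<rho>" for t
  proof -
    have *: "\<bar>\<sigma> * t\<bar> < \<rho>0" using that \<rho>(3) \<sigma> by auto
    have "h (of_real \<sigma> * of_real t) = of_real (\<eta> (\<sigma> * t))" using \<eta>[OF *] by simp
    then show ?thesis using r1(3) \<eta>r[OF *] r(2) by (simp add: \<gamma>_def vec_eq_iff cvec_nth)
  qed
  have ball\<sigma>: "of_real \<sigma> * z \<in> ball 0 \<rho>0" if "z \<in> ball 0 \<rho>" for z :: complex
    using that \<sigma> \<rho>(3) by auto
  have holc: "(\<lambda>t. \<Gamma> j (h (of_real \<sigma> * t))) holomorphic_on ball 0 \<rho>" for j
  proof -
    have 1: "(\<lambda>t. h (of_real \<sigma> * t)) holomorphic_on ball 0 \<rho>"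
      by (rule holomorphic_on_compose_gen[OF _ h(1), unfolded o_def]) (use ball\<sigma> in \<open>auto intro!: holomorphic_intros\<close>)
    show ?thesis
      by (rule holomorphic_on_compose_gen[OF 1 hol, unfolded o_def]) (use ball\<sigma> h(4) in auto)
  qed
  have hb: "holo_branch x0 i0 \<sigma> 1 \<rho> \<gamma> (w /\<^sub>R \<bar>\<omega>\<bar>)"
    unfolding holo_branch_def
  proof (intro conjI allI ballI)
    show "(\<lambda>t. \<gamma> t $ j) holomorphic_on ball 0 \<rho>" for j using holc[of j] by (simp add: \<gamma>_def)
    show "\<gamma> 0 = cvec x0" by (simp add: \<gamma>_def h(2) \<Gamma>0 vec_eq_iff cvec_nth)
    show "\<gamma> t $ i0 = of_real (x0 $ i0) + of_real \<sigma> * t ^ 1" if "t \<in> ball 0 \<rho>" for t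
      using h(3)[OF ball\<sigma>[OF that]] by (simp add: \<gamma>_def algebra_simps)
    fix j
    define F where "F t = \<Gamma> j (h (of_real \<sigma> * t)) - of_real (x0 $ j)" for t
    have "F holomorphic_on ball 0 \<rho>" unfolding F_def by (intro holomorphic_intros holc)
    then obtain \<psi> where \<psi>: "\<psi> holomorphic_on ball 0 \<rho>" "\<And>t. F t = t * \<psi> t"
      by (rule factor_at_zero[of F \<rho>]) (use \<rho>(1) in \<open>auto simp: F_def h(2) \<Gamma>0\<close>)
    have D1: "((\<lambda>t. h (of_real \<sigma> * t)) has_field_derivative of_real (1 / \<omega>) * of_real \<sigma>) (at 0)"
      by (rule DERIV_chain2[where f = h]) (use h(5) in \<open>auto intro!: derivative_eq_intros\<close>)
    have "((\<lambda>t. \<Gamma> j (h (of_real \<sigma> * t))) has_field_derivative of_real (w $ j) * (of_real (1 / \<omega>) * of_real \<sigma>)) (at 0)"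
      by (rule DERIV_chain2[where f = "\<Gamma> j", OF _ D1]) (use D[of j] h(2) in simp)
    then have DF: "(F has_field_derivative of_real (w $ j) * (of_real (1 / \<omega>) * of_real \<sigma>)) (at 0)"
      unfolding F_def by (auto intro!: derivative_eq_intros)
    have "(\<psi> has_field_derivative deriv \<psi> 0) (at 0)" using holomorphic_derivI[OF \<psi>(1) open_ball, of 0] \<rho>(1) by simp
    then have "((\<lambda>t. t * \<psi> t) has_field_derivative \<psi> 0) (at 0)" by (auto intro!: derivative_eq_intros)
    then have "(F has_field_derivative \<psi> 0) (at 0)" by (simp add: \<psi>(2)[symmetric])
    from DERIV_unique[OF this DF] have "\<psi> 0 = of_real ((w /\<^sub>R \<bar>\<omega>\<bar>) $ j)"
      using \<omega> by (simp add: \<sigma>_def sgn_if divide_inverse) (simp add: mult_ac)?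
    moreover have "\<gamma> t $ j = of_real (x0 $ j) + t ^ 1 * \<psi> t" for t
      using \<psi>(2)[of t] by (simp add: F_def \<gamma>_def algebra_simps)
    ultimately show "\<exists>\<psi>. \<psi> holomorphic_on ball 0 \<rho> \<and> (\<forall>t\<in>ball 0 \<rho>. \<gamma> t $ j = of_real (x0 $ j) + t ^ 1 * \<psi> t)
        \<and> \<psi> 0 = of_real ((w /\<^sub>R \<bar>\<omega>\<bar>) $ j)" using \<psi>(1) by blast
  qed (use \<rho> \<sigma> in auto)
  show ?thesis
  proof (rule that[of \<rho> \<gamma>])
    show "holo_branch x0 i0 (sgn (vector_derivative g (at 0) $ i0)) 1 \<rho> \<gamma>
      (vector_derivative g (at 0) /\<^sub>R \<bar>vector_derivative g (at 0) $ i0\<bar>)"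
      using hb by (simp add: \<sigma>_def \<omega>_def w_def)
    show "\<exists>a\<in>A. \<gamma> (of_real t) = cvec a" if t: "0 \<le> t" "t < \<rho>" for t
    proof -
      have "0 \<le> \<eta> (\<sigma> * t)" using d(2)[of t] t \<rho>(2) \<eta>0 by (cases "t = 0") auto
      moreover have "\<bar>\<sigma> * t\<bar> < \<rho>0" using t \<rho>(3) \<sigma> by auto
      ultimately have "\<eta> (\<sigma> * t) \<in> {0..<\<delta>}" "\<eta> (\<sigma> * t) \<in> {-\<delta><..<\<delta>}" using \<eta>r[of "\<sigma> * t"] r(3) by auto
      then have "g (\<eta> (\<sigma> * t)) \<in> A" using hom by (auto simp: homeomorphism_def)
      then show ?thesis using \<gamma>[of t] t by auto
    qed
    show "\<exists>a\<in>A. \<gamma> (of_real t) = cvec a" if ne: "x0 \<notin> end_points A" and t: "\<bar>t\<bar> < \<rho>" for t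
    proof -
      \<comment> \<open>Rescaled to \<open>{0..<1}\<close>, the half-open alternative would exhibit
        \<open>x0\<close> as an end point.\<close>
      have "\<not> homeomorphism {0..<\<delta>} (A \<inter> U) g k"
      proof
        assume h: "homeomorphism {0..<\<delta>} (A \<inter> U) g k"
        have "homeomorphism {0..<1} {0..<\<delta>} (\<lambda>t. \<delta> * t) (\<lambda>t. t / \<delta>)"
          by (rule homeomorphismI) (use \<delta> in \<open>auto intro!: continuous_intros simp: field_simps\<close>)
        from homeomorphism_compose[OF this h]
        have "homeomorphism {0..<1} (A \<inter> U) (g \<circ> (\<lambda>t. \<delta> * t)) ((\<lambda>t. t / \<delta>) \<circ> k)" .
        moreover have "(g \<circ> (\<lambda>t. \<delta> * t)) 0 = x0" using g0 by simp
        moreover have "x0 \<in> A" using h g0 \<delta> by (auto simp: homeomorphism_def)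
        ultimately have "x0 \<in> end_points A" using U unfolding end_points_def by blast
        then show False using ne by simp
      qed
      then have "homeomorphism {-\<delta><..<\<delta>} (A \<inter> U) g k" using hom by blast
      moreover have "\<bar>\<sigma> * t\<bar> < \<rho>0" using t \<rho>(3) \<sigma> by auto
      then have "\<eta> (\<sigma> * t) \<in> {-\<delta><..<\<delta>}" using \<eta>r[of "\<sigma> * t"] r(3) by auto
      ultimately have "g (\<eta> (\<sigma> * t)) \<in> A" by (auto simp: homeomorphism_def)
      then show ?thesis using \<gamma>[of t] t by auto
    qed
  qed
qed

text \<open>The points of \<open>g\<close> at positive parameters show that the negative of the
  normalised derivative is in the cone. This links tangent spaces to the finiteness of unit cone
  vectors and to coordinates that vary on \<open>A\<close>.\<close>

lemma tangent_space_unit: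
  fixes A :: "(real ^ 'n::finite) set" and v :: "real ^ 'n"
  assumes v: "v \<in> tangent_space A x0" "norm v = 1"
  obtains g where "regular_param A x0 g" "vector_derivative g (at 0) \<noteq> 0"
    "v = vector_derivative g (at 0) /\<^sub>R norm (vector_derivative g (at 0)) \<or>
     v = - (vector_derivative g (at 0) /\<^sub>R norm (vector_derivative g (at 0)))"
    "v \<in> tangent_cone A x0 \<or> - v \<in> tangent_cone A x0"
proof -
  obtain g where g: "regular_param A x0 g" "v \<in> span {vector_derivative g (at 0)}"
    using v(1) unfolding tangent_space_def by blast
  define w where "w = vector_derivative g (at 0)"
  obtain \<delta> U k where \<delta>: "0 < \<delta>" and an: "analytic_path_on g {-\<delta><..<\<delta>}" and g0: "g 0 = x0"
    and w0: "\<forall>t\<in>{-\<delta><..<\<delta>}. vector_derivative g (at t) \<noteq> 0"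
    and hom: "homeomorphism {-\<delta><..<\<delta>} (A \<inter> U) g k \<or> homeomorphism {0..<\<delta>} (A \<inter> U) g k"
    using g(1) unfolding regular_param_def by blast
  have w: "w \<noteq> 0" using w0 \<delta> by (simp add: w_def)
  obtain c where c: "v = c *\<^sub>R w" using g(2) by (auto simp: span_singleton w_def)
  then have "\<bar>c\<bar> = 1 / norm w" using v(2) w by (simp add: field_simps)
  then have "c = inverse (norm w) \<or> c = - inverse (norm w)" by (simp add: divide_inverse abs_if split: if_splits)
  then have vw: "v = w /\<^sub>R norm w \<or> v = - (w /\<^sub>R norm w)" using c by auto
  obtain r1 and \<Gamma> :: "'n \<Rightarrow> complex \<Rightarrow> complex" where r1: "0 < r1" "\<And>j. \<Gamma> j holomorphic_on ball 0 r1"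
    "\<And>j s. \<bar>s\<bar> < r1 \<Longrightarrow> \<Gamma> j (of_real s) = of_real (g s $ j)"
    by (rule analytic_path_complexify[OF an]) (use \<delta> that in auto)
  have vd: "(g has_vector_derivative w) (at 0)"
    unfolding w_def by (rule complexify_derivative(2)[OF r1]) auto
  define s where "s l = \<delta> / 2 * inverse (real (Suc l))" for l :: nat
  have s: "0 < s l" "s l < \<delta>" for l
  proof -
    have "inverse (real (Suc l)) \<le> 1" by (simp add: inverse_le_1_iff)
    then have "s l \<le> \<delta> / 2 * 1" unfolding s_def using \<delta> by (intro mult_left_mono) auto
    then show "s l < \<delta>" using \<delta> by simp
    show "0 < s l" using \<delta> by (simp add: s_def)
  qed
  have "s \<longlonglongrightarrow> \<delta> / 2 * 0" unfolding s_def by (intro tendsto_intros LIMSEQ_inverse_real_of_nat)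
  then have s0: "s \<longlonglongrightarrow> 0" by simp
  have gA: "g (s l) \<in> A" for l
  proof -
    have "s l \<in> {0..<\<delta>}" "s l \<in> {-\<delta><..<\<delta>}" using s[of l] \<delta> by auto
    then show ?thesis using hom by (auto simp: homeomorphism_def)
  qed
  have "isCont g 0" using vd by (rule has_vector_derivative_continuous)
  then have gs: "(\<lambda>l. g (s l)) \<longlonglongrightarrow> x0" using isCont_tendsto_compose[OF _ s0, of g] g0 by simp
  have "(\<lambda>l. (g (s l) - x0) /\<^sub>R s l) \<longlonglongrightarrow> w"
  proof (rule vec_tendstoI)
    fix j
    have "((\<lambda>t. g t $ j) has_real_derivative w $ j) (at 0)"
      using bounded_linear.has_vector_derivative[OF bounded_linear_vec_nth vd, of j]
      by (simp add: has_real_derivative_iff_has_vector_derivative)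
    then have "((\<lambda>h. (g (0 + h) $ j - g 0 $ j) / h) \<longlongrightarrow> w $ j) (at 0)" by (rule DERIV_D)
    then have "((\<lambda>h. (g h $ j - x0 $ j) / h) \<longlongrightarrow> w $ j) (at 0)" by (simp add: g0)
    then have "(\<lambda>l. (g (s l) $ j - x0 $ j) / s l) \<longlonglongrightarrow> w $ j"
      by (rule filterlim_compose) (use s0 s(1) in \<open>auto simp: filterlim_at less_imp_neq[symmetric]\<close>)
    then show "(\<lambda>l. ((g (s l) - x0) /\<^sub>R s l) $ j) \<longlonglongrightarrow> w $ j" by (simp add: divide_inverse mult.commute)
  qed
  then have "(\<lambda>l. (- inverse (norm w)) *\<^sub>R ((g (s l) - x0) /\<^sub>R s l)) \<longlonglongrightarrow> (- inverse (norm w)) *\<^sub>R w" by (intro tendsto_intros)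
  moreover have "(- inverse (norm w)) *\<^sub>R ((g (s l) - x0) /\<^sub>R s l) = (inverse (norm w) * inverse (s l)) *\<^sub>R (x0 - g (s l))" for l
    by (simp add: algebra_simps)
  ultimately have "(\<lambda>l. (inverse (norm w) * inverse (s l)) *\<^sub>R (x0 - g (s l))) \<longlonglongrightarrow> - (w /\<^sub>R norm w)" by simp
  then have "- (w /\<^sub>R norm w) \<in> tangent_cone A x0"
    unfolding tangent_cone_def mem_Collect_eq
    by (intro exI[of _ "\<lambda>l. g (s l)"] exI[of _ "\<lambda>l. inverse (norm w) * inverse (s l)"]) (use gA gs s(1) w in auto)
  then have "v \<in> tangent_cone A x0 \<or> - v \<in> tangent_cone A x0" using vw by auto
  with g(1) w vw show ?thesis unfolding w_def by (rule that)
qed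

subsection \<open>Local estimates\<close>

text \<open>Polynomials are bounded on balls, so the supremum is a genuine one.\<close>

lemma abs_peval_le_unif_norm:
  fixes p :: "(real, 'n::finite) mpolynomial"
  assumes "a \<in> A \<inter> ball x0 r"
  shows "\<bar>peval p a\<bar> \<le> unif_norm (A \<inter> ball x0 r) (peval p)"
proof -
  have "compact ((\<lambda>a. \<bar>peval p a\<bar>) ` cball x0 r)"
    by (intro compact_continuous_image continuous_intros continuous_on_id compact_cball)
  then have "bdd_above ((\<lambda>a. \<bar>peval p a\<bar>) ` cball x0 r)" by (intro bounded_imp_bdd_above compact_imp_bounded)
  then have "bdd_above ((\<lambda>a. \<bar>peval p a\<bar>) ` (A \<inter> ball x0 r))" by (rule bdd_above_mono) auto
  then show ?thesis unfolding unif_norm_def using assms by (intro cSUP_upper)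
qed

lemma peval_const:
  fixes p :: "(real, 'n::finite) mpolynomial"
  assumes "total_deg p = 0"
  shows "peval p x = peval p y"
proof -
  have "m = 0" if m: "m \<in> Poly_Mapping.keys p" for m
  proof -
    have "(\<Sum>i\<in>UNIV. Poly_Mapping.lookup m i) \<le> total_deg p" unfolding total_deg_def by (rule Max_ge) (use m in auto)
    then show ?thesis using assms by (intro poly_mapping_eqI) simp
  qed
  then have k: "Poly_Mapping.keys p \<subseteq> {0}" by auto
  have "peval p z = Poly_Mapping.lookup p 0" for z
    using peval_superset[OF _ k] by (simp add: monom_val_zero)
  then show ?thesis by simp
qed

text \<open>One shape for all three cases: \<open>F\<close> gives the factor in terms of
  \<open>\<epsilon>\<close> and the degree, \<open>R\<close> the radius of the ball,
  \<open>e\<close> the threshold.\<close>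

definition bernstein_at :: "(real ^ 'n::finite) set \<Rightarrow> real ^ 'n \<Rightarrow> real ^ 'n \<Rightarrow> (real \<Rightarrow> real \<Rightarrow> real) \<Rightarrow> (real \<Rightarrow> real) \<Rightarrow> real \<Rightarrow> bool" where
  "bernstein_at A x0 v F R e \<longleftrightarrow> (\<forall>\<epsilon>. 0 < \<epsilon> \<and> \<epsilon> < e \<longrightarrow> (\<forall>p. \<bar>dir_deriv (peval p) v x0\<bar>
     \<le> F \<epsilon> (real (total_deg p)) * unif_norm (A \<inter> ball x0 (R \<epsilon>)) (peval p)))"

text \<open>Separates degree 0, where the derivative vanishes and the branch estimates do not
  apply.\<close>

lemma bernstein_atI:
  fixes A :: "(real ^ 'n::finite) set"
  assumes x0: "x0 \<in> A" and pos: "\<And>\<epsilon>. 0 < \<epsilon> \<Longrightarrow> 0 < R \<epsilon>" "\<And>\<epsilon>. 0 < \<epsilon> \<Longrightarrow> 0 \<le> F \<epsilon> 0"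
    and est: "\<And>\<epsilon> p D. 0 < \<epsilon> \<Longrightarrow> \<epsilon> < e \<Longrightarrow> 0 < total_deg p \<Longrightarrow> (peval p has_derivative D) (at x0) \<Longrightarrow>
      0 \<le> unif_norm (A \<inter> ball x0 (R \<epsilon>)) (peval p) \<Longrightarrow>
      \<bar>D v\<bar> \<le> F \<epsilon> (real (total_deg p)) * unif_norm (A \<inter> ball x0 (R \<epsilon>)) (peval p)"
  shows "bernstein_at A x0 v F R e"
  unfolding bernstein_at_def
proof (intro allI impI)
  fix \<epsilon> and p :: "(real, 'n) mpolynomial" assume \<epsilon>: "0 < \<epsilon> \<and> \<epsilon> < e"
  obtain D where D: "(peval p has_derivative D) (at x0)" using peval_differentiable[of p x0] unfolding differentiable_def by blast
  have "x0 \<in> A \<inter> ball x0 (R \<epsilon>)" using x0 pos(1) \<epsilon> by simp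
  from abs_peval_le_unif_norm[OF this, of p] have M: "0 \<le> unif_norm (A \<inter> ball x0 (R \<epsilon>)) (peval p)" by linarith
  show "\<bar>dir_deriv (peval p) v x0\<bar> \<le> F \<epsilon> (real (total_deg p)) * unif_norm (A \<inter> ball x0 (R \<epsilon>)) (peval p)"
  proof (cases "total_deg p = 0")
    case True
    have "peval p = (\<lambda>x. peval p 0)" using peval_const[OF True] by blast
    then have "(peval p has_derivative (\<lambda>x. 0)) (at x0)" by (metis has_derivative_const)
    then have "dir_deriv (peval p) v x0 = 0" by (rule dir_deriv_eq)
    then show ?thesis using True M pos(2)[of \<epsilon>] \<epsilon> by simp
  next
    case False
    then show ?thesis using est[OF _ _ _ D M] \<epsilon> by (simp add: dir_deriv_eq[OF D])
  qed
qed

lemma holo_branch_close: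
  fixes W :: "real ^ 'n::finite"
  assumes br: "holo_branch x0 i0 \<sigma> m \<rho> \<gamma> W"
  obtains r where "0 < r" "r \<le> \<rho>" "\<And>t a. \<bar>t\<bar> < r \<Longrightarrow> \<gamma> (of_real t) = cvec a \<Longrightarrow> dist x0 a \<le> (norm W + 1) * \<bar>t\<bar> ^ m"
proof -
  have \<rho>: "0 < \<rho>" using br by (simp add: holo_branch_def)
  have "\<exists>\<psi>. \<psi> holomorphic_on ball 0 \<rho> \<and> (\<forall>t\<in>ball 0 \<rho>. \<gamma> t $ j = of_real (x0 $ j) + t ^ m * \<psi> t) \<and> \<psi> 0 = of_real (W $ j)" for j
    using br by (simp add: holo_branch_def)
  then obtain \<psi> where \<psi>: "\<And>j. \<psi> j holomorphic_on ball 0 \<rho>"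
    "\<And>j t. t \<in> ball 0 \<rho> \<Longrightarrow> \<gamma> t $ j = of_real (x0 $ j) + t ^ m * \<psi> j t" "\<And>j. \<psi> j 0 = of_real (W $ j)" by metis
  define \<Psi> :: "complex \<Rightarrow> complex ^ 'n" where "\<Psi> t = (\<chi> j. \<psi> j t)" for t
  have "isCont (\<psi> j) 0" for j
    using holomorphic_on_imp_continuous_on[OF \<psi>(1)[of j]] \<rho> by (simp add: continuous_on_eq_continuous_at)
  then have "isCont \<Psi> 0" unfolding \<Psi>_def isCont_def by (intro vec_tendstoI) simp
  then have c: "((\<lambda>t. norm (\<Psi> t)) \<longlongrightarrow> norm (\<Psi> 0)) (nhds 0)"
    by (intro tendsto_norm) (simp add: isCont_def tendsto_at_iff_tendsto_nhds)
  have "\<Psi> 0 = cvec W" by (simp add: \<Psi>_def \<psi>(3) vec_eq_iff cvec_nth)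
  moreover have "norm (cvec W) = norm W" by (simp add: norm_vec_def cvec_nth)
  ultimately have "norm (\<Psi> 0) < norm W + 1" by simp
  from order_tendstoD(2)[OF c this] obtain e where e: "0 < e" "\<And>t. dist t 0 < e \<Longrightarrow> norm (\<Psi> t) < norm W + 1"
    by (auto simp: eventually_nhds_metric)
  show ?thesis
  proof (rule that[of "min e \<rho>"])
    fix t :: real and a assume t: "\<bar>t\<bar> < min e \<rho>" and a: "\<gamma> (of_real t) = cvec a"
    have "cvec a - cvec x0 = (of_real t) ^ m *s \<Psi> (of_real t)"
      using \<psi>(2)[of "of_real t"] t by (simp add: a[symmetric] vec_eq_iff cvec_nth \<Psi>_def)
    moreover have "norm (cvec a - cvec x0) = dist x0 a"
    proof -
      have "cvec a - cvec x0 = cvec (a - x0)" by (simp add: vec_eq_iff cvec_nth)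
      then have "norm (cvec a - cvec x0) = norm (a - x0)" by (simp add: norm_vec_def cvec_nth flip: of_real_diff)
      then show ?thesis by (simp add: dist_norm norm_minus_commute)
    qed
    moreover have "norm (c *s (w :: complex ^ 'n)) = norm c * norm w" for c w
      by (simp add: norm_vec_def L2_set_def norm_mult power_mult_distrib real_sqrt_mult flip: sum_distrib_left)
    ultimately have "dist x0 a = \<bar>t\<bar> ^ m * norm (\<Psi> (of_real t))" by (simp add: norm_power)
    also have "\<dots> \<le> \<bar>t\<bar> ^ m * (norm W + 1)" using e(2)[of "of_real t"] t by (intro mult_left_mono) auto
    finally show "dist x0 a \<le> (norm W + 1) * \<bar>t\<bar> ^ m" by (simp add: mult.commute)
  qed (use e(1) \<rho> in auto)
qed

text \<open>Restates the branch estimates in terms of the radius \<open>h\<close> of a ball instead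
  of the range \<open>\<epsilon>\<close> of the parameter.\<close>

lemma (in curve_coord) arc_estimates:
  obtains B :: nat where "0 < B"
    "\<And>x0 \<sigma> m \<rho> \<gamma> W t1. holo_branch x0 i0 \<sigma> m \<rho> \<gamma> W \<Longrightarrow> 0 < t1 \<Longrightarrow>
       (\<forall>t. 0 \<le> t \<and> t \<le> t1 \<longrightarrow> (\<exists>a\<in>A. \<gamma> (of_real t) = cvec a)) \<Longrightarrow>
       \<exists>h0>0. \<forall>h p D. 0 < h \<longrightarrow> h < h0 \<longrightarrow> (peval p has_derivative D) (at x0) \<longrightarrow> 0 < total_deg p \<longrightarrow>
         \<bar>D W\<bar> \<le> 4 * (32 * (real (B * total_deg p))\<^sup>2) ^ m * (2 * (norm W + 1) / h) * unif_norm (A \<inter> ball x0 h) (peval p)"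
    "\<And>x0 \<sigma> \<rho> \<gamma> W t1. holo_branch x0 i0 \<sigma> 1 \<rho> \<gamma> W \<Longrightarrow> 0 < t1 \<Longrightarrow>
       (\<forall>t. \<bar>t\<bar> \<le> t1 \<longrightarrow> (\<exists>a\<in>A. \<gamma> (of_real t) = cvec a)) \<Longrightarrow>
       \<exists>h0>0. \<forall>h p D. 0 < h \<longrightarrow> h < h0 \<longrightarrow> (peval p has_derivative D) (at x0) \<longrightarrow> 0 < total_deg p \<longrightarrow>
         \<bar>D W\<bar> \<le> 32 * real (B * total_deg p) * (2 * (norm W + 1) / h) * unif_norm (A \<inter> ball x0 h) (peval p)"
proof (rule branch_estimates, goal_cases)
  case (1 B)
  note B = 1(2-4)
  have scale: "\<exists>h0>0. \<forall>h. 0 < h \<longrightarrow> h < h0 \<longrightarrow> (\<exists>\<epsilon>. 0 < \<epsilon> \<and> \<epsilon> < \<rho> \<and> \<epsilon> \<le> t1 \<and> \<epsilon> ^ m = h / (2 * (norm W + 1)) \<and>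
      (\<forall>t a. \<bar>t\<bar> \<le> \<epsilon> \<longrightarrow> a \<in> A \<longrightarrow> \<gamma> (of_real t) = cvec a \<longrightarrow> a \<in> A \<inter> ball x0 h))"
    if br: "holo_branch x0 i0 \<sigma> m \<rho> \<gamma> W" and t1: "0 < t1" for x0 \<sigma> m \<rho> \<gamma> t1 and W :: "real ^ 'n"
  proof -
    obtain r where r: "0 < r" "r \<le> \<rho>"
      "\<And>t a. \<bar>t\<bar> < r \<Longrightarrow> \<gamma> (of_real t) = cvec a \<Longrightarrow> dist x0 a \<le> (norm W + 1) * \<bar>t\<bar> ^ m"
      by (rule holo_branch_close[OF br]) (rule that)
    define K where "K = norm W + 1"
    have K: "0 < K" by (simp add: K_def add_nonneg_pos)
    define \<mu> where "\<mu> = min r t1"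
    have \<mu>: "0 < \<mu>" "\<mu> \<le> r" "\<mu> \<le> t1" using r t1 by (auto simp: \<mu>_def)
    have m: "0 < m" using br by (simp add: holo_branch_def)
    show ?thesis
    proof (rule exI[of _ "2 * K * \<mu> ^ m"], intro conjI allI impI)
      show "0 < 2 * K * \<mu> ^ m" using K \<mu> by simp
      fix h assume h: "0 < h" "h < 2 * K * \<mu> ^ m"
      \<comment> \<open>Points of the arc with \<open>\<bar>t\<bar> \<le> \<epsilon>\<close> are
        within \<open>K * \<epsilon> ^ m = h / 2\<close> of \<open>x0\<close>, hence inside the open
        ball of radius \<open>h\<close>.\<close>
      define \<epsilon> where "\<epsilon> = root m (h / (2 * K))"
      have \<epsilon>m: "\<epsilon> ^ m = h / (2 * K)" using m h K by (simp add: \<epsilon>_def)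
      have \<epsilon>0: "0 < \<epsilon>" using m h K by (simp add: \<epsilon>_def)
      have "\<epsilon> ^ m < \<mu> ^ m" using h K by (simp add: \<epsilon>m field_simps)
      then have \<epsilon>\<mu>: "\<epsilon> < \<mu>" using \<mu>(1) by (intro power_less_imp_less_base[of \<epsilon> m]) auto
      have "a \<in> A \<inter> ball x0 h" if "\<bar>t\<bar> \<le> \<epsilon>" "a \<in> A" "\<gamma> (of_real t) = cvec a" for t a
      proof -
        have "dist x0 a \<le> K * \<bar>t\<bar> ^ m" using r(3)[of t a] that \<epsilon>\<mu> \<mu>(2) by (simp add: K_def)
        also have "\<dots> \<le> K * \<epsilon> ^ m" using that K by (intro mult_left_mono power_mono) auto
        also have "\<dots> < h" using h K by (simp add: \<epsilon>m)
        finally show ?thesis using that by simp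
      qed
      then show "\<exists>\<epsilon>. 0 < \<epsilon> \<and> \<epsilon> < \<rho> \<and> \<epsilon> \<le> t1 \<and> \<epsilon> ^ m = h / (2 * (norm W + 1)) \<and>
        (\<forall>t a. \<bar>t\<bar> \<le> \<epsilon> \<longrightarrow> a \<in> A \<longrightarrow> \<gamma> (of_real t) = cvec a \<longrightarrow> a \<in> A \<inter> ball x0 h)"
        using \<epsilon>0 \<epsilon>\<mu> \<mu> r(2) \<epsilon>m unfolding K_def by (intro exI[of _ \<epsilon>]) auto
    qed
  qed
  show ?thesis
  proof (rule that[OF B(1)])
    fix x0 \<sigma> m \<rho> \<gamma> W t1
    assume br: "holo_branch x0 i0 \<sigma> m \<rho> \<gamma> W" and t1: "0 < t1"
      and arc: "\<forall>t. 0 \<le> t \<and> t \<le> t1 \<longrightarrow> (\<exists>a\<in>A. \<gamma> (of_real t) = cvec a)"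
    obtain h0 where h0: "0 < h0" "\<And>h. 0 < h \<Longrightarrow> h < h0 \<Longrightarrow> \<exists>\<epsilon>. 0 < \<epsilon> \<and> \<epsilon> < \<rho> \<and> \<epsilon> \<le> t1 \<and> \<epsilon> ^ m = h / (2 * (norm W + 1)) \<and>
      (\<forall>t a. \<bar>t\<bar> \<le> \<epsilon> \<longrightarrow> a \<in> A \<longrightarrow> \<gamma> (of_real t) = cvec a \<longrightarrow> a \<in> A \<inter> ball x0 h)"
      using scale[OF br t1] by blast
    show "\<exists>h0>0. \<forall>h p D. 0 < h \<longrightarrow> h < h0 \<longrightarrow> (peval p has_derivative D) (at x0) \<longrightarrow> 0 < total_deg p \<longrightarrow>
         \<bar>D W\<bar> \<le> 4 * (32 * (real (B * total_deg p))\<^sup>2) ^ m * (2 * (norm W + 1) / h) * unif_norm (A \<inter> ball x0 h) (peval p)"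
    proof (intro exI[of _ h0] conjI allI impI h0(1))
      fix h D and p :: "(real, 'n) mpolynomial"
      assume h: "0 < h" "h < h0" and D: "(peval p has_derivative D) (at x0)" and d: "0 < total_deg p"
      obtain \<epsilon> where \<epsilon>: "0 < \<epsilon>" "\<epsilon> < \<rho>" "\<epsilon> \<le> t1" "\<epsilon> ^ m = h / (2 * (norm W + 1))"
        "\<And>t a. \<bar>t\<bar> \<le> \<epsilon> \<Longrightarrow> a \<in> A \<Longrightarrow> \<gamma> (of_real t) = cvec a \<Longrightarrow> a \<in> A \<inter> ball x0 h"
        using h0(2)[OF h] by blast
      have "\<bar>D W\<bar> \<le> 4 * (32 * (real (B * total_deg p))\<^sup>2 / \<epsilon>) ^ m * unif_norm (A \<inter> ball x0 h) (peval p)"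
      proof (rule B(2)[OF br \<epsilon>(1,2) _ D d])
        fix t assume t: "0 \<le> t" "t \<le> \<epsilon>"
        then obtain a where a: "a \<in> A" "\<gamma> (of_real t) = cvec a" using arc \<epsilon>(3) by fastforce
        then have "a \<in> A \<inter> ball x0 h" using \<epsilon>(5)[of t a] t by simp
        then show "\<exists>a\<in>A. \<gamma> (of_real t) = cvec a \<and> \<bar>peval p a\<bar> \<le> unif_norm (A \<inter> ball x0 h) (peval p)"
          using a abs_peval_le_unif_norm by blast
      qed
      then show "\<bar>D W\<bar> \<le> 4 * (32 * (real (B * total_deg p))\<^sup>2) ^ m * (2 * (norm W + 1) / h) * unif_norm (A \<inter> ball x0 h) (peval p)"
        unfolding power_divide \<epsilon>(4) by simp
    qed
  next
    fix x0 \<sigma> \<rho> \<gamma> W t1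
    assume br: "holo_branch x0 i0 \<sigma> 1 \<rho> \<gamma> W" and t1: "0 < t1"
      and arc: "\<forall>t. \<bar>t\<bar> \<le> t1 \<longrightarrow> (\<exists>a\<in>A. \<gamma> (of_real t) = cvec a)"
    obtain h0 where h0: "0 < h0" "\<And>h. 0 < h \<Longrightarrow> h < h0 \<Longrightarrow> \<exists>\<epsilon>. 0 < \<epsilon> \<and> \<epsilon> < \<rho> \<and> \<epsilon> \<le> t1 \<and> \<epsilon> ^ 1 = h / (2 * (norm W + 1)) \<and>
      (\<forall>t a. \<bar>t\<bar> \<le> \<epsilon> \<longrightarrow> a \<in> A \<longrightarrow> \<gamma> (of_real t) = cvec a \<longrightarrow> a \<in> A \<inter> ball x0 h)"
      using scale[OF br t1] by blast
    show "\<exists>h0>0. \<forall>h p D. 0 < h \<longrightarrow> h < h0 \<longrightarrow> (peval p has_derivative D) (at x0) \<longrightarrow> 0 < total_deg p \<longrightarrow>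
         \<bar>D W\<bar> \<le> 32 * real (B * total_deg p) * (2 * (norm W + 1) / h) * unif_norm (A \<inter> ball x0 h) (peval p)"
    proof (intro exI[of _ h0] conjI allI impI h0(1))
      fix h D and p :: "(real, 'n) mpolynomial"
      assume h: "0 < h" "h < h0" and D: "(peval p has_derivative D) (at x0)" and d: "0 < total_deg p"
      obtain \<epsilon> where \<epsilon>: "0 < \<epsilon>" "\<epsilon> < \<rho>" "\<epsilon> \<le> t1" "\<epsilon> ^ 1 = h / (2 * (norm W + 1))"
        "\<And>t a. \<bar>t\<bar> \<le> \<epsilon> \<Longrightarrow> a \<in> A \<Longrightarrow> \<gamma> (of_real t) = cvec a \<Longrightarrow> a \<in> A \<inter> ball x0 h"
        using h0(2)[OF h] by blast
      have "\<bar>D W\<bar> \<le> 32 * real (B * total_deg p) / \<epsilon> * unif_norm (A \<inter> ball x0 h) (peval p)"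
      proof (rule B(3)[OF br \<epsilon>(1,2) _ D d])
        fix t assume t: "\<bar>t\<bar> \<le> \<epsilon>"
        then have "\<bar>t\<bar> \<le> t1" using \<epsilon>(3) by linarith
        then obtain a where a: "a \<in> A" "\<gamma> (of_real t) = cvec a" using arc by blast
        then have "a \<in> A \<inter> ball x0 h" using \<epsilon>(5)[of t a] t by simp
        then show "\<exists>a\<in>A. \<gamma> (of_real t) = cvec a \<and> \<bar>peval p a\<bar> \<le> unif_norm (A \<inter> ball x0 h) (peval p)"
          using a abs_peval_le_unif_norm by blast
      qed
      then show "\<bar>D W\<bar> \<le> 32 * real (B * total_deg p) * (2 * (norm W + 1) / h) * unif_norm (A \<inter> ball x0 h) (peval p)"
        using \<epsilon>(4) by (simp add: algebra_simps)
    qed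
  qed
qed

section \<open>Choice of a coordinate and uniform constants\<close>

lemma piece_curve_coord:
  fixes A :: "(real ^ 'n::finite) set" and a1 a2 :: "real ^ 'n"
  assumes A: "piece_of_algebraic_curve A" and a: "a1 \<in> A" "a2 \<in> A" "a1 $ i0 \<noteq> a2 $ i0"
  shows "\<exists>P. curve_coord A i0 P a1 a2"
proof -
  have conn: "connected A" using A by (simp add: piece_of_algebraic_curve_def)
  have "infinite A"
  proof
    assume "finite A"
    then obtain b where "A \<subseteq> {b}" using connected_finite_iff_sing[OF conn] by auto
    then show False using a by auto
  qed
  with A obtain P where P: "A \<subseteq> zeros (peval P)" "\<And>x. 0 \<le> peval P x"
    "\<And>f. polyfun f \<Longrightarrow> \<exists>a\<in>A. f a \<noteq> 0 \<Longrightarrow> finite (zeros (peval P) \<inter> zeros f)"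
    by (rule piece_zariski_closure) (rule that)
  have "curve_coord A i0 P a1 a2" by unfold_locales (use conn P a in auto)
  then show ?thesis by blast
qed

lemma tangent_cone_nonconstant:
  fixes v x0 :: "real ^ 'n::finite"
  assumes "v \<in> tangent_cone A x0" "v $ i0 \<noteq> 0"
  shows "\<exists>a\<in>A. a $ i0 \<noteq> x0 $ i0"
proof -
  obtain s :: "nat \<Rightarrow> real ^ 'n" where "\<And>l. s l \<in> A" "\<And>l. 0 < - sgn (v $ i0) * (s l $ i0 - x0 $ i0)"
    by (rule tangent_cone_sequence[OF assms]) (rule that)
  from this(1)[of 0] this(2)[of 0] show ?thesis by (intro bexI[of _ "s 0"]) auto
qed

text \<open>Every unit vector has a nonzero coordinate, and a coordinate that is nonzero on a cone
  vector is not constant on \<open>A\<close>; so the finiteness for single coordinates covers all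
  directions.\<close>

lemma piece_finite_tangent_directions:
  fixes A :: "(real ^ 'n::finite) set" and x0 :: "real ^ 'n"
  assumes A: "piece_of_algebraic_curve A" and x0: "x0 \<in> A"
  shows "finite {v \<in> tangent_cone A x0. norm v = 1}"
proof -
  have fin: "finite {v \<in> tangent_cone A x0. norm v = 1 \<and> v $ i \<noteq> 0}" for i
  proof (cases "\<exists>a\<in>A. a $ i \<noteq> x0 $ i")
    case True
    then obtain a where "a \<in> A" "a $ i \<noteq> x0 $ i" by blast
    then obtain P where "curve_coord A i P a x0" using piece_curve_coord[OF A _ x0] by blast
    then show ?thesis by (rule curve_coord.finite_tangent_directions)
  next
    case False
    then have "{v \<in> tangent_cone A x0. norm v = 1 \<and> v $ i \<noteq> 0} = {}" using tangent_cone_nonconstant by blast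
    then show ?thesis by (simp only: finite.emptyI)
  qed
  have "{v \<in> tangent_cone A x0. norm v = 1} \<subseteq> (\<Union>i. {v \<in> tangent_cone A x0. norm v = 1 \<and> v $ i \<noteq> 0})"
  proof
    fix v :: "real ^ 'n" assume v: "v \<in> {v \<in> tangent_cone A x0. norm v = 1}"
    then have "v \<noteq> 0" by auto
    then obtain i where "v $ i \<noteq> 0" by (auto simp: vec_eq_iff)
    then show "v \<in> (\<Union>i. {v \<in> tangent_cone A x0. norm v = 1 \<and> v $ i \<noteq> 0})" using v by blast
  qed
  then show ?thesis by (rule finite_subset) (intro finite_UN_I fin finite)
qed

text \<open>The order \<open>m\<close> of the branch may be raised to the multiplicity
  \<open>k\<close> because the base \<open>32 * (b * d) ^ 2\<close> is at least 1; the radius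
  \<open>\<epsilon> ^ k\<close> then fits the power \<open>k\<close>.\<close>

lemma singular_scale:
  fixes b B d m k :: nat and \<epsilon> x :: real
  assumes B: "0 < b" "b \<le> B" and d: "0 < d" and m: "m \<le> k" and x: "0 \<le> x" "x \<le> 2" and \<epsilon>: "0 < \<epsilon>"
  shows "4 * (32 * (real (b * d))\<^sup>2) ^ m * (2 * x / \<epsilon> ^ k) \<le> 16 * (32 * (real B)\<^sup>2 * (real d)\<^sup>2 / \<epsilon>) ^ k"
proof -
  have "(1::real) \<le> (real (b * d))\<^sup>2" using B(1) d by (intro one_le_power) (simp add: Suc_le_eq flip: of_nat_mult)
  then have "(32 * (real (b * d))\<^sup>2) ^ m \<le> (32 * (real (b * d))\<^sup>2) ^ k" using m by (intro power_increasing) auto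
  also have "\<dots> \<le> (32 * (real (B * d))\<^sup>2) ^ k" using mult_le_mono1[OF B(2), of d] by (intro power_mono mult_left_mono) (auto simp del: of_nat_mult)
  finally have "(32 * (real (b * d))\<^sup>2) ^ m \<le> (32 * (real B)\<^sup>2 * (real d)\<^sup>2) ^ k" by (simp add: power_mult_distrib mult_ac)
  moreover have "2 * x / \<epsilon> ^ k \<le> 4 / \<epsilon> ^ k" using x \<epsilon> by (intro divide_right_mono) auto
  ultimately have "4 * (32 * (real (b * d))\<^sup>2) ^ m * (2 * x / \<epsilon> ^ k) \<le> 4 * (32 * (real B)\<^sup>2 * (real d)\<^sup>2) ^ k * (4 / \<epsilon> ^ k)"
    using x \<epsilon> by (intro mult_mono) auto
  then show ?thesis by (simp add: power_divide)
qed

lemma scaled_direction: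
  fixes D :: "real ^ 'n::finite \<Rightarrow> real"
  assumes D: "linear D" and v: "v = c *\<^sub>R W" "\<bar>c\<bar> * (norm W + 1) \<le> 2" and DW: "\<bar>D W\<bar> \<le> K * (2 * (norm W + 1) / h) * M"
    and est: "K * (2 * (\<bar>c\<bar> * (norm W + 1)) / h) \<le> E" and M: "0 \<le> M"
  shows "\<bar>D v\<bar> \<le> E * M"
proof -
  have "\<bar>D v\<bar> = \<bar>c\<bar> * \<bar>D W\<bar>" by (simp add: v(1) linear_scale[OF D] abs_mult)
  also have "\<dots> \<le> \<bar>c\<bar> * (K * (2 * (norm W + 1) / h) * M)" using DW by (rule mult_left_mono) simp
  also have "\<dots> = K * (2 * (\<bar>c\<bar> * (norm W + 1)) / h) * M" by (simp add: mult_ac)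
  also have "\<dots> \<le> E * M" using est M by (rule mult_right_mono)
  finally show ?thesis .
qed

text \<open>Here the length of \<open>W\<close> disappears from the estimates:
  \<open>\<bar>c\<bar> * norm W = 1\<close>, and \<open>\<bar>c\<bar> = \<bar>v $ i\<bar>\<close> is
  at most 1. The bound 2 is the same for all points and branches.\<close>

lemma direction_scale:
  fixes v W :: "real ^ 'n::finite"
  assumes "norm v = 1" "v = c *\<^sub>R W" "\<bar>W $ i\<bar> = 1"
  shows "\<bar>c\<bar> * (norm W + 1) \<le> 2"
proof -
  have "\<bar>c\<bar> * norm W = 1" using assms(1,2) by simp
  moreover have "\<bar>c\<bar> = \<bar>v $ i\<bar>" using assms(2,3) by (simp add: abs_mult)
  then have "\<bar>c\<bar> \<le> 1" using component_le_norm_cart[of v i] assms(1) by simp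
  ultimately show ?thesis by (simp add: distrib_left)
qed

text \<open>Stated for all \<open>B \<ge> b\<close>, so that the bounds for different coordinates
  can later be merged into one.\<close>

lemma (in curve_coord) coordinate_estimates:
  shows "\<exists>b::nat. \<forall>B\<ge>b. \<forall>x0\<in>A. \<forall>v. norm v = 1 \<and> v $ i0 \<noteq> 0 \<longrightarrow>
    (v \<in> tangent_cone A x0 \<longrightarrow> (\<exists>e>0. bernstein_at A x0 v
       (\<lambda>\<epsilon> d. 16 * (32 * (real B)\<^sup>2 * d\<^sup>2 / \<epsilon>) ^ complex_multiplicity 1 (complexification A) (cvec x0))
       (\<lambda>\<epsilon>. \<epsilon> ^ complex_multiplicity 1 (complexification A) (cvec x0)) e)) \<and>
    (v \<in> tangent_space A x0 \<longrightarrow> x0 \<notin> end_points A \<longrightarrow>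
       (\<exists>e>0. bernstein_at A x0 v (\<lambda>\<epsilon> d. 16 * (32 * (real B)\<^sup>2 * d / \<epsilon>)) (\<lambda>\<epsilon>. \<epsilon>) e)) \<and>
    (v \<in> tangent_space A x0 \<longrightarrow>
       (\<exists>e>0. bernstein_at A x0 v (\<lambda>\<epsilon> d. 16 * (32 * (real B)\<^sup>2 * d / \<epsilon>)\<^sup>2) (\<lambda>\<epsilon>. \<epsilon>) e))"
proof -
  obtain b :: nat where b: "0 < b"
    and half: "\<And>x0 \<sigma> m \<rho> \<gamma> W t1. holo_branch x0 i0 \<sigma> m \<rho> \<gamma> W \<Longrightarrow> 0 < t1 \<Longrightarrow>
       (\<forall>t. 0 \<le> t \<and> t \<le> t1 \<longrightarrow> (\<exists>a\<in>A. \<gamma> (of_real t) = cvec a)) \<Longrightarrow>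
       \<exists>h0>0. \<forall>h p D. 0 < h \<longrightarrow> h < h0 \<longrightarrow> (peval p has_derivative D) (at x0) \<longrightarrow> 0 < total_deg p \<longrightarrow>
         \<bar>D W\<bar> \<le> 4 * (32 * (real (b * total_deg p))\<^sup>2) ^ m * (2 * (norm W + 1) / h) * unif_norm (A \<inter> ball x0 h) (peval p)"
    and full: "\<And>x0 \<sigma> \<rho> \<gamma> W t1. holo_branch x0 i0 \<sigma> 1 \<rho> \<gamma> W \<Longrightarrow> 0 < t1 \<Longrightarrow>
       (\<forall>t. \<bar>t\<bar> \<le> t1 \<longrightarrow> (\<exists>a\<in>A. \<gamma> (of_real t) = cvec a)) \<Longrightarrow>
       \<exists>h0>0. \<forall>h p D. 0 < h \<longrightarrow> h < h0 \<longrightarrow> (peval p has_derivative D) (at x0) \<longrightarrow> 0 < total_deg p \<longrightarrow>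
         \<bar>D W\<bar> \<le> 32 * real (b * total_deg p) * (2 * (norm W + 1) / h) * unif_norm (A \<inter> ball x0 h) (peval p)"
    by (rule arc_estimates) (rule that)
  obtain E D where "curve_eqs A i0 P a1 a2 E D" using curve_eqs_exists by blast
  then interpret curve_eqs A i0 P a1 a2 E D .
  have cone: "\<exists>e>0. bernstein_at A x0 v
       (\<lambda>\<epsilon> d. 16 * (32 * (real B)\<^sup>2 * d\<^sup>2 / \<epsilon>) ^ complex_multiplicity 1 (complexification A) (cvec x0))
       (\<lambda>\<epsilon>. \<epsilon> ^ complex_multiplicity 1 (complexification A) (cvec x0)) e"
    if B: "b \<le> B" and x0: "x0 \<in> A" and v: "norm v = 1" "v $ i0 \<noteq> 0" "v \<in> tangent_cone A x0" for B and x0 v :: "real ^ 'n"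
  proof -
    define k where "k = complex_multiplicity 1 (complexification A) (cvec x0)"
    define \<sigma> where "\<sigma> = - sgn (v $ i0)"
    \<comment> \<open>The limit of \<open>(s l - x0) / t ^ m\<close> with
      \<open>t ^ m = \<sigma> * (s l $ i0 - x0 $ i0)\<close>. Its \<open>i0\<close>-th component is
      \<open>\<sigma>\<close>.\<close>
    define W where "W = (- inverse \<bar>v $ i0\<bar>) *\<^sub>R v"
    have \<sigma>: "\<sigma> = 1 \<or> \<sigma> = - 1" using sgn_real_cases[OF v(2)] by (auto simp: \<sigma>_def)
    obtain s :: "nat \<Rightarrow> real ^ 'n" where s: "\<And>l. s l \<in> A" "s \<longlonglongrightarrow> x0" "\<And>l. 0 < - sgn (v $ i0) * (s l $ i0 - x0 $ i0)"
      "\<And>j. (\<lambda>l. (s l $ j - x0 $ j) / (s l $ i0 - x0 $ i0)) \<longlonglongrightarrow> v $ j / v $ i0"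
      by (rule tangent_cone_sequence[OF v(3,2)]) (rule that)
    have lim: "(\<lambda>l. (s l $ j - x0 $ j) / (\<sigma> * (s l $ i0 - x0 $ i0))) \<longlonglongrightarrow> W $ j" for j
    proof -
      have "(\<lambda>l. inverse \<sigma> * ((s l $ j - x0 $ j) / (s l $ i0 - x0 $ i0))) \<longlonglongrightarrow> inverse \<sigma> * (v $ j / v $ i0)"
        by (intro tendsto_intros s(4))
      moreover have "inverse \<sigma> * (v $ j / v $ i0) = W $ j"
        using v(2) by (simp add: W_def \<sigma>_def sgn_if abs_if divide_inverse mult_ac)
      ultimately show ?thesis by (simp add: divide_inverse mult_ac)
    qed
    obtain m :: nat and \<rho> t1 :: real and \<gamma> :: "complex \<Rightarrow> complex ^ 'n" where \<gamma>:
      "0 < m" "0 < t1" "t1 < \<rho>" "\<And>j. (\<lambda>t. \<gamma> t $ j) holomorphic_on ball 0 \<rho>" "\<gamma> 0 = cvec x0"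
      "\<And>t. t \<in> ball 0 \<rho> \<Longrightarrow> \<gamma> t $ i0 = of_real (x0 $ i0) + of_real \<sigma> * t ^ m"
      "\<And>j. \<exists>\<psi>. \<psi> holomorphic_on ball 0 \<rho> \<and> (\<forall>t\<in>ball 0 \<rho>. \<gamma> t $ j = of_real (x0 $ j) + t ^ m * \<psi> t) \<and> \<psi> 0 = of_real (W $ j)"
      "\<And>t. 0 \<le> t \<Longrightarrow> t \<le> t1 \<Longrightarrow> \<exists>a\<in>A. \<gamma> (of_real t) = cvec a" "inj_on \<gamma> (ball 0 \<rho>)"
      by (rule branch[OF x0 s(1,2) \<sigma> s(3)[folded \<sigma>_def] lim]) (rule that)
    have \<rho>: "0 < \<rho>" using \<gamma>(2,3) by linarith
    have br: "holo_branch x0 i0 \<sigma> m \<rho> \<gamma> W" unfolding holo_branch_def using \<gamma>(1,4-7) \<rho> \<sigma> by blast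
    have mk: "m \<le> k" unfolding k_def
      by (rule branch_multiplicity_le[OF \<gamma>(1) \<rho> \<gamma>(4,5) _ \<gamma>(9) branch_in_complexification[OF \<gamma>(4,2,8)]]) (use \<gamma>(7) in blast)+
    obtain h0 where h0: "0 < h0" "\<And>h p D. 0 < h \<Longrightarrow> h < h0 \<Longrightarrow> (peval p has_derivative D) (at x0) \<Longrightarrow> 0 < total_deg p \<Longrightarrow>
         \<bar>D W\<bar> \<le> 4 * (32 * (real (b * total_deg p))\<^sup>2) ^ m * (2 * (norm W + 1) / h) * unif_norm (A \<inter> ball x0 h) (peval p)"
      using half[OF br \<gamma>(2)] \<gamma>(8) by blast
    have vW: "v = (- \<bar>v $ i0\<bar>) *\<^sub>R W" using v(2) by (simp add: W_def)
    have "\<bar>W $ i0\<bar> = 1" using v(2) by (simp add: W_def abs_mult)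
    from direction_scale[OF v(1) vW this] have c: "\<bar>- \<bar>v $ i0\<bar>\<bar> * (norm W + 1) \<le> 2" .
    \<comment> \<open>For \<open>\<epsilon> < 1\<close> and \<open>k \<ge> m \<ge> 1\<close> the
      radius \<open>\<epsilon> ^ k\<close> is at most \<open>\<epsilon>\<close>, hence below
      \<open>h0\<close>.\<close>
    have "bernstein_at A x0 v (\<lambda>\<epsilon> d. 16 * (32 * (real B)\<^sup>2 * d\<^sup>2 / \<epsilon>) ^ k) (\<lambda>\<epsilon>. \<epsilon> ^ k) (min 1 h0)"
    proof (rule bernstein_atI[OF x0])
      fix \<epsilon> D and p :: "(real, 'n) mpolynomial"
      assume \<epsilon>: "0 < \<epsilon>" "\<epsilon> < min 1 h0" and d: "0 < total_deg p" and D: "(peval p has_derivative D) (at x0)"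
        and M: "0 \<le> unif_norm (A \<inter> ball x0 (\<epsilon> ^ k)) (peval p)"
      have "\<epsilon> ^ k \<le> \<epsilon> ^ 1" using \<epsilon> mk \<gamma>(1) by (intro power_decreasing) auto
      then have "\<epsilon> ^ k < h0" using \<epsilon> by simp
      from h0(2)[OF _ this D d] \<epsilon> have DW: "\<bar>D W\<bar> \<le> 4 * (32 * (real (b * total_deg p))\<^sup>2) ^ m * (2 * (norm W + 1) / \<epsilon> ^ k)
        * unif_norm (A \<inter> ball x0 (\<epsilon> ^ k)) (peval p)" by simp
      have "4 * (32 * (real (b * total_deg p))\<^sup>2) ^ m * (2 * (\<bar>- \<bar>v $ i0\<bar>\<bar> * (norm W + 1)) / \<epsilon> ^ k)
        \<le> 16 * (32 * (real B)\<^sup>2 * (real (total_deg p))\<^sup>2 / \<epsilon>) ^ k"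
        by (rule singular_scale[OF b B d mk _ c \<epsilon>(1)]) (simp add: add_nonneg_nonneg)
      with D c DW M show "\<bar>D v\<bar> \<le> 16 * (32 * (real B)\<^sup>2 * (real (total_deg p))\<^sup>2 / \<epsilon>) ^ k * unif_norm (A \<inter> ball x0 (\<epsilon> ^ k)) (peval p)"
        by (intro scaled_direction[OF has_derivative_linear[OF D] vW])
    qed auto
    then show ?thesis unfolding k_def using h0(1) by (intro exI[of _ "min 1 h0"]) auto
  qed
  have regular: "\<exists>\<sigma> \<rho> \<gamma> W c. holo_branch x0 i0 \<sigma> 1 \<rho> \<gamma> W \<and> 0 < \<rho> \<and> v = c *\<^sub>R W \<and> \<bar>c\<bar> * (norm W + 1) \<le> 2 \<and>
      (\<forall>t. 0 \<le> t \<and> t < \<rho> \<longrightarrow> (\<exists>a\<in>A. \<gamma> (of_real t) = cvec a)) \<and>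
      (x0 \<notin> end_points A \<longrightarrow> (\<forall>t. \<bar>t\<bar> < \<rho> \<longrightarrow> (\<exists>a\<in>A. \<gamma> (of_real t) = cvec a)))"
    if v: "norm v = 1" "v $ i0 \<noteq> 0" "v \<in> tangent_space A x0" for x0 v :: "real ^ 'n"
  proof -
    obtain g where g: "regular_param A x0 g" "vector_derivative g (at 0) \<noteq> 0"
      "v = vector_derivative g (at 0) /\<^sub>R norm (vector_derivative g (at 0)) \<or>
       v = - (vector_derivative g (at 0) /\<^sub>R norm (vector_derivative g (at 0)))"
      by (rule tangent_space_unit[OF v(3,1)]) (rule that)
    define w where "w = vector_derivative g (at 0)"
    have w0: "w $ i0 \<noteq> 0" using g(3) v(2) unfolding w_def by auto
    define W where "W = w /\<^sub>R \<bar>w $ i0\<bar>"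
    obtain \<rho> and \<gamma> :: "complex \<Rightarrow> complex ^ 'n" where \<gamma>: "holo_branch x0 i0 (sgn (w $ i0)) 1 \<rho> \<gamma> W"
      "\<And>t. 0 \<le> t \<Longrightarrow> t < \<rho> \<Longrightarrow> \<exists>a\<in>A. \<gamma> (of_real t) = cvec a"
      "\<And>t. x0 \<notin> end_points A \<Longrightarrow> \<bar>t\<bar> < \<rho> \<Longrightarrow> \<exists>a\<in>A. \<gamma> (of_real t) = cvec a"
      by (rule regular_branch[OF g(1) w0[unfolded w_def], folded w_def, folded W_def]) (rule that)
    have wW: "w = \<bar>w $ i0\<bar> *\<^sub>R W" using w0 by (simp add: W_def)
    have "\<exists>c. v = c *\<^sub>R W"
    proof (cases "v = w /\<^sub>R norm w")
      case True
      then have "v = (inverse (norm w) * \<bar>w $ i0\<bar>) *\<^sub>R W" by (metis wW scaleR_scaleR)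
      then show ?thesis by blast
    next
      case False
      then have "v = - (w /\<^sub>R norm w)" using g(3) unfolding w_def by blast
      then have "v = (- inverse (norm w) * \<bar>w $ i0\<bar>) *\<^sub>R W" by (metis wW scaleR_scaleR scaleR_minus_left)
      then show ?thesis by blast
    qed
    then obtain c where c: "v = c *\<^sub>R W" by blast
    have "\<bar>W $ i0\<bar> = 1" using w0 by (simp add: W_def abs_mult)
    from direction_scale[OF v(1) c this] have c2: "\<bar>c\<bar> * (norm W + 1) \<le> 2" .
    have "0 < \<rho>" using \<gamma>(1) by (simp add: holo_branch_def)
    then show ?thesis
      by (intro exI[of _ "sgn (w $ i0)"] exI[of _ \<rho>] exI[of _ \<gamma>] exI[of _ W] exI[of _ c] conjI)
        (use \<gamma> c c2 in auto)
  qed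
  have interior: "\<exists>e>0. bernstein_at A x0 v (\<lambda>\<epsilon> d. 16 * (32 * (real B)\<^sup>2 * d / \<epsilon>)) (\<lambda>\<epsilon>. \<epsilon>) e"
    if B: "b \<le> B" and x0: "x0 \<in> A" "x0 \<notin> end_points A" and v: "norm v = 1" "v $ i0 \<noteq> 0" "v \<in> tangent_space A x0"
    for B and x0 v :: "real ^ 'n"
  proof -
    obtain \<sigma> \<rho> \<gamma> W c where br: "holo_branch x0 i0 \<sigma> 1 \<rho> \<gamma> W" and \<rho>: "0 < \<rho>" and vW: "v = c *\<^sub>R W"
      and c: "\<bar>c\<bar> * (norm W + 1) \<le> 2" and arc: "\<forall>t. \<bar>t\<bar> < \<rho> \<longrightarrow> (\<exists>a\<in>A. \<gamma> (of_real t) = cvec a)"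
      using regular[OF v] x0(2) by blast
    have "0 < \<rho> / 2" "\<forall>t. \<bar>t\<bar> \<le> \<rho> / 2 \<longrightarrow> (\<exists>a\<in>A. \<gamma> (of_real t) = cvec a)" using \<rho> arc by auto
    from full[OF br this] obtain h0 where h0: "0 < h0" "\<And>h p D. 0 < h \<Longrightarrow> h < h0 \<Longrightarrow> (peval p has_derivative D) (at x0) \<Longrightarrow> 0 < total_deg p \<Longrightarrow>
         \<bar>D W\<bar> \<le> 32 * real (b * total_deg p) * (2 * (norm W + 1) / h) * unif_norm (A \<inter> ball x0 h) (peval p)"
      by blast
    have "bernstein_at A x0 v (\<lambda>\<epsilon> d. 16 * (32 * (real B)\<^sup>2 * d / \<epsilon>)) (\<lambda>\<epsilon>. \<epsilon>) h0"
    proof (rule bernstein_atI[OF x0(1)])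
      fix \<epsilon> D and p :: "(real, 'n) mpolynomial"
      assume \<epsilon>: "0 < \<epsilon>" "\<epsilon> < h0" and d: "0 < total_deg p" and D: "(peval p has_derivative D) (at x0)"
        and M: "0 \<le> unif_norm (A \<inter> ball x0 \<epsilon>) (peval p)"
      show "\<bar>D v\<bar> \<le> 16 * (32 * (real B)\<^sup>2 * real (total_deg p) / \<epsilon>) * unif_norm (A \<inter> ball x0 \<epsilon>) (peval p)"
      proof (rule scaled_direction[OF has_derivative_linear[OF D] vW c h0(2)[OF \<epsilon> D d] _ M])
        \<comment> \<open>The full arc needs only the first power of \<open>b\<close>; it is
          weakened to \<open>B ^ 2\<close> so that the same constant serves in all cases.\<close>
        have "b \<le> B\<^sup>2" using B b by (simp add: power2_eq_square) (metis le_trans le_square)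
        then have "real b \<le> (real B)\<^sup>2" by (metis of_nat_le_iff of_nat_power)
        then have "32 * real (b * total_deg p) \<le> 32 * (real B)\<^sup>2 * real (total_deg p)" by (simp add: mult_right_mono)
        moreover have "2 * (\<bar>c\<bar> * (norm W + 1)) / \<epsilon> \<le> 16 / \<epsilon>" using c \<epsilon> by (intro divide_right_mono) auto
        ultimately have "32 * real (b * total_deg p) * (2 * (\<bar>c\<bar> * (norm W + 1)) / \<epsilon>)
            \<le> 32 * (real B)\<^sup>2 * real (total_deg p) * (16 / \<epsilon>)" by (rule mult_mono) (use \<epsilon> in auto)
        then show "32 * real (b * total_deg p) * (2 * (\<bar>c\<bar> * (norm W + 1)) / \<epsilon>)
            \<le> 16 * (32 * (real B)\<^sup>2 * real (total_deg p) / \<epsilon>)" by (simp add: mult_ac)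
      qed
    qed auto
    then show ?thesis using h0(1) by blast
  qed
  have boundary: "\<exists>e>0. bernstein_at A x0 v (\<lambda>\<epsilon> d. 16 * (32 * (real B)\<^sup>2 * d / \<epsilon>)\<^sup>2) (\<lambda>\<epsilon>. \<epsilon>) e"
    if B: "b \<le> B" and x0: "x0 \<in> A" and v: "norm v = 1" "v $ i0 \<noteq> 0" "v \<in> tangent_space A x0"
    for B and x0 v :: "real ^ 'n"
  proof -
    obtain \<sigma> \<rho> \<gamma> W c where br: "holo_branch x0 i0 \<sigma> 1 \<rho> \<gamma> W" and \<rho>: "0 < \<rho>" and vW: "v = c *\<^sub>R W"
      and c: "\<bar>c\<bar> * (norm W + 1) \<le> 2" and arc: "\<forall>t. 0 \<le> t \<and> t < \<rho> \<longrightarrow> (\<exists>a\<in>A. \<gamma> (of_real t) = cvec a)"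
      using regular[OF v] by blast
    have "0 < \<rho> / 2" "\<forall>t. 0 \<le> t \<and> t \<le> \<rho> / 2 \<longrightarrow> (\<exists>a\<in>A. \<gamma> (of_real t) = cvec a)" using \<rho> arc by auto
    from half[OF br this] obtain h0 where h0: "0 < h0" "\<And>h p D. 0 < h \<Longrightarrow> h < h0 \<Longrightarrow> (peval p has_derivative D) (at x0) \<Longrightarrow> 0 < total_deg p \<Longrightarrow>
         \<bar>D W\<bar> \<le> 4 * (32 * (real (b * total_deg p))\<^sup>2) ^ 1 * (2 * (norm W + 1) / h) * unif_norm (A \<inter> ball x0 h) (peval p)"
      by blast
    have "bernstein_at A x0 v (\<lambda>\<epsilon> d. 16 * (32 * (real B)\<^sup>2 * d / \<epsilon>)\<^sup>2) (\<lambda>\<epsilon>. \<epsilon>) (min 1 h0)"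
    proof (rule bernstein_atI[OF x0])
      fix \<epsilon> D and p :: "(real, 'n) mpolynomial"
      assume \<epsilon>: "0 < \<epsilon>" "\<epsilon> < min 1 h0" and d: "0 < total_deg p" and D: "(peval p has_derivative D) (at x0)"
        and M: "0 \<le> unif_norm (A \<inter> ball x0 \<epsilon>) (peval p)"
      have \<epsilon>h: "\<epsilon> < h0" using \<epsilon> by simp
      show "\<bar>D v\<bar> \<le> 16 * (32 * (real B)\<^sup>2 * real (total_deg p) / \<epsilon>)\<^sup>2 * unif_norm (A \<inter> ball x0 \<epsilon>) (peval p)"
      proof (rule scaled_direction[OF has_derivative_linear[OF D] vW c h0(2)[OF \<epsilon>(1) \<epsilon>h D d] _ M])
        have "4 * (32 * (real (b * total_deg p))\<^sup>2) ^ 1 * (2 * (\<bar>c\<bar> * (norm W + 1)) / \<epsilon> ^ 1)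
            \<le> 16 * (32 * (real B)\<^sup>2 * (real (total_deg p))\<^sup>2 / \<epsilon>) ^ 1"
          by (rule singular_scale[OF b B d order_refl _ c \<epsilon>(1)]) (simp add: add_nonneg_nonneg)
        also have "\<dots> = 16 * (32 * (real B)\<^sup>2 * (real (total_deg p))\<^sup>2) * (1 / \<epsilon>)" by simp
        \<comment> \<open>The half arc with \<open>m = 1\<close> gives a bound of order
          \<open>d ^ 2 / \<epsilon>\<close>; for \<open>\<epsilon> < 1\<close> it implies the
          required \<open>(d / \<epsilon>) ^ 2\<close>.\<close>
        also have "\<dots> \<le> 16 * (32 * (real B)\<^sup>2 * real (total_deg p))\<^sup>2 * (1 / \<epsilon>\<^sup>2)"
        proof (rule mult_mono)
          have "1 \<le> (real B)\<^sup>2" using b B by (intro one_le_power) simp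
          then have "32 * (real B)\<^sup>2 * 1 \<le> 32 * (real B)\<^sup>2 * (32 * (real B)\<^sup>2)" by (intro mult_left_mono) auto
          then have "32 * (real B)\<^sup>2 * (real (total_deg p))\<^sup>2 \<le> 32 * (real B)\<^sup>2 * (32 * (real B)\<^sup>2) * (real (total_deg p))\<^sup>2"
            by (intro mult_right_mono) auto
          then show "16 * (32 * (real B)\<^sup>2 * (real (total_deg p))\<^sup>2) \<le> 16 * (32 * (real B)\<^sup>2 * real (total_deg p))\<^sup>2"
            by (simp add: power2_eq_square mult_ac)
          have "\<epsilon>\<^sup>2 \<le> \<epsilon>" using \<epsilon> by (simp add: power2_eq_square mult_left_le)
          then show "1 / \<epsilon> \<le> 1 / \<epsilon>\<^sup>2" using \<epsilon> by (intro divide_left_mono) auto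
        qed (use \<epsilon> in auto)
        finally show "4 * (32 * (real (b * total_deg p))\<^sup>2) ^ 1 * (2 * (\<bar>c\<bar> * (norm W + 1)) / \<epsilon>)
            \<le> 16 * (32 * (real B)\<^sup>2 * real (total_deg p) / \<epsilon>)\<^sup>2" by (simp add: power_divide)
      qed
    qed auto
    then show ?thesis using h0(1) by (intro exI[of _ "min 1 h0"]) auto
  qed
  show ?thesis using cone interior boundary by (intro exI[of _ b]) blast
qed


text \<open>For each \<open>v\<close> a coordinate with \<open>v $ i\<close> nonzero is selected. It
  varies on \<open>A\<close>, because \<open>v\<close> or \<open>- v\<close> is in the tangent cone,
  so the estimates for that coordinate apply.\<close>

lemma piece_estimates:
  fixes A :: "(real ^ 'n::finite) set"
  assumes A: "piece_of_algebraic_curve A"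
  obtains B :: nat where "0 < B"
    "\<And>x0 v. x0 \<in> A \<Longrightarrow> norm v = 1 \<Longrightarrow> v \<in> tangent_cone A x0 \<Longrightarrow> \<exists>e>0. bernstein_at A x0 v
       (\<lambda>\<epsilon> d. 16 * (32 * (real B)\<^sup>2 * d\<^sup>2 / \<epsilon>) ^ complex_multiplicity 1 (complexification A) (cvec x0))
       (\<lambda>\<epsilon>. \<epsilon> ^ complex_multiplicity 1 (complexification A) (cvec x0)) e"
    "\<And>x0 v. x0 \<in> A \<Longrightarrow> norm v = 1 \<Longrightarrow> v \<in> tangent_space A x0 \<Longrightarrow> x0 \<notin> end_points A \<Longrightarrow>
       \<exists>e>0. bernstein_at A x0 v (\<lambda>\<epsilon> d. 16 * (32 * (real B)\<^sup>2 * d / \<epsilon>)) (\<lambda>\<epsilon>. \<epsilon>) e"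
    "\<And>x0 v. x0 \<in> A \<Longrightarrow> norm v = 1 \<Longrightarrow> v \<in> tangent_space A x0 \<Longrightarrow>
       \<exists>e>0. bernstein_at A x0 v (\<lambda>\<epsilon> d. 16 * (32 * (real B)\<^sup>2 * d / \<epsilon>)\<^sup>2) (\<lambda>\<epsilon>. \<epsilon>) e"
proof -
  define Q where "Q i B \<longleftrightarrow> (\<forall>x0\<in>A. \<forall>v. norm v = 1 \<and> v $ i \<noteq> 0 \<longrightarrow>
    (v \<in> tangent_cone A x0 \<longrightarrow> (\<exists>e>0. bernstein_at A x0 v
       (\<lambda>\<epsilon> d. 16 * (32 * (real B)\<^sup>2 * d\<^sup>2 / \<epsilon>) ^ complex_multiplicity 1 (complexification A) (cvec x0))
       (\<lambda>\<epsilon>. \<epsilon> ^ complex_multiplicity 1 (complexification A) (cvec x0)) e)) \<and>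
    (v \<in> tangent_space A x0 \<longrightarrow> x0 \<notin> end_points A \<longrightarrow>
       (\<exists>e>0. bernstein_at A x0 v (\<lambda>\<epsilon> d. 16 * (32 * (real B)\<^sup>2 * d / \<epsilon>)) (\<lambda>\<epsilon>. \<epsilon>) e)) \<and>
    (v \<in> tangent_space A x0 \<longrightarrow>
       (\<exists>e>0. bernstein_at A x0 v (\<lambda>\<epsilon> d. 16 * (32 * (real B)\<^sup>2 * d / \<epsilon>)\<^sup>2) (\<lambda>\<epsilon>. \<epsilon>) e)))" for i and B :: nat
  have "\<exists>b. \<forall>B\<ge>b. Q i B" if a: "a1 \<in> A" "a2 \<in> A" "a1 $ i \<noteq> a2 $ i" for i and a1 a2 :: "real ^ 'n"
  proof -
    obtain P where "curve_coord A i P a1 a2" using piece_curve_coord[OF A a] by blast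
    then show ?thesis unfolding Q_def by (rule curve_coord.coordinate_estimates)
  qed
  then have "\<exists>b. (\<exists>a1\<in>A. \<exists>a2\<in>A. (a1 :: real ^ 'n) $ i \<noteq> a2 $ i) \<longrightarrow> (\<forall>B\<ge>b. Q i B)" for i by blast
  then obtain b where b: "\<And>i. (\<exists>a1\<in>A. \<exists>a2\<in>A. (a1 :: real ^ 'n) $ i \<noteq> a2 $ i) \<longrightarrow> (\<forall>B\<ge>b i. Q i B)" by metis
  \<comment> \<open>Above all finitely many \<open>b i\<close>, and positive.\<close>
  define B where "B = Suc (\<Sum>i\<in>UNIV. b i)"
  have bB: "b i \<le> B" for i unfolding B_def by (rule le_SucI) (rule member_le_sum, auto)
  have cone: "\<exists>i. v $ i \<noteq> 0 \<and> Q i B" if v: "norm v = 1" "v \<in> tangent_cone A x0 \<or> - v \<in> tangent_cone A x0" "x0 \<in> A" for v x0 :: "real ^ 'n"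
  proof -
    have "v \<noteq> 0" using v(1) by auto
    then obtain i where i: "v $ i \<noteq> 0" by (auto simp: vec_eq_iff)
    then have "\<exists>a\<in>A. a $ i \<noteq> x0 $ i" using v(2) tangent_cone_nonconstant[of v A x0 i] tangent_cone_nonconstant[of "- v" A x0 i] by auto
    then show ?thesis using b[of i] bB[of i] i v(3) by blast
  qed
  have space: "v \<in> tangent_cone A x0 \<or> - v \<in> tangent_cone A x0" if "norm v = 1" "v \<in> tangent_space A x0" for v x0 :: "real ^ 'n"
    by (rule tangent_space_unit[OF that(2,1)])
  show ?thesis
  proof (rule that[of B])
    show "0 < B" by (simp add: B_def)
    fix x0 v :: "real ^ 'n" assume x0: "x0 \<in> A" and v: "norm v = 1"
    show "\<exists>e>0. bernstein_at A x0 v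
       (\<lambda>\<epsilon> d. 16 * (32 * (real B)\<^sup>2 * d\<^sup>2 / \<epsilon>) ^ complex_multiplicity 1 (complexification A) (cvec x0))
       (\<lambda>\<epsilon>. \<epsilon> ^ complex_multiplicity 1 (complexification A) (cvec x0)) e" if c: "v \<in> tangent_cone A x0"
    proof -
      obtain i where "v $ i \<noteq> 0" "Q i B" using cone[OF v disjI1[OF c] x0] by blast
      then show ?thesis unfolding Q_def using x0 v c by blast
    qed
    show "\<exists>e>0. bernstein_at A x0 v (\<lambda>\<epsilon> d. 16 * (32 * (real B)\<^sup>2 * d / \<epsilon>)) (\<lambda>\<epsilon>. \<epsilon>) e"
      if c: "v \<in> tangent_space A x0" and e: "x0 \<notin> end_points A"
    proof -
      obtain i where "v $ i \<noteq> 0" "Q i B" using cone[OF v space[OF v c] x0] by blast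
      then show ?thesis unfolding Q_def using x0 v c e by blast
    qed
    show "\<exists>e>0. bernstein_at A x0 v (\<lambda>\<epsilon> d. 16 * (32 * (real B)\<^sup>2 * d / \<epsilon>)\<^sup>2) (\<lambda>\<epsilon>. \<epsilon>) e"
      if c: "v \<in> tangent_space A x0"
    proof -
      obtain i where "v $ i \<noteq> 0" "Q i B" using cone[OF v space[OF v c] x0] by blast
      then show ?thesis unfolding Q_def using x0 v c by blast
    qed
  qed
qed

text \<open>Thresholds depend on the direction; finiteness of the set of directions makes a common
  one possible.\<close>

lemma finite_common_threshold:
  assumes "finite V" and "\<And>v. v \<in> V \<Longrightarrow> \<exists>e>0. bernstein_at A x0 v F R e"
  shows "\<exists>e>0. \<forall>v\<in>V. bernstein_at A x0 v F R e"
  using assms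
proof (induction V)
  case empty
  show ?case by (rule exI[of _ 1]) simp
next
  case (insert v V)
  then obtain e e' where "0 < e" "\<forall>v\<in>V. bernstein_at A x0 v F R e" "0 < e'" "bernstein_at A x0 v F R e'" by blast
  then show ?case by (intro exI[of _ "min e e'"]) (auto simp: bernstein_at_def)
qed

theorem mainTheorem1:
  fixes A :: "(real ^ 'n::finite) set"
  assumes "piece_of_algebraic_curve A"
  shows "\<exists>C1 C2 \<epsilon>0 :: real ^ 'n \<Rightarrow> real.
    (\<forall>x\<in>A. C1 x > 0 \<and> C2 x > 0 \<and> \<epsilon>0 x > 0) \<and>
    locally_bounded_above_on A C1 \<and> locally_bounded_above_on A C2 \<and>
    locally_bounded_above_on A \<epsilon>0 \<and>
    (\<forall>x0\<in>A. \<forall>\<epsilon>. 0 < \<epsilon> \<and> \<epsilon> < \<epsilon>0 x0 \<longrightarrow> (\<forall>p :: (real, 'n) mpolynomial.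
      (x0 \<in> sing_points A \<longrightarrow>
        (\<forall>v\<in>tangent_cone A x0. norm v = 1 \<longrightarrow>
          (let k = complex_multiplicity 1 (complexification A) (cvec x0) in
            \<bar>dir_deriv (peval p) v x0\<bar>
              \<le> C1 x0 * (C2 x0 * (real (total_deg p))\<^sup>2 / \<epsilon>) ^ k *
                unif_norm (A \<inter> ball x0 (\<epsilon> ^ k)) (peval p)))) \<and>
      (x0 \<in> reg_points A - end_points A \<longrightarrow>
        (\<forall>v\<in>tangent_space A x0. norm v = 1 \<longrightarrow>
          \<bar>dir_deriv (peval p) v x0\<bar>
            \<le> C1 x0 * (C2 x0 * real (total_deg p) / \<epsilon>) *
              unif_norm (A \<inter> ball x0 \<epsilon>) (peval p))) \<and>
      (x0 \<in> end_points A - sing_points A \<longrightarrow>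
        (\<forall>v\<in>tangent_space A x0. norm v = 1 \<longrightarrow>
          \<bar>dir_deriv (peval p) v x0\<bar>
            \<le> C1 x0 * (C2 x0 * real (total_deg p) / \<epsilon>)\<^sup>2 *
              unif_norm (A \<inter> ball x0 \<epsilon>) (peval p)))))"
proof -
  obtain B :: nat where B: "0 < B"
    and cone: "\<And>x0 v. x0 \<in> A \<Longrightarrow> norm v = 1 \<Longrightarrow> v \<in> tangent_cone A x0 \<Longrightarrow> \<exists>e>0. bernstein_at A x0 v
       (\<lambda>\<epsilon> d. 16 * (32 * (real B)\<^sup>2 * d\<^sup>2 / \<epsilon>) ^ complex_multiplicity 1 (complexification A) (cvec x0))
       (\<lambda>\<epsilon>. \<epsilon> ^ complex_multiplicity 1 (complexification A) (cvec x0)) e"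
    and interior: "\<And>x0 v. x0 \<in> A \<Longrightarrow> norm v = 1 \<Longrightarrow> v \<in> tangent_space A x0 \<Longrightarrow> x0 \<notin> end_points A \<Longrightarrow>
       \<exists>e>0. bernstein_at A x0 v (\<lambda>\<epsilon> d. 16 * (32 * (real B)\<^sup>2 * d / \<epsilon>)) (\<lambda>\<epsilon>. \<epsilon>) e"
    and boundary: "\<And>x0 v. x0 \<in> A \<Longrightarrow> norm v = 1 \<Longrightarrow> v \<in> tangent_space A x0 \<Longrightarrow>
       \<exists>e>0. bernstein_at A x0 v (\<lambda>\<epsilon> d. 16 * (32 * (real B)\<^sup>2 * d / \<epsilon>)\<^sup>2) (\<lambda>\<epsilon>. \<epsilon>) e"
    by (rule piece_estimates[OF assms]) (rule that)
  \<comment> \<open>Together with 16 this is the constant for all points of \<open>A\<close>, so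
    local boundedness of \<open>C1\<close> and \<open>C2\<close> is immediate.\<close>
  define K where "K = 32 * (real B)\<^sup>2"
  \<comment> \<open>The condition \<open>e \<le> 1\<close> makes the threshold function bounded
    above, as the statement requires of \<open>\<epsilon>0\<close> too.\<close>
  define good where "good x0 e \<longleftrightarrow> 0 < e \<and> e \<le> 1 \<and>
      (\<forall>v\<in>tangent_cone A x0. norm v = 1 \<longrightarrow> bernstein_at A x0 v
        (\<lambda>\<epsilon> d. 16 * (K * d\<^sup>2 / \<epsilon>) ^ complex_multiplicity 1 (complexification A) (cvec x0))
        (\<lambda>\<epsilon>. \<epsilon> ^ complex_multiplicity 1 (complexification A) (cvec x0)) e) \<and>
      (x0 \<notin> end_points A \<longrightarrow> (\<forall>v\<in>tangent_space A x0. norm v = 1 \<longrightarrow>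
        bernstein_at A x0 v (\<lambda>\<epsilon> d. 16 * (K * d / \<epsilon>)) (\<lambda>\<epsilon>. \<epsilon>) e)) \<and>
      (\<forall>v\<in>tangent_space A x0. norm v = 1 \<longrightarrow> bernstein_at A x0 v (\<lambda>\<epsilon> d. 16 * (K * d / \<epsilon>)\<^sup>2) (\<lambda>\<epsilon>. \<epsilon>) e)" for x0 e
  have thr: "\<exists>e. good x0 e"
    if x0: "x0 \<in> A" for x0
  proof -
    define V where "V = {v \<in> tangent_cone A x0. norm v = 1}"
    define T where "T = {v \<in> tangent_space A x0. norm v = 1}"
    have V: "finite V" unfolding V_def by (rule piece_finite_tangent_directions[OF assms x0])
    \<comment> \<open>Unit tangent vectors are unit cone vectors up to sign, so they inherit
      finiteness.\<close>
    have "T \<subseteq> V \<union> uminus ` V"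
    proof
      fix v assume v: "v \<in> T"
      then have "v \<in> tangent_cone A x0 \<or> - v \<in> tangent_cone A x0"
        unfolding T_def by (auto intro: tangent_space_unit[of v A x0])
      then have "v \<in> V \<or> - v \<in> V" using v by (auto simp: V_def T_def)
      then show "v \<in> V \<union> uminus ` V" by (metis UnI1 UnI2 imageI minus_minus)
    qed
    then have T: "finite T" using V by (meson finite_UnI finite_imageI finite_subset)
    obtain e1 where e1: "0 < e1" "\<forall>v\<in>V. bernstein_at A x0 v
        (\<lambda>\<epsilon> d. 16 * (K * d\<^sup>2 / \<epsilon>) ^ complex_multiplicity 1 (complexification A) (cvec x0))
        (\<lambda>\<epsilon>. \<epsilon> ^ complex_multiplicity 1 (complexification A) (cvec x0)) e1"
      using finite_common_threshold[OF V cone[OF x0, folded K_def]] unfolding V_def by blast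
    obtain e2 where e2: "0 < e2" "x0 \<notin> end_points A \<Longrightarrow> \<forall>v\<in>T. bernstein_at A x0 v (\<lambda>\<epsilon> d. 16 * (K * d / \<epsilon>)) (\<lambda>\<epsilon>. \<epsilon>) e2"
    proof (cases "x0 \<in> end_points A")
      case True
      then show ?thesis using that[of 1] by simp
    next
      case False
      then show ?thesis using finite_common_threshold[OF T interior[OF x0, folded K_def]] that unfolding T_def by blast
    qed
    obtain e3 where e3: "0 < e3" "\<forall>v\<in>T. bernstein_at A x0 v (\<lambda>\<epsilon> d. 16 * (K * d / \<epsilon>)\<^sup>2) (\<lambda>\<epsilon>. \<epsilon>) e3"
      using finite_common_threshold[OF T boundary[OF x0, folded K_def]] unfolding T_def by blast
    show ?thesis
      unfolding good_def by (intro exI[of _ "min 1 (min e1 (min e2 e3))"] conjI)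
        (use e1 e2 e3 in \<open>auto simp: bernstein_at_def V_def T_def\<close>)
  qed
  define e0 where "e0 x0 = (SOME e. good x0 e)" for x0
  have e0: "good x0 (e0 x0)" if "x0 \<in> A" for x0
    unfolding e0_def using thr[OF that] by (rule someI_ex)
  have e0_bounds: "0 < e0 x \<and> e0 x \<le> 1" if "x \<in> A" for x using e0[OF that] unfolding good_def by blast
  have const: "locally_bounded_above_on A (\<lambda>x. c)" for c :: real
    unfolding locally_bounded_above_on_def by (intro ballI exI[of _ 1] conjI exI[of _ c]) auto
  have e0b: "locally_bounded_above_on A e0"
    unfolding locally_bounded_above_on_def by (intro ballI exI[of _ 1] conjI) (use e0_bounds in auto)
  show ?thesis
  proof (rule exI[of _ "\<lambda>_. 16"], rule exI[of _ "\<lambda>_. K"], rule exI[of _ e0], intro conjI const e0b ballI allI impI, goal_cases)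
    case (4 x0 \<epsilon> p v)
    then show ?case using e0[of x0] unfolding good_def bernstein_at_def Let_def by blast
  next
    case (5 x0 \<epsilon> p v)
    then show ?case using e0[of x0] unfolding good_def bernstein_at_def by blast
  next
    case (6 x0 \<epsilon> p v)
    then show ?case using e0[of x0] unfolding good_def bernstein_at_def by blast
  qed (use B e0_bounds in \<open>auto simp: K_def\<close>)
qed

end
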